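(* Let $q^{1/2}$ be a primitive $(2N)$-th root of unity, let $2k\in\mathbb Z$, $0<k<N/2$, consider the $\mathcal H$-module $V_{2N-4k}$ for $t=(q^{1/2})^{2k}$, and put $k'=k-N/2$. Then $$t=(q^{1/2})^{2k}=(q^{1/2})^{N+2k'}=-(q^{1/2})^{2k'}\quad\text{and}\quad V_{2N-4k}\cong V'_{4|k'|},$$ where $V'_{4|k'|}$ is well defined at this primitive $(2N)$-th root of unity $q^{1/2}$. Since the modules $V'_{4|k'|}$ (with $k'$ fixed and $t=-(q^{1/2})^{2k'}$) are well defined for any $q\ne0$ and are irreducible for sufficiently general $q$, they are flat $q$-deformations of the modules $V_{2N-4k}$ with all their structures. Namely: the dimension remains the same; the projective action of $PSL_2(\mathbb Z)$ and the multiplication in $V'_{4|k'|}$ (which is $Y$-spherical, i.e. a quotient of $\mathscr X$) deform those in $V_{2N-4k}$; the module $V'_{4|k'|}$ is $X$-semisimple and $Y$-semisimple for generic $q$; and the standard Hermitian inner product in $V_{2N-4k}$ is the specialization of that in $V'_{4|k'|}$. Moreover, the inner product in $V'_{4|k'|}$ remains positive definite if $|q|=1$, provided $|\arg(q)|\le 2\pi/N$.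
   Context: DAHA of type $A_1$. $\mathcal H=\mathcal H_{q^{1/2},t^{1/2}}$ is generated by $X^{\pm1},Y^{\pm1},T$ over $\mathbb Z_{q;t}=\mathbb Z[q^{\pm1/2},t^{\pm1/2}]$ (with $q^{\pm1/4}$ added when needed), with relations $(T-t^{1/2})(T+t^{-1/2})=0$, $TXT=X^{-1}$, $T^{-1}YT^{-1}=Y^{-1}$, $Y^{-1}X^{-1}YXT^2q^{1/2}=1$; $\pi=YT^{-1}$. The projective action of $PSL_2(\mathbb Z)$ in $\mathcal H$ is generated by the automorphisms $\tau_+$: $X\mapsto X$, $T\mapsto T$, $Y\mapsto q^{-1/4}XY$ and $\tau_-$: $Y\mapsto Y$, $T\mapsto T$, $X\mapsto q^{1/4}YX$; its action in a module is by operators inducing $\tau_\pm$ by conjugation. Polynomial representation $\mathscr X=\mathbb Z_{q;t}[X^{\pm1}]$: $X$ acts by multiplication, $T=t^{1/2}s+\frac{t^{1/2}-t^{-1/2}}{X^2-1}(s-1)$, $Y=\pi T$, where $s(X^n)=X^{-n}$, $\pi(X^n)=q^{n/2}X^{-n}$. The polynomials $e_n$ ($n\in\mathbb Z$) are defined for generic $q,t$ by $Ye_n=(t^{1/2}q^{|n|/2})^{-\mathrm{sign}(n)}e_n$ ($\mathrm{sign}(0)=-1$), $e_n=X^n+$ lower terms (combinations of $X^{\pm m}$ with $|m|<|n|$ and, for $n<0$, also of $X^{|n|}$), and by specialization when the coefficients are regular. Modules. For a primitive $(2N)$-th root of unity $q^{1/2}$ and $0<2k<N$: $V_{2N-4k}=\mathscr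 X/(e_{-n})$ with $t=(q^{1/2})^{2k}$, $n=N-2k$; it is irreducible of dimension $2N-4k$ with basis the images $e'_m$ of $e_m$, $-n+1\le m\le n$. For $n\in\mathbb N$, $k'=-n/2$, $t=-(q^{1/2})^{-n}=-(q^{1/2})^{2k'}$: $V'_{2n}=V'_{4|k'|}=\mathscr X/(e_{-n})$, of dimension $2n=4|k'|$, with basis the images of $e_m$, $1-n\le m\le n$, for generic $q$. The multiplications are those of quotient algebras of $\mathscr X$. The standard Hermitian inner product (with respect to $q^{1/4}\mapsto q^{-1/4}$, $t^{1/2}\mapsto t^{-1/2}$, for which $X,Y,T$ are unitary) is given on the images of the $e_m$ by $$\langle e_m,e_l\rangle=\delta_{ml}\prod_{0<j<|\tilde m|}\frac{(1-q^j)(1-q^jt^2)}{(1-q^jt)(1-q^jt)},$$ where $|\tilde m|=|m|+1$ if $m\le0$ and $|\tilde m|=|m|$ if $m>0$.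
   Formalization: In the last claim q=1 is excluded when N-2k is at least 2 (the product formula then contains the factor 1-q^j=0 and the form is degenerate), and q^{1/2} is taken to be exp(i arg(q)/2), the branch continuous in arg(q). *)

theory Defs
  imports
    Complex_Main
    "HOL-Library.Poly_Mapping"
    "HOL-Computational_Algebra.Polynomial"
    "HOL-Computational_Algebra.Fraction_Field"
    "HOL-Algebra.QuotRing"
    "HOL-Algebra.Module"
    "HOL-Algebra.Algebraic_Closure_Type"
begin

text \<open>
  Throughout, \<open>r\<close> stands for \<open>q^(1/4)\<close>, \<open>h\<close> for \<open>q^(1/2)\<close> and \<open>v\<close> for \<open>t^(1/2)\<close>; thus
  \<open>h = r^2\<close>, \<open>q = r^4\<close> and \<open>t = v^2\<close>.
\<close>

section \<open>The polynomial representation\<close>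

text \<open>Laurent polynomials are finitely supported functions on the integers, under convolution.\<close>

type_synonym 'a laurent = "int \<Rightarrow>\<^sub>0 'a"

definition lconst :: "'a::zero \<Rightarrow> 'a laurent" where
  "lconst c = Poly_Mapping.single 0 c"

definition lX :: "int \<Rightarrow> 'a::zero_neq_one laurent" where
  "lX m = Poly_Mapping.single m 1"

definition s_op :: "'a::comm_ring_1 laurent \<Rightarrow> 'a laurent" where
  "s_op f = (\<Sum>m\<in>Poly_Mapping.keys f. Poly_Mapping.single (- m) (Poly_Mapping.lookup f m))"

definition pi_op :: "'a::field \<Rightarrow> 'a laurent \<Rightarrow> 'a laurent" where
  "pi_op h f = (\<Sum>m\<in>Poly_Mapping.keys f. 
     Poly_Mapping.single (- m) (h powi m * Poly_Mapping.lookup f m))"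

definition X_pol :: "'a::comm_ring_1 laurent \<Rightarrow> 'a laurent" where
  "X_pol f = lX 1 * f"

text \<open>The quotient \<open>(s f - f) / (X^2 - 1)\<close> exists and is unique in the domain of Laurent
  polynomials.\<close>

definition T_pol :: "'a::field \<Rightarrow> 'a laurent \<Rightarrow> 'a laurent" where
  "T_pol v f = lconst v * s_op f
     + lconst (v - inverse v) * (THE g. (lX 2 - 1) * g = s_op f - f)"

definition Y_pol :: "'a::field \<Rightarrow> 'a \<Rightarrow> 'a laurent \<Rightarrow> 'a laurent" where
  "Y_pol h v f = pi_op h (T_pol v f)"

section \<open>The nonsymmetric polynomials and their specializations\<close>

text \<open>Generic parameters: \<open>q^(1/4)\<close> and \<open>t^(1/2)\<close> are the inner and the outer indeterminate of
  \<open>int poly poly\<close>.  Its field of fractions is also that of \<open>\<int>[q^(\<plusminus>1/4), t^(\<plusminus>1/2)]\<close>.\<close>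

type_synonym gfield = "int poly poly fract"

definition gen_r :: gfield where "gen_r = Fract [:[:0, 1:]:] 1"

definition gen_v :: gfield where "gen_v = Fract [:0, 1:] 1"

definition sgn_m :: "int \<Rightarrow> int" where
  "sgn_m m = (if m > 0 then 1 else - 1)"

definition e_gen :: "int \<Rightarrow> gfield laurent" where
  "e_gen m = (THE e.
     Y_pol (gen_r\<^sup>2) gen_v e = lconst ((gen_v * (gen_r\<^sup>2) ^ nat \<bar>m\<bar>) powi (- sgn_m m)) * e \<and>
     Poly_Mapping.lookup e m = 1 \<and>
     (\<forall>j. Poly_Mapping.lookup e j \<noteq> 0 \<longrightarrow> j = m \<or> \<bar>j\<bar> < \<bar>m\<bar> \<or> (m < 0 \<and> j = \<bar>m\<bar>)))"

definition eval2 :: "'a::comm_ring_1 \<Rightarrow> 'a \<Rightarrow> int poly poly \<Rightarrow> 'a" where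
  "eval2 a b P = poly (map_poly (\<lambda>p. poly (map_poly of_int p) a) P) b"

definition regular2 :: "'a::field \<Rightarrow> 'a \<Rightarrow> gfield \<Rightarrow> bool" where
  "regular2 a b f \<longleftrightarrow> (\<exists>P Q. Q \<noteq> 0 \<and> f = Fract P Q \<and> eval2 a b Q \<noteq> 0)"

definition value2 :: "'a::field \<Rightarrow> 'a \<Rightarrow> gfield \<Rightarrow> 'a" where
  "value2 a b f = (THE z. \<exists>P Q. Q \<noteq> 0 \<and> f = Fract P Q \<and> eval2 a b Q \<noteq> 0 \<and>
     z = eval2 a b P / eval2 a b Q)"

text \<open>Specialization of \<open>e_m\<close> at \<open>q^(1/4) = a\<close>, \<open>t^(1/2) = b\<close> in an arbitrary field.\<close>

definition e_regular :: "'a::field \<Rightarrow> 'a \<Rightarrow> int \<Rightarrow> bool" where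
  "e_regular a b m \<longleftrightarrow> (\<forall>j. regular2 a b (Poly_Mapping.lookup (e_gen m) j))"

definition e_at :: "'a::field \<Rightarrow> 'a \<Rightarrow> int \<Rightarrow> 'a laurent" where
  "e_at a b m = Poly_Mapping.map (value2 a b) (e_gen m)"

subsection \<open>Specialization along the curve \<open>t = - (q^(1/2))^(-n)\<close>\<close>

text \<open>The curve \<open>v^2 = - r^(-2n)\<close> has the two components \<open>v = \<sigma> r^(-n)\<close>, where \<open>\<sigma>^2 = -1\<close>; each
  of them is parametrized by \<open>r\<close>.  A polynomial \<open>e_m\<close> is specialized first to the generic point
  of the component (over the field of rational functions of \<open>r\<close>), and then to a value of \<open>r\<close>.
  The second step can exist where \<open>e_m\<close> is not regular as a function of two variables.\<close>

definition curve_v :: "nat \<Rightarrow> 'a::field \<Rightarrow> 'a \<Rightarrow> 'a" where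
  "curve_v n \<sigma> r = \<sigma> * r powi (- int n)"

type_synonym rfield = "complex poly fract"

definition gen_r1 :: rfield where "gen_r1 = Fract [:0, 1:] 1"

definition regular1 :: "complex \<Rightarrow> rfield \<Rightarrow> bool" where
  "regular1 r f \<longleftrightarrow> (\<exists>P Q. Q \<noteq> 0 \<and> f = Fract P Q \<and> poly Q r \<noteq> 0)"

definition value1 :: "complex \<Rightarrow> rfield \<Rightarrow> complex" where
  "value1 r f = (THE z. \<exists>P Q. Q \<noteq> 0 \<and> f = Fract P Q \<and> poly Q r \<noteq> 0 \<and> z = poly P r / poly Q r)"

definition ec_regular_gen :: "nat \<Rightarrow> complex \<Rightarrow> int \<Rightarrow> bool" where
  "ec_regular_gen n \<sigma> m \<longleftrightarrow> e_regular gen_r1 (curve_v n (Fract [:\<sigma>:] 1) gen_r1) m"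

definition ec_gen :: "nat \<Rightarrow> complex \<Rightarrow> int \<Rightarrow> rfield laurent" where
  "ec_gen n \<sigma> m = e_at gen_r1 (curve_v n (Fract [:\<sigma>:] 1) gen_r1) m"

definition ec_regular :: "nat \<Rightarrow> complex \<Rightarrow> complex \<Rightarrow> int \<Rightarrow> bool" where
  "ec_regular n \<sigma> r m \<longleftrightarrow> ec_regular_gen n \<sigma> m \<and>
     (\<forall>j. regular1 r (Poly_Mapping.lookup (ec_gen n \<sigma> m) j))"

definition ec_at :: "nat \<Rightarrow> complex \<Rightarrow> complex \<Rightarrow> int \<Rightarrow> complex laurent" where
  "ec_at n \<sigma> r m = Poly_Mapping.map (value1 r) (ec_gen n \<sigma> m)"

section \<open>Modules over the double affine Hecke algebra\<close>

abbreviation CC :: "complex ring" where "CC \<equiv> ring_of_type_algebra"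

text \<open>A module is given by the actions of the generators; the multiplication is part of the
  record because the modules in question are quotient algebras of the polynomial representation.\<close>

record 'b hmod = "(complex, 'b) module" +
  opX :: "'b \<Rightarrow> 'b"
  opY :: "'b \<Rightarrow> 'b"
  opT :: "'b \<Rightarrow> 'b"

abbreviation inv_op :: "'b hmod \<Rightarrow> ('b \<Rightarrow> 'b) \<Rightarrow> 'b \<Rightarrow> 'b" where
  "inv_op M F \<equiv> inv_into (carrier M) F"

definition linear_map :: "'b hmod \<Rightarrow> 'c hmod \<Rightarrow> ('b \<Rightarrow> 'c) \<Rightarrow> bool" where
  "linear_map M N F \<longleftrightarrow>
     F ` carrier M \<subseteq> carrier N \<and>
     (\<forall>x\<in>carrier M. \<forall>y\<in>carrier M. F (x \<oplus>\<^bsub>M\<^esub> y) = F x \<oplus>\<^bsub>N\<^esub> F y) \<and>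
     (\<forall>c. \<forall>x\<in>carrier M. F (c \<odot>\<^bsub>M\<^esub> x) = c \<odot>\<^bsub>N\<^esub> F x)"

definition linear_iso :: "'b hmod \<Rightarrow> 'c hmod \<Rightarrow> ('b \<Rightarrow> 'c) \<Rightarrow> bool" where
  "linear_iso M N F \<longleftrightarrow> linear_map M N F \<and> bij_betw F (carrier M) (carrier N)"

text \<open>The relations are \<open>(T - t^(1/2)) (T + t^(-1/2)) = 0\<close>, \<open>T X T = X^(-1)\<close>,
  \<open>T^(-1) Y T^(-1) = Y^(-1)\<close> and \<open>q^(1/2) Y^(-1) X^(-1) Y X T^2 = 1\<close>.\<close>

definition daha_module :: "complex \<Rightarrow> complex \<Rightarrow> 'b hmod \<Rightarrow> bool" where
  "daha_module h v M \<longleftrightarrow>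
     module CC M \<and>
     linear_iso M M (opX M) \<and> linear_iso M M (opY M) \<and> linear_iso M M (opT M) \<and>
     (\<forall>x\<in>carrier M.
        (let iX = inv_op M (opX M); iY = inv_op M (opY M); iT = inv_op M (opT M);
             y = opT M x \<oplus>\<^bsub>M\<^esub> inverse v \<odot>\<^bsub>M\<^esub> x
         in opT M y \<ominus>\<^bsub>M\<^esub> v \<odot>\<^bsub>M\<^esub> y = \<zero>\<^bsub>M\<^esub> \<and>
            opT M (opX M (opT M x)) = iX x \<and>
            iT (opY M (iT x)) = iY x \<and>
            h \<odot>\<^bsub>M\<^esub> iY (iX (opY M (opX M (opT M (opT M x))))) = x))"

definition hmod_iso :: "'b hmod \<Rightarrow> 'c hmod \<Rightarrow> ('b \<Rightarrow> 'c) \<Rightarrow> bool" where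
  "hmod_iso M N F \<longleftrightarrow> linear_iso M N F \<and>
     (\<forall>x\<in>carrier M. F (opX M x) = opX N (F x) \<and> F (opY M x) = opY N (F x) \<and>
        F (opT M x) = opT N (F x))"

definition irreducible_hmod :: "'b hmod \<Rightarrow> bool" where
  "irreducible_hmod M \<longleftrightarrow> carrier M \<noteq> {\<zero>\<^bsub>M\<^esub>} \<and>
     (\<forall>W. submodule W CC M \<and>
        (\<forall>F\<in>{opX M, opY M, opT M}. F ` W \<subseteq> W \<and> inv_op M F ` W \<subseteq> W) \<longrightarrow>
        W = {\<zero>\<^bsub>M\<^esub>} \<or> W = carrier M)"

definition lincomb :: "'b hmod \<Rightarrow> 'i set \<Rightarrow> ('i \<Rightarrow> complex) \<Rightarrow> ('i \<Rightarrow> 'b) \<Rightarrow> 'b" where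
  "lincomb M S c b = (\<Oplus>\<^bsub>M\<^esub>i\<in>S. c i \<odot>\<^bsub>M\<^esub> b i)"

definition is_basis :: "'b hmod \<Rightarrow> 'i set \<Rightarrow> ('i \<Rightarrow> 'b) \<Rightarrow> bool" where
  "is_basis M S b \<longleftrightarrow> finite S \<and> b ` S \<subseteq> carrier M \<and>
     (\<forall>x\<in>carrier M. \<exists>!c. (\<forall>i. i \<notin> S \<longrightarrow> c i = 0) \<and> x = lincomb M S c b)"

definition coords :: "'b hmod \<Rightarrow> 'i set \<Rightarrow> ('i \<Rightarrow> 'b) \<Rightarrow> 'b \<Rightarrow> 'i \<Rightarrow> complex" where
  "coords M S b x = (THE c. (\<forall>i. i \<notin> S \<longrightarrow> c i = 0) \<and> x = lincomb M S c b)"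

definition has_dim :: "'b hmod \<Rightarrow> nat \<Rightarrow> bool" where
  "has_dim M d \<longleftrightarrow> (\<exists>b :: nat \<Rightarrow> 'b. is_basis M {..<d} b)"

definition semisimple_op :: "'b hmod \<Rightarrow> ('b \<Rightarrow> 'b) \<Rightarrow> bool" where
  "semisimple_op M F \<longleftrightarrow>
     (\<exists>(S :: nat set) b. is_basis M S b \<and> (\<forall>i\<in>S. \<exists>c. F (b i) = c \<odot>\<^bsub>M\<^esub> b i))"

text \<open>Operators \<open>A\<close>, \<open>B\<close> inducing \<open>\<tau>\<^sub>+\<close>, \<open>\<tau>\<^sub>-\<close> by conjugation.  The last clause says that they
  satisfy \<open>\<tau>\<^sub>+ \<tau>\<^sub>-\<^sup>-\<^sup>1 \<tau>\<^sub>+ = \<tau>\<^sub>-\<^sup>-\<^sup>1 \<tau>\<^sub>+ \<tau>\<^sub>-\<^sup>-\<^sup>1\<close> up to proportionality; this is the defining relation of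
  the projective \<open>PSL\<^sub>2(\<int>)\<close>, and it holds for the automorphisms themselves.\<close>

definition psl2_action :: "complex \<Rightarrow> 'b hmod \<Rightarrow> ('b \<Rightarrow> 'b) \<Rightarrow> ('b \<Rightarrow> 'b) \<Rightarrow> bool" where
  "psl2_action r M A B \<longleftrightarrow>
     linear_iso M M A \<and> linear_iso M M B \<and>
     (\<forall>x\<in>carrier M.
        A (opX M x) = opX M (A x) \<and> A (opT M x) = opT M (A x) \<and>
        A (opY M x) = inverse r \<odot>\<^bsub>M\<^esub> opX M (opY M (A x)) \<and>
        B (opY M x) = opY M (B x) \<and> B (opT M x) = opT M (B x) \<and>
        B (opX M x) = r \<odot>\<^bsub>M\<^esub> opY M (opX M (B x))) \<and>
     (\<exists>c. c \<noteq> 0 \<and> (\<forall>x\<in>carrier M.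
        A (inv_op M B (A x)) = c \<odot>\<^bsub>M\<^esub> inv_op M B (A (inv_op M B x))))"

section \<open>Quotients of the polynomial representation\<close>

abbreviation LL :: "complex laurent ring" where "LL \<equiv> ring_of_type_algebra"

definition qclass :: "complex laurent \<Rightarrow> complex laurent \<Rightarrow> complex laurent set" where
  "qclass e f = PIdl\<^bsub>LL\<^esub> e +>\<^bsub>LL\<^esub> f"

definition induced ::
    "complex laurent \<Rightarrow> (complex laurent \<Rightarrow> complex laurent) \<Rightarrow>
     complex laurent set \<Rightarrow> complex laurent set" where
  "induced e F c = (\<Union>f\<in>c. qclass e (F f))"

definition pol_quot :: "complex \<Rightarrow> complex \<Rightarrow> complex laurent \<Rightarrow> complex laurent set hmod" where
  "pol_quot h v e =
     (let Q = LL Quot (PIdl\<^bsub>LL\<^esub> e) in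
      \<lparr>carrier = carrier Q, monoid.mult = monoid.mult Q, one = \<one>\<^bsub>Q\<^esub>, zero = \<zero>\<^bsub>Q\<^esub>, add = add Q,
       module.smult = (\<lambda>c x. qclass e (lconst c) \<otimes>\<^bsub>Q\<^esub> x),
       opX = induced e X_pol, opY = induced e (Y_pol h v), opT = induced e (T_pol v)\<rparr>)"

definition stable_ideal :: "complex \<Rightarrow> complex \<Rightarrow> complex laurent \<Rightarrow> bool" where
  "stable_ideal h v e \<longleftrightarrow>
     (\<forall>F\<in>{X_pol, Y_pol h v, T_pol v}. F ` (PIdl\<^bsub>LL\<^esub> e) = PIdl\<^bsub>LL\<^esub> e)"

text \<open>The module \<open>V\<^bsub>2n\<^esub>\<close> with \<open>n = N - 2k\<close>, given by \<open>q^(1/4)\<close>, \<open>t^(1/2)\<close> and \<open>n\<close>.\<close>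

definition V_mod :: "nat \<Rightarrow> complex \<Rightarrow> complex \<Rightarrow> complex laurent set hmod" where
  "V_mod n r v = pol_quot (r\<^sup>2) v (e_at r v (- int n))"

definition V_well_defined :: "nat \<Rightarrow> complex \<Rightarrow> complex \<Rightarrow> bool" where
  "V_well_defined n r v \<longleftrightarrow> e_regular r v (- int n) \<and>
     stable_ideal (r\<^sup>2) v (e_at r v (- int n)) \<and>
     algebra CC (V_mod n r v) \<and> daha_module (r\<^sup>2) v (V_mod n r v)"

definition Vp_mod :: "nat \<Rightarrow> complex \<Rightarrow> complex \<Rightarrow> complex laurent set hmod" where
  "Vp_mod n \<sigma> r = pol_quot (r\<^sup>2) (curve_v n \<sigma> r) (ec_at n \<sigma> r (- int n))"

definition Vp_well_defined :: "nat \<Rightarrow> complex \<Rightarrow> complex \<Rightarrow> bool" where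
  "Vp_well_defined n \<sigma> r \<longleftrightarrow> ec_regular n \<sigma> r (- int n) \<and>
     stable_ideal (r\<^sup>2) (curve_v n \<sigma> r) (ec_at n \<sigma> r (- int n)) \<and>
     algebra CC (Vp_mod n \<sigma> r) \<and> daha_module (r\<^sup>2) (curve_v n \<sigma> r) (Vp_mod n \<sigma> r)"

definition idx :: "nat \<Rightarrow> int set" where
  "idx n = {1 - int n .. int n}"

definition Vp_X :: "nat \<Rightarrow> complex \<Rightarrow> complex \<Rightarrow> int \<Rightarrow> complex laurent set" where
  "Vp_X n \<sigma> r m = qclass (ec_at n \<sigma> r (- int n)) (lX m)"

definition Vp_e :: "nat \<Rightarrow> complex \<Rightarrow> complex \<Rightarrow> int \<Rightarrow> complex laurent set" where
  "Vp_e n \<sigma> r m = qclass (ec_at n \<sigma> r (- int n)) (ec_at n \<sigma> r m)"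

definition V_e :: "nat \<Rightarrow> complex \<Rightarrow> complex \<Rightarrow> int \<Rightarrow> complex laurent set" where
  "V_e n r v m = qclass (e_at r v (- int n)) (e_at r v m)"

section \<open>The standard inner product\<close>

definition e_norm :: "complex \<Rightarrow> complex \<Rightarrow> int \<Rightarrow> complex" where
  "e_norm q t m =
     (\<Prod>j\<in>{0<..<(if m \<le> 0 then nat \<bar>m\<bar> + 1 else nat \<bar>m\<bar>)}.
        ((1 - q ^ j) * (1 - q ^ j * t\<^sup>2)) / ((1 - q ^ j * t) * (1 - q ^ j * t)))"

text \<open>For \<open>|q| = |t| = 1\<close> the involution \<open>q^(1/4) \<mapsto> q^(-1/4)\<close>, \<open>t^(1/2) \<mapsto> t^(-1/2)\<close> of the
  coefficients is complex conjugation.\<close>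

definition orth_form ::
    "'b hmod \<Rightarrow> 'i set \<Rightarrow> ('i \<Rightarrow> 'b) \<Rightarrow> ('i \<Rightarrow> complex) \<Rightarrow> 'b \<Rightarrow> 'b \<Rightarrow> complex" where
  "orth_form M S b w x y = (\<Sum>m\<in>S. coords M S b x m * cnj (coords M S b y m) * w m)"

definition V_form ::
    "nat \<Rightarrow> complex \<Rightarrow> complex \<Rightarrow> complex laurent set \<Rightarrow> complex laurent set \<Rightarrow> complex" where
  "V_form n r v = orth_form (V_mod n r v) (idx n) (V_e n r v) (e_norm (r ^ 4) (v\<^sup>2))"

definition Vp_form ::
    "nat \<Rightarrow> complex \<Rightarrow> complex \<Rightarrow> complex laurent set \<Rightarrow> complex laurent set \<Rightarrow> complex" where
  "Vp_form n \<sigma> r = orth_form (Vp_mod n \<sigma> r) (idx n) (Vp_e n \<sigma> r)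
     (e_norm (r ^ 4) ((curve_v n \<sigma> r)\<^sup>2))"

definition hermitian_unitary :: "'b hmod \<Rightarrow> ('b \<Rightarrow> 'b \<Rightarrow> complex) \<Rightarrow> bool" where
  "hermitian_unitary M B \<longleftrightarrow> (\<forall>x\<in>carrier M. \<forall>y\<in>carrier M.
     B y x = cnj (B x y) \<and> (\<forall>F\<in>{opX M, opY M, opT M}. B (F x) (F y) = B x y))"

definition positive_definite :: "'b hmod \<Rightarrow> ('b \<Rightarrow> 'b \<Rightarrow> complex) \<Rightarrow> bool" where
  "positive_definite M B \<longleftrightarrow>
     (\<forall>x\<in>carrier M - {\<zero>\<^bsub>M\<^esub>}. B x x \<in> \<real> \<and> Re (B x x) > 0)"

definition V_form_ok :: "nat \<Rightarrow> complex \<Rightarrow> complex \<Rightarrow> bool" where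
  "V_form_ok n r v \<longleftrightarrow> (\<forall>m\<in>idx n. e_regular r v m) \<and>
     is_basis (V_mod n r v) (idx n) (V_e n r v) \<and>
     hermitian_unitary (V_mod n r v) (V_form n r v)"

definition Vp_form_ok :: "nat \<Rightarrow> complex \<Rightarrow> complex \<Rightarrow> bool" where
  "Vp_form_ok n \<sigma> r \<longleftrightarrow> (\<forall>m\<in>idx n. ec_regular n \<sigma> r m) \<and>
     is_basis (Vp_mod n \<sigma> r) (idx n) (Vp_e n \<sigma> r) \<and>
     hermitian_unitary (Vp_mod n \<sigma> r) (Vp_form n \<sigma> r)"

section \<open>Flat families\<close>

text \<open>Linear operators \<open>F r\<close> on a family of modules with distinguished bases \<open>b r\<close> depend
  algebraically on \<open>r \<in> D\<close> if the entries of their matrices are rational functions of \<open>r\<close> regular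
  on \<open>D\<close>.\<close>

definition regular_vectors ::
    "complex set \<Rightarrow> (complex \<Rightarrow> 'b hmod) \<Rightarrow> 'i set \<Rightarrow> (complex \<Rightarrow> 'i \<Rightarrow> 'b) \<Rightarrow>
     (complex \<Rightarrow> 'b) \<Rightarrow> bool" where
  "regular_vectors D M S b x \<longleftrightarrow> (\<exists>a :: 'i \<Rightarrow> rfield. \<forall>r\<in>D.
     (\<forall>i\<in>S. regular1 r (a i)) \<and> x r = lincomb (M r) S (\<lambda>i. value1 r (a i)) (b r))"

definition regular_ops ::
    "complex set \<Rightarrow> (complex \<Rightarrow> 'b hmod) \<Rightarrow> 'i set \<Rightarrow> (complex \<Rightarrow> 'i \<Rightarrow> 'b) \<Rightarrow>
     (complex \<Rightarrow> 'b \<Rightarrow> 'b) \<Rightarrow> bool" where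
  "regular_ops D M S b F \<longleftrightarrow> (\<forall>j\<in>S. regular_vectors D M S b (\<lambda>r. F r (b r j)))"

text \<open>For \<open>D = - {0}\<close> the functions regular on \<open>D\<close> are the Laurent polynomials in \<open>r\<close>, and a flat
  family is (the collection of the fibers of) a free module of finite rank over
  \<open>\<complex>[r, r^(-1)]\<close> with actions of \<open>X\<close>, \<open>Y\<close>, \<open>T\<close>, a multiplication and a unit.\<close>

definition flat_family ::
    "complex set \<Rightarrow> (complex \<Rightarrow> 'b hmod) \<Rightarrow> 'i set \<Rightarrow> (complex \<Rightarrow> 'i \<Rightarrow> 'b) \<Rightarrow> bool" where
  "flat_family D M S b \<longleftrightarrow>
     (\<forall>r\<in>D. is_basis (M r) S (b r)) \<and>
     regular_ops D M S b (\<lambda>r. opX (M r)) \<and>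
     regular_ops D M S b (\<lambda>r. opY (M r)) \<and>
     regular_ops D M S b (\<lambda>r. opT (M r)) \<and>
     (\<forall>i\<in>S. regular_ops D M S b (\<lambda>r x. b r i \<otimes>\<^bsub>M r\<^esub> x)) \<and>
     regular_vectors D M S b (\<lambda>r. \<one>\<^bsub>M r\<^esub>)"

definition regular_form ::
    "complex set \<Rightarrow> 'i set \<Rightarrow> (complex \<Rightarrow> 'i \<Rightarrow> 'b) \<Rightarrow> (complex \<Rightarrow> 'b \<Rightarrow> 'b \<Rightarrow> complex) \<Rightarrow> bool" where
  "regular_form D S b B \<longleftrightarrow> (\<exists>G :: 'i \<Rightarrow> 'i \<Rightarrow> rfield. \<forall>r\<in>D. \<forall>i\<in>S. \<forall>j\<in>S.
     regular1 r (G i j) \<and> B r (b r i) (b r j) = value1 r (G i j))"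

text \<open>Values of \<open>r = q^(1/4) \<noteq> 0\<close> for which \<open>q\<close> is not a root of unity of order at most \<open>d\<close>.  A
  property holds for sufficiently general \<open>q\<close> if it holds on such a set for some \<open>d\<close>, i.e. off
  finitely many roots of unity.\<close>

definition general_r :: "nat \<Rightarrow> complex set" where
  "general_r d = {r. r \<noteq> 0 \<and> (\<forall>j\<in>{1..d}. (r ^ 4) ^ j \<noteq> 1)}"

definition primitive_root_of_unity :: "nat \<Rightarrow> complex \<Rightarrow> bool" where
  "primitive_root_of_unity d z \<longleftrightarrow> z ^ d = 1 \<and> (\<forall>j. 0 < j \<and> j < d \<longrightarrow> z ^ j \<noteq> 1)"

end

theory Submission
  imports Defs
begin

text \<open>
  On the curve \<open>t h\<^sup>n = -1\<close>, where \<open>h = q\<^sup>1\<^sup>/\<^sup>2\<close>, the \<open>q\<close>-binomial theorem turns \<open>e\<^bsub>-n\<^esub>\<close> into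
  \<open>X\<^bsup>-n\<^esup> \<Prod>\<^bsub>j<n\<^esub> (1 + h\<^bsup>2j-n\<^esup> X\<^sup>2)\<close>, which is regular for every \<open>h \<noteq> 0\<close>.  The factor with \<open>j = 0\<close> gives
  \<open>X\<^sup>-\<^sup>1 - t X\<close> and intertwines \<open>T\<close> for \<open>t\<^sup>1\<^sup>/\<^sup>2\<close> with \<open>T\<close> for \<open>-t\<^bsup>-1/2\<^esup>\<close>; the rest is invariant under \<open>s\<close>, and
  the whole product is invariant under \<open>\<pi>\<close>.  Hence the ideal is stable, and the monomials \<open>X\<^sup>m\<close> with
  \<open>-n < m \<le> n\<close> form a basis of the quotient in which all structure constants are Laurent polynomials
  in \<open>q\<^bsup>1/4\<^esup>\<close>.  At a primitive \<open>2N\<close>-th root of unity \<open>h\<^sup>N = -1\<close>, so that \<open>t = h\<^sup>2\<^sup>k\<close> lies on the curve and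
  the two modules coincide there.

  Let \<open>q\<^sup>j \<noteq> 1\<close> for \<open>0 < j < n\<close> and \<open>h\<^sup>n \<noteq> -1\<close>.  Then the spectra of \<open>X\<close> and \<open>Y\<close> are simple and the norms of
  the \<open>e\<^sub>m\<close> are finite and nonzero, which yields irreducibility.  Multiplication by the function on the
  spectrum of \<open>X\<close> that interpolates the Gaussian induces \<open>\<tau>\<^sub>+\<close>, an operator diagonal in the \<open>e\<^sub>m\<close> induces
  \<open>\<tau>\<^sub>-\<close>, and Schur's lemma gives both the braid relation up to a scalar and the uniqueness of these
  operators up to scalars.  For \<open>q = e\<^sup>i\<^sup>\<theta>\<close> the norms are products of ratios of values of sine and cosine,
  which are positive as long as \<open>n |\<theta>| < 2\<pi>\<close>.
\<close>

section \<open>Laurent polynomials\<close>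

text \<open>Three obstacles shape the proof. The \<open>e_m\<close> come from definite descriptions
  over a fraction field, and regularity asserts that a suitable fraction exists. Explicit
  coefficients are therefore studied over an arbitrary field, and the relation
  \<open>spec f z\<close> (regular with value z) carries them from the generic point of the plane to
  that of the curve and then to numbers. A deformation needs matrix entries that are single rational
  functions of q^{1/4}, valid at the special root of unity as well; so bases, operators and forms
  are treated as families over a set \<open>D\<close> with regular coefficients. The form is
  sesquilinear, but for |q| = 1 the conjugates that occur are again rational in q^{1/4}, whose
  conjugate is its inverse. The operators inducing the action on V are arbitrary, so they are
  matched with constructed ones only up to scalars; these scalars are kept constant along the
  family. The locale \<open>good_curve\<close> holds at the root of unity, for general q and on the
  arc where positivity is claimed, so one argument serves all three.\<close>

abbreviation lk :: "'a::zero laurent \<Rightarrow> int \<Rightarrow> 'a" where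
  "lk \<equiv> Poly_Mapping.lookup"

lemma lookup_single_mult:
  fixes f :: "'a::comm_ring_1 laurent"
  shows "lk (Poly_Mapping.single a c * f) k = c * lk f (k - a)"
proof -
  have eq: "(k = l + q) = (q = k - l)" for l q :: int by auto
  show ?thesis
    by (simp add: lookup_mult lookup_single when_mult eq)
qed

lemma lookup_lX_mult [simp]: "lk (lX a * f) k = lk (f :: 'a::comm_ring_1 laurent) (k - a)"
  by (simp add: lX_def lookup_single_mult)

lemma lookup_lconst_mult [simp]: "lk (lconst c * f) k = c * lk (f :: 'a::comm_ring_1 laurent) k"
  by (simp add: lconst_def lookup_single_mult)

lemma lookup_lX: "lk (lX m :: 'a::zero_neq_one laurent) k = (if k = m then 1 else 0)"
  by (auto simp: lX_def lookup_single when_def)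

lemma lookup_lconst: "lk (lconst c) k = (if k = 0 then c else 0)"
  by (auto simp: lconst_def lookup_single when_def)

lemma lconst_0 [simp]: "lconst 0 = 0"
  and lconst_1 [simp]: "lconst 1 = (1 :: 'a::comm_ring_1 laurent)"
  by (auto simp: lconst_def)

lemma lconst_add: "lconst (a + b) = (lconst a + lconst b :: 'a::comm_ring_1 laurent)"
  and lconst_diff: "lconst (a - b) = (lconst a - lconst b :: 'a::comm_ring_1 laurent)"
  and lconst_uminus: "lconst (- a) = (- lconst a :: 'a::comm_ring_1 laurent)"
  and lconst_mult: "lconst (a * b) = (lconst a * lconst b :: 'a::comm_ring_1 laurent)"
  by (simp_all add: lconst_def single_add single_diff single_uminus mult_single)

lemma lconst_prod: "lconst (prod g S) = (\<Prod>i\<in>S. lconst (g i) :: 'a::comm_ring_1 laurent)"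
  by (induction S rule: infinite_finite_induct) (auto simp: lconst_mult)

lemma lconst_power: "lconst (a ^ j) = (lconst a ^ j :: 'a::comm_ring_1 laurent)"
  by (induction j) (auto simp: lconst_mult)

lemma lconst_eq_0_iff [simp]: "lconst c = 0 \<longleftrightarrow> c = 0"
  by (metis lconst_0 lookup_lconst lookup_zero)

lemma lX_0 [simp]: "lX 0 = (1 :: 'a::comm_ring_1 laurent)"
  by (simp add: lX_def)

lemma lX_add: "lX (a + b) = (lX a * lX b :: 'a::comm_ring_1 laurent)"
  by (simp add: lX_def mult_single)

lemma lX_inverse [simp]: "lX a * lX (- a) = (1 :: 'a::comm_ring_1 laurent)"
  "lX (- a) * lX a = (1 :: 'a::comm_ring_1 laurent)"
  by (simp_all flip: lX_add)

lemma lX_ne_0 [simp]: "lX a \<noteq> (0 :: 'a::comm_ring_1 laurent)"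
  by (metis lookup_lX lookup_zero zero_neq_one)

lemma laurent_eq_sum:
  fixes f :: "'a::comm_ring_1 laurent"
  assumes "finite S" "\<And>k. lk f k \<noteq> 0 \<Longrightarrow> k \<in> S"
  shows "f = (\<Sum>k\<in>S. lconst (lk f k) * lX k)"
proof (rule poly_mapping_eqI)
  fix k
  have "(\<Sum>x\<in>S. lk (lconst (lk f x) * lX x) k) = (\<Sum>x\<in>S. if x = k then lk f k else 0)"
    by (rule sum.cong) (auto simp: lookup_lX)
  also have "\<dots> = lk f k" using assms by auto
  finally show "lk f k = lk (\<Sum>k\<in>S. lconst (lk f k) * lX k) k"
    by (simp add: lookup_sum)
qed

lemma laurent_induct [case_names zero monom add]:
  fixes f :: "'a::comm_ring_1 laurent"
  assumes "P 0" "\<And>c k. P (lconst c * lX k)" "\<And>f g. P f \<Longrightarrow> P g \<Longrightarrow> P (f + g)"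
  shows "P f"
proof -
  have "P (\<Sum>k\<in>S. lconst (lk f k) * lX k)" if "finite S" for S
    using that by induction (auto intro: assms)
  moreover have "f = (\<Sum>k\<in>Poly_Mapping.keys f. lconst (lk f k) * lX k)"
    by (rule laurent_eq_sum) (auto simp: in_keys_iff)
  ultimately show ?thesis by (metis finite_keys)
qed

section \<open>The operators s, pi, and T\<close>

text \<open>Both \<open>s_op\<close> and \<open>pi_op\<close> reflect exponents and differ only in a
  weight, which is \<open>g\<close> here.\<close>

lemma lookup_sum_keys_neg:
  fixes f :: "'a::comm_ring_1 laurent"
  shows "lk (\<Sum>m\<in>Poly_Mapping.keys f. Poly_Mapping.single (- m) (g m * lk f m)) k
     = g (- k) * lk f (- k)"
proof -
  have "lk (\<Sum>m\<in>Poly_Mapping.keys f. Poly_Mapping.single (- m) (g m * lk f m)) k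
     = (\<Sum>m\<in>Poly_Mapping.keys f. if m = - k then g (- k) * lk f (- k) else 0)"
    unfolding lookup_sum by (rule sum.cong) (auto simp: lookup_single when_def)
  also have "\<dots> = g (- k) * lk f (- k)"
    by (auto simp: in_keys_iff)
  finally show ?thesis .
qed

lemma lookup_s_op [simp]: "lk (s_op f) k = lk (f :: 'a::comm_ring_1 laurent) (- k)"
  using lookup_sum_keys_neg[of "\<lambda>_. 1" f k] by (simp add: s_op_def)

lemma lookup_pi_op [simp]: "lk (pi_op h f) k = h powi (- k) * lk f (- k)"
  using lookup_sum_keys_neg[of "\<lambda>m. h powi m" f k] by (simp add: pi_op_def)

lemma s_op_0 [simp]: "s_op 0 = (0 :: 'a::comm_ring_1 laurent)"
  and s_op_add: "s_op (f + g) = s_op f + (s_op g :: 'a::comm_ring_1 laurent)"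
  and s_op_diff: "s_op (f - g) = s_op f - (s_op g :: 'a::comm_ring_1 laurent)"
  and s_op_lX [simp]: "s_op (lX m) = (lX (- m) :: 'a::comm_ring_1 laurent)"
  and s_op_lconst [simp]: "s_op (lconst c) = (lconst c :: 'a::comm_ring_1 laurent)"
  and s_op_lconst_mult: "s_op (lconst c * f) = lconst c * (s_op f :: 'a::comm_ring_1 laurent)"
  and s_op_s_op [simp]: "s_op (s_op f) = (f :: 'a::comm_ring_1 laurent)"
  by (rule poly_mapping_eqI; auto simp: lookup_add lookup_minus lookup_lX lookup_lconst)+

lemma s_op_lX_mult: "s_op (lX m * f) = lX (- m) * (s_op f :: 'a::comm_ring_1 laurent)"
  by (rule poly_mapping_eqI) (simp add: add.commute)

lemma s_op_mult: "s_op (f * g) = s_op f * (s_op g :: 'a::comm_ring_1 laurent)"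
proof (induction f rule: laurent_induct)
  case (monom c k)
  then show ?case
    by (simp add: mult.assoc s_op_lconst_mult s_op_lX_mult)
qed (auto simp: s_op_add algebra_simps)

lemma s_op_1 [simp]: "s_op 1 = (1 :: 'a::comm_ring_1 laurent)"
  using s_op_lX[of 0] by simp

lemma s_op_prod: "s_op (prod g S) = (\<Prod>i\<in>S. s_op (g i) :: 'a::comm_ring_1 laurent)"
  by (induction S rule: infinite_finite_induct) (auto simp: s_op_mult)

lemma pi_op_0 [simp]: "pi_op h 0 = 0"
  and pi_op_add: "pi_op h (f + g) = pi_op h f + pi_op h g"
  and pi_op_diff: "pi_op h (f - g) = pi_op h f - pi_op h g"
  and pi_op_lX [simp]: "pi_op h (lX m) = lconst (h powi m) * lX (- m)"
  and pi_op_lconst [simp]: "pi_op h (lconst c) = lconst c"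
  and pi_op_lconst_mult: "pi_op h (lconst c * f) = lconst c * pi_op h f"
  by (rule poly_mapping_eqI;
      auto simp: lookup_add lookup_minus lookup_lX lookup_lconst distrib_left right_diff_distrib)+

lemma pi_op_lX_mult:
  assumes "h \<noteq> 0"
  shows "pi_op h (lX m * f) = lconst (h powi m) * (lX (- m) * pi_op h f)"
proof (rule poly_mapping_eqI)
  fix k
  have "h powi (- k) = h powi m * h powi (- (k + m))"
    using assms by (simp flip: power_int_add)
  then show "lk (pi_op h (lX m * f)) k = lk (lconst (h powi m) * (lX (- m) * pi_op h f)) k"
    by (simp add: add.commute)
qed

lemma pi_op_pi_op [simp]: "h \<noteq> 0 \<Longrightarrow> pi_op h (pi_op h f) = f"
  by (rule poly_mapping_eqI) (simp add: power_int_minus)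

lemma pi_op_1 [simp]: "pi_op h 1 = 1"
  using pi_op_lX[of h 0] by simp

lemma pi_op_mult: "h \<noteq> 0 \<Longrightarrow> pi_op h (f * g) = pi_op h f * pi_op h g"
proof (induction f rule: laurent_induct)
  case (monom c k)
  then show ?case
    by (simp add: mult.assoc pi_op_lconst_mult pi_op_lX_mult)
qed (auto simp: pi_op_add algebra_simps)

lemma pi_op_sum: "pi_op h (sum g S) = (\<Sum>i\<in>S. pi_op h (g i))"
  by (induction S rule: infinite_finite_induct) (auto simp: pi_op_add)

lemma pi_op_prod: "h \<noteq> 0 \<Longrightarrow> pi_op h (prod g S) = (\<Prod>i\<in>S. pi_op h (g i))"
  by (induction S rule: infinite_finite_induct) (auto simp: pi_op_mult)

text \<open>The divided difference (s - 1)/(X^2 - 1) is split off from \<open>T_pol\<close>, so that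
  the definite description is resolved only once.\<close>

definition div_diff :: "'a::idom laurent \<Rightarrow> 'a laurent" where
  "div_diff f = (THE g. (lX 2 - 1) * g = s_op f - f)"

lemma lX2_minus_1_ne_0 [simp]: "(lX 2 - 1 :: 'a::comm_ring_1 laurent) \<noteq> 0"
proof -
  have "lk (lX 2 - 1 :: 'a laurent) 2 = 1"
    by (simp add: lookup_minus lookup_lX lookup_one)
  then show ?thesis by force
qed

text \<open>On a monomial, X^{-k} - X^k is, up to sign and a power of X, equal to X^{2|k|} - 1,
  which is a multiple of X^2 - 1 by telescoping.\<close>

lemma s_op_diff_dvd: "(lX 2 - 1) dvd (s_op f - f :: 'a::idom laurent)"
proof (induction f rule: laurent_induct)
  case (monom c k)
  have base: "(lX 2 - 1) dvd (lX (2 * int n) - 1 :: 'a laurent)" for n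
  proof (induction n)
    case (Suc n)
    have "lX (2 * int (Suc n)) - 1 = lX 2 * (lX (2 * int n) - 1) + (lX 2 - 1 :: 'a laurent)"
      by (simp add: algebra_simps lX_add[symmetric])
    then show ?case using dvd_add[OF dvd_mult[OF Suc] dvd_refl] by (simp only:)
  qed auto
  have "(lX 2 - 1) dvd (lX (- k) - lX k :: 'a laurent)"
  proof (cases "k \<ge> 0")
    case True
    then have "lX (- k) - lX k = - lX (- k) * (lX (2 * int (nat k)) - 1 :: 'a laurent)"
      by (simp add: algebra_simps lX_add[symmetric])
    then show ?thesis using base by (metis dvd_mult)
  next
    case False
    then have "lX (- k) - lX k = lX k * (lX (2 * int (nat (- k))) - 1 :: 'a laurent)"
      by (simp add: algebra_simps lX_add[symmetric])
    then show ?thesis using base by (metis dvd_mult)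
  qed
  moreover have "s_op (lconst c * lX k) - lconst c * lX k = lconst c * (lX (- k) - lX k :: 'a laurent)"
    by (simp add: s_op_mult algebra_simps)
  ultimately show ?case by (simp only: dvd_mult)
next
  case (add f g)
  moreover have "s_op (f + g) - (f + g) = (s_op f - f) + (s_op g - g)"
    by (simp add: s_op_add)
  ultimately show ?case by (simp only: dvd_add)
qed auto

lemma div_diff: "(lX 2 - 1) * div_diff f = s_op f - (f :: 'a::idom laurent)"
proof -
  obtain g where g: "(lX 2 - 1) * g = s_op f - f" using s_op_diff_dvd by (metis dvdE)
  show ?thesis unfolding div_diff_def
    by (rule theI[of _ g]) (use g mult_left_cancel[OF lX2_minus_1_ne_0] in metis)+
qed

lemma T_pol_alt: "T_pol v f = lconst v * s_op f + lconst (v - inverse v) * div_diff f"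
  by (simp add: T_pol_def div_diff_def)

text \<open>The defining formula with its denominator cleared. The ring is a domain, so identities
  for T are verified after multiplication by X^2 - 1, which is then cancelled.\<close>

lemma T_pol_mult_eq:
  assumes "v \<noteq> 0"
  shows "(lX 2 - 1) * T_pol v f
    = (lconst v * lX 2 - lconst (inverse v)) * s_op f - lconst (v - inverse v) * f"
proof -
  have "(lX 2 - 1) * T_pol v f
    = lconst v * (lX 2 - 1) * s_op f + lconst (v - inverse v) * ((lX 2 - 1) * div_diff f)"
    unfolding T_pol_alt by (simp only: algebra_simps)
  then show ?thesis unfolding div_diff lconst_diff by (simp add: algebra_simps)
qed

lemma lX2_power: "lX 2 = (lX 1 ^ 2 :: 'a::comm_ring_1 laurent)"
  "lX (- 2) = (lX (- 1) ^ 2 :: 'a::comm_ring_1 laurent)"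
  by (simp_all add: power2_eq_square flip: lX_add)

lemma lX2_cancel: "(lX 2 - 1) * f = (lX 2 - 1) * g \<Longrightarrow> f = (g :: 'a::idom laurent)"
  using mult_left_cancel[OF lX2_minus_1_ne_0] by blast

lemma lX2_cancel2:
  "((lX 1)\<^sup>2 - 1) * (((lX 1)\<^sup>2 - 1) * f) = ((lX 1)\<^sup>2 - 1) * (((lX 1)\<^sup>2 - 1) * g)
    \<Longrightarrow> f = (g :: 'a::idom laurent)"
  unfolding lX2_power(1)[symmetric] by (rule lX2_cancel, rule lX2_cancel)

lemma T_pol_eqI:
  assumes "v \<noteq> 0"
    "(lX 2 - 1) * g = (lconst v * lX 2 - lconst (inverse v)) * s_op f - lconst (v - inverse v) * f"
  shows "T_pol v f = g"
  by (rule lX2_cancel) (rule trans[OF T_pol_mult_eq[OF assms(1)] assms(2)[symmetric]])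

section \<open>Linearity and Hecke relations of T\<close>

lemma T_pol_add:
  assumes "v \<noteq> 0"
  shows "T_pol v (f + g) = T_pol v f + T_pol v g"
  by (rule T_pol_eqI[OF assms],
      simp only: distrib_left[of "lX 2 - 1"] T_pol_mult_eq[OF assms] s_op_add)
    (simp add: algebra_simps)

text \<open>Since s(g f) = g s(f), the factor g passes through the cleared formula.\<close>

lemma T_pol_sym_mult:
  assumes "v \<noteq> 0" "s_op g = g"
  shows "T_pol v (g * f) = g * T_pol v f"
  by (rule T_pol_eqI[OF assms(1)],
      simp only: mult.left_commute[of _ g] T_pol_mult_eq[OF assms(1)] s_op_mult assms(2))
    (simp add: algebra_simps)

lemma T_pol_lconst_mult: "v \<noteq> 0 \<Longrightarrow> T_pol v (lconst c * f) = lconst c * T_pol v f"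
  by (simp add: T_pol_sym_mult)

lemma T_pol_0 [simp]: "v \<noteq> 0 \<Longrightarrow> T_pol v 0 = 0"
  using T_pol_lconst_mult[of v 0 0] by simp

lemma T_pol_uminus: "v \<noteq> 0 \<Longrightarrow> T_pol v (- f) = - T_pol v f"
  using T_pol_lconst_mult[of v "- 1" f] by (simp add: lconst_uminus)

lemma T_pol_diff: "v \<noteq> 0 \<Longrightarrow> T_pol v (f - g) = T_pol v f - T_pol v g"
  using T_pol_add[of v f "- g"] by (simp add: T_pol_uminus)

lemma T_pol_1: "v \<noteq> 0 \<Longrightarrow> T_pol v 1 = lconst v"
  by (rule T_pol_eqI) (simp_all add: lconst_diff algebra_simps)

lemma s_T_pol_mult_eq:
  assumes "v \<noteq> 0"
  shows "(lX (- 2) - 1) * s_op (T_pol v f)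
    = (lconst v * lX (- 2) - lconst (inverse v)) * f - lconst (v - inverse v) * s_op f"
  using arg_cong[OF T_pol_mult_eq[OF assms, of f], of s_op]
  by (simp add: s_op_mult s_op_diff)

text \<open>Commutative algebra behind two relations. Reading: x, y are X and X^{-1}; V, W are
  t^{1/2} and t^{-1/2}; g is s f; T is T f; S is s(T f); U is T(T f) in the first part and T(X T f)
  in the second. The correction terms with factors x y - 1 and V W - 1 make the intermediate steps
  polynomial identities.\<close>

lemma hecke_identities:
  fixes x y V W f g S T U :: "'a::idom"
  assumes "x * y = 1" "V * W = 1"
    "(x\<^sup>2 - 1) * T = (V * x\<^sup>2 - W) * g - (V - W) * f"
    "(y\<^sup>2 - 1) * S = (V * y\<^sup>2 - W) * f - (V - W) * g"
  shows "(x\<^sup>2 - 1) * U = (V * x\<^sup>2 - W) * S - (V - W) * T \<Longrightarrow>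
      (x\<^sup>2 - 1) * ((x\<^sup>2 - 1) * U) = (x\<^sup>2 - 1) * ((x\<^sup>2 - 1) * ((V - W) * T + f))"
    and "(x\<^sup>2 - 1) * U = (V * x\<^sup>2 - W) * (y * S) - (V - W) * (x * T) \<Longrightarrow>
      (x\<^sup>2 - 1) * ((x\<^sup>2 - 1) * U) = (x\<^sup>2 - 1) * ((x\<^sup>2 - 1) * (y * f))"
proof -
  have "x\<^sup>2 * y\<^sup>2 = 1"
    using assms(1) by (metis power_mult_distrib power_one)
  moreover have "(x\<^sup>2 - x\<^sup>2 * y\<^sup>2) * S = - (x\<^sup>2 * ((y\<^sup>2 - 1) * S))"
    by (simp add: algebra_simps)
  ultimately have S: "(x\<^sup>2 - 1) * S = (V - W) * x\<^sup>2 * g - (V * (x\<^sup>2 * y\<^sup>2) - W * x\<^sup>2) * f"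
    unfolding assms(4) by (simp add: algebra_simps)
  note S = S[unfolded \<open>x\<^sup>2 * y\<^sup>2 = 1\<close>]
  show "(x\<^sup>2 - 1) * ((x\<^sup>2 - 1) * U) = (x\<^sup>2 - 1) * ((x\<^sup>2 - 1) * ((V - W) * T + f))"
    if U: "(x\<^sup>2 - 1) * U = (V * x\<^sup>2 - W) * S - (V - W) * T"
  proof -
    have "(x\<^sup>2 - 1) * ((x\<^sup>2 - 1) * U) = (V * x\<^sup>2 - W) * ((x\<^sup>2 - 1) * S) - (V - W) * ((x\<^sup>2 - 1) * T)"
      unfolding U by (simp only: algebra_simps)
    also have "\<dots> = (x\<^sup>2 - 1) * ((V - W) * ((V * x\<^sup>2 - W) * g - (V - W) * f) + (x\<^sup>2 - 1) * f)
        + (V * W - 1) * ((x\<^sup>2 - 1)\<^sup>2 * f)"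
      unfolding S assms(3) by (simp add: algebra_simps power2_eq_square)
    also have "\<dots> = (x\<^sup>2 - 1) * ((x\<^sup>2 - 1) * ((V - W) * T + f))"
      unfolding assms(3)[symmetric] assms(2) by (simp add: algebra_simps)
    finally show ?thesis .
  qed
  show "(x\<^sup>2 - 1) * ((x\<^sup>2 - 1) * U) = (x\<^sup>2 - 1) * ((x\<^sup>2 - 1) * (y * f))"
    if U: "(x\<^sup>2 - 1) * U = (V * x\<^sup>2 - W) * (y * S) - (V - W) * (x * T)"
  proof -
    have "(x\<^sup>2 - 1) * ((x\<^sup>2 - 1) * U)
        = (V * x\<^sup>2 - W) * y * ((x\<^sup>2 - 1) * S) - (V - W) * x * ((x\<^sup>2 - 1) * T)"
      unfolding U by (simp only: algebra_simps)
    also have "\<dots> = (x\<^sup>2 - 1) * ((x\<^sup>2 - 1) * (y * f))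
        + (x * y - 1) * ((V * x\<^sup>2 - W) * (V - W) * x * g + x * (2 - V\<^sup>2 - W\<^sup>2) * f)
        + (V * W - 1) * ((y * (x ^ 4 + 1) - 2 * x) * f)"
      unfolding S assms(3) by (simp add: algebra_simps power2_eq_square power4_eq_xxxx)
    also have "\<dots> = (x\<^sup>2 - 1) * ((x\<^sup>2 - 1) * (y * f))"
      unfolding assms(1,2) by simp
    finally show ?thesis .
  qed
qed

lemma lconst_inverse: "(v :: 'a::field) \<noteq> 0 \<Longrightarrow> lconst v * lconst (inverse v) = 1"
  by (simp flip: lconst_mult)

lemma T_pol_quadratic:
  assumes "v \<noteq> 0"
  shows "T_pol v (T_pol v f) = lconst (v - inverse v) * T_pol v f + f"
  unfolding lconst_diff
  by (rule lX2_cancel2,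
      rule hecke_identities(1)[OF lX_inverse(1)[of 1] lconst_inverse[OF assms]
      T_pol_mult_eq[OF assms, of f, unfolded lX2_power lconst_diff]
      s_T_pol_mult_eq[OF assms, of f, unfolded lX2_power lconst_diff]
      T_pol_mult_eq[OF assms, of "T_pol v f", unfolded lX2_power lconst_diff]])

lemma T_pol_X_T_pol:
  assumes "v \<noteq> 0"
  shows "T_pol v (lX 1 * T_pol v f) = lX (- 1) * f"
  by (rule lX2_cancel2,
      rule hecke_identities(2)[OF lX_inverse(1)[of 1] lconst_inverse[OF assms]
      T_pol_mult_eq[OF assms, of f, unfolded lX2_power lconst_diff]
      s_T_pol_mult_eq[OF assms, of f, unfolded lX2_power lconst_diff]
      T_pol_mult_eq[OF assms, of "lX 1 * T_pol v f", unfolded lX2_power lconst_diff s_op_lX_mult]])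

text \<open>By the quadratic relation, T^{-1} is T minus the scalar t^{1/2} - t^{-1/2}; being linear
  in T, it inherits most properties of T.\<close>

definition T_inv :: "'a::field \<Rightarrow> 'a laurent \<Rightarrow> 'a laurent" where
  "T_inv v f = T_pol v f - lconst (v - inverse v) * f"

lemma T_inv_T_pol [simp]: "v \<noteq> 0 \<Longrightarrow> T_inv v (T_pol v f) = f"
  and T_pol_T_inv [simp]: "v \<noteq> 0 \<Longrightarrow> T_pol v (T_inv v f) = f"
  by (simp_all add: T_inv_def T_pol_quadratic T_pol_diff T_pol_lconst_mult)

section \<open>Explicit nonsymmetric polynomials\<close>

fun qbinom :: "'a::comm_ring_1 \<Rightarrow> nat \<Rightarrow> nat \<Rightarrow> 'a" where
  "qbinom q n 0 = 1"
| "qbinom q 0 (Suc k) = 0"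
| "qbinom q (Suc n) (Suc k) = qbinom q n k + q ^ Suc k * qbinom q n (Suc k)"

lemma qbinom_eq_0: "k > n \<Longrightarrow> qbinom q n k = 0"
  by (induction q n k rule: qbinom.induct) auto

lemma qbinom_self [simp]: "qbinom q n n = 1"
  by (induction n) (auto simp: qbinom_eq_0)

text \<open>The second Pascal rule, mirror image of the defining one. In the step, the defining rule
  is applied and the induction hypothesis is used for both of its terms; the symmetry of the
  coefficients comes from having both rules.\<close>

lemma qbinom_Suc_Suc':
  "k \<le> n \<Longrightarrow> qbinom q (Suc n) (Suc k) = qbinom q n (Suc k) + q ^ (n - k) * qbinom q n k"
proof (induction n arbitrary: k)
  case (Suc n)
  show ?case
  proof (cases k)
    case 0
    then show ?thesis using Suc.IH[of 0] by (simp add: algebra_simps)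
  next
    case (Suc j)
    then have j: "j \<le> n" using Suc.prems by simp
    show ?thesis
    proof (cases "j = n")
      case True
      then show ?thesis by (simp add: Suc qbinom_eq_0)
    next
      case False
      then obtain m where m: "n = Suc (j + m)" using j less_imp_Suc_add le_neq_implies_less by blast
      have "qbinom q (Suc (Suc n)) (Suc (Suc j))
          = qbinom q (Suc n) (Suc j) + q ^ Suc (Suc j) * qbinom q (Suc n) (Suc (Suc j))"
        by (rule qbinom.simps(3))
      also have "qbinom q (Suc n) (Suc j) = qbinom q n (Suc j) + q ^ Suc m * qbinom q n j"
        using Suc.IH[of j] m by simp
      also have "qbinom q (Suc n) (Suc (Suc j)) = qbinom q n (Suc (Suc j)) + q ^ m * qbinom q n (Suc j)"
        using Suc.IH[of "Suc j"] m by simp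
      finally show ?thesis
        using m Suc by (simp add: algebra_simps)
    qed
  qed
qed auto

lemma qbinom_sym: "k \<le> n \<Longrightarrow> qbinom q n (n - k) = qbinom q n k"
proof (induction n arbitrary: k)
  case (Suc n)
  show ?case
  proof (cases k)
    case (Suc j)
    then have j: "j \<le> n" using Suc.prems by simp
    show ?thesis
    proof (cases "j = n")
      case False
      then obtain m where m: "n = Suc (j + m)" using j less_imp_Suc_add le_neq_implies_less by blast
      have "qbinom q (Suc n) (Suc m) = qbinom q n (Suc m) + q ^ (n - m) * qbinom q n m"
        by (rule qbinom_Suc_Suc') (use m in simp)
      moreover have "qbinom q n (Suc m) = qbinom q n j" "qbinom q n m = qbinom q n (Suc j)"
        using Suc.IH[of j] Suc.IH[of "Suc j"] m by simp_all
      ultimately show ?thesis using m Suc by simp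
    qed (use Suc in simp)
  qed simp
qed auto

lemma qbinomial_theorem:
  "(\<Prod>j<n. 1 + q ^ j * z) = (\<Sum>j\<le>n. q ^ (j * (j - 1) div 2) * qbinom q n j * z ^ j)"
proof (induction n)
  case (Suc n)
  let ?T = "\<lambda>j. j * (j - 1) div 2"
  have T: "?T (Suc j) = ?T j + j" for j
    by (induction j) (simp_all add: algebra_simps)
  have "(\<Prod>j<Suc n. 1 + q ^ j * z)
    = (\<Sum>j\<le>n. q ^ ?T j * qbinom q n j * z ^ j) + (\<Sum>j\<le>n. q ^ (?T j + n) * qbinom q n j * z ^ Suc j)"
  proof -
    let ?S = "\<Sum>j\<le>n. q ^ ?T j * qbinom q n j * z ^ j"
    have "?S * (q ^ n * z) = (\<Sum>j\<le>n. q ^ (?T j + n) * qbinom q n j * z ^ Suc j)"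
      unfolding sum_distrib_right by (rule sum.cong) (simp_all add: power_add mult_ac)
    then show ?thesis unfolding prod.lessThan_Suc Suc by (simp only: distrib_left mult_1_right)
  qed
  also have "(\<Sum>j\<le>n. q ^ ?T j * qbinom q n j * z ^ j)
      = (\<Sum>j\<le>Suc n. q ^ ?T j * qbinom q n j * z ^ j)"
    by (simp add: qbinom_eq_0)
  also have "\<dots> = 1 + (\<Sum>j\<le>n. q ^ ?T (Suc j) * qbinom q n (Suc j) * z ^ Suc j)"
    by (subst sum.atMost_Suc_shift) simp
  also have "1 + (\<Sum>j\<le>n. q ^ ?T (Suc j) * qbinom q n (Suc j) * z ^ Suc j)
        + (\<Sum>j\<le>n. q ^ (?T j + n) * qbinom q n j * z ^ Suc j)
      = 1 + (\<Sum>j\<le>n. q ^ ?T (Suc j) * qbinom q (Suc n) (Suc j) * z ^ Suc j)"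
  proof -
    have "q ^ ?T (Suc j) * qbinom q n (Suc j) * z ^ Suc j + q ^ (?T j + n) * qbinom q n j * z ^ Suc j
      = q ^ ?T (Suc j) * qbinom q (Suc n) (Suc j) * z ^ Suc j" if "j \<le> n" for j
    proof -
      have "q ^ (?T j + n) = q ^ ?T (Suc j) * q ^ (n - j)"
        unfolding T using that by (simp flip: power_add)
      then show ?thesis
        unfolding qbinom_Suc_Suc'[OF that] by (simp only: algebra_simps)
    qed
    then have "(\<Sum>j\<le>n. q ^ ?T (Suc j) * qbinom q n (Suc j) * z ^ Suc j)
        + (\<Sum>j\<le>n. q ^ (?T j + n) * qbinom q n j * z ^ Suc j)
      = (\<Sum>j\<le>n. q ^ ?T (Suc j) * qbinom q (Suc n) (Suc j) * z ^ Suc j)"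
      unfolding sum.distrib[symmetric] by (intro sum.cong) (simp_all only: atMost_iff)
    then show ?thesis by (simp only: add.assoc)
  qed
  also have "\<dots> = (\<Sum>j\<le>Suc n. q ^ ?T j * qbinom q (Suc n) j * z ^ j)"
    by (subst sum.atMost_Suc_shift) simp
  finally show ?case .
qed simp

definition qpoch :: "'a::comm_ring_1 \<Rightarrow> 'a \<Rightarrow> nat \<Rightarrow> 'a" where
  "qpoch t q k = (\<Prod>i<k. 1 - t * q ^ i)"

lemma qpoch_0 [simp]: "qpoch t q 0 = 1"
  and qpoch_Suc: "qpoch t q (Suc k) = qpoch t q k * (1 - t * q ^ k)"
  by (simp_all add: qpoch_def)

lemma qpoch_Suc_shift: "qpoch t q (Suc k) = (1 - t) * qpoch (t * q) q k"
  unfolding qpoch_def by (subst prod.lessThan_Suc_shift) (simp add: mult.assoc)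

text \<open>Closed form of the coefficients of the nonsymmetric Rogers polynomials, normalized to be
  1 at j = 0.\<close>

definition e_coeff :: "'a::field \<Rightarrow> 'a \<Rightarrow> nat \<Rightarrow> nat \<Rightarrow> 'a" where
  "e_coeff q t n j = qbinom q n j * qpoch t q j * qpoch (t * q) q (n - j) / qpoch (t * q) q n"

definition e_neg :: "'a::field \<Rightarrow> 'a \<Rightarrow> nat \<Rightarrow> 'a laurent" where
  "e_neg q t n = (\<Sum>j\<le>n. lconst (e_coeff q t n j) * lX (2 * int j - int n))"

text \<open>The polynomial of index n + 1, not n: it arises from the one of index -n by applying X
  \<pi>, hence the common parameter n.\<close>

definition e_pos :: "'a::field \<Rightarrow> 'a \<Rightarrow> nat \<Rightarrow> 'a laurent" where
  "e_pos q t n = (\<Sum>j\<le>n. lconst (q ^ j * e_coeff q t n j) * lX (int n + 1 - 2 * int j))"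

text \<open>These are the factors of the denominator (tq;q)_n, common to the polynomials of indices
  -n and n + 1.\<close>

definition nondeg :: "'a::field \<Rightarrow> 'a \<Rightarrow> nat \<Rightarrow> bool" where
  "nondeg q t n \<longleftrightarrow> (\<forall>i\<in>{1..n}. 1 - t * q ^ i \<noteq> 0)"

lemma nondeg_mono: "nondeg q t n \<Longrightarrow> m \<le> n \<Longrightarrow> nondeg q t m"
  by (auto simp: nondeg_def)

lemma nondeg_Suc: "nondeg q t (Suc n) \<Longrightarrow> 1 - t * q ^ Suc n \<noteq> 0"
  unfolding nondeg_def by (drule bspec[of _ _ "Suc n"]) (simp_all del: power_Suc)

lemma qpoch_ne_0: "nondeg q t n \<Longrightarrow> qpoch (t * q) q n \<noteq> 0"
  unfolding qpoch_def nondeg_def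
  by (auto simp: mult.assoc power_Suc[symmetric] simp del: power_Suc)

lemma e_coeff_eq_0: "j > n \<Longrightarrow> e_coeff q t n j = 0"
  by (simp add: e_coeff_def qbinom_eq_0)

lemma e_coeff_0: "nondeg q t n \<Longrightarrow> e_coeff q t n 0 = 1"
  by (simp add: e_coeff_def qpoch_ne_0)

text \<open>Coefficientwise form of X^{-1} e_{-n} = e_{-n-1} + c e_{n+1}. In the interior case the
  three coefficients share the factors A, B and P, and what remains is linear in two neighbouring
  Gaussian binomials.\<close>

lemma e_coeff_recursion:
  assumes "nondeg q t (Suc n)" "j \<le> Suc n"
  shows "e_coeff q t n j = e_coeff q t (Suc n) j
    + (t - 1) / (1 - t * q ^ Suc n) * (q ^ (Suc n - j) * e_coeff q t n (Suc n - j))"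
proof -
  have nz: "qpoch (t * q) q n \<noteq> 0" "1 - t * q ^ Suc n \<noteq> 0"
    using qpoch_ne_0[OF nondeg_mono[OF assms(1)], of n] nondeg_Suc[OF assms(1)] by simp_all
  have PS: "qpoch (t * q) q (Suc k) = qpoch (t * q) q k * (1 - t * q ^ Suc k)" for k
    by (simp add: qpoch_Suc mult.assoc)
  consider "j = 0" | "j = Suc n" | i m where "j = Suc i" "n = Suc (i + m)"
    using assms(2) by (metis Suc_le_mono le_neq_implies_less less_imp_Suc_add not0_implies_Suc)
  then show ?thesis
  proof cases
    case 1
    then show ?thesis
      using assms nondeg_mono[of q t "Suc n" n] by (simp add: e_coeff_0 e_coeff_eq_0)
  next
    case 2
    have "e_coeff q t (Suc n) (Suc n) = (1 - t) / (1 - t * q ^ Suc n)"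
      using nz by (simp add: e_coeff_def qpoch_Suc_shift[of t] PS del: power_Suc)
    then show ?thesis
      using 2 assms nondeg_mono[of q t "Suc n" n]
      by (simp add: e_coeff_0 e_coeff_eq_0 add_divide_distrib[symmetric] del: power_Suc)
  next
    case (3 i m)
    define g where "g = qbinom q n i"
    define g' where "g' = qbinom q n (Suc i)"
    define P where "P = qpoch (t * q) q n"
    define A where "A = qpoch (t * q) q i"
    define B where "B = qpoch (t * q) q m"
    define Q where "Q = q ^ Suc m"
    define R where "R = 1 - t * q ^ Suc n"
    \<comment> \<open>Both Pascal rules are needed: in the product of 1 - t Q with the binomial, one
      rule expands the term with 1 and the other the term with t Q.\<close>
    have G: "qbinom q (Suc n) (Suc i) = g + q ^ Suc i * g'" "qbinom q (Suc n) (Suc i) = g' + Q * g"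
      using qbinom_Suc_Suc'[of i n q] 3 by (simp_all add: g_def g'_def Q_def)
    have sym: "qbinom q n (Suc m) = g"
      using qbinom_sym[of i n q] 3 by (simp add: g_def)
    have c1: "e_coeff q t n j = g' * ((1 - t) * A) * B / P"
      using 3 by (simp add: e_coeff_def g'_def A_def B_def P_def qpoch_Suc_shift)
    have c2: "e_coeff q t (Suc n) j
        = qbinom q (Suc n) (Suc i) * ((1 - t) * A) * (B * (1 - t * Q)) / (P * R)"
    proof -
      have "Suc n - Suc i = Suc m" using 3 by simp
      then show ?thesis unfolding e_coeff_def 3(1) PS Q_def P_def R_def A_def B_def
        by (simp only: qpoch_Suc_shift[of t] PS)
    qed
    have c3: "e_coeff q t n (Suc n - j) = g * ((1 - t) * B) * A / P"
      using 3 sym by (simp add: e_coeff_def A_def B_def P_def qpoch_Suc_shift)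
    have Q: "q ^ (Suc n - j) = Q" using 3 by (simp add: Q_def)
    have QQ: "Q * q ^ Suc i = q ^ Suc n" using 3 by (simp add: Q_def add.commute flip: power_add)
    have "g' * R = (1 - t * Q) * qbinom q (Suc n) (Suc i) - (1 - t) * Q * g"
    proof -
      have "(1 - t * Q) * qbinom q (Suc n) (Suc i) = (g' + Q * g) - t * Q * (g + q ^ Suc i * g')"
        unfolding left_diff_distrib by (simp only: G(2) mult_1 flip: G(1))
      then have "(1 - t * Q) * qbinom q (Suc n) (Suc i) - (1 - t) * Q * g
          = g' - t * (Q * q ^ Suc i) * g'"
        by (simp add: algebra_simps)
      then show ?thesis unfolding QQ R_def by (simp add: algebra_simps)
    qed
    moreover have "R \<noteq> 0" "P \<noteq> 0" using nz by (auto simp: R_def P_def)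
    ultimately have "g' = ((1 - t * Q) * qbinom q (Suc n) (Suc i) - (1 - t) * Q * g) / R"
      by (simp add: field_simps)
    then have "g' * ((1 - t) * A) * B / P
       = ((1 - t * Q) * qbinom q (Suc n) (Suc i) - (1 - t) * Q * g) / R * ((1 - t) * A) * B / P"
      by simp
    also have "\<dots> = qbinom q (Suc n) (Suc i) * ((1 - t) * A) * (B * (1 - t * Q)) / (P * R)
        + (t - 1) / R * (Q * (g * ((1 - t) * B) * A / P))"
      using \<open>R \<noteq> 0\<close> \<open>P \<noteq> 0\<close> by (simp add: divide_simps) (simp add: algebra_simps)
    finally show ?thesis unfolding c1 c2 c3 Q R_def .
  qed
qed

lemma e_neg_recursion:
  assumes "nondeg q t (Suc n)"
  shows "lX (- 1) * e_neg q t n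
    = e_neg q t (Suc n) + lconst ((t - 1) / (1 - t * q ^ Suc n)) * e_pos q t n"
proof -
  let ?c = "(t - 1) / (1 - t * q ^ Suc n)"
  have "lX (- 1) * e_neg q t n
      = (\<Sum>j\<le>n. lconst (e_coeff q t n j) * lX (2 * int j - int (Suc n)))"
    unfolding e_neg_def sum_distrib_left
    by (rule sum.cong) (simp_all add: mult.left_commute[of "lX (- 1)"] lX_add[symmetric] diff_diff_eq add.commute)
  also have "\<dots> = (\<Sum>j\<le>Suc n. lconst (e_coeff q t n j) * lX (2 * int j - int (Suc n)))"
    by (simp add: e_coeff_eq_0)
  finally have 1: "lX (- 1) * e_neg q t n = \<dots>" .
  \<comment> \<open>The sum is extended by the vanishing term j = n + 1 and then reversed, so that
    its exponents match those of \<open>e_neg\<close> at n + 1.\<close>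
  have "e_pos q t n = (\<Sum>j<Suc (Suc n). lconst (q ^ j * e_coeff q t n j) * lX (int n + 1 - 2 * int j))"
    unfolding e_pos_def lessThan_Suc_atMost by (simp add: e_coeff_eq_0)
  also have "\<dots> = (\<Sum>j<Suc (Suc n). lconst (q ^ (Suc n - j) * e_coeff q t n (Suc n - j))
        * lX (int n + 1 - 2 * int (Suc n - j)))"
    by (subst sum.nat_diff_reindex[symmetric]) simp
  also have "\<dots> = (\<Sum>j\<le>Suc n. lconst (q ^ (Suc n - j) * e_coeff q t n (Suc n - j))
        * lX (2 * int j - int (Suc n)))"
    unfolding lessThan_Suc_atMost by (rule sum.cong) (auto simp: of_nat_diff algebra_simps)
  finally have 2: "e_pos q t n = \<dots>" .
  show ?thesis
    unfolding 1 2 e_neg_def[of q t "Suc n"] sum_distrib_left sum.distrib[symmetric]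
  proof (rule sum.cong)
    fix j assume "j \<in> {..Suc n}"
    then have "j \<le> Suc n" by simp
    show "lconst (e_coeff q t n j) * lX (2 * int j - int (Suc n)) =
        lconst (e_coeff q t (Suc n) j) * lX (2 * int j - int (Suc n)) +
        lconst ?c * (lconst (q ^ (Suc n - j) * e_coeff q t n (Suc n - j)) *
          lX (2 * int j - int (Suc n)))"
      unfolding e_coeff_recursion[OF assms \<open>j \<le> Suc n\<close>] lconst_add lconst_mult
      by (simp only: distrib_right mult.assoc)
  qed simp
qed

text \<open>X \<pi> is the raising operator of the theory. It leads from e_{-n} to e_{n+1} because
  \<pi> multiplies X^{2j-n} by h^{2j-n}, which the factor h^n turns into q^j.\<close>

lemma e_pos_eq_pi:
  assumes "h \<noteq> 0"
  shows "e_pos (h\<^sup>2) t n = lconst (h ^ n) * (lX 1 * pi_op h (e_neg (h\<^sup>2) t n))"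
proof -
  have "lconst (h ^ n) * (lX 1 * pi_op h (e_neg (h\<^sup>2) t n))
     = (\<Sum>j\<le>n. lconst (h ^ n * (e_coeff (h\<^sup>2) t n j * h powi (2 * int j - int n)))
          * (lX 1 * lX (- (2 * int j - int n))))"
    unfolding e_neg_def pi_op_sum pi_op_lconst_mult pi_op_lX sum_distrib_left lconst_mult
    by (rule sum.cong) (simp_all only: mult_ac)
  also have "\<dots> = e_pos (h\<^sup>2) t n"
    unfolding e_pos_def
  proof (rule sum.cong)
    fix j assume "j \<in> {..n}"
    have "h ^ n * (e_coeff (h\<^sup>2) t n j * h powi (2 * int j - int n))
       = (h powi int n * h powi (2 * int j - int n)) * e_coeff (h\<^sup>2) t n j" by simp
    also have "h powi int n * h powi (2 * int j - int n) = h powi (2 * int j)"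
      using assms by (subst power_int_add[symmetric]) simp_all
    also have "\<dots> = (h\<^sup>2) ^ j" by (metis of_nat_mult of_nat_numeral power_int_of_nat power_mult)
    finally have E: "h ^ n * (e_coeff (h\<^sup>2) t n j * h powi (2 * int j - int n))
      = (h\<^sup>2) ^ j * e_coeff (h\<^sup>2) t n j" .
    have idx: "1 + - (2 * int j - int n) = int n + 1 - 2 * int j" by simp
    show "lconst (h ^ n * (e_coeff (h\<^sup>2) t n j * h powi (2 * int j - int n)))
          * (lX 1 * lX (- (2 * int j - int n)))
       = lconst ((h\<^sup>2) ^ j * e_coeff (h\<^sup>2) t n j) * lX (int n + 1 - 2 * int j)"
      by (simp only: E lX_add[symmetric] idx)
  qed simp
  finally show ?thesis by simp
qed

lemma e_neg_0 [simp]: "e_neg q t 0 = 1"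
  by (simp add: e_neg_def e_coeff_def)

text \<open>The diagonal entry of T at e_n in the plane spanned by e_{-n} and e_n.\<close>

definition T_diag :: "'a::field \<Rightarrow> 'a \<Rightarrow> nat \<Rightarrow> 'a" where
  "T_diag h v n = (v - inverse v) / (1 - v\<^sup>2 * (h\<^sup>2) ^ n)"

lemma T_pol_eq_pi:
  assumes "h \<noteq> 0" "Y_pol h v f = lconst c * f"
  shows "T_pol v f = lconst c * pi_op h f"
  using assms by (metis Y_pol_def pi_op_pi_op pi_op_lconst_mult)

context
  fixes h v :: "'a::field"
  assumes h: "h \<noteq> 0" and v: "v \<noteq> 0"
begin

text \<open>The eigenvector equation turns \<pi> e_{-n} into a multiple of T e_{-n}; hence e_{n+1}
  is a multiple of X T e_{-n}, and T X T = X^{-1} applies.\<close>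

lemma T_pol_e_pos_aux:
  assumes "Y_pol h v (e_neg (h\<^sup>2) (v\<^sup>2) n) = lconst (v * h ^ n) * e_neg (h\<^sup>2) (v\<^sup>2) n"
  shows "T_pol v (e_pos (h\<^sup>2) (v\<^sup>2) n) = lconst (inverse v) * (lX (- 1) * e_neg (h\<^sup>2) (v\<^sup>2) n)"
proof -
  let ?e = "e_neg (h\<^sup>2) (v\<^sup>2) n"
  have "T_pol v ?e = lconst (v * h ^ n) * pi_op h ?e"
    using T_pol_eq_pi[OF h assms] .
  then have "lconst (inverse v) * T_pol v ?e = lconst (h ^ n) * pi_op h ?e"
    using v by (simp add: mult.assoc[symmetric] lconst_mult[symmetric])
  then have "e_pos (h\<^sup>2) (v\<^sup>2) n = lconst (inverse v) * (lX 1 * T_pol v ?e)"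
    unfolding e_pos_eq_pi[OF h] by (metis mult.left_commute)
  then show ?thesis
    using v by (simp add: T_pol_lconst_mult T_pol_X_T_pol)
qed

lemma Y_pol_e_pos_aux:
  assumes "Y_pol h v (e_neg (h\<^sup>2) (v\<^sup>2) n) = lconst (v * h ^ n) * e_neg (h\<^sup>2) (v\<^sup>2) n"
  shows "Y_pol h v (e_pos (h\<^sup>2) (v\<^sup>2) n) = lconst (inverse (v * h ^ Suc n)) * e_pos (h\<^sup>2) (v\<^sup>2) n"
proof -
  have "Y_pol h v (e_pos (h\<^sup>2) (v\<^sup>2) n)
      = lconst (inverse v * inverse h) * (lX 1 * pi_op h (e_neg (h\<^sup>2) (v\<^sup>2) n))"
    unfolding Y_pol_def T_pol_e_pos_aux[OF assms] pi_op_lconst_mult pi_op_lX_mult[OF h] lconst_mult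
    by (simp add: power_int_minus mult.assoc)
  also have "inverse v * inverse h = inverse (v * h ^ Suc n) * h ^ n"
    using h v by (simp add: field_simps)
  finally show ?thesis unfolding e_pos_eq_pi[OF h] lconst_mult by (simp only: mult.assoc)
qed

lemma T_pol_e_pos_aux2:
  assumes "Y_pol h v (e_neg (h\<^sup>2) (v\<^sup>2) n) = lconst (v * h ^ n) * e_neg (h\<^sup>2) (v\<^sup>2) n"
    "nondeg (h\<^sup>2) (v\<^sup>2) (Suc n)"
  shows "T_pol v (e_pos (h\<^sup>2) (v\<^sup>2) n) = lconst (inverse v) * e_neg (h\<^sup>2) (v\<^sup>2) (Suc n)
      + lconst (T_diag h v (Suc n)) * e_pos (h\<^sup>2) (v\<^sup>2) n"
proof -
  have "inverse v * ((v\<^sup>2 - 1) / (1 - v\<^sup>2 * (h\<^sup>2) ^ Suc n)) = T_diag h v (Suc n)"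
    using v by (simp add: T_diag_def field_simps power2_eq_square)
  then show ?thesis
    unfolding T_pol_e_pos_aux[OF assms(1)] e_neg_recursion[OF assms(2)]
    by (simp add: distrib_left mult.assoc[symmetric] lconst_mult[symmetric])
qed

text \<open>Induction along e_{-n}, e_{n+1}, e_{-n-1}. Let w = e_{n+1}, with eigenvalue 1/L for L =
  t^{1/2} h^{n+1}. The span of w and T w is stable under Y, and e = v T w - v a w is an eigenvector
  for L because a (1 - L^2) = t^{1/2} - t^{-1/2}, which is how the diagonal entry a arises.\<close>

lemma Y_pol_e_neg:
  "nondeg (h\<^sup>2) (v\<^sup>2) n \<Longrightarrow>
    Y_pol h v (e_neg (h\<^sup>2) (v\<^sup>2) n) = lconst (v * h ^ n) * e_neg (h\<^sup>2) (v\<^sup>2) n"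
proof (induction n)
  case 0
  show ?case using v by (simp add: Y_pol_def T_pol_1)
next
  case (Suc n)
  have IH: "Y_pol h v (e_neg (h\<^sup>2) (v\<^sup>2) n) = lconst (v * h ^ n) * e_neg (h\<^sup>2) (v\<^sup>2) n"
    using Suc nondeg_mono[OF Suc.prems, of n] by auto
  define w where "w = e_pos (h\<^sup>2) (v\<^sup>2) n"
  define e where "e = e_neg (h\<^sup>2) (v\<^sup>2) (Suc n)"
  define L where "L = v * h ^ Suc n"
  define a where "a = T_diag h v (Suc n)"
  define d where "d = v - inverse v"
  have L: "L \<noteq> 0" using h v by (simp add: L_def)
  have Yw: "Y_pol h v w = lconst (inverse L) * w"
    using Y_pol_e_pos_aux[OF IH] by (simp add: w_def L_def)
  have Tw: "T_pol v w = lconst (inverse v) * e + lconst a * w"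
    using T_pol_e_pos_aux2[OF IH Suc.prems] by (simp add: w_def e_def a_def)
  have Tw': "T_pol v w = lconst (inverse L) * pi_op h w"
    by (rule T_pol_eq_pi[OF h Yw])
  have w: "w = lconst (inverse L) * T_inv v (pi_op h w)"
    using T_inv_T_pol[OF v, of w] unfolding Tw'
    by (simp add: T_inv_def T_pol_lconst_mult v algebra_simps)
  have "lconst L * w = T_inv v (pi_op h w)"
    by (subst w) (simp add: mult.assoc[symmetric] lconst_mult[symmetric] L)
  then have Tpw: "T_pol v (pi_op h w) = lconst L * w + lconst d * pi_op h w"
    by (simp add: T_inv_def d_def)
  have pT: "pi_op h w = lconst L * T_pol v w"
    unfolding Tw' using L by (simp add: mult.assoc[symmetric] lconst_mult[symmetric])
  \<comment> \<open>T w is 1/L times \<pi> w, so Y T w is obtained from T(\<pi> w), which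
    \<open>Tpw\<close> supplies by inverting T.\<close>
  have YTw: "Y_pol h v (T_pol v w) = lconst L * T_pol v w + lconst (inverse L * d) * w"
  proof -
    have "Y_pol h v (T_pol v w) = lconst (inverse L) * pi_op h (T_pol v (pi_op h w))"
      by (subst Tw') (simp add: Y_pol_def T_pol_lconst_mult v pi_op_lconst_mult)
    also have "\<dots> = lconst (inverse L * L) * pi_op h w + lconst (inverse L * d) * w"
      unfolding Tpw pi_op_add pi_op_lconst_mult pi_op_pi_op[OF h] lconst_mult
      by (simp only: distrib_left mult.assoc)
    finally show ?thesis using L by (simp add: pT)
  qed
  have e: "e = lconst v * T_pol v w - lconst (v * a) * w"
    unfolding Tw using v by (simp add: distrib_left mult.assoc[symmetric] lconst_mult lconst_inverse)
  have nz: "1 - v\<^sup>2 * (h\<^sup>2) ^ Suc n \<noteq> 0" by (rule nondeg_Suc[OF Suc.prems])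
  have LL: "L * L = v\<^sup>2 * (h\<^sup>2) ^ Suc n"
    by (simp add: L_def power2_eq_square power_mult_distrib mult_ac)
  have ad: "a * (1 - L * L) = d"
    unfolding a_def d_def T_diag_def LL using nz by simp
  have coef: "v * (inverse L * d) - v * a * inverse L = - (L * (v * a))"
    unfolding ad[symmetric] using L by (simp add: field_simps)
  have "Y_pol h v e = lconst v * Y_pol h v (T_pol v w) - lconst (v * a) * Y_pol h v w"
    unfolding e by (simp add: Y_pol_def T_pol_diff T_pol_lconst_mult v pi_op_diff pi_op_lconst_mult)
  also have "\<dots> = lconst (v * L) * T_pol v w + lconst (v * (inverse L * d) - v * a * inverse L) * w"
    unfolding YTw Yw lconst_mult lconst_diff by (simp only: algebra_simps)
  also have "\<dots> = lconst L * e"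
    unfolding coef e by (simp add: lconst_mult lconst_uminus algebra_simps)
  finally show ?case by (simp add: e_def L_def)
qed

lemma Y_pol_e_pos:
  "nondeg (h\<^sup>2) (v\<^sup>2) n \<Longrightarrow> Y_pol h v (e_pos (h\<^sup>2) (v\<^sup>2) n)
     = lconst (inverse (v * h ^ Suc n)) * e_pos (h\<^sup>2) (v\<^sup>2) n"
  by (rule Y_pol_e_pos_aux) (rule Y_pol_e_neg)

lemma T_pol_e_pos:
  "nondeg (h\<^sup>2) (v\<^sup>2) (Suc n) \<Longrightarrow>
    T_pol v (e_pos (h\<^sup>2) (v\<^sup>2) n) = lconst (inverse v) * e_neg (h\<^sup>2) (v\<^sup>2) (Suc n)
      + lconst (T_diag h v (Suc n)) * e_pos (h\<^sup>2) (v\<^sup>2) n"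
  by (rule T_pol_e_pos_aux2[OF Y_pol_e_neg]) (auto intro: nondeg_mono)

text \<open>The other half of the two-by-two block of T: e_{-n-1} is a combination of T e_{n+1} and
  e_{n+1}, and the quadratic relation evaluates T on it.\<close>

lemma T_pol_e_neg:
  assumes "nondeg (h\<^sup>2) (v\<^sup>2) (Suc n)"
  defines "a \<equiv> T_diag h v (Suc n)" and "d \<equiv> v - inverse v"
  shows "T_pol v (e_neg (h\<^sup>2) (v\<^sup>2) (Suc n)) = lconst (d - a) * e_neg (h\<^sup>2) (v\<^sup>2) (Suc n)
      + lconst (v * (a * (d - a) + 1)) * e_pos (h\<^sup>2) (v\<^sup>2) n"
proof -
  define w where "w = e_pos (h\<^sup>2) (v\<^sup>2) n"
  define e where "e = e_neg (h\<^sup>2) (v\<^sup>2) (Suc n)"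
  have Tw: "T_pol v w = lconst (inverse v) * e + lconst a * w"
    using T_pol_e_pos[OF assms(1)] by (simp add: w_def e_def a_def)
  have e: "e = lconst v * T_pol v w - lconst (v * a) * w"
    unfolding Tw using v by (simp add: distrib_left mult.assoc[symmetric] lconst_mult lconst_inverse)
  have "T_pol v e = lconst v * (lconst d * T_pol v w + w) - lconst (v * a) * T_pol v w"
    by (subst e) (simp add: T_pol_diff T_pol_lconst_mult v T_pol_quadratic d_def)
  also have "\<dots> = lconst (v * (d - a)) * T_pol v w + lconst v * w"
    by (simp add: lconst_mult lconst_diff algebra_simps)
  also have "\<dots> = lconst (v * (d - a) * inverse v) * e + lconst (v * (d - a) * a + v) * w"
    unfolding Tw lconst_add lconst_mult by (simp only: algebra_simps)
  also have "v * (d - a) * inverse v = d - a" using v by simp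
  also have "v * (d - a) * a + v = v * (a * (d - a) + 1)" by (simp add: algebra_simps)
  finally show ?thesis by (simp add: w_def e_def)
qed

end

section \<open>Triangularity\<close>

text \<open>The order \<open>0, 1, -1, 2, -2, \<dots>\<close> underlying the definition of the \<open>e\<^sub>m\<close>.\<close>

definition rk :: "int \<Rightarrow> nat" where
  "rk m = (if m \<le> 0 then 2 * nat (- m) else 2 * nat m - 1)"

definition unrk :: "nat \<Rightarrow> int" where
  "unrk i = (if even i then - int (i div 2) else int (i div 2) + 1)"

lemma rk_unrk [simp]: "rk (unrk i) = i"
  by (auto simp: rk_def unrk_def elim!: oddE)

lemma unrk_rk [simp]: "unrk (rk m) = m"
proof (cases "m \<le> 0")
  case False
  then obtain k where "nat m = Suc k" by (metis Suc_pred nat_0_iff neq0_conv nat_eq_iff2 not_le zero_less_nat_eq)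
  then have "m = int k + 1" by linarith
  then show ?thesis by (simp add: rk_def unrk_def)
qed (simp add: rk_def unrk_def)

lemma rk_inj: "rk a = rk b \<Longrightarrow> a = b"
  by (metis unrk_rk)

definition below :: "nat \<Rightarrow> int set" where
  "below K = {m. rk m < K}"

lemma below_0 [simp]: "below 0 = {}"
  and below_Suc: "below (Suc K) = insert (unrk K) (below K)"
  using rk_inj by (auto simp: below_def less_Suc_eq)

lemma finite_below [simp]: "finite (below K)"
  by (induction K) (auto simp: below_Suc)

lemma unrk_notin_below [simp]: "unrk K \<notin> below K"
  by (simp add: below_def)

lemma card_below [simp]: "card (below K) = K"
  by (induction K) (auto simp: below_Suc)

lemma below_idx: "below (2 * n) = idx n"
  by (auto simp: below_def idx_def rk_def split: if_splits)

definition triangular :: "nat \<Rightarrow> (int \<Rightarrow> 'a::field laurent) \<Rightarrow> bool" where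
  "triangular K b \<longleftrightarrow> (\<forall>m\<in>below K. lk (b m) m = 1 \<and> (\<forall>j. lk (b m) j \<noteq> 0 \<longrightarrow> j = m \<or> rk j < rk m))"

lemma triangular_Suc: "triangular (Suc K) b \<Longrightarrow> triangular K b"
  by (auto simp: triangular_def below_Suc)

text \<open>The coefficients of the expansion stay in any ring of functions of a parameter that contains
  the coefficients of the given polynomials.\<close>

lemma triangular_expand:
  fixes b :: "'r \<Rightarrow> int \<Rightarrow> 'a::field laurent" and R :: "('r \<Rightarrow> 'a) \<Rightarrow> bool"
  assumes R: "R (\<lambda>_. 0)" "\<And>f g. R f \<Longrightarrow> R g \<Longrightarrow> R (\<lambda>r. f r - g r)"
      "\<And>f g. R f \<Longrightarrow> R g \<Longrightarrow> R (\<lambda>r. f r * g r)"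
    and tri: "\<And>r. r \<in> D \<Longrightarrow> triangular K (b r)"
    and b: "\<And>m j. m \<in> below K \<Longrightarrow> R (\<lambda>r. lk (b r m) j)"
    and f: "\<And>r j. r \<in> D \<Longrightarrow> lk (f r) j \<noteq> 0 \<Longrightarrow> j \<in> below K" "\<And>j. R (\<lambda>r. lk (f r) j)"
  shows "\<exists>c. (\<forall>m. R (c m)) \<and> (\<forall>r\<in>D. f r = (\<Sum>m\<in>below K. lconst (c m r) * b r m))"
  using tri b f
proof (induction K arbitrary: f)
  case 0
  then have "f r = 0" if "r \<in> D" for r
    using that by (intro poly_mapping_eqI) auto
  then show ?case using R(1) by (intro exI[of _ "\<lambda>_ _. 0"]) auto
next
  case (Suc K)
  let ?k = "unrk K"
  define g where "g r = f r - lconst (lk (f r) ?k) * b r ?k" for r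
  have "\<exists>c. (\<forall>m. R (c m)) \<and> (\<forall>r\<in>D. g r = (\<Sum>m\<in>below K. lconst (c m r) * b r m))"
  proof (rule Suc.IH)
    show "triangular K (b r)" if "r \<in> D" for r
      using Suc.prems(1)[OF that] by (rule triangular_Suc)
    show "R (\<lambda>r. lk (b r m) j)" if "m \<in> below K" for m j
      using Suc.prems(2)[of m j] that by (simp add: below_Suc)
    show "R (\<lambda>r. lk (g r) j)" for j
      unfolding g_def lookup_minus lookup_lconst_mult
      by (intro R(2,3) Suc.prems(2,4)) (simp add: below_Suc)
    show "j \<in> below K" if "r \<in> D" "lk (g r) j \<noteq> 0" for r j
    proof -
      have top: "lk (b r ?k) ?k = 1" "\<And>j. lk (b r ?k) j \<noteq> 0 \<Longrightarrow> j = ?k \<or> rk j < K"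
        using Suc.prems(1)[OF that(1)] by (auto simp: triangular_def below_Suc)
      have "j \<noteq> ?k" using that top by (auto simp: g_def lookup_minus)
      moreover have "lk (f r) j \<noteq> 0 \<or> lk (b r ?k) j \<noteq> 0"
        using that by (auto simp: g_def lookup_minus)
      then have "j \<in> below (Suc K)"
        using Suc.prems(3)[OF that(1), of j] top(2)[of j] by (auto simp: below_def)
      ultimately show ?thesis by (simp add: below_Suc)
    qed
  qed
  then obtain c where c: "\<And>m. R (c m)" "\<And>r. r \<in> D \<Longrightarrow> g r = (\<Sum>m\<in>below K. lconst (c m r) * b r m)"
    by blast
  define c' where "c' m = (if m = ?k then (\<lambda>r. lk (f r) ?k) else c m)" for m
  have "f r = (\<Sum>m\<in>below (Suc K). lconst (c' m r) * b r m)" if "r \<in> D" for r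
  proof -
    have "(\<Sum>m\<in>below K. lconst (c' m r) * b r m) = (\<Sum>m\<in>below K. lconst (c m r) * b r m)"
      by (rule sum.cong) (auto simp: c'_def)
    then show ?thesis
      using c(2)[OF that] by (simp add: below_Suc c'_def g_def algebra_simps)
  qed
  moreover have "R (c' m)" for m using c Suc.prems(4) by (simp add: c'_def)
  ultimately show ?case by blast
qed

lemma triangular_expand1:
  fixes b :: "int \<Rightarrow> 'a::field laurent"
  assumes "triangular K b" "\<And>j. lk f j \<noteq> 0 \<Longrightarrow> j \<in> below K"
  obtains c where "f = (\<Sum>m\<in>below K. lconst (c m) * b m)"
proof -
  \<comment> \<open>The one-point parameter type \<open>unit\<close> with the trivial predicate
    recovers the case of a single polynomial.\<close>
  have "\<exists>c. (\<forall>m. True) \<and> (\<forall>r\<in>UNIV. f = (\<Sum>m\<in>below K. lconst (c m (r :: unit)) * b m))"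
    using triangular_expand[of "\<lambda>_ :: unit \<Rightarrow> 'a. True" "UNIV :: unit set" K "\<lambda>_. b" "\<lambda>_. f"] assms
    by simp
  then show ?thesis using that by auto
qed

text \<open>The exponent of largest rank occurs only in the last polynomial, so its coefficient can
  be read off and removed.\<close>

lemma triangular_independent:
  fixes b :: "int \<Rightarrow> 'a::field laurent"
  assumes "triangular K b" "(\<Sum>m\<in>below K. lconst (c m) * b m) = 0" "m \<in> below K"
  shows "c m = 0"
  using assms
proof (induction K)
  case (Suc K)
  let ?k = "unrk K"
  have "lk (lconst (c m) * b m) ?k = 0" if "m \<in> below K" for m
  proof (rule ccontr)
    assume "lk (lconst (c m) * b m) ?k \<noteq> 0"
    moreover have "\<forall>j. lk (b m) j \<noteq> 0 \<longrightarrow> j = m \<or> rk j < rk m"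
      using Suc.prems(1) that by (simp add: triangular_def below_Suc)
    ultimately have "?k = m \<or> rk ?k < rk m" by (metis lookup_lconst_mult mult_zero_right)
    then show False using that by (auto simp: below_def)
  qed
  then have "lk (\<Sum>m\<in>below (Suc K). lconst (c m) * b m) ?k = c ?k"
    using Suc.prems(1)
    by (auto simp: below_Suc lookup_add lookup_sum triangular_def intro!: sum.neutral)
  then have "c ?k = 0" using Suc.prems(2) by simp
  then show ?case
    using Suc.IH[OF triangular_Suc[OF Suc.prems(1)]] Suc.prems(2,3) by (auto simp: below_Suc)
qed simp

definition e_poly :: "'a::field \<Rightarrow> 'a \<Rightarrow> int \<Rightarrow> 'a laurent" where
  "e_poly h v m = (if m \<le> 0 then e_neg (h\<^sup>2) (v\<^sup>2) (nat (- m)) else e_pos (h\<^sup>2) (v\<^sup>2) (nat (m - 1)))"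

definition Y_eig :: "'a::field \<Rightarrow> 'a \<Rightarrow> int \<Rightarrow> 'a" where
  "Y_eig h v m = (if m \<le> 0 then v * h ^ nat (- m) else inverse (v * h ^ nat m))"

lemma lookup_e_neg:
  "lk (e_neg q t n) k = (\<Sum>j\<le>n. if k = 2 * int j - int n then e_coeff q t n j else 0)"
  unfolding e_neg_def lookup_sum by (rule sum.cong) (auto simp: lookup_lX)

lemma lookup_e_pos:
  "lk (e_pos q t n) k = (\<Sum>j\<le>n. if k = int n + 1 - 2 * int j then q ^ j * e_coeff q t n j else 0)"
  unfolding e_pos_def lookup_sum by (rule sum.cong) (auto simp: lookup_lX)

lemma lookup_e_neg_lead: "lk (e_neg q t n) (- int n) = e_coeff q t n 0"
proof -
  have "lk (e_neg q t n) (- int n) = (\<Sum>j\<le>n. if j = 0 then e_coeff q t n 0 else 0)"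
    unfolding lookup_e_neg by (rule sum.cong) auto
  then show ?thesis by simp
qed

lemma lookup_e_pos_lead: "lk (e_pos q t n) (int n + 1) = e_coeff q t n 0"
proof -
  have "lk (e_pos q t n) (int n + 1) = (\<Sum>j\<le>n. if j = 0 then e_coeff q t n 0 else 0)"
    unfolding lookup_e_pos by (rule sum.cong) auto
  then show ?thesis by simp
qed

lemma rk_less_even: "rk m < 2 * n \<longleftrightarrow> 1 - int n \<le> m \<and> m \<le> int n"
proof -
  have "rk m < 2 * n \<longleftrightarrow> m \<in> idx n" unfolding below_idx[symmetric] by (simp add: below_def)
  then show ?thesis by (simp add: idx_def)
qed

lemma rk_less_odd: "rk m < 2 * n + 1 \<longleftrightarrow> - int n \<le> m \<and> m \<le> int n"
proof (cases "m \<le> 0")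
  case True
  then have "rk m < 2 * n + 1 \<longleftrightarrow> nat (- m) \<le> n" unfolding rk_def by simp linarith
  then show ?thesis using True by linarith
next
  case False
  then have "rk m < 2 * n + 1 \<longleftrightarrow> nat m \<le> n" unfolding rk_def by simp linarith
  then show ?thesis using False by linarith
qed

lemma e_neg_support: "lk (e_neg q t n) k \<noteq> 0 \<Longrightarrow> k = - int n \<or> rk k < 2 * n"
proof -
  assume "lk (e_neg q t n) k \<noteq> 0"
  then obtain j where "j \<in> {..n}" "(if k = 2 * int j - int n then e_coeff q t n j else 0) \<noteq> 0"
    unfolding lookup_e_neg by (rule sum.not_neutral_contains_not_neutral)
  then have "j \<le> n" "k = 2 * int j - int n" by (auto split: if_splits)
  then show ?thesis unfolding rk_less_even by linarith
qed

lemma e_pos_support: "lk (e_pos q t n) k \<noteq> 0 \<Longrightarrow> k = int n + 1 \<or> rk k < 2 * n + 1"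
proof -
  assume "lk (e_pos q t n) k \<noteq> 0"
  then obtain j where "j \<in> {..n}"
      "(if k = int n + 1 - 2 * int j then q ^ j * e_coeff q t n j else 0) \<noteq> 0"
    unfolding lookup_e_pos by (rule sum.not_neutral_contains_not_neutral)
  then have "j \<le> n" "k = int n + 1 - 2 * int j" by (auto split: if_splits)
  then show ?thesis unfolding rk_less_odd by linarith
qed

lemma e_poly_support: "lk (e_poly h v m) j \<noteq> 0 \<Longrightarrow> j = m \<or> rk j < rk m"
  using e_neg_support[of "h\<^sup>2" "v\<^sup>2" "nat (- m)" j] e_pos_support[of "h\<^sup>2" "v\<^sup>2" "nat (m - 1)" j]
  by (auto simp: e_poly_def rk_def[of m] split: if_splits)

lemma e_poly_lead:
  assumes "nondeg (h\<^sup>2) (v\<^sup>2) (rk m div 2)"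
  shows "lk (e_poly h v m) m = 1"
proof -
  have "rk m div 2 = (if m \<le> 0 then nat (- m) else nat (m - 1))"
    by (auto simp: rk_def)
  then show ?thesis
    using assms lookup_e_neg_lead[of "h\<^sup>2" "v\<^sup>2" "nat (- m)"]
      lookup_e_pos_lead[of "h\<^sup>2" "v\<^sup>2" "nat (m - 1)"]
    by (auto simp: e_poly_def e_coeff_0)
qed

lemma Y_pol_e_poly:
  assumes "h \<noteq> 0" "v \<noteq> 0" "nondeg (h\<^sup>2) (v\<^sup>2) (rk m div 2)"
  shows "Y_pol h v (e_poly h v m) = lconst (Y_eig h v m) * e_poly h v m"
proof (cases "m \<le> 0")
  case True
  then show ?thesis using Y_pol_e_neg[OF assms(1,2), of "nat (- m)"] assms(3)
    by (simp add: e_poly_def Y_eig_def rk_def)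
next
  case False
  then have "Suc (nat (m - 1)) = nat m" "rk m div 2 = nat (m - 1)" by (auto simp: rk_def)
  then show ?thesis using Y_pol_e_pos[OF assms(1,2), of "nat (m - 1)"] assms(3) False
    by (simp only: e_poly_def Y_eig_def if_False)
qed

lemma triangular_e_poly:
  assumes "nondeg (h\<^sup>2) (v\<^sup>2) ((K - 1) div 2)"
  shows "triangular K (e_poly h v)"
  unfolding triangular_def
proof (intro ballI conjI allI impI)
  fix m j assume m: "m \<in> below K"
  then have "rk m div 2 \<le> (K - 1) div 2" by (intro div_le_mono) (simp add: below_def)
  then show "lk (e_poly h v m) m = 1"
    using assms by (intro e_poly_lead) (rule nondeg_mono)
  show "j = m \<or> rk j < rk m" if "lk (e_poly h v m) j \<noteq> 0"
    using e_poly_support[OF that] .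
qed

section \<open>Linearity of Y and uniqueness of its triangular eigenvectors\<close>

lemma Y_pol_add: "v \<noteq> 0 \<Longrightarrow> Y_pol h v (f + g) = Y_pol h v f + Y_pol h v g"
  and Y_pol_diff: "v \<noteq> 0 \<Longrightarrow> Y_pol h v (f - g) = Y_pol h v f - Y_pol h v g"
  and Y_pol_lconst_mult: "v \<noteq> 0 \<Longrightarrow> Y_pol h v (lconst c * f) = lconst c * Y_pol h v f"
  and Y_pol_0: "v \<noteq> 0 \<Longrightarrow> Y_pol h v 0 = 0"
  by (simp_all add: Y_pol_def T_pol_add T_pol_diff T_pol_lconst_mult pi_op_add pi_op_diff
      pi_op_lconst_mult)

lemma Y_pol_sum: "v \<noteq> 0 \<Longrightarrow> Y_pol h v (sum g S) = (\<Sum>i\<in>S. Y_pol h v (g i))"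
  by (induction S rule: infinite_finite_induct) (auto simp: Y_pol_add Y_pol_0)

text \<open>The difference of two candidates has lower rank and the same eigenvalue. Expanded in
  lower eigenvectors, whose eigenvalues are different, it must vanish.\<close>

lemma e_poly_unique:
  assumes "h \<noteq> 0" "v \<noteq> 0" and nd: "\<And>n. nondeg (h\<^sup>2) (v\<^sup>2) n"
    and eig: "\<And>i j. rk i < rk j \<Longrightarrow> Y_eig h v i \<noteq> Y_eig h v j"
    and e: "Y_pol h v e = lconst (Y_eig h v m) * e" "lk e m = 1"
      "\<And>j. lk e j \<noteq> 0 \<Longrightarrow> j = m \<or> rk j < rk m"
  shows "e = e_poly h v m"
proof -
  define g where "g = e - e_poly h v m"
  let ?K = "rk m"
  have Yg: "Y_pol h v g = lconst (Y_eig h v m) * g"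
    using e(1) Y_pol_e_poly[OF assms(1,2) nd, of m]
    by (simp add: g_def Y_pol_diff assms(2) algebra_simps)
  have "j \<in> below ?K" if "lk g j \<noteq> 0" for j
  proof -
    have "j \<noteq> m" using that e(2) e_poly_lead[OF nd, of m] by (auto simp: g_def lookup_minus)
    moreover have "lk e j \<noteq> 0 \<or> lk (e_poly h v m) j \<noteq> 0"
      using that by (auto simp: g_def lookup_minus)
    ultimately show ?thesis using e(3)[of j] e_poly_support[of h v m j] by (auto simp: below_def)
  qed
  then obtain c where c: "g = (\<Sum>j\<in>below ?K. lconst (c j) * e_poly h v j)"
    using triangular_expand1[OF triangular_e_poly[OF nd]] by metis
  have "0 = Y_pol h v g - lconst (Y_eig h v m) * g" using Yg by simp
  also have "\<dots> = (\<Sum>j\<in>below ?K. lconst (c j * (Y_eig h v j - Y_eig h v m)) * e_poly h v j)"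
    by (simp add: c Y_pol_sum assms(2) Y_pol_lconst_mult Y_pol_e_poly[OF assms(1,2) nd]
        sum_distrib_left sum_subtractf[symmetric] lconst_mult lconst_diff algebra_simps)
  finally have "c j * (Y_eig h v j - Y_eig h v m) = 0" if "j \<in> below ?K" for j
    using triangular_independent[OF triangular_e_poly[OF nd] _ that, of "\<lambda>j. c j * (Y_eig h v j - Y_eig h v m)"]
    by simp
  then have "c j = 0" if "j \<in> below ?K" for j
    using that eig[of j m] by (auto simp: below_def)
  then have "g = 0" by (simp add: c)
  then show ?thesis by (simp add: g_def)
qed

section \<open>Specialization of rational functions\<close>

locale specialization =
  fixes \<phi> :: "'r::idom \<Rightarrow> 'b::field"
  assumes hom_0: "\<phi> 0 = 0" and hom_1: "\<phi> 1 = 1"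
    and hom_add: "\<phi> (x + y) = \<phi> x + \<phi> y" and hom_mult: "\<phi> (x * y) = \<phi> x * \<phi> y"
begin

text \<open>Regularity and value in one relation. It propagates through arithmetic by introduction
  rules, and it shows a fraction to be nonzero by means of its value at a single point.\<close>

definition spec :: "'r fract \<Rightarrow> 'b \<Rightarrow> bool" where
  "spec f z \<longleftrightarrow> (\<exists>P Q. Q \<noteq> 0 \<and> f = Fract P Q \<and> \<phi> Q \<noteq> 0 \<and> z = \<phi> P / \<phi> Q)"

lemma specI: "\<phi> Q \<noteq> 0 \<Longrightarrow> spec (Fract P Q) (\<phi> P / \<phi> Q)"
  unfolding spec_def by (intro exI[of _ P] exI[of _ Q]) (auto simp: hom_0)

lemma spec_Fract_1: "spec (Fract P 1) (\<phi> P)"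
  using specI[of 1 P] by (simp add: hom_1)

lemma spec_0 [intro!]: "spec 0 0" and spec_1 [intro!]: "spec 1 1"
  using spec_Fract_1[of 0] spec_Fract_1[of 1] by (simp_all add: hom_0 hom_1 Zero_fract_def One_fract_def)

lemma hom_uminus: "\<phi> (- x) = - \<phi> x"
  by (metis add.right_inverse hom_0 hom_add minus_unique)

lemma spec_uminus [intro]:
  assumes "spec f z" shows "spec (- f) (- z)"
proof -
  obtain P Q where "Q \<noteq> 0" "f = Fract P Q" "\<phi> Q \<noteq> 0" "z = \<phi> P / \<phi> Q"
    using assms by (auto simp: spec_def)
  then show ?thesis using specI[of Q "- P"] by (simp add: hom_uminus)
qed

lemma spec_add [intro]:
  assumes "spec f z" "spec g w" shows "spec (f + g) (z + w)"
proof -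
  obtain P Q where 1: "Q \<noteq> 0" "f = Fract P Q" "\<phi> Q \<noteq> 0" "z = \<phi> P / \<phi> Q"
    using assms(1) by (auto simp: spec_def)
  obtain R S where 2: "S \<noteq> 0" "g = Fract R S" "\<phi> S \<noteq> 0" "w = \<phi> R / \<phi> S"
    using assms(2) by (auto simp: spec_def)
  have "spec (Fract (P * S + R * Q) (Q * S)) (\<phi> (P * S + R * Q) / \<phi> (Q * S))"
    by (rule specI) (simp add: 1 2 hom_mult)
  then show ?thesis using 1 2 by (simp add: hom_mult hom_add add_frac_eq)
qed

lemma spec_diff [intro]: "spec f z \<Longrightarrow> spec g w \<Longrightarrow> spec (f - g) (z - w)"
  using spec_add[of f z "- g" "- w"] by auto

lemma spec_mult [intro]:
  assumes "spec f z" "spec g w" shows "spec (f * g) (z * w)"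
proof -
  obtain P Q where 1: "Q \<noteq> 0" "f = Fract P Q" "\<phi> Q \<noteq> 0" "z = \<phi> P / \<phi> Q"
    using assms(1) by (auto simp: spec_def)
  obtain R S where 2: "S \<noteq> 0" "g = Fract R S" "\<phi> S \<noteq> 0" "w = \<phi> R / \<phi> S"
    using assms(2) by (auto simp: spec_def)
  have "spec (Fract (P * R) (Q * S)) (\<phi> (P * R) / \<phi> (Q * S))"
    by (rule specI) (simp add: 1 2 hom_mult)
  then show ?thesis using 1 2 by (simp add: hom_mult)
qed

lemma spec_inverse [intro]:
  assumes "spec f z" "z \<noteq> 0" shows "spec (inverse f) (inverse z)"
proof -
  obtain P Q where 1: "Q \<noteq> 0" "f = Fract P Q" "\<phi> Q \<noteq> 0" "z = \<phi> P / \<phi> Q"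
    using assms(1) by (auto simp: spec_def)
  then show ?thesis using specI[of P Q] assms(2) by auto
qed

lemma spec_divide [intro]: "spec f z \<Longrightarrow> spec g w \<Longrightarrow> w \<noteq> 0 \<Longrightarrow> spec (f / g) (z / w)"
  by (simp add: divide_inverse spec_mult spec_inverse)

lemma spec_power [intro]: "spec f z \<Longrightarrow> spec (f ^ n) (z ^ n)"
  by (induction n) auto

lemma spec_power_int [intro]: "spec f z \<Longrightarrow> z \<noteq> 0 \<Longrightarrow> spec (f powi i) (z powi i)"
  by (auto simp: power_int_def intro!: spec_power)

lemma spec_sum [intro]: "(\<And>i. i \<in> S \<Longrightarrow> spec (f i) (z i)) \<Longrightarrow> spec (sum f S) (sum z S)"
  by (induction S rule: infinite_finite_induct) auto

lemma spec_prod [intro]: "(\<And>i. i \<in> S \<Longrightarrow> spec (f i) (z i)) \<Longrightarrow> spec (prod f S) (prod z S)"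
  by (induction S rule: infinite_finite_induct) auto

lemma spec_unique:
  assumes "spec f z" "spec f w" shows "z = w"
proof -
  obtain P Q where 1: "Q \<noteq> 0" "f = Fract P Q" "\<phi> Q \<noteq> 0" "z = \<phi> P / \<phi> Q"
    using assms(1) by (auto simp: spec_def)
  obtain R S where 2: "S \<noteq> 0" "f = Fract R S" "\<phi> S \<noteq> 0" "w = \<phi> R / \<phi> S"
    using assms(2) by (auto simp: spec_def)
  have "P * S = R * Q" using 1 2 by (metis eq_fract(1))
  then have "\<phi> P * \<phi> S = \<phi> R * \<phi> Q" by (metis hom_mult)
  then show ?thesis using 1 2 by (simp add: frac_eq_eq)
qed

lemma spec_ne_0: "spec f z \<Longrightarrow> z \<noteq> 0 \<Longrightarrow> f \<noteq> 0"
  using spec_unique[of 0 0 z] by auto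

lemma spec_eqD: "spec f z \<Longrightarrow> spec g w \<Longrightarrow> z \<noteq> w \<Longrightarrow> f \<noteq> g"
  using spec_unique by blast

lemma spec_qbinom [intro]: "spec q q' \<Longrightarrow> spec (qbinom q n k) (qbinom q' n k)"
  by (induction q n k rule: qbinom.induct)
    (auto simp del: power_Suc intro!: spec_add spec_mult spec_power)

lemma spec_qpoch [intro]: "spec t t' \<Longrightarrow> spec q q' \<Longrightarrow> spec (qpoch t q k) (qpoch t' q' k)"
  unfolding qpoch_def by (intro spec_prod spec_diff spec_mult spec_power spec_1)

lemma spec_e_coeff:
  "spec t t' \<Longrightarrow> spec q q' \<Longrightarrow> nondeg q' t' n \<Longrightarrow> spec (e_coeff q t n j) (e_coeff q' t' n j)"
  unfolding e_coeff_def by (intro spec_divide spec_mult spec_qpoch spec_qbinom qpoch_ne_0)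

lemma spec_e_poly:
  assumes "spec h h'" "spec v v'" "nondeg (h'\<^sup>2) (v'\<^sup>2) (rk m div 2)"
  shows "spec (lk (e_poly h v m) j) (lk (e_poly h' v' m) j)"
proof -
  have *: "spec (h\<^sup>2) (h'\<^sup>2)" "spec (v\<^sup>2) (v'\<^sup>2)"
    using assms by (auto intro!: spec_power)
  have "rk m div 2 = (if m \<le> 0 then nat (- m) else nat (m - 1))"
    by (auto simp: rk_def)
  then show ?thesis
    using assms(3) * unfolding e_poly_def
    by (auto simp: lookup_e_neg lookup_e_pos intro!: spec_sum spec_mult spec_e_coeff spec_power)
qed

lemma nondeg_spec:
  assumes "spec q q'" "spec t t'" "nondeg q' t' n" shows "nondeg q t n"
  unfolding nondeg_def
proof
  fix i assume "i \<in> {1..n}"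
  then have "1 - t' * q' ^ i \<noteq> 0" using assms(3) by (auto simp: nondeg_def)
  moreover have "spec (1 - t * q ^ i) (1 - t' * q' ^ i)"
    using assms by (intro spec_diff spec_mult spec_power spec_1)
  ultimately show "1 - t * q ^ i \<noteq> 0" using spec_ne_0 by blast
qed

end

text \<open>Evaluation in two variables is evaluation of polynomials applied twice; the one result
  on \<open>map_poly\<close> followed by \<open>poly\<close> serves both layers.\<close>

locale comm_ring_hom_fun =
  fixes \<phi> :: "'r::comm_ring_1 \<Rightarrow> 'b::comm_ring_1"
  assumes hom_0: "\<phi> 0 = 0" and hom_1: "\<phi> 1 = 1"
    and hom_add: "\<phi> (x + y) = \<phi> x + \<phi> y" and hom_mult: "\<phi> (x * y) = \<phi> x * \<phi> y"
begin

lemma poly_map_poly_hom: "comm_ring_hom_fun (\<lambda>P. poly (map_poly \<phi> P) b)"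
proof
  show "poly (map_poly \<phi> 0) b = 0" "poly (map_poly \<phi> 1) b = 1"
    by (simp_all add: hom_1)
  show add: "poly (map_poly \<phi> (P + Q)) b = poly (map_poly \<phi> P) b + poly (map_poly \<phi> Q) b" for P Q
  proof -
    have "map_poly \<phi> (P + Q) = map_poly \<phi> P + map_poly \<phi> Q"
      by (rule poly_eqI) (simp add: coeff_map_poly hom_0 hom_add)
    then show ?thesis by simp
  qed
  have mp: "map_poly \<phi> (pCons c P) = pCons (\<phi> c) (map_poly \<phi> P)" for c P
    by (rule poly_eqI) (auto simp: coeff_map_poly hom_0 coeff_pCons split: nat.splits)
  have smult: "map_poly \<phi> (smult c P) = smult (\<phi> c) (map_poly \<phi> P)" for c P
    by (rule poly_eqI) (simp add: coeff_map_poly hom_0 hom_mult)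
  show "poly (map_poly \<phi> (P * Q)) b = poly (map_poly \<phi> P) b * poly (map_poly \<phi> Q) b" for P Q
  proof (induction P)
    case (pCons c P)
    then show ?case
      by (simp only: mult_pCons_left add smult mp)
        (simp add: hom_0 algebra_simps)
  qed simp
qed

end

lemma comm_ring_hom_eval2: "comm_ring_hom_fun (eval2 a b)"
proof -
  interpret of_int: comm_ring_hom_fun "of_int :: int \<Rightarrow> 'a" by unfold_locales auto
  interpret inner: comm_ring_hom_fun "\<lambda>p. poly (map_poly of_int p) a" by (rule of_int.poly_map_poly_hom)
  have "comm_ring_hom_fun (\<lambda>P. poly (map_poly (\<lambda>p. poly (map_poly of_int p) a) P) b)"
    by (rule inner.poly_map_poly_hom)
  then show ?thesis unfolding eval2_def .
qed

interpretation s2: specialization "eval2 a b" for a b :: "'a::field"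
  using comm_ring_hom_eval2[of a b] unfolding comm_ring_hom_fun_def specialization_def .

interpretation s1: specialization "\<lambda>p. poly p r" for r :: complex
  by unfold_locales auto

lemma eval2_gens [simp]: "eval2 a b [:[:0, 1:]:] = a" "eval2 a b [:0, 1:] = b"
proof -
  interpret of_int: comm_ring_hom_fun "of_int :: int \<Rightarrow> 'a" by unfold_locales auto
  show "eval2 a b [:[:0, 1:]:] = a" "eval2 a b [:0, 1:] = b"
    by (simp_all add: eval2_def map_poly_pCons)
qed

lemma spec_gen_r: "s2.spec a b gen_r a" and spec_gen_v: "s2.spec a b gen_v b"
  using s2.spec_Fract_1[of a b "[:[:0, 1:]:]"] s2.spec_Fract_1[of a b "[:0, 1:]"]
  by (simp_all add: gen_r_def gen_v_def)

lemma spec_gen_r1: "s1.spec r gen_r1 r"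
  using s1.spec_Fract_1[of r "[:0, 1:]"] by (simp add: gen_r1_def)

lemma spec_const: "s1.spec r (Fract [:c:] 1) c"
  using s1.spec_Fract_1[of r "[:c:]"] by simp

lemma regular2I: "s2.spec a b f z \<Longrightarrow> regular2 a b f"
  by (auto simp: s2.spec_def regular2_def)

lemma value2_eqI: "s2.spec a b f z \<Longrightarrow> value2 a b f = z"
  unfolding value2_def s2.spec_def[symmetric] by (rule the_equality) (auto dest: s2.spec_unique)

lemma regular1I: "s1.spec a f z \<Longrightarrow> regular1 a f"
  by (auto simp: s1.spec_def regular1_def)

lemma value1_eqI: "s1.spec a f z \<Longrightarrow> value1 a f = z"
  unfolding value1_def s1.spec_def[symmetric] by (rule the_equality) (auto dest: s1.spec_unique)

lemma lookup_map_0: "F 0 = 0 \<Longrightarrow> lk (Poly_Mapping.map F f) k = F (lk f k)"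
  by (auto simp: map.rep_eq when_def)

section \<open>The generic polynomials\<close>

text \<open>Tested at q^{1/4} = 2, t^{1/2} = 1 over the rationals, where the factors become 1 -
  16^i.\<close>

lemma nondeg_gen: "nondeg ((gen_r\<^sup>2)\<^sup>2) (gen_v\<^sup>2) n"
proof (rule s2.nondeg_spec[where a = "2 :: rat" and b = 1])
  show "s2.spec 2 1 ((gen_r\<^sup>2)\<^sup>2) ((2\<^sup>2)\<^sup>2)" "s2.spec 2 1 (gen_v\<^sup>2) (1\<^sup>2)"
    by (intro s2.spec_power spec_gen_r spec_gen_v)+
  show "nondeg (((2 :: rat)\<^sup>2)\<^sup>2) (1\<^sup>2) n"
  proof (unfold nondeg_def, intro ballI)
    fix i :: nat assume "i \<in> {1..n}"
    then have "(16 :: rat) ^ i > 1" by (intro one_less_power) auto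
    then show "1 - 1\<^sup>2 * ((2 :: rat)\<^sup>2)\<^sup>2 ^ i \<noteq> 0" by simp
  qed
qed

lemma gen_ne_0 [simp]: "gen_r \<noteq> 0" "gen_v \<noteq> 0"
  by (rule s2.spec_ne_0[OF spec_gen_r[of "1 :: rat" 1]], simp)
    (rule s2.spec_ne_0[OF spec_gen_v[of "1 :: rat" 1]], simp)

text \<open>At the same test point the eigenvalue of index i becomes 4^{-i}.\<close>

lemma Y_eig_gen_inj: "rk i < rk j \<Longrightarrow> Y_eig (gen_r\<^sup>2) gen_v i \<noteq> Y_eig (gen_r\<^sup>2) gen_v j"
proof (rule s2.spec_eqD[where a = "2 :: rat" and b = 1])
  show "s2.spec 2 1 (Y_eig (gen_r\<^sup>2) gen_v i) ((4::rat) powi (- i))" for i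
  proof -
    have "s2.spec (2::rat) 1 (Y_eig (gen_r\<^sup>2) gen_v i) (Y_eig (2\<^sup>2) 1 i)"
      unfolding Y_eig_def
      by (cases "i \<le> 0"; simp only: if_True if_False;
          (intro s2.spec_mult s2.spec_power s2.spec_inverse spec_gen_r spec_gen_v)?; simp)
    also have "Y_eig (2\<^sup>2) 1 i = (4::rat) powi (- i)"
      by (auto simp: Y_eig_def power_int_def power_one_over inverse_eq_divide)
    finally show ?thesis .
  qed
  then show "s2.spec 2 1 (Y_eig (gen_r\<^sup>2) gen_v j) ((4::rat) powi (- j))" .
  assume "rk i < rk j"
  then have "i \<noteq> j" by auto
  then show "(4::rat) powi - i \<noteq> 4 powi - j"
    using power_int_strict_increasing[of "- i" "- j" "4 :: rat"]
      power_int_strict_increasing[of "- j" "- i" "4 :: rat"] by (cases "i < j") auto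
qed

lemma e_gen_support_iff: "(j = m \<or> \<bar>j\<bar> < \<bar>m\<bar> \<or> (m < 0 \<and> j = \<bar>m\<bar>)) \<longleftrightarrow> j = m \<or> rk j < rk m"
proof (cases "m \<le> 0")
  case True
  then have "rk m = 2 * nat (- m)" by (simp add: rk_def)
  then show ?thesis using True rk_less_even[of j "nat (- m)"] by auto
next
  case False
  then have "rk m = 2 * nat (m - 1) + 1" by (simp add: rk_def)
  then show ?thesis using False rk_less_odd[of j "nat (m - 1)"] by auto
qed

lemma e_gen_eig: "(gen_v * (gen_r\<^sup>2) ^ nat \<bar>m\<bar>) powi (- sgn_m m) = Y_eig (gen_r\<^sup>2) gen_v m"
  by (auto simp: Y_eig_def sgn_m_def power_int_minus)

lemma e_gen_eq: "e_gen m = e_poly (gen_r\<^sup>2) gen_v m"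
  unfolding e_gen_def e_gen_support_iff e_gen_eig
proof (rule the_equality, goal_cases)
  case 1
  show ?case
    by (intro conjI allI impI Y_pol_e_poly nondeg_gen e_poly_lead e_poly_support) simp_all
next
  case (2 e)
  then show ?case
    using e_poly_unique[OF _ _ nondeg_gen Y_eig_gen_inj, of e m] by auto
qed

context
  fixes a b :: "'a::field" and m :: int
  assumes nd: "nondeg ((a\<^sup>2)\<^sup>2) (b\<^sup>2) (rk m div 2)"
begin

lemma spec_e_gen: "s2.spec a b (lk (e_gen m) j) (lk (e_poly (a\<^sup>2) b m) j)"
  unfolding e_gen_eq
  by (rule s2.spec_e_poly) (use nd in \<open>auto intro!: s2.spec_power spec_gen_r spec_gen_v\<close>)

lemma e_regular_nondeg: "e_regular a b m"
  unfolding e_regular_def using spec_e_gen regular2I by blast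

lemma e_at_nondeg: "e_at a b m = e_poly (a\<^sup>2) b m"
  by (rule poly_mapping_eqI)
    (simp add: e_at_def lookup_map_0 value2_eqI[OF s2.spec_0] value2_eqI[OF spec_e_gen])

end

section \<open>Specialization along the curve\<close>

text \<open>The value of \<open>e\<^bsub>-n\<^esub>\<close> on the curve.\<close>

definition E_curve :: "nat \<Rightarrow> 'a::field \<Rightarrow> 'a laurent" where
  "E_curve n h = (\<Sum>j\<le>n. lconst (qbinom (h\<^sup>2) n j * h powi (int j * (int j - 1) - int n * int j))
     * lX (2 * int j - int n))"

text \<open>On the curve (t q^j)(t q^{n-j}) = t^2 q^n = 1, so 1 - t q^j = h^{2j-n} (1 - t q^{n-j}).
  Moving the factors one at a time turns the quotient in \<open>e_coeff\<close> into a power of h,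
  whose exponent is the sum of 2i - n over i < j, that is j(j-1) - nj. The denominators
  disappear.\<close>

lemma qpoch_curve:
  fixes h t :: "'a::field"
  assumes h: "h \<noteq> 0" and t: "t * h ^ n = - 1"
  shows "j \<le> n \<Longrightarrow> qpoch t (h\<^sup>2) j * qpoch (t * h\<^sup>2) (h\<^sup>2) (n - j)
    = h powi (int j * (int j - 1) - int n * int j) * qpoch (t * h\<^sup>2) (h\<^sup>2) n"
proof (induction j)
  case (Suc j)
  have t': "t = - (h powi (- int n))"
    using assms by (simp add: power_int_minus field_simps)
  have pw2: "h powi (2 * int k) = (h\<^sup>2) ^ k" for k
    by (metis of_nat_mult of_nat_numeral power_int_of_nat power_mult)
  obtain m where m: "n = Suc (j + m)" using Suc.prems less_imp_Suc_add[of j n] by auto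
  have "1 - t * (h\<^sup>2) ^ j = 1 + h powi (- int n) * h powi (2 * int j)"
    unfolding pw2 by (simp add: t')
  also have "\<dots> = 1 + h powi (2 * int j - int n)"
    using h by (simp add: power_int_add[symmetric])
  also have "\<dots> = h powi (2 * int j - int n) * (1 + h powi (int n - 2 * int j))"
    using h by (simp add: distrib_left power_int_add[symmetric])
  also have "h powi (int n - 2 * int j) = h powi (- int n) * h powi (2 * int (n - j))"
    using h Suc.prems by (simp add: power_int_add[symmetric] of_nat_diff algebra_simps)
  also have "1 + h powi (- int n) * h powi (2 * int (n - j)) = 1 - t * h\<^sup>2 * (h\<^sup>2) ^ m"
    unfolding pw2 using m by (simp add: t' mult.assoc)
  finally have key: "1 - t * (h\<^sup>2) ^ j = h powi (2 * int j - int n) * (1 - t * h\<^sup>2 * (h\<^sup>2) ^ m)" .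
  have nj: "n - j = Suc m" "n - Suc j = m" using m by auto
  have "qpoch t (h\<^sup>2) (Suc j) * qpoch (t * h\<^sup>2) (h\<^sup>2) (n - Suc j)
     = h powi (2 * int j - int n) * (qpoch t (h\<^sup>2) j * qpoch (t * h\<^sup>2) (h\<^sup>2) (n - j))"
    unfolding nj qpoch_Suc key by (simp only: mult_ac)
  also have "\<dots> = h powi (2 * int j - int n + (int j * (int j - 1) - int n * int j))
      * qpoch (t * h\<^sup>2) (h\<^sup>2) n"
    using Suc h by (simp add: power_int_add)
  also have "2 * int j - int n + (int j * (int j - 1) - int n * int j)
      = int (Suc j) * (int (Suc j) - 1) - int n * int (Suc j)"
    by (simp add: algebra_simps)
  finally show ?case .
qed simp

lemma e_neg_curve:
  assumes "h \<noteq> 0" "t * h ^ n = - 1" "nondeg (h\<^sup>2) t n"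
  shows "e_neg (h\<^sup>2) t n = E_curve n h"
proof -
  have "e_coeff (h\<^sup>2) t n j = qbinom (h\<^sup>2) n j * h powi (int j * (int j - 1) - int n * int j)"
    if "j \<le> n" for j
    unfolding e_coeff_def mult.assoc qpoch_curve[OF assms(1,2) that]
    using qpoch_ne_0[OF assms(3)] by simp
  then show ?thesis unfolding e_neg_def E_curve_def by (intro sum.cong) simp_all
qed

lemma curve_v_sq:
  assumes "r \<noteq> 0" "\<sigma>\<^sup>2 = - 1"
  shows "(curve_v n \<sigma> r)\<^sup>2 = - inverse ((r\<^sup>2) ^ n)"
  using assms by (simp add: curve_v_def power_mult_distrib power_int_minus power_inverse
      power_mult[symmetric] mult.commute)

lemma curve_t: "r \<noteq> 0 \<Longrightarrow> \<sigma>\<^sup>2 = - 1 \<Longrightarrow> (curve_v n \<sigma> r)\<^sup>2 * (r\<^sup>2) ^ n = - 1"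
  by (simp add: curve_v_sq)

lemma curve_v_ne_0: "r \<noteq> 0 \<Longrightarrow> \<sigma>\<^sup>2 = - 1 \<Longrightarrow> curve_v n \<sigma> r \<noteq> 0"
  by (auto simp: curve_v_def)

abbreviation gen_curve :: "nat \<Rightarrow> complex \<Rightarrow> rfield" where
  "gen_curve n \<sigma> \<equiv> curve_v n (Fract [:\<sigma>:] 1) gen_r1"

lemma spec_curve: "r \<noteq> 0 \<Longrightarrow> s1.spec r (gen_curve n \<sigma>) (curve_v n \<sigma> r)"
  unfolding curve_v_def by (intro s1.spec_mult spec_const s1.spec_power_int spec_gen_r1)

lemma gen_r1_ne_0 [simp]: "gen_r1 \<noteq> 0"
  by (rule s1.spec_ne_0[OF spec_gen_r1[of 1]]) simp

text \<open>Tested at r = 1, where q = 1 and t = -1, so every factor equals 2.\<close>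

lemma gen_curve_nondeg:
  assumes "\<sigma>\<^sup>2 = - 1" shows "nondeg ((gen_r1\<^sup>2)\<^sup>2) ((gen_curve n \<sigma>)\<^sup>2) k"
proof (rule s1.nondeg_spec[where r = 1])
  show "s1.spec 1 ((gen_r1\<^sup>2)\<^sup>2) ((1\<^sup>2)\<^sup>2)" by (intro s1.spec_power spec_gen_r1)
  show "s1.spec 1 ((gen_curve n \<sigma>)\<^sup>2) ((curve_v n \<sigma> 1)\<^sup>2)"
    by (intro s1.spec_power spec_curve) simp
  show "nondeg ((1\<^sup>2)\<^sup>2) ((curve_v n \<sigma> 1)\<^sup>2) k"
    by (simp add: nondeg_def curve_v_def assms)
qed

context
  fixes n :: nat and \<sigma> :: complex
  assumes \<sigma>: "\<sigma>\<^sup>2 = - 1"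
begin

lemma ec_gen_eq: "ec_gen n \<sigma> m = e_poly (gen_r1\<^sup>2) (gen_curve n \<sigma>) m"
  unfolding ec_gen_def by (rule e_at_nondeg[OF gen_curve_nondeg[OF \<sigma>]])

lemma ec_regular_gen: "ec_regular_gen n \<sigma> m"
  unfolding ec_regular_gen_def by (rule e_regular_nondeg[OF gen_curve_nondeg[OF \<sigma>]])

lemma ec_from_spec:
  assumes "\<And>j. s1.spec r (lk (ec_gen n \<sigma> m) j) (lk f j)"
  shows "ec_regular n \<sigma> r m" "ec_at n \<sigma> r m = f"
proof -
  show "ec_regular n \<sigma> r m"
    unfolding ec_regular_def using ec_regular_gen assms regular1I by blast
  show "ec_at n \<sigma> r m = f"
    by (rule poly_mapping_eqI)
      (simp add: ec_at_def lookup_map_0 value1_eqI[OF s1.spec_0] value1_eqI[OF assms])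
qed

lemma spec_ec_gen:
  assumes "r \<noteq> 0" "nondeg ((r\<^sup>2)\<^sup>2) ((curve_v n \<sigma> r)\<^sup>2) (rk m div 2)"
  shows "s1.spec r (lk (ec_gen n \<sigma> m) j) (lk (e_poly (r\<^sup>2) (curve_v n \<sigma> r) m) j)"
  unfolding ec_gen_eq
  by (rule s1.spec_e_poly) (use assms in \<open>auto intro!: s1.spec_power spec_gen_r1 spec_curve\<close>)

lemmas ec_nondeg = ec_from_spec[OF spec_ec_gen]

lemma gen_curve_sq: "(gen_curve n \<sigma>)\<^sup>2 * (gen_r1\<^sup>2) ^ n = - 1"
proof (rule curve_t)
  show "(Fract [:\<sigma>:] 1)\<^sup>2 = - (1 :: rfield)"
    using \<sigma> by (simp add: power2_eq_square One_fract_def one_pCons)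
qed simp

lemma ec_gen_minus_n: "ec_gen n \<sigma> (- int n) = E_curve n (gen_r1\<^sup>2)"
  unfolding ec_gen_eq
  using e_neg_curve[OF _ gen_curve_sq gen_curve_nondeg[OF \<sigma>]] by (simp add: e_poly_def)

lemma lookup_E_curve: "lk (E_curve n h) k = (\<Sum>j\<le>n. if k = 2 * int j - int n
    then qbinom (h\<^sup>2) n j * h powi (int j * (int j - 1) - int n * int j) else 0)"
  unfolding E_curve_def lookup_sum by (rule sum.cong) (auto simp: lookup_lX)

lemma spec_E_curve: "r \<noteq> 0 \<Longrightarrow> s1.spec r (lk (E_curve n (gen_r1\<^sup>2)) j) (lk (E_curve n (r\<^sup>2)) j)"
  unfolding lookup_E_curve
  by (auto intro!: s1.spec_sum s1.spec_mult s1.spec_qbinom s1.spec_power s1.spec_power_int spec_gen_r1)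

lemma ec_minus_n:
  assumes "r \<noteq> 0"
  shows "ec_regular n \<sigma> r (- int n)" "ec_at n \<sigma> r (- int n) = E_curve n (r\<^sup>2)"
  using ec_from_spec[of r "- int n", unfolded ec_gen_minus_n, OF spec_E_curve[OF assms]] by auto

end

section \<open>Quotients of the polynomial representation\<close>

lemma LL_simps [simp]: "carrier LL = UNIV" "x \<otimes>\<^bsub>LL\<^esub> y = x * y" "x \<oplus>\<^bsub>LL\<^esub> y = x + y"
    "\<one>\<^bsub>LL\<^esub> = 1" "\<zero>\<^bsub>LL\<^esub> = 0"
  by (simp_all add: ring_of_type_algebra_def)

lemma CC_simps [simp]: "carrier CC = UNIV" "x \<otimes>\<^bsub>CC\<^esub> y = x * y" "x \<oplus>\<^bsub>CC\<^esub> y = x + y"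
    "\<one>\<^bsub>CC\<^esub> = 1" "\<zero>\<^bsub>CC\<^esub> = 0"
  by (simp_all add: ring_of_type_algebra_def)

lemma PIdl_LL: "PIdl\<^bsub>LL\<^esub> e = {f. e dvd f}"
  by (auto simp: cgenideal_def dvd_def mult.commute)

lemma ideal_LL: "ideal (PIdl\<^bsub>LL\<^esub> e) LL"
  by (rule cring.cgenideal_ideal) auto

lemma qclass_alt: "qclass e f = {g. e dvd g - f}"
  unfolding qclass_def a_r_coset_def' PIdl_LL
  by (auto intro!: exI[of _ "g - f" for g])

lemma qclass_eq_iff: "qclass e f = qclass e g \<longleftrightarrow> e dvd f - g"
proof
  assume "qclass e f = qclass e g"
  moreover have "f \<in> qclass e f" by (simp add: qclass_alt)
  ultimately show "e dvd f - g" by (simp add: qclass_alt)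
next
  assume *: "e dvd f - g"
  then have "e dvd x - f \<longleftrightarrow> e dvd x - g" for x
    using dvd_add_left_iff[OF *, of "x - f"] by simp
  then show "qclass e f = qclass e g" by (simp add: qclass_alt)
qed

text \<open>The last clause speaks only of multiples of \<open>e\<close>; with additivity it makes F
  well defined modulo the ideal.\<close>

definition descends :: "complex laurent \<Rightarrow> (complex laurent \<Rightarrow> complex laurent) \<Rightarrow> bool" where
  "descends e F \<longleftrightarrow> (\<forall>f g. F (f + g) = F f + F g) \<and> (\<forall>c f. F (lconst c * f) = lconst c * F f) \<and>
     (\<forall>f. e dvd F (e * f))"

lemma descends_cong:
  assumes "descends e F" "qclass e f = qclass e g"
  shows "qclass e (F f) = qclass e (F g)"
proof -
  obtain k where k: "f = e * k + g"
    using assms(2) by (metis diff_add_cancel dvdE qclass_eq_iff)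
  have "F f - F g = F (e * k)" using assms(1) by (simp add: k descends_def)
  then show ?thesis using assms(1) by (simp add: qclass_eq_iff descends_def)
qed

text \<open>The union in \<open>induced\<close> runs over all representatives; all of them yield the
  same class, so the union is that class.\<close>

lemma induced_qclass:
  assumes "descends e F" shows "induced e F (qclass e f) = qclass e (F f)"
proof -
  have "qclass e (F g) = qclass e (F f)" if "g \<in> qclass e f" for g
    using that descends_cong[OF assms, of g f] qclass_eq_iff[of e g f] by (simp add: qclass_alt)
  moreover have "f \<in> qclass e f" by (simp add: qclass_alt)
  ultimately show ?thesis unfolding induced_def by blast
qed

lemma descends_add: "descends e F \<Longrightarrow> F (f + g) = F f + F g"
  and descends_scale: "descends e F \<Longrightarrow> F (lconst c * f) = lconst c * F f"
  by (simp_all add: descends_def)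

lemma descends_0: "descends e F \<Longrightarrow> F 0 = 0"
  using descends_scale[of e F 0 0] by simp

lemma descends_sum:
  "descends e F \<Longrightarrow> F (\<Sum>i\<in>S. lconst (c i) * g i) = (\<Sum>i\<in>S. lconst (c i) * F (g i))"
  by (induction S rule: infinite_finite_induct) (auto simp: descends_add descends_scale descends_0)

lemma descends_comp: "descends e F \<Longrightarrow> descends e G \<Longrightarrow> descends e (F \<circ> G)"
  unfolding descends_def by (auto simp: comp_def) (metis dvdE)

lemma descends_mult: "descends e (\<lambda>f. g * f)"
  by (auto simp: descends_def algebra_simps)

context
  fixes h v :: complex and e :: "complex laurent" and M :: "complex laurent set hmod"
  defines "M \<equiv> pol_quot h v e"
begin

lemma carrier_pol_quot: "carrier M = range (qclass e)"
  by (auto simp: M_def pol_quot_def Let_def FactRing_def A_RCOSETS_def RCOSETS_def qclass_def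
      a_r_coset_def)

lemma pol_quot_cases:
  assumes "x \<in> carrier M" obtains f where "x = qclass e f"
  using assms by (auto simp: carrier_pol_quot)

lemma pol_quot_add: "qclass e f \<oplus>\<^bsub>M\<^esub> qclass e g = qclass e (f + g)"
proof -
  interpret ideal "PIdl\<^bsub>LL\<^esub> e" LL by (rule ideal_LL)
  show ?thesis using a_rcos_sum[of f g]
    by (simp add: M_def pol_quot_def Let_def FactRing_simps qclass_def)
qed

lemma pol_quot_mult: "qclass e f \<otimes>\<^bsub>M\<^esub> qclass e g = qclass e (f * g)"
proof -
  interpret ideal "PIdl\<^bsub>LL\<^esub> e" LL by (rule ideal_LL)
  show ?thesis using rcoset_mult_add[of f g]
    by (simp add: M_def pol_quot_def Let_def FactRing_simps qclass_def)
qed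

lemma pol_quot_one: "\<one>\<^bsub>M\<^esub> = qclass e 1"
  by (simp add: M_def pol_quot_def Let_def FactRing_simps qclass_def)

lemma pol_quot_zero: "\<zero>\<^bsub>M\<^esub> = qclass e 0"
  by (simp add: M_def pol_quot_def Let_def FactRing_simps qclass_alt PIdl_LL)

lemma pol_quot_smult: "c \<odot>\<^bsub>M\<^esub> qclass e f = qclass e (lconst c * f)"
  using pol_quot_mult[of "lconst c" f] by (simp add: M_def pol_quot_def Let_def)

lemmas pol_quot_simps = pol_quot_add pol_quot_mult pol_quot_one pol_quot_zero pol_quot_smult

lemma cring_pol_quot: "cring M"
proof -
  have "\<exists>y\<in>carrier M. y \<oplus>\<^bsub>M\<^esub> x = \<zero>\<^bsub>M\<^esub>" if x: "x \<in> carrier M" for x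
  proof -
    obtain f where "x = qclass e f" using x by (auto simp: carrier_pol_quot)
    then show ?thesis
      by (intro bexI[of _ "qclass e (- f)"]) (auto simp: carrier_pol_quot pol_quot_simps)
  qed
  then show ?thesis
    by (intro cringI abelian_groupI comm_monoidI)
      (auto simp: carrier_pol_quot pol_quot_simps algebra_simps)
qed

lemma algebra_pol_quot: "algebra CC M"
  by (rule algebraI)
    (auto simp: cring_pol_quot carrier_pol_quot pol_quot_simps algebra_simps lconst_add lconst_mult)

lemma module_pol_quot: "module CC M"
  using algebra_pol_quot by (rule algebra.module)

lemma pol_quot_uminus: "\<ominus>\<^bsub>M\<^esub> qclass e f = qclass e (- f)"
proof -
  interpret cring M by (rule cring_pol_quot)
  show ?thesis by (rule minus_equality) (auto simp: carrier_pol_quot pol_quot_simps)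
qed

lemma pol_quot_minus: "qclass e f \<ominus>\<^bsub>M\<^esub> qclass e g = qclass e (f - g)"
  by (simp add: a_minus_def pol_quot_uminus pol_quot_add)

lemma pol_quot_lincomb:
  assumes "finite S" "\<And>i. i \<in> S \<Longrightarrow> b i = qclass e (f i)"
  shows "lincomb M S c b = qclass e (\<Sum>i\<in>S. lconst (c i) * f i)"
proof -
  interpret cring M by (rule cring_pol_quot)
  show ?thesis using assms unfolding lincomb_def
  proof (induction S)
    case (insert x S)
    then have "(\<lambda>i. c i \<odot>\<^bsub>M\<^esub> b i) \<in> S \<rightarrow> carrier M"
      by (auto simp: carrier_pol_quot pol_quot_simps)
    then show ?case using insert
      by (simp add: pol_quot_simps carrier_pol_quot)
  qed (simp add: pol_quot_zero)
qed

text \<open>Once an operator and its inverse both preserve the ideal, the induced maps are inverse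
  to each other.\<close>

lemma pol_quot_linear_iso:
  assumes "descends e F" "descends e G" "\<And>f. F (G f) = f" "\<And>f. G (F f) = f"
    "\<And>f. A (qclass e f) = qclass e (F f)"
  shows "linear_iso M M A" and "inv_op M A (qclass e f) = qclass e (G f)"
proof -
  have inj: "inj_on A (carrier M)"
  proof (rule inj_onI)
    fix x y assume "x \<in> carrier M" "y \<in> carrier M" "A x = A y"
    then obtain f g where fg: "x = qclass e f" "y = qclass e g" "qclass e (F f) = qclass e (F g)"
      by (auto simp: carrier_pol_quot assms(5))
    then have "qclass e (G (F f)) = qclass e (G (F g))" by (intro descends_cong[OF assms(2)])
    then show "x = y" using fg assms(4) by simp
  qed
  have A: "A (qclass e (G f)) = qclass e f" for f by (simp add: assms)
  then have "carrier M \<subseteq> A ` carrier M" unfolding carrier_pol_quot by (metis image_subsetI rangeI image_eqI)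
  moreover have "A ` carrier M \<subseteq> carrier M" by (auto simp: carrier_pol_quot assms)
  ultimately show "linear_iso M M A"
    using inj unfolding linear_iso_def linear_map_def bij_betw_def
    by (auto simp: carrier_pol_quot pol_quot_simps assms descends_add[OF assms(1)]
        descends_scale[OF assms(1)])
  show "inv_op M A (qclass e f) = qclass e (G f)"
    by (rule inv_into_f_eq[OF inj]) (auto simp: carrier_pol_quot A)
qed

lemma pol_quot_linear_map:
  assumes "descends e F" "\<And>f. A (qclass e f) = qclass e (F f)"
  shows "linear_map M M A"
  unfolding linear_map_def
  by (auto simp: carrier_pol_quot pol_quot_simps assms descends_add[OF assms(1)]
        descends_scale[OF assms(1)])

end

section \<open>The action of the generators on a quotient by a stable ideal\<close>

lemma pol_quot_ops: "opX (pol_quot h v e) = induced e X_pol" "opY (pol_quot h v e) = induced e (Y_pol h v)"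
  "opT (pol_quot h v e) = induced e (T_pol v)"
  by (simp_all add: pol_quot_def Let_def)

definition X_inv :: "'a::comm_ring_1 laurent \<Rightarrow> 'a laurent" where
  "X_inv f = lX (- 1) * f"

definition Y_inv :: "'a::field \<Rightarrow> 'a \<Rightarrow> 'a laurent \<Rightarrow> 'a laurent" where
  "Y_inv h v f = T_inv v (pi_op h f)"

lemma X_inv_X_pol [simp]: "X_inv (X_pol f) = f" and X_pol_X_inv [simp]: "X_pol (X_inv f) = f"
  by (simp_all add: X_inv_def X_pol_def mult.assoc[symmetric])

lemma Y_inv_Y_pol [simp]: "h \<noteq> 0 \<Longrightarrow> v \<noteq> 0 \<Longrightarrow> Y_inv h v (Y_pol h v f) = f"
  and Y_pol_Y_inv [simp]: "h \<noteq> 0 \<Longrightarrow> v \<noteq> 0 \<Longrightarrow> Y_pol h v (Y_inv h v f) = f"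
  by (simp_all add: Y_inv_def Y_pol_def)

text \<open>Stability of the ideal \<open>(e)\<close> is reduced to two factorizations, of \<open>T\<close> and of \<open>\<pi>\<close>.\<close>

locale stable_quot =
  fixes h v u :: complex and e :: "complex laurent"
  assumes h: "h \<noteq> 0" and v: "v \<noteq> 0" and u: "u \<noteq> 0"
    and T_e: "\<And>f. T_pol v (e * f) = e * T_pol u f"
    and pi_e: "pi_op h e = e"
begin

abbreviation Q :: "complex laurent set hmod" where "Q \<equiv> pol_quot h v e"

lemma descends_X: "descends e X_pol" and descends_X_inv: "descends e X_inv"
  unfolding X_pol_def X_inv_def by (rule descends_mult)+

lemma descends_T: "descends e (T_pol v)"
  by (simp add: descends_def T_pol_add v T_pol_lconst_mult T_e)

lemma descends_T_inv: "descends e (T_inv v)"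
proof -
  have "T_inv v (e * f) = e * (T_pol u f - lconst (v - inverse v) * f)" for f
    by (simp add: T_inv_def T_e right_diff_distrib mult.left_commute)
  moreover have "T_inv v (lconst c * f) = lconst c * T_inv v f" for c f
    by (simp add: T_inv_def T_pol_lconst_mult v right_diff_distrib mult.left_commute)
  moreover have "T_inv v (f + g) = T_inv v f + T_inv v g" for f g
    by (simp add: T_inv_def T_pol_add v distrib_left)
  ultimately show ?thesis by (simp add: descends_def)
qed

lemma descends_pi: "descends e (pi_op h)"
  by (simp add: descends_def pi_op_add pi_op_lconst_mult pi_op_mult h pi_e)

lemma descends_Y: "descends e (Y_pol h v)"
  using descends_comp[OF descends_pi descends_T] by (simp add: comp_def Y_pol_def[abs_def])

lemma descends_Y_inv: "descends e (Y_inv h v)"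
  using descends_comp[OF descends_T_inv descends_pi] by (simp add: comp_def Y_inv_def[abs_def])

lemma opX_q [simp]: "opX Q (qclass e f) = qclass e (X_pol f)"
  and opY_q [simp]: "opY Q (qclass e f) = qclass e (Y_pol h v f)"
  and opT_q [simp]: "opT Q (qclass e f) = qclass e (T_pol v f)"
  by (simp_all add: pol_quot_ops induced_qclass descends_X descends_Y descends_T)

lemma iso_X: "linear_iso Q Q (opX Q)"
    and inv_X [simp]: "inv_op Q (opX Q) (qclass e f) = qclass e (X_inv f)"
  using pol_quot_linear_iso[OF descends_X descends_X_inv, of "opX Q" h v] by auto

lemma iso_Y: "linear_iso Q Q (opY Q)"
    and inv_Y [simp]: "inv_op Q (opY Q) (qclass e f) = qclass e (Y_inv h v f)"
  using pol_quot_linear_iso[OF descends_Y descends_Y_inv, of "opY Q" h v] h v by auto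

lemma iso_T: "linear_iso Q Q (opT Q)"
    and inv_T [simp]: "inv_op Q (opT Q) (qclass e f) = qclass e (T_inv v f)"
  using pol_quot_linear_iso[OF descends_T descends_T_inv, of "opT Q" h v] v by auto

text \<open>The relations hold on Laurent polynomials and pass to classes. For the last one, T X T =
  X^{-1} and \<pi> X^{-1} = h^{-1} X \<pi> give Y X T^2 = h^{-1} X Y.\<close>

lemma daha_module_Q: "daha_module h v Q"
proof -
  have 1: "T_pol v (T_pol v f + lconst (inverse v) * f) - lconst v * (T_pol v f + lconst (inverse v) * f) = 0" for f
    unfolding T_pol_add[OF v] T_pol_lconst_mult[OF v] T_pol_quadratic[OF v] lconst_diff
    by (simp add: algebra_simps lconst_inverse[OF v])
  have 2: "T_pol v (X_pol (T_pol v f)) = X_inv f" for f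
    by (simp add: X_pol_def X_inv_def T_pol_X_T_pol v)
  have 3: "T_inv v (Y_pol h v (T_inv v f)) = Y_inv h v f" for f
    by (simp add: Y_pol_def Y_inv_def v)
  have 4: "lconst h * Y_inv h v (X_inv (Y_pol h v (X_pol (T_pol v (T_pol v f))))) = f" for f
  proof -
    have "Y_pol h v (X_pol (T_pol v (T_pol v f))) = lconst (inverse h) * (lX 1 * Y_pol h v f)"
      using h by (simp add: Y_pol_def X_pol_def T_pol_X_T_pol v pi_op_lX_mult power_int_minus)
    then have "lconst h * (X_inv (Y_pol h v (X_pol (T_pol v (T_pol v f))))) = Y_pol h v f"
      using h by (simp add: X_inv_def mult.left_commute mult.assoc[symmetric] lconst_mult[symmetric])
    then show ?thesis
      using descends_scale[OF descends_Y_inv] h v by (metis Y_inv_Y_pol)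
  qed
  show ?thesis
    unfolding daha_module_def Let_def
    by (intro conjI ballI module_pol_quot iso_X iso_Y iso_T; erule pol_quot_cases)
      (simp_all add: pol_quot_simps pol_quot_minus 1 2 3 4)
qed

lemma stable_ideal_e: "stable_ideal h v e"
proof -
  have surj: "F ` {f. e dvd f} = {f. e dvd f}"
    if "descends e F" "descends e G" "\<And>f. F (G f) = f" for F G
  proof (intro equalityI subsetI)
    fix x assume "x \<in> F ` {f. e dvd f}"
    then show "x \<in> {f. e dvd f}" using that by (auto simp: descends_def)
  next
    fix x assume "x \<in> {f. e dvd f}"
    then have "e dvd G x" using that by (auto simp: descends_def)
    then show "x \<in> F ` {f. e dvd f}" using that(3)[of x] by (metis image_eqI mem_Collect_eq)
  qed
  show ?thesis unfolding stable_ideal_def PIdl_LL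
    using surj[OF descends_X descends_X_inv] surj[OF descends_Y descends_Y_inv]
      surj[OF descends_T descends_T_inv] h v by auto
qed

end

section \<open>Factorization of \<open>e\<^bsub>-n\<^esub>\<close> on the curve\<close>

lemma qbinom_lconst: "qbinom (lconst q) n k = (lconst (qbinom q n k) :: 'a::comm_ring_1 laurent)"
  by (induction q n k rule: qbinom.induct)
    (simp_all add: lconst_add lconst_mult lconst_power del: power_Suc)

lemma power_lX: "lX a ^ k = (lX (int k * a) :: 'a::comm_ring_1 laurent)"
  by (induction k) (auto simp: lX_add[symmetric] algebra_simps)

lemma lconst_monomial:
  fixes a b c :: "'a::comm_ring_1"
  shows "lconst a ^ k * lconst b * (lconst c * x) ^ j = lconst (b * (a ^ k * c ^ j)) * x ^ j"
  by (simp add: lconst_mult lconst_power power_mult_distrib mult_ac)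

text \<open>The q-binomial theorem with base q = h^2 at z = h^{-n} X^2: the power q^{j(j-1)/2}
  contributes h^{j(j-1)} and z^j contributes h^{-nj}.\<close>

lemma E_curve_prod:
  fixes h :: "'a::field"
  assumes h: "h \<noteq> 0"
  shows "E_curve n h = lX (- int n) * (\<Prod>j<n. 1 + lconst (h powi (2 * int j - int n)) * lX 2)"
proof -
  let ?z = "lconst (h powi (- int n)) * lX 2 :: 'a laurent"
  have c: "h powi (2 * int j - int n) = (h\<^sup>2) ^ j * h powi (- int n)" for j
  proof -
    have "(h\<^sup>2) ^ j = h powi (2 * int j)"
      by (metis of_nat_mult of_nat_numeral power_int_of_nat power_mult)
    then show ?thesis using h by (simp add: power_int_add[symmetric])
  qed
  have "(\<Prod>j<n. 1 + lconst (h powi (2 * int j - int n)) * lX 2) = (\<Prod>j<n. 1 + lconst (h\<^sup>2) ^ j * ?z)"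
    unfolding c lconst_mult lconst_power by (simp only: mult.assoc)
  also have "\<dots> = (\<Sum>j\<le>n. lconst (h\<^sup>2) ^ (j * (j - 1) div 2) * qbinom (lconst (h\<^sup>2)) n j * ?z ^ j)"
    by (rule qbinomial_theorem)
  also have "\<dots> = (\<Sum>j\<le>n. lconst (qbinom (h\<^sup>2) n j * h powi (int j * (int j - 1) - int n * int j))
     * lX (2 * int j))"
  proof (rule sum.cong)
    fix j
    have "(h\<^sup>2) ^ (j * (j - 1) div 2) = h ^ (j * (j - 1))"
      by (cases j) (simp_all flip: power_mult)
    also have "\<dots> = h powi (int j * (int j - 1))"
      by (cases j) (simp_all flip: power_int_of_nat add: algebra_simps)
    finally have 1: "(h\<^sup>2) ^ (j * (j - 1) div 2) * (h powi (- int n)) ^ j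
        = h powi (int j * (int j - 1) - int n * int j)"
      using h by (simp add: power_int_power' power_int_add[symmetric])
    have "lconst (h\<^sup>2) ^ (j * (j - 1) div 2) * qbinom (lconst (h\<^sup>2)) n j * ?z ^ j
      = lconst (qbinom (h\<^sup>2) n j * ((h\<^sup>2) ^ (j * (j - 1) div 2) * (h powi (- int n)) ^ j)) * lX 2 ^ j"
      unfolding qbinom_lconst by (rule lconst_monomial)
    then show "lconst (h\<^sup>2) ^ (j * (j - 1) div 2) * qbinom (lconst (h\<^sup>2)) n j * ?z ^ j
      = lconst (qbinom (h\<^sup>2) n j * h powi (int j * (int j - 1) - int n * int j)) * lX (2 * int j)"
      unfolding 1 power_lX by (simp only: mult.commute)
  qed simp
  finally show ?thesis
    unfolding E_curve_def
    by (simp add: sum_distrib_left mult.left_commute[of "lX _" "lconst _"] lX_add[symmetric])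
qed

lemma prod_power_int: "h \<noteq> 0 \<Longrightarrow> (\<Prod>j\<in>S. h powi f j) = (h :: 'a::field) powi (\<Sum>j\<in>S. f j)"
  by (induction S rule: infinite_finite_induct) (auto simp: power_int_add)

text \<open>For \<open>p = n - 1\<close> this is the factor of \<open>E_curve n h\<close> complementary to \<open>X\<^sup>-\<^sup>1 - t X\<close>.\<close>

lemma s_op_balanced:
  fixes h :: "'a::field" and p :: nat
  assumes h: "h \<noteq> 0"
  defines "g \<equiv> lX (- int p) * (\<Prod>i<p. 1 + lconst (h powi (2 * int i + 1 - int p)) * lX 2)"
  shows "s_op g = g"
proof -
  let ?c = "\<lambda>i. h powi (2 * int i + 1 - int p)"
  \<comment> \<open>The coefficients with indices i and p - 1 - i have product 1, so s sends each
    factor to a monomial times its mirror image. The scalars multiply to 1, and the powers of X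
    combine with X^p to X^{-p}.\<close>
  have c: "1 + lconst (?c i) * lX (- 2) = lconst (?c i) * lX (- 2) * (1 + lconst (?c (p - Suc i)) * lX 2)"
    if "i < p" for i
  proof -
    have "?c i * ?c (p - Suc i) = 1"
      using h that by (simp add: power_int_add[symmetric] of_nat_diff)
    then have "lconst (?c i) * lconst (?c (p - Suc i)) = 1" by (simp flip: lconst_mult)
    moreover have "lX (- 2) * lX 2 = (1 :: 'a laurent)" by (simp flip: lX_add)
    moreover have "lconst (?c i) * lX (- 2) * (lconst (?c (p - Suc i)) * lX 2)
        = (lconst (?c i) * lconst (?c (p - Suc i))) * (lX (- 2) * lX 2)"
      by (simp only: mult_ac)
    ultimately have "lconst (?c i) * lX (- 2) * (lconst (?c (p - Suc i)) * lX 2) = 1" by simp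
    then show ?thesis by (simp add: distrib_left)
  qed
  have "(\<Sum>i<p. 2 * int i + 1 - int p) = 0"
  proof -
    have "(\<Sum>i<k. 2 * int i + 1 - int p) = int k * (int k - int p)" for k
      by (induction k) (auto simp: algebra_simps)
    then show ?thesis by simp
  qed
  then have one: "(\<Prod>i<p. ?c i) = 1" using h by (simp add: prod_power_int)
  have "s_op g = lX (int p) * (\<Prod>i<p. 1 + lconst (?c i) * lX (- 2))"
    by (simp add: g_def s_op_mult s_op_prod s_op_add)
  also have "(\<Prod>i<p. 1 + lconst (?c i) * lX (- 2))
      = (\<Prod>i<p. lconst (?c i)) * lX (- 2) ^ p * (\<Prod>i<p. 1 + lconst (?c (p - Suc i)) * lX 2)"
    by (simp add: c prod.distrib)
  also have "(\<Prod>i<p. 1 + lconst (?c (p - Suc i)) * lX 2) = (\<Prod>i<p. 1 + lconst (?c i) * lX 2 :: 'a laurent)"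
    by (rule prod.nat_diff_reindex)
  also have "(\<Prod>i<p. lconst (?c i)) = (1 :: 'a laurent)" by (simp flip: lconst_prod add: one)
  finally show ?thesis
    by (simp add: g_def power_lX mult.assoc[symmetric] lX_add[symmetric])
qed

text \<open>As for s, but \<pi> replaces X^2 by h^2 X^{-2}. The mirror image of factor i is factor n
  - 1 - i, and the scalars \<open>?d i\<close> have product h^n, which cancels the h^{-n} that \<pi>
  produces from X^{-n}.\<close>

lemma pi_op_E_curve:
  fixes h :: "'a::field"
  assumes h: "h \<noteq> 0"
  shows "pi_op h (E_curve n h) = E_curve n h"
proof -
  let ?c = "\<lambda>i. h powi (2 * int i - int n)"
  let ?d = "\<lambda>i. h powi (2 * int i - int n + 2)"
  have c: "1 + lconst (?c i) * (lconst (h\<^sup>2) * lX (- 2))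
      = lconst (?d i) * lX (- 2) * (1 + lconst (?c (n - Suc i)) * lX 2)"
    if "i < n" for i
  proof -
    have "?d i * ?c (n - Suc i) = 1"
      using h that by (simp add: power_int_add[symmetric] of_nat_diff)
    then have "lconst (?d i) * lconst (?c (n - Suc i)) = 1" by (simp flip: lconst_mult)
    moreover have "lX (- 2) * lX 2 = (1 :: 'a laurent)" by (simp flip: lX_add)
    moreover have "lconst (?d i) * lX (- 2) * (lconst (?c (n - Suc i)) * lX 2)
        = (lconst (?d i) * lconst (?c (n - Suc i))) * (lX (- 2) * lX 2)"
      by (simp only: mult_ac)
    ultimately have "lconst (?d i) * lX (- 2) * (lconst (?c (n - Suc i)) * lX 2) = 1" by simp
    moreover have "?c i * h\<^sup>2 = ?d i" using h by (simp add: power_int_add)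
    then have "lconst (?c i) * (lconst (h\<^sup>2) * lX (- 2)) = lconst (?d i) * lX (- 2)"
      by (metis lconst_mult mult.assoc)
    ultimately show ?thesis by (simp add: distrib_left)
  qed
  have "(\<Sum>i<n. 2 * int i - int n + 2) = int n"
  proof -
    have "(\<Sum>i<k. 2 * int i - int n + 2) = int k * (int k - int n + 1)" for k
      by (induction k) (auto simp: algebra_simps)
    then show ?thesis by simp
  qed
  then have one: "(\<Prod>i<n. ?d i) = h ^ n" using h by (simp add: prod_power_int)
  have "pi_op h (E_curve n h)
      = lconst (h powi (- int n)) * lX (int n) * (\<Prod>i<n. 1 + lconst (?c i) * (lconst (h\<^sup>2) * lX (- 2)))"
    using h by (simp add: E_curve_prod pi_op_mult pi_op_prod pi_op_add)
  also have "(\<Prod>i<n. 1 + lconst (?c i) * (lconst (h\<^sup>2) * lX (- 2)))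
      = (\<Prod>i<n. lconst (?d i)) * lX (- 2) ^ n * (\<Prod>i<n. 1 + lconst (?c (n - Suc i)) * lX 2)"
    by (simp add: c prod.distrib)
  also have "(\<Prod>i<n. 1 + lconst (?c (n - Suc i)) * lX 2) = (\<Prod>i<n. 1 + lconst (?c i) * lX 2 :: 'a laurent)"
    by (rule prod.nat_diff_reindex)
  also have "(\<Prod>i<n. lconst (?d i)) = (lconst (h ^ n) :: 'a laurent)" by (simp flip: lconst_prod add: one)
  also have "lconst (h powi (- int n)) * lX (int n) * (lconst (h ^ n) * lX (- 2) ^ n
        * (\<Prod>i<n. 1 + lconst (?c i) * lX 2))
      = lconst (h powi (- int n) * h ^ n) * (lX (int n) * lX (- 2) ^ n * (\<Prod>i<n. 1 + lconst (?c i) * lX 2))"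
    unfolding lconst_mult by (simp only: mult_ac)
  also have "h powi (- int n) * h ^ n = 1" using h by (simp add: power_int_minus)
  also have "lX (int n) * lX (- 2) ^ n = (lX (- int n) :: 'a laurent)"
    by (simp add: power_lX lX_add[symmetric])
  finally show ?thesis using h by (simp add: E_curve_prod)
qed

text \<open>Replacing t^{1/2} by -t^{-1/2} preserves t^{1/2} - t^{-1/2} and turns t^{1/2} X^2 -
  t^{-1/2} into t^{1/2} - t^{-1/2} X^2. Everything reduces to (X^{-1} - tX)(t^{1/2} - t^{-1/2} X^2)
  = (t^{1/2} X^2 - t^{-1/2})(X - t X^{-1}).\<close>

lemma T_pol_linear_factor:
  fixes v :: "'a::field"
  assumes v: "v \<noteq> 0"
  shows "T_pol v ((lX (- 1) - lconst (v\<^sup>2) * lX 1) * f)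
    = (lX (- 1) - lconst (v\<^sup>2) * lX 1) * T_pol (- inverse v) f"
proof (rule T_pol_eqI[OF v])
  let ?a = "lX (- 1) - lconst (v\<^sup>2) * lX 1 :: 'a laurent"
  define x y V W where "x = (lX 1 :: 'a laurent)" and "y = (lX (-1) :: 'a laurent)"
    and "V = lconst v" and "W = lconst (inverse v)"
  have xy: "x * y = 1" and VW: "V * W = 1" by (simp_all add: x_def y_def V_def W_def lconst_inverse v)
  have inv: "inverse (- inverse v) = - v" by simp
  have "(lX 2 - 1) * (?a * T_pol (- inverse v) f) = ?a * ((lX 2 - 1) * T_pol (- inverse v) f)"
    by (simp only: mult.left_commute)
  also have "\<dots> = ?a * ((lconst v - lconst (inverse v) * lX 2) * s_op f - lconst (v - inverse v) * f)"
    using v by (subst T_pol_mult_eq) (simp_all add: inv lconst_uminus lconst_diff algebra_simps)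
  also have "\<dots> = (lconst v * lX 2 - lconst (inverse v)) * (lX 1 - lconst (v\<^sup>2) * lX (- 1)) * s_op f
      - lconst (v - inverse v) * (?a * f)"
  proof -
    have "(y - V\<^sup>2 * x) * (V - W * x\<^sup>2) = (V * x\<^sup>2 - W) * (x - V\<^sup>2 * y)
        + (x * y - 1) * (- W * x + V ^ 3 * x) + (V * W - 1) * (V * x ^ 3 - V * y)"
      by (simp add: algebra_simps power2_eq_square power3_eq_cube)
    then have "(y - V\<^sup>2 * x) * (V - W * x\<^sup>2) = (V * x\<^sup>2 - W) * (x - V\<^sup>2 * y)"
      unfolding xy VW by simp
    then have "?a * (lconst v - lconst (inverse v) * lX 2)
        = (lconst v * lX 2 - lconst (inverse v)) * (lX 1 - lconst (v\<^sup>2) * lX (- 1))"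
      by (simp add: lX2_power(1) lconst_power x_def y_def V_def W_def)
    moreover have "a * (k * g - d * f) = l * g - d * (a * f)" if "a * k = l" for a k l d g f :: "'a laurent"
      using that by (auto simp: algebra_simps)
    ultimately show ?thesis by blast
  qed
  finally show "(lX 2 - 1) * (?a * T_pol (- inverse v) f)
    = (lconst v * lX 2 - lconst (inverse v)) * s_op (?a * f) - lconst (v - inverse v) * (?a * f)"
    by (simp add: s_op_mult s_op_diff mult.assoc)
qed

text \<open>The factor j = 0 supplies X^{-1} - tX, since h^{-n} = -t; the other n - 1 factors form
  the symmetric polynomial g, through which T passes.\<close>

lemma T_pol_E_curve:
  fixes h v :: "'a::field"
  assumes h: "h \<noteq> 0" and v: "v \<noteq> 0" and t: "v\<^sup>2 * h ^ n = - 1" and n: "n > 0"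
  shows "T_pol v (E_curve n h * f) = E_curve n h * T_pol (- inverse v) f"
proof -
  obtain p where p: "n = Suc p" using n by (metis Suc_pred)
  define g where "g = lX (- int p) * (\<Prod>i<p. 1 + lconst (h powi (2 * int i + 1 - int p)) * lX 2)"
  let ?a = "lX (- 1) - lconst (v\<^sup>2) * lX 1 :: 'a laurent"
  have t': "h powi (- int n) = - (v\<^sup>2)"
    using t h by (simp add: power_int_minus field_simps)
  have "E_curve n h = lX (- 1 - int p) * ((1 - lconst (v\<^sup>2) * lX 2)
      * (\<Prod>i<p. 1 + lconst (h powi (2 * int i + 1 - int p)) * lX 2))"
  proof -
    have "lX (- int n) = (lX (- 1 - int p) :: 'a laurent)" by (simp add: p)
    moreover have "(\<Prod>j<n. 1 + lconst (h powi (2 * int j - int n)) * lX 2 :: 'a laurent)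
      = (1 + lconst (h powi (2 * int 0 - int n)) * lX 2)
        * (\<Prod>i<p. 1 + lconst (h powi (2 * int (Suc i) - int n)) * lX 2)"
      unfolding p by (rule prod.lessThan_Suc_shift)
    moreover have "2 * int (Suc i) - int n = 2 * int i + 1 - int p" for i by (simp add: p)
    moreover have "1 + lconst (h powi (2 * int 0 - int n)) * lX 2 = (1 - lconst (v\<^sup>2) * lX 2 :: 'a laurent)"
      using t' by (simp add: lconst_uminus)
    ultimately show ?thesis unfolding E_curve_prod[OF h] by presburger
  qed
  also have "\<dots> = (lX (- 1) * (1 - lconst (v\<^sup>2) * lX 2)) * g"
  proof -
    have "lX (- 1 - int p) = (lX (- 1) * lX (- int p) :: 'a laurent)" by (simp flip: lX_add)
    then show ?thesis unfolding g_def by (simp only: mult_ac)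
  qed
  also have "lX (- 1) * (1 - lconst (v\<^sup>2) * lX 2) = ?a"
    by (simp add: right_diff_distrib mult.left_commute[of "lX _"] lX_add[symmetric])
  finally have E: "E_curve n h = g * ?a" by (simp only: mult.commute)
  have "s_op g = g" unfolding g_def by (rule s_op_balanced[OF h])
  then show ?thesis
    unfolding E mult.assoc by (simp only: T_pol_sym_mult[OF v] T_pol_linear_factor[OF v])
qed

section \<open>Regular functions of the parameter\<close>

text \<open>One rational function has to represent f on all of D; this ties the special parameter to
  the general ones.\<close>

definition regular_on :: "complex set \<Rightarrow> (complex \<Rightarrow> complex) \<Rightarrow> bool" where
  "regular_on D f \<longleftrightarrow> (\<exists>F. \<forall>r\<in>D. s1.spec r F (f r))"

lemma regular_on_const [intro!]: "regular_on D (\<lambda>_. c)"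
  unfolding regular_on_def using spec_const by blast

lemma regular_on_id [intro!]: "regular_on D (\<lambda>r. r)"
  unfolding regular_on_def using spec_gen_r1 by blast

lemma regular_on_add [intro]: "regular_on D f \<Longrightarrow> regular_on D g \<Longrightarrow> regular_on D (\<lambda>r. f r + g r)"
  and regular_on_diff [intro]: "regular_on D f \<Longrightarrow> regular_on D g \<Longrightarrow> regular_on D (\<lambda>r. f r - g r)"
  and regular_on_mult [intro]: "regular_on D f \<Longrightarrow> regular_on D g \<Longrightarrow> regular_on D (\<lambda>r. f r * g r)"
  unfolding regular_on_def using s1.spec_add s1.spec_diff s1.spec_mult by meson+

lemma regular_on_uminus [intro]: "regular_on D f \<Longrightarrow> regular_on D (\<lambda>r. - f r)"
  unfolding regular_on_def using s1.spec_uminus by meson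

lemma regular_on_inverse [intro]:
  "regular_on D f \<Longrightarrow> (\<And>r. r \<in> D \<Longrightarrow> f r \<noteq> 0) \<Longrightarrow> regular_on D (\<lambda>r. inverse (f r))"
  unfolding regular_on_def using s1.spec_inverse by meson

lemma regular_on_divide [intro]:
  "regular_on D f \<Longrightarrow> regular_on D g \<Longrightarrow> (\<And>r. r \<in> D \<Longrightarrow> g r \<noteq> 0) \<Longrightarrow> regular_on D (\<lambda>r. f r / g r)"
  by (simp add: divide_inverse regular_on_mult regular_on_inverse)

lemma regular_on_power [intro]: "regular_on D f \<Longrightarrow> regular_on D (\<lambda>r. f r ^ k)"
  by (induction k) auto

lemma regular_on_power_int:
  "regular_on D f \<Longrightarrow> (\<And>r. r \<in> D \<Longrightarrow> f r \<noteq> 0) \<Longrightarrow> regular_on D (\<lambda>r. f r powi i)"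
  by (cases "0 \<le> i") (simp_all add: power_int_def regular_on_power regular_on_inverse)

lemma regular_on_sum [intro]: "(\<And>i. i \<in> S \<Longrightarrow> regular_on D (f i)) \<Longrightarrow> regular_on D (\<lambda>r. \<Sum>i\<in>S. f i r)"
  and regular_on_prod [intro]: "(\<And>i. i \<in> S \<Longrightarrow> regular_on D (f i)) \<Longrightarrow> regular_on D (\<lambda>r. \<Prod>i\<in>S. f i r)"
  by (induction S rule: infinite_finite_induct) auto

lemma regular_on_cong: "(\<And>r. r \<in> D \<Longrightarrow> f r = g r) \<Longrightarrow> regular_on D f \<longleftrightarrow> regular_on D g"
  by (simp add: regular_on_def)

lemma regular_on_curve: "0 \<notin> D \<Longrightarrow> regular_on D (curve_v n \<sigma>)"
  unfolding regular_on_def using spec_curve by metis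

lemma regular_on_values:
  assumes "\<And>i. regular_on D (c i)"
  obtains a :: "'i \<Rightarrow> rfield" where "\<And>r i. r \<in> D \<Longrightarrow> regular1 r (a i)" "\<And>r i. r \<in> D \<Longrightarrow> value1 r (a i) = c i r"
proof -
  have "\<forall>i. \<exists>F. \<forall>r\<in>D. s1.spec r F (c i r)" using assms by (simp add: regular_on_def)
  then obtain a where "\<And>i r. r \<in> D \<Longrightarrow> s1.spec r (a i) (c i r)" by metis
  then show ?thesis using that[of a] regular1I value1_eqI by blast
qed

section \<open>Bases of the quotient\<close>

lemma lookup_E_curve_mult:
  fixes g :: "'a::field laurent"
  shows "lk (E_curve n h * g) k = (\<Sum>j\<le>n. qbinom (h\<^sup>2) n j *
    h powi (int j * (int j - 1) - int n * int j) * lk g (k - (2 * int j - int n)))"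
  unfolding E_curve_def sum_distrib_right lookup_sum mult.assoc[of _ _ g] lookup_lconst_mult lookup_lX_mult ..

text \<open>The extreme exponents -n and n of \<open>E_curve\<close> have nonzero coefficients, so a
  nonzero multiple by g reaches the exponents min - n and max + n, with min and max the ends of the
  support of g. Both lie in {1-n..n} only if max \<le> 0 and min \<ge> 1, which is
  impossible.\<close>

lemma E_curve_dvd_small:
  fixes f :: "'a::field laurent"
  assumes h: "h \<noteq> 0" and dvd: "E_curve n h dvd f" and f: "\<And>k. lk f k \<noteq> 0 \<Longrightarrow> k \<in> idx n"
  shows "f = 0"
proof (rule ccontr)
  assume "f \<noteq> 0"
  obtain g where g: "f = E_curve n h * g" using dvd by (rule dvdE)
  define K where "K = Poly_Mapping.keys g"
  have "g \<noteq> 0" using g \<open>f \<noteq> 0\<close> by auto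
  then have K: "finite K" "K \<noteq> {}" by (auto simp: K_def)
  have out: "lk g k = 0" if "k < Min K \<or> k > Max K" for k
    using that K by (auto simp: K_def in_keys_iff dest: Min_le[of K k] Max_ge[of K k])
  have nz: "lk g (Min K) \<noteq> 0" "lk g (Max K) \<noteq> 0"
    using Min_in[OF K] Max_in[OF K] by (auto simp: K_def in_keys_iff)
  let ?c = "\<lambda>j. qbinom (h\<^sup>2) n j * h powi (int j * (int j - 1) - int n * int j)"
  have "lk f (Max K + int n) = (\<Sum>j\<le>n. if j = n then ?c n * lk g (Max K) else 0)"
    unfolding g lookup_E_curve_mult by (rule sum.cong) (auto intro!: out)
  then have "lk f (Max K + int n) \<noteq> 0" using nz h by simp
  then have 1: "Max K \<le> 0" using f[of "Max K + int n"] by (simp add: idx_def)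
  have "lk f (Min K - int n) = (\<Sum>j\<le>n. if j = 0 then ?c 0 * lk g (Min K) else 0)"
    unfolding g lookup_E_curve_mult by (rule sum.cong) (auto intro!: out)
  then have "lk f (Min K - int n) \<noteq> 0" using nz h by simp
  then have 2: "Min K \<ge> 1" using f[of "Min K - int n"] by (simp add: idx_def)
  show False using 1 2 Min_le[OF K(1) Max_in[OF K]] by simp
qed

text \<open>Division with remainder by \<open>E_curve\<close> in families: the remainder lives in
  the window of 2n exponents, with coefficients regular in r.\<close>

definition reduces :: "nat \<Rightarrow> complex set \<Rightarrow> (complex \<Rightarrow> complex laurent) \<Rightarrow> bool" where
  "reduces n D f \<longleftrightarrow> (\<exists>c. (\<forall>i. regular_on D (c i)) \<and>
     (\<forall>r\<in>D. E_curve n (r\<^sup>2) dvd f r - (\<Sum>i\<in>idx n. lconst (c i r) * lX i)))"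

lemma reduces_add:
  assumes "reduces n D f" "reduces n D g"
  shows "reduces n D (\<lambda>r. f r + g r)"
proof -
  obtain c where c: "\<And>i. regular_on D (c i)"
      "\<And>r. r \<in> D \<Longrightarrow> E_curve n (r\<^sup>2) dvd f r - (\<Sum>i\<in>idx n. lconst (c i r) * lX i)"
    using assms(1) unfolding reduces_def by blast
  obtain d where d: "\<And>i. regular_on D (d i)"
      "\<And>r. r \<in> D \<Longrightarrow> E_curve n (r\<^sup>2) dvd g r - (\<Sum>i\<in>idx n. lconst (d i r) * lX i)"
    using assms(2) unfolding reduces_def by blast
  show ?thesis unfolding reduces_def
  proof (intro exI[of _ "\<lambda>i r. c i r + d i r"] conjI allI ballI)
    fix r assume "r \<in> D"
    have "f r + g r - (\<Sum>i\<in>idx n. lconst (c i r + d i r) * lX i)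
      = (f r - (\<Sum>i\<in>idx n. lconst (c i r) * lX i)) + (g r - (\<Sum>i\<in>idx n. lconst (d i r) * lX i))"
      by (simp add: lconst_add distrib_right sum.distrib)
    then show "E_curve n (r\<^sup>2) dvd f r + g r - (\<Sum>i\<in>idx n. lconst (c i r + d i r) * lX i)"
      using dvd_add[OF c(2)[OF \<open>r \<in> D\<close>] d(2)[OF \<open>r \<in> D\<close>]] by (simp only:)
  qed (use c d in auto)
qed

lemma reduces_scale:
  assumes "reduces n D f" "regular_on D a"
  shows "reduces n D (\<lambda>r. lconst (a r) * f r)"
proof -
  obtain c where c: "\<And>i. regular_on D (c i)"
      "\<And>r. r \<in> D \<Longrightarrow> E_curve n (r\<^sup>2) dvd f r - (\<Sum>i\<in>idx n. lconst (c i r) * lX i)"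
    using assms(1) unfolding reduces_def by blast
  show ?thesis unfolding reduces_def
  proof (intro exI[of _ "\<lambda>i r. a r * c i r"] conjI allI ballI)
    fix r assume "r \<in> D"
    have "lconst (a r) * f r - (\<Sum>i\<in>idx n. lconst (a r * c i r) * lX i)
      = lconst (a r) * (f r - (\<Sum>i\<in>idx n. lconst (c i r) * lX i))"
      by (simp add: lconst_mult right_diff_distrib sum_distrib_left mult.assoc)
    then show "E_curve n (r\<^sup>2) dvd lconst (a r) * f r - (\<Sum>i\<in>idx n. lconst (a r * c i r) * lX i)"
      using c(2) \<open>r \<in> D\<close> by simp
  qed (use c assms in auto)
qed

lemma reduces_cong_dvd:
  assumes "reduces n D g" "\<And>r. r \<in> D \<Longrightarrow> E_curve n (r\<^sup>2) dvd f r - g r"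
  shows "reduces n D f"
proof -
  obtain c where c: "\<And>i. regular_on D (c i)"
      "\<And>r. r \<in> D \<Longrightarrow> E_curve n (r\<^sup>2) dvd g r - (\<Sum>i\<in>idx n. lconst (c i r) * lX i)"
    using assms(1) unfolding reduces_def by blast
  have "E_curve n (r\<^sup>2) dvd f r - (\<Sum>i\<in>idx n. lconst (c i r) * lX i)" if "r \<in> D" for r
    using dvd_add[OF assms(2)[OF that] c(2)[OF that]] by simp
  then show ?thesis unfolding reduces_def using c(1) by blast
qed

lemma reduces_0: "reduces n D (\<lambda>_. 0)"
  unfolding reduces_def by (intro exI[of _ "\<lambda>_ _. 0"]) auto

lemma reduces_sum: "(\<And>i. i \<in> S \<Longrightarrow> reduces n D (f i)) \<Longrightarrow> reduces n D (\<lambda>r. \<Sum>i\<in>S. f i r)"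
  by (induction S rule: infinite_finite_induct) (auto intro: reduces_add reduces_0)

lemma reduces_idx: "k \<in> idx n \<Longrightarrow> reduces n D (\<lambda>_. lX k)"
proof -
  assume k: "k \<in> idx n"
  have "(\<Sum>i\<in>idx n. lconst (if i = k then 1 else 0) * lX i) = (lX k :: complex laurent)"
  proof -
    have "(\<Sum>i\<in>idx n. lconst (if i = k then 1 else 0) * lX i)
      = (\<Sum>i\<in>idx n. if i = k then lX k else (0 :: complex laurent))"
      by (rule sum.cong) auto
    then show ?thesis using k by (simp add: idx_def)
  qed
  then show ?thesis unfolding reduces_def
    by (intro exI[of _ "\<lambda>i _. if i = k then 1 else 0"]) auto
qed

text \<open>Just outside the window, the relations E = 0 and X E = 0 are solved for X^{-n} and
  X^{n+1}. The coefficients to be inverted are the extreme ones, 1 and h^{-n}, which are units among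
  the regular functions.\<close>

lemma reduces_boundary:
  assumes D: "0 \<notin> D"
  shows "reduces n D (\<lambda>_. lX (int n + 1))" "reduces n D (\<lambda>_. lX (- int n))"
proof -
  let ?c = "\<lambda>j r. qbinom ((r\<^sup>2)\<^sup>2) n j * (r\<^sup>2) powi (int j * (int j - 1) - int n * int j)"
  have reg: "regular_on D (?c j)" for j
  proof -
    have "regular_on D (\<lambda>r. qbinom ((r\<^sup>2)\<^sup>2) n j)"
      unfolding regular_on_def
      using s1.spec_qbinom[OF s1.spec_power[OF s1.spec_power[OF spec_gen_r1]]] by blast
    moreover have "regular_on D (\<lambda>r. (r\<^sup>2) powi (int j * (int j - 1) - int n * int j))"
      using D by (intro regular_on_power_int regular_on_power regular_on_id) auto
    ultimately show ?thesis by (rule regular_on_mult)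
  qed
  have E: "E_curve n (r\<^sup>2) = (\<Sum>j\<le>n. lconst (?c j r) * lX (2 * int j - int n))" for r
    by (simp add: E_curve_def)
  show "reduces n D (\<lambda>_. lX (- int n))"
  proof (rule reduces_cong_dvd)
    show "reduces n D (\<lambda>r. \<Sum>j\<in>{1..n}. lconst (- ?c j r) * lX (2 * int j - int n))"
      by (intro reduces_sum reduces_scale reduces_idx regular_on_uminus reg) (auto simp: idx_def)
    fix r
    have "{..n} = insert 0 {1..n}" by auto
    then have "E_curve n (r\<^sup>2) = lX (- int n) - (\<Sum>j\<in>{1..n}. lconst (- ?c j r) * lX (2 * int j - int n))"
      unfolding E by (simp add: lconst_uminus sum_negf)
    then show "E_curve n (r\<^sup>2) dvd lX (- int n) - (\<Sum>j\<in>{1..n}. lconst (- ?c j r) * lX (2 * int j - int n))"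
      by simp
  qed
  show "reduces n D (\<lambda>_. lX (int n + 1))"
  proof (rule reduces_cong_dvd)
    show "reduces n D (\<lambda>r. lconst ((r\<^sup>2) powi int n) *
        (\<Sum>j\<in>{..<n}. lconst (- ?c j r) * lX (2 * int j - int n + 1)))"
      using D by (intro reduces_sum reduces_scale reduces_idx regular_on_uminus reg
          regular_on_power_int regular_on_power regular_on_id) (auto simp: idx_def)
    fix r assume "r \<in> D"
    then have r: "r \<noteq> 0" using D by auto
    have "{..n} = insert n {..<n}" by auto
    then have E': "lX 1 * E_curve n (r\<^sup>2) = lconst (?c n r) * lX (int n + 1)
        - (\<Sum>j\<in>{..<n}. lconst (- ?c j r) * lX (2 * int j - int n + 1))"
      unfolding E sum_distrib_left
      by (simp add: lconst_uminus sum_negf mult.left_commute[of "lX _"] lX_add[symmetric] add.commute)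
    have one: "(r\<^sup>2) powi int n * ?c n r = 1"
    proof -
      have "int n + (int n * (int n - 1) - int n * int n) = 0" by (simp add: algebra_simps)
      then have "(r\<^sup>2) powi int n * (r\<^sup>2) powi (int n * (int n - 1) - int n * int n) = 1"
        using r by (subst power_int_add[symmetric]) simp_all
      then show ?thesis by simp
    qed
    have "lconst ((r\<^sup>2) powi int n) * (lX 1 * E_curve n (r\<^sup>2))
      = lconst ((r\<^sup>2) powi int n * ?c n r) * lX (int n + 1) - lconst ((r\<^sup>2) powi int n) *
        (\<Sum>j\<in>{..<n}. lconst (- ?c j r) * lX (2 * int j - int n + 1))"
      unfolding E' lconst_mult right_diff_distrib mult.assoc ..
    then have "lX (int n + 1) - lconst ((r\<^sup>2) powi int n) *
        (\<Sum>j\<in>{..<n}. lconst (- ?c j r) * lX (2 * int j - int n + 1))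
      = E_curve n (r\<^sup>2) * (lconst ((r\<^sup>2) powi int n) * lX 1)"
      unfolding one by (simp add: mult_ac)
    then show "E_curve n (r\<^sup>2) dvd lX (int n + 1) - lconst ((r\<^sup>2) powi int n) *
        (\<Sum>j\<in>{..<n}. lconst (- ?c j r) * lX (2 * int j - int n + 1))" by simp
  qed
qed

text \<open>A shift by one leaves the window at no more than one exponent, where
  \<open>reduces_boundary\<close> applies.\<close>

lemma reduces_shift:
  assumes "reduces n D f" "0 \<notin> D" "d = 1 \<or> d = - 1"
  shows "reduces n D (\<lambda>r. lX d * f r)"
proof -
  obtain c where c: "\<And>i. regular_on D (c i)"
      "\<And>r. r \<in> D \<Longrightarrow> E_curve n (r\<^sup>2) dvd f r - (\<Sum>i\<in>idx n. lconst (c i r) * lX i)"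
    using assms(1) unfolding reduces_def by blast
  have *: "reduces n D (\<lambda>_. lX (i + d))" if "i \<in> idx n" for i
  proof -
    have "i + d \<in> idx n \<or> i + d = int n + 1 \<or> i + d = - int n"
      using that assms(3) by (auto simp: idx_def)
    then show ?thesis using reduces_idx reduces_boundary[OF assms(2)] by auto
  qed
  show ?thesis
  proof (rule reduces_cong_dvd)
    show "reduces n D (\<lambda>r. \<Sum>i\<in>idx n. lconst (c i r) * lX (i + d))"
      by (intro reduces_sum reduces_scale * c)
    fix r assume "r \<in> D"
    have "lX d * f r - (\<Sum>i\<in>idx n. lconst (c i r) * lX (i + d))
      = lX d * (f r - (\<Sum>i\<in>idx n. lconst (c i r) * lX i))"
      by (simp add: right_diff_distrib sum_distrib_left lX_add mult_ac)
    then show "E_curve n (r\<^sup>2) dvd lX d * f r - (\<Sum>i\<in>idx n. lconst (c i r) * lX (i + d))"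
      using c(2)[OF \<open>r \<in> D\<close>] by simp
  qed
qed

lemma reduces_lX:
  assumes n: "n > 0" and D: "0 \<notin> D"
  shows "reduces n D (\<lambda>_. lX k)"
proof -
  have "reduces n D (\<lambda>_. lX (int i))" for i
  proof (induction i)
    case (Suc i)
    then show ?case using reduces_shift[OF Suc D, of 1] by (simp add: lX_add[symmetric])
  qed (use n in \<open>simp add: reduces_idx idx_def del: lX_0\<close>)
  moreover have "reduces n D (\<lambda>_. lX (- int i))" for i
  proof (induction i)
    case (Suc i)
    then show ?case using reduces_shift[OF Suc D, of "- 1"] by (simp add: lX_add[symmetric])
  qed (use n in \<open>simp add: reduces_idx idx_def del: lX_0\<close>)
  ultimately show ?thesis by (cases k rule: int_cases2) auto
qed

lemma reduces_family:
  assumes "n > 0" "0 \<notin> D" "finite S" "\<And>r k. r \<in> D \<Longrightarrow> lk (f r) k \<noteq> 0 \<Longrightarrow> k \<in> S"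
    "\<And>k. regular_on D (\<lambda>r. lk (f r) k)"
  shows "reduces n D f"
proof (rule reduces_cong_dvd)
  show "reduces n D (\<lambda>r. \<Sum>k\<in>S. lconst (lk (f r) k) * lX k)"
    by (intro reduces_sum reduces_scale reduces_lX assms)
  show "E_curve n (r\<^sup>2) dvd f r - (\<Sum>k\<in>S. lconst (lk (f r) k) * lX k)" if "r \<in> D" for r
    using laurent_eq_sum[of S "f r"] assms(3,4) that by simp
qed

lemma reduces_fixed: "n > 0 \<Longrightarrow> 0 \<notin> D \<Longrightarrow> reduces n D (\<lambda>_. f)"
  by (rule reduces_family[where S = "Poly_Mapping.keys f"]) (auto simp: in_keys_iff)

lemma triangular_lX: "triangular K (lX :: int \<Rightarrow> 'a::field laurent)"
  by (auto simp: triangular_def lookup_lX split: if_splits)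

context
  fixes n :: nat and r v :: complex
  assumes n: "n > 0" and r: "r \<noteq> 0"
begin

abbreviation (input) "QE \<equiv> pol_quot (r\<^sup>2) v (E_curve n (r\<^sup>2))"

text \<open>Spanning: reduce to the window, then expand in b. Independence: a combination vanishing
  in the quotient is a multiple of \<open>E_curve\<close> supported in the window, hence zero
  already as a Laurent polynomial.\<close>

lemma triangular_is_basis:
  assumes tri: "triangular (2 * n) b" and b': "\<And>m. m \<in> idx n \<Longrightarrow> b' m = qclass (E_curve n (r\<^sup>2)) (b m)"
  shows "is_basis QE (idx n) b'"
  unfolding is_basis_def
proof (intro conjI ballI)
  let ?E = "E_curve n (r\<^sup>2)"
  show "finite (idx n)" by (simp add: idx_def)
  then have lc: "lincomb QE (idx n) c b' = qclass ?E (\<Sum>m\<in>idx n. lconst (c m) * b m)" for c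
    using pol_quot_lincomb b' by blast
  show "b' ` idx n \<subseteq> carrier QE" using b' by (auto simp: carrier_pol_quot)
  fix x assume "x \<in> carrier QE"
  then obtain f where x: "x = qclass ?E f" by (rule pol_quot_cases)
  \<comment> \<open>A single parameter is treated as a one-point family.\<close>
  have "reduces n {r} (\<lambda>_. f)" using n r by (intro reduces_fixed) auto
  then obtain c0 where c0: "?E dvd f - (\<Sum>i\<in>idx n. lconst (c0 i r) * lX i)"
    unfolding reduces_def by blast
  define f' where "f' = (\<Sum>i\<in>idx n. lconst (c0 i r) * lX i)"
  have supp: "k \<in> below (2 * n)" if nz: "lk f' k \<noteq> 0" for k
  proof -
    obtain i where "i \<in> idx n" "lk (lconst (c0 i r) * lX i) k \<noteq> 0"
      using nz unfolding f'_def lookup_sum by (rule sum.not_neutral_contains_not_neutral)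
    then show ?thesis unfolding below_idx by (auto simp: lookup_lX split: if_splits)
  qed
  obtain c where c: "f' = (\<Sum>m\<in>idx n. lconst (c m) * b m)"
    using triangular_expand1[OF tri supp] unfolding below_idx by blast
  show "\<exists>!c. (\<forall>i. i \<notin> idx n \<longrightarrow> c i = 0) \<and> x = lincomb QE (idx n) c b'"
  proof (rule ex1I[of _ "\<lambda>m. if m \<in> idx n then c m else 0"])
    have "(\<Sum>m\<in>idx n. lconst (if m \<in> idx n then c m else 0) * b m) = f'"
      unfolding c by (rule sum.cong) auto
    then show "(\<forall>i. i \<notin> idx n \<longrightarrow> (if i \<in> idx n then c i else 0) = 0) \<and>
        x = lincomb QE (idx n) (\<lambda>m. if m \<in> idx n then c m else 0) b'"
      using c0 by (simp add: lc x qclass_eq_iff f'_def)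
    fix d assume d: "(\<forall>i. i \<notin> idx n \<longrightarrow> d i = 0) \<and> x = lincomb QE (idx n) d b'"
    define g where "g = (\<Sum>m\<in>idx n. lconst (c m - d m) * b m)"
    have "?E dvd f' - (\<Sum>m\<in>idx n. lconst (d m) * b m)"
      using d c0 by (metis f'_def lc qclass_eq_iff x)
    also have "f' - (\<Sum>m\<in>idx n. lconst (d m) * b m) = g"
      by (simp add: c g_def lconst_diff left_diff_distrib sum_subtractf)
    finally have "?E dvd g" .
    moreover have "k \<in> idx n" if nz: "lk g k \<noteq> 0" for k
    proof -
      obtain m where "m \<in> idx n" "lk (lconst (c m - d m) * b m) k \<noteq> 0"
        using nz unfolding g_def lookup_sum by (rule sum.not_neutral_contains_not_neutral)
      then have "m \<in> below (2 * n)" "lk (b m) k \<noteq> 0" by (auto simp: below_idx)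
      then have "k \<in> below (2 * n)" using tri by (fastforce simp: triangular_def below_def)
      then show ?thesis by (simp add: below_idx)
    qed
    ultimately have "g = 0" using r by (intro E_curve_dvd_small[of "r\<^sup>2" n g]) auto
    then have "c m - d m = 0" if "m \<in> idx n" for m
      using triangular_independent[OF tri, of "\<lambda>m. c m - d m" m] that
      by (simp add: g_def below_idx)
    then show "d = (\<lambda>m. if m \<in> idx n then c m else 0)" using d by auto
  qed
qed

end

text \<open>Dimension and semisimplicity are defined with bases indexed by natural numbers, whereas
  the bases at hand are indexed by integers or by points of a spectrum.\<close>

lemma is_basis_reindex:
  assumes M: "M = pol_quot h v e" and S: "is_basis M S b" and g: "bij_betw g T S"
  shows "is_basis M T (b \<circ> g)"
proof -
  have fin: "finite S" "finite T" and bS: "b ` S \<subseteq> carrier M"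
    using S bij_betw_finite[OF g] by (auto simp: is_basis_def)
  have "\<forall>i\<in>S. \<exists>f. b i = qclass e f" using bS by (auto simp: M carrier_pol_quot)
  then obtain f where f: "\<And>i. i \<in> S \<Longrightarrow> b i = qclass e (f i)" by metis
  have gT: "g i \<in> S" if "i \<in> T" for i using that g by (auto dest: bij_betwE)
  have lcT: "lincomb M T c (b \<circ> g) = qclass e (\<Sum>i\<in>T. lconst (c i) * f (g i))" for c
    unfolding M by (rule pol_quot_lincomb) (use fin f gT in auto)
  have lcS: "lincomb M S c b = qclass e (\<Sum>i\<in>S. lconst (c i) * f i)" for c
    unfolding M by (rule pol_quot_lincomb) (use fin f in auto)
  have eq: "lincomb M S c b = lincomb M T (c \<circ> g) (b \<circ> g)" for c
    unfolding lcT lcS using sum.reindex_bij_betw[OF g, of "\<lambda>i. lconst (c i) * f i"] by simp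
  have lincomb_cong: "lincomb M T c (b \<circ> g) = lincomb M T d (b \<circ> g)" if "\<And>i. i \<in> T \<Longrightarrow> c i = d i" for c d
    unfolding lcT using that by (simp cong: sum.cong)
  show ?thesis unfolding is_basis_def
  proof (intro conjI ballI)
    show "finite T" by (rule fin)
    show "(b \<circ> g) ` T \<subseteq> carrier M" using bS gT by auto
    fix x assume "x \<in> carrier M"
    then have "\<exists>!c. (\<forall>i. i \<notin> S \<longrightarrow> c i = 0) \<and> x = lincomb M S c b"
      using S by (auto simp: is_basis_def)
    then obtain c where c: "\<forall>i. i \<notin> S \<longrightarrow> c i = 0" "x = lincomb M S c b"
      and uniq: "\<And>d. (\<forall>i. i \<notin> S \<longrightarrow> d i = 0) \<Longrightarrow> x = lincomb M S d b \<Longrightarrow> d = c" by metis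
    show "\<exists>!c. (\<forall>i. i \<notin> T \<longrightarrow> c i = 0) \<and> x = lincomb M T c (b \<circ> g)"
    proof (rule ex1I[of _ "\<lambda>i. if i \<in> T then c (g i) else 0"])
      have "lincomb M T (\<lambda>i. if i \<in> T then c (g i) else 0) (b \<circ> g) = lincomb M T (c \<circ> g) (b \<circ> g)"
        by (rule lincomb_cong) auto
      then show "(\<forall>i. i \<notin> T \<longrightarrow> (if i \<in> T then c (g i) else 0) = 0) \<and>
          x = lincomb M T (\<lambda>i. if i \<in> T then c (g i) else 0) (b \<circ> g)"
        using c by (simp add: eq)
      fix d assume d: "(\<forall>i. i \<notin> T \<longrightarrow> d i = 0) \<and> x = lincomb M T d (b \<circ> g)"
      define d' where "d' i = (if i \<in> S then d (inv_into T g i) else 0)" for i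
      have d'g: "d' (g i) = d i" if "i \<in> T" for i
        using that g gT by (simp add: d'_def bij_betw_inv_into_left)
      have "x = lincomb M T (d' \<circ> g) (b \<circ> g)"
        using d lincomb_cong[of d "d' \<circ> g"] d'g by simp
      then have "x = lincomb M S d' b" by (simp add: eq)
      then have "d' = c" by (intro uniq) (auto simp: d'_def)
      then show "d = (\<lambda>i. if i \<in> T then c (g i) else 0)" using d d'g by auto
    qed
  qed
qed

lemma is_basis_has_dim:
  assumes "M = pol_quot h v e" "is_basis M S b" "card S = d"
  shows "has_dim M d"
proof -
  have "finite S" using assms by (simp add: is_basis_def)
  then obtain g where "bij_betw g {0..<card S} S" using ex_bij_betw_nat_finite by blast
  then show ?thesis using is_basis_reindex[OF assms(1,2)] assms(3)
    unfolding has_dim_def by (metis atLeast0LessThan)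
qed

lemma is_basis_semisimple:
  assumes "M = pol_quot h v e" "is_basis M S b" "\<And>i. i \<in> S \<Longrightarrow> \<exists>c. F (b i) = c \<odot>\<^bsub>M\<^esub> b i"
  shows "semisimple_op M F"
proof -
  have "finite S" using assms by (simp add: is_basis_def)
  then obtain g where g: "bij_betw g {0..<card S} S" using ex_bij_betw_nat_finite by blast
  then show ?thesis using is_basis_reindex[OF assms(1,2) g] assms(3)
    unfolding semisimple_op_def by (metis bij_betwE comp_apply)
qed

lemma coords_eqI:
  assumes "is_basis M S b" "x \<in> carrier M" "\<And>i. i \<notin> S \<Longrightarrow> c i = 0" "x = lincomb M S c b"
  shows "coords M S b x = c"
  unfolding coords_def
  by (rule the1_equality) (use assms in \<open>auto simp: is_basis_def\<close>)

section \<open>The modules on the curve\<close>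

locale curve =
  fixes n :: nat and \<sigma> r :: complex
  assumes n: "n > 0" and \<sigma>: "\<sigma>\<^sup>2 = - 1" and r: "r \<noteq> 0"
begin

abbreviation "hh \<equiv> r\<^sup>2"
abbreviation "vv \<equiv> curve_v n \<sigma> r"
abbreviation "EE \<equiv> E_curve n (r\<^sup>2)"
abbreviation "MM \<equiv> pol_quot hh vv EE"

lemma hh: "hh \<noteq> 0" and vv: "vv \<noteq> 0" and tt: "vv\<^sup>2 * hh ^ n = - 1"
  using r curve_v_ne_0[OF r \<sigma>] curve_t[OF r \<sigma>] by auto

text \<open>The partner parameter is -t^{-1/2}, the one to which X^{-1} - tX carries T.\<close>

sublocale stable_quot hh vv "- inverse vv" EE
  by unfold_locales (use hh vv tt n in \<open>auto simp: T_pol_E_curve pi_op_E_curve\<close>)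

lemma Vp_mod_eq: "Vp_mod n \<sigma> r = MM"
  by (simp add: Vp_mod_def ec_minus_n[OF \<sigma> r])

lemma Vp_well_defined: "Vp_well_defined n \<sigma> r"
  unfolding Vp_well_defined_def Vp_mod_eq
  by (simp add: ec_minus_n[OF \<sigma> r] stable_ideal_e daha_module_Q algebra_pol_quot)

lemma basis_X: "is_basis MM (idx n) (Vp_X n \<sigma> r)"
  by (rule triangular_is_basis[OF n r triangular_lX]) (simp add: Vp_X_def ec_minus_n[OF \<sigma> r])

lemma card_idx: "card (idx n) = 2 * n"
  by (simp add: below_idx[symmetric])

lemma has_dim_MM: "has_dim MM (2 * n)"
  by (rule is_basis_has_dim[OF refl basis_X card_idx])

end

lemma reduces_regular_vectors:
  assumes "reduces n D f" and n: "n > 0" and D: "0 \<notin> D" and \<sigma>: "\<sigma>\<^sup>2 = - 1"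
    and x: "\<And>r. r \<in> D \<Longrightarrow> x r = qclass (E_curve n (r\<^sup>2)) (f r)"
  shows "regular_vectors D (Vp_mod n \<sigma>) (idx n) (Vp_X n \<sigma>) x"
proof -
  obtain c where c: "\<And>i. regular_on D (c i)"
      "\<And>r. r \<in> D \<Longrightarrow> E_curve n (r\<^sup>2) dvd f r - (\<Sum>i\<in>idx n. lconst (c i r) * lX i)"
    using assms(1) unfolding reduces_def by blast
  obtain a :: "int \<Rightarrow> rfield" where a: "\<And>r i. r \<in> D \<Longrightarrow> regular1 r (a i)" "\<And>r i. r \<in> D \<Longrightarrow> value1 r (a i) = c i r"
    by (rule regular_on_values[of D c, OF c(1)]) (rule that)
  show ?thesis unfolding regular_vectors_def
  proof (intro exI[of _ a] ballI conjI)
    fix r assume rD: "r \<in> D"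
    then interpret curve n \<sigma> r using n D \<sigma> by unfold_locales auto
    show "regular1 r (a i)" for i using a rD by simp
    have "lincomb MM (idx n) (\<lambda>i. value1 r (a i)) (Vp_X n \<sigma> r)
        = qclass EE (\<Sum>i\<in>idx n. lconst (c i r) * lX i)"
      using a(2)[OF rD] by (subst pol_quot_lincomb[where f = lX])
        (auto simp: idx_def Vp_X_def ec_minus_n[OF \<sigma> r])
    also have "\<dots> = qclass EE (f r)"
      unfolding qclass_eq_iff using c(2)[OF rD] by (metis dvd_minus_iff minus_diff_eq)
    also have "\<dots> = x r" by (simp add: x[OF rD])
    finally show "x r = lincomb (Vp_mod n \<sigma> r) (idx n) (\<lambda>i. value1 r (a i)) (Vp_X n \<sigma> r)"
      by (simp add: Vp_mod_eq)
  qed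
qed

text \<open>Here the operator itself varies: the image of X^k acquires the factor h^k, which is
  regular away from r = 0.\<close>

lemma reduces_pi:
  assumes "n > 0" "0 \<notin> D" shows "reduces n D (\<lambda>r. pi_op (r\<^sup>2) f)"
proof (induction f rule: laurent_induct)
  case zero then show ?case by (simp add: reduces_0)
next
  case (monom c k)
  have "regular_on D (\<lambda>r. c * r\<^sup>2 powi k)"
    using assms(2) by (intro regular_on_mult regular_on_const regular_on_power_int regular_on_power
        regular_on_id) auto
  from reduces_scale[OF reduces_lX[OF assms, of "- k"] this] show ?case
    by (simp add: pi_op_lconst_mult lconst_mult mult.assoc)
next
  case (add f g) then show ?case by (simp add: pi_op_add reduces_add)
qed

text \<open>Structure constants are coefficients of reduced Laurent polynomials. T is split into
  scalars depending on r and the operators s and \<open>div_diff\<close>, which do not.\<close>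

lemma flat_family_Vp:
  assumes n: "n > 0" and \<sigma>: "\<sigma>\<^sup>2 = - 1"
  shows "flat_family (- {0}) (Vp_mod n \<sigma>) (idx n) (Vp_X n \<sigma>)"
proof -
  have curve: "curve n \<sigma> r" if "r \<in> - {0}" for r using that n \<sigma> by (simp add: curve_def)
  have D: "0 \<notin> - {0 :: complex}" by simp
  have X: "Vp_X n \<sigma> r j = qclass (E_curve n (r\<^sup>2)) (lX j)" if "r \<in> - {0}" for r j
    using that by (simp add: Vp_X_def ec_minus_n[OF \<sigma>])
  note rv = reduces_regular_vectors[OF _ n D \<sigma>]
  have reg: "regular_on (- {0}) (curve_v n \<sigma>)" "regular_on (- {0}) (\<lambda>r. curve_v n \<sigma> r - inverse (curve_v n \<sigma> r))"
    using curve_v_ne_0[OF _ \<sigma>] by (auto intro!: regular_on_curve regular_on_diff regular_on_inverse)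
  have "regular_vectors (- {0}) (Vp_mod n \<sigma>) (idx n) (Vp_X n \<sigma>) (\<lambda>r. opX (Vp_mod n \<sigma> r) (Vp_X n \<sigma> r j))" for j
  proof (rule rv[OF reduces_fixed[OF n D, of "X_pol (lX j)"]])
    fix r :: complex assume rD: "r \<in> - {0}"
    interpret curve n \<sigma> r by (rule curve[OF rD])
    show "opX (Vp_mod n \<sigma> r) (Vp_X n \<sigma> r j) = qclass EE (X_pol (lX j))"
      by (simp add: Vp_mod_eq X[OF rD])
  qed
  moreover have "regular_vectors (- {0}) (Vp_mod n \<sigma>) (idx n) (Vp_X n \<sigma>) (\<lambda>r. opT (Vp_mod n \<sigma> r) (Vp_X n \<sigma> r j))" for j
  proof (rule rv)
    show "reduces n (- {0}) (\<lambda>r. T_pol (curve_v n \<sigma> r) (lX j))"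
      unfolding T_pol_alt by (intro reduces_add reduces_scale reduces_fixed n D reg)
    fix r :: complex assume rD: "r \<in> - {0}"
    interpret curve n \<sigma> r by (rule curve[OF rD])
    show "opT (Vp_mod n \<sigma> r) (Vp_X n \<sigma> r j) = qclass EE (T_pol vv (lX j))"
      by (simp add: Vp_mod_eq X[OF rD])
  qed
  moreover have "regular_vectors (- {0}) (Vp_mod n \<sigma>) (idx n) (Vp_X n \<sigma>) (\<lambda>r. opY (Vp_mod n \<sigma> r) (Vp_X n \<sigma> r j))" for j
  proof (rule rv)
    show "reduces n (- {0}) (\<lambda>r. Y_pol (r\<^sup>2) (curve_v n \<sigma> r) (lX j))"
      unfolding Y_pol_def T_pol_alt pi_op_add pi_op_lconst_mult
      by (intro reduces_add reduces_scale reduces_pi n D reg)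
    fix r :: complex assume rD: "r \<in> - {0}"
    interpret curve n \<sigma> r by (rule curve[OF rD])
    show "opY (Vp_mod n \<sigma> r) (Vp_X n \<sigma> r j) = qclass EE (Y_pol hh vv (lX j))"
      by (simp add: Vp_mod_eq X[OF rD])
  qed
  moreover have "regular_vectors (- {0}) (Vp_mod n \<sigma>) (idx n) (Vp_X n \<sigma>)
      (\<lambda>r. Vp_X n \<sigma> r i \<otimes>\<^bsub>Vp_mod n \<sigma> r\<^esub> Vp_X n \<sigma> r j)" for i j
  proof (rule rv[OF reduces_fixed[OF n D, of "lX i * lX j"]])
    fix r :: complex assume rD: "r \<in> - {0}"
    interpret curve n \<sigma> r by (rule curve[OF rD])
    show "Vp_X n \<sigma> r i \<otimes>\<^bsub>Vp_mod n \<sigma> r\<^esub> Vp_X n \<sigma> r j = qclass EE (lX i * lX j)"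
      by (simp add: Vp_mod_eq X[OF rD] pol_quot_mult)
  qed
  moreover have "regular_vectors (- {0}) (Vp_mod n \<sigma>) (idx n) (Vp_X n \<sigma>) (\<lambda>r. \<one>\<^bsub>Vp_mod n \<sigma> r\<^esub>)"
  proof (rule rv[OF reduces_fixed[OF n D, of 1]])
    fix r :: complex assume rD: "r \<in> - {0}"
    interpret curve n \<sigma> r by (rule curve[OF rD])
    show "\<one>\<^bsub>Vp_mod n \<sigma> r\<^esub> = qclass EE 1" by (simp add: Vp_mod_eq pol_quot_one)
  qed
  moreover have "is_basis (Vp_mod n \<sigma> r) (idx n) (Vp_X n \<sigma> r)" if "r \<in> - {0}" for r
    using curve.basis_X[OF curve[OF that]] curve.Vp_mod_eq[OF curve[OF that]] by simp
  ultimately show ?thesis unfolding flat_family_def regular_ops_def by blast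
qed

section \<open>The basis of nonsymmetric polynomials\<close>

lemma power_eq_imp_diff_eq_1:
  fixes x :: "'a::field"
  assumes "x \<noteq> 0" "x ^ i = x ^ j" "i \<le> j"
  shows "x ^ (j - i) = 1"
  using assms by (simp add: power_diff)

text \<open>These conditions suffice for simple spectra of X and Y and for finite nonzero norms.
  They admit n = 1 with q = 1 and h = 1, which occurs on the arc.\<close>

locale good_curve = curve +
  assumes q_ne_1: "\<And>j. 0 < j \<Longrightarrow> j < n \<Longrightarrow> (hh\<^sup>2) ^ j \<noteq> 1" and hn: "hh ^ n \<noteq> - 1"
begin

abbreviation "qq \<equiv> hh\<^sup>2"
abbreviation "tt' \<equiv> vv\<^sup>2"

lemma qq_power: "qq ^ k = (hh ^ k)\<^sup>2"
  by (metis mult.commute power_mult)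

text \<open>Squaring gives q^i = q^n with 0 < |i - n| < n.\<close>

lemma hh_power_ne: "hh ^ i \<noteq> - (hh ^ n)" if "i \<noteq> n" "i < 2 * n" "0 < i" for i
proof
  assume "hh ^ i = - (hh ^ n)"
  then have *: "qq ^ i = qq ^ n" unfolding qq_power by (simp only: power2_minus)
  have q: "qq \<noteq> 0" using hh by simp
  show False
  proof (cases "i \<le> n")
    case True
    then show False using power_eq_imp_diff_eq_1[OF q *] q_ne_1[of "n - i"] that by auto
  next
    case False
    then have "0 < i - n" "i - n < n" using that by linarith+
    then show False using power_eq_imp_diff_eq_1[OF q *[symmetric]] q_ne_1[of "i - n"] False by auto
  qed
qed

text \<open>On the curve, t q^i = 1 means h^{2i} = -h^n. For i = n this gives h^n = -1, for 2i = n
  it gives h^n = -h^n, and all other i fall under \<open>hh_power_ne\<close>.\<close>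

lemma nondeg_n: "nondeg qq tt' n"
  unfolding nondeg_def
proof (intro ballI notI)
  fix i assume i: "i \<in> {1..n}" and "1 - tt' * qq ^ i = 0"
  then have "tt' * hh ^ n * qq ^ i = hh ^ n" by (simp add: algebra_simps)
  then have *: "- (qq ^ i) = hh ^ n" unfolding tt by simp
  have q2: "qq ^ i = hh ^ (2 * i)" by (rule power_mult[symmetric])
  consider "i = n" | "2 * i = n" | "i < n" "2 * i \<noteq> n" using i by fastforce
  then show False
  proof cases
    case 1
    have "hh ^ n * (hh ^ n + 1) = (hh ^ n)\<^sup>2 + hh ^ n" by (simp add: power2_eq_square algebra_simps)
    also have "\<dots> = 0" using * unfolding 1 qq_power by (metis add.right_inverse)
    finally have "hh ^ n + 1 = 0" using hh by simp
    then show False using hn eq_neg_iff_add_eq_0 by blast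
  next
    case 2
    then show False using * q2 hh by simp
  next
    case 3
    have "hh ^ (2 * i) = - (hh ^ n)" using * q2 by (metis add.inverse_inverse)
    then show False using hh_power_ne[of "2 * i"] 3 i by simp
  qed
qed

abbreviation "ep \<equiv> e_poly hh vv"
abbreviation "ev \<equiv> Y_eig hh vv"

lemma rk_idx: "m \<in> idx n \<Longrightarrow> rk m div 2 \<le> n - 1"
  by (simp add: below_idx[symmetric] below_def)

lemma nondeg_idx: "m \<in> idx n \<Longrightarrow> nondeg qq tt' (rk m div 2)"
  using nondeg_mono[OF nondeg_n] rk_idx[of m] by auto

lemma ec_idx: "m \<in> idx n \<Longrightarrow> ec_regular n \<sigma> r m" "m \<in> idx n \<Longrightarrow> ec_at n \<sigma> r m = ep m"
  using ec_nondeg[OF \<sigma> r nondeg_idx] by auto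

lemma triangular_ep: "triangular (2 * n) ep"
  by (rule triangular_e_poly) (use nondeg_mono[OF nondeg_n] in auto)

lemma Vp_e_eq: "m \<in> idx n \<Longrightarrow> Vp_e n \<sigma> r m = qclass EE (ep m)"
  by (simp add: Vp_e_def ec_idx ec_minus_n[OF \<sigma> r])

lemma basis_e: "is_basis MM (idx n) (Vp_e n \<sigma> r)"
  by (rule triangular_is_basis[OF n r triangular_ep Vp_e_eq])

section \<open>Coordinates in the basis of the e_m\<close>

lemma finite_idx: "finite (idx n)" by (simp add: idx_def)

lemma lincomb_e: "lincomb MM (idx n) c (Vp_e n \<sigma> r) = qclass EE (\<Sum>m\<in>idx n. lconst (c m) * ep m)"
  by (rule pol_quot_lincomb[OF finite_idx Vp_e_eq])

text \<open>Coordinates are attached to representatives, so that congruence modulo the ideal becomes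
  equality of functions.\<close>

definition cf :: "complex laurent \<Rightarrow> int \<Rightarrow> complex" where
  "cf f = coords MM (idx n) (Vp_e n \<sigma> r) (qclass EE f)"

lemma cf_eqI:
  assumes "\<And>m. m \<notin> idx n \<Longrightarrow> c m = 0" "qclass EE f = qclass EE (\<Sum>m\<in>idx n. lconst (c m) * ep m)"
  shows "cf f = c"
  unfolding cf_def by (rule coords_eqI[OF basis_e]) (use assms in \<open>auto simp: lincomb_e carrier_pol_quot\<close>)

lemma cf_expand: "qclass EE f = qclass EE (\<Sum>m\<in>idx n. lconst (cf f m) * ep m)"
  and cf_outside: "m \<notin> idx n \<Longrightarrow> cf f m = 0"
proof -
  have "qclass EE f \<in> carrier MM" by (simp add: carrier_pol_quot)
  then obtain c where c: "\<And>m. m \<notin> idx n \<Longrightarrow> c m = 0" "qclass EE f = lincomb MM (idx n) c (Vp_e n \<sigma> r)"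
    using basis_e unfolding is_basis_def by metis
  then have "cf f = c" by (intro cf_eqI) (auto simp: lincomb_e)
  then show "qclass EE f = qclass EE (\<Sum>m\<in>idx n. lconst (cf f m) * ep m)"
    "m \<notin> idx n \<Longrightarrow> cf f m = 0" using c by (auto simp: lincomb_e)
qed

lemma cf_cong: "qclass EE f = qclass EE g \<Longrightarrow> cf f = cf g"
  by (simp add: cf_def)

lemma qclass_cf: "qclass EE f = qclass EE g \<longleftrightarrow> cf f = cf g"
  by (metis cf_cong cf_expand)

lemma cf_lincomb: "cf (\<Sum>m\<in>idx n. lconst (c m) * ep m) = (\<lambda>m. if m \<in> idx n then c m else 0)"
  by (rule cf_eqI) (auto intro!: arg_cong[of _ _ "qclass EE"] sum.cong)

lemma cf_add: "cf (f + g) = (\<lambda>m. cf f m + cf g m)"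
proof (rule cf_eqI)
  have "qclass EE (f + g) = qclass EE f \<oplus>\<^bsub>MM\<^esub> qclass EE g" by (simp add: pol_quot_add)
  also have "\<dots> = qclass EE (\<Sum>m\<in>idx n. lconst (cf f m) * ep m) \<oplus>\<^bsub>MM\<^esub> qclass EE (\<Sum>m\<in>idx n. lconst (cf g m) * ep m)"
    by (simp flip: cf_expand)
  finally show "qclass EE (f + g) = qclass EE (\<Sum>m\<in>idx n. lconst (cf f m + cf g m) * ep m)"
    by (simp add: pol_quot_add lconst_add distrib_right sum.distrib)
qed (simp add: cf_outside)

lemma cf_scale: "cf (lconst c * f) = (\<lambda>m. c * cf f m)"
proof (rule cf_eqI)
  have "qclass EE (lconst c * f) = c \<odot>\<^bsub>MM\<^esub> qclass EE f" by (simp add: pol_quot_smult)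
  also have "\<dots> = c \<odot>\<^bsub>MM\<^esub> qclass EE (\<Sum>m\<in>idx n. lconst (cf f m) * ep m)"
    by (simp flip: cf_expand)
  finally show "qclass EE (lconst c * f) = qclass EE (\<Sum>m\<in>idx n. lconst (c * cf f m) * ep m)"
    by (simp add: pol_quot_smult lconst_mult sum_distrib_left mult.assoc)
qed (simp add: cf_outside)

lemma cf_ep: "l \<in> idx n \<Longrightarrow> cf (ep l) = (\<lambda>m. if m = l then 1 else 0)"
proof (rule cf_eqI)
  assume l: "l \<in> idx n"
  have "(\<Sum>m\<in>idx n. lconst (if m = l then 1 else 0) * ep m) = (\<Sum>m\<in>idx n. if m = l then ep l else 0)"
    by (rule sum.cong) auto
  then show "qclass EE (ep l) = qclass EE (\<Sum>m\<in>idx n. lconst (if m = l then 1 else 0) * ep m)"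
    using l finite_idx by simp
qed auto

lemma cf_0: "cf 0 = (\<lambda>_. 0)"
  using cf_scale[of 0 0] by simp

lemma cf_sum: "cf (sum g S) = (\<lambda>m. \<Sum>i\<in>S. cf (g i) m)"
  by (induction S rule: infinite_finite_induct) (auto simp: cf_add cf_0)

lemma cf_descends:
  assumes "descends EE F"
  shows "cf (F f) = (\<lambda>l. \<Sum>m\<in>idx n. cf f m * cf (F (ep m)) l)"
proof -
  have "cf (F f) = cf (F (\<Sum>m\<in>idx n. lconst (cf f m) * ep m))"
    by (rule cf_cong, rule descends_cong[OF assms], rule cf_expand)
  then show ?thesis by (simp add: descends_sum[OF assms] cf_sum cf_scale)
qed

lemma cf_diff: "cf (f - g) = (\<lambda>m. cf f m - cf g m)"
  using cf_add[of "f - g" g] by (auto simp: fun_eq_iff algebra_simps)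

lemma Y_ep: "m \<in> idx n \<Longrightarrow> Y_pol hh vv (ep m) = lconst (ev m) * ep m"
  by (rule Y_pol_e_poly[OF hh vv nondeg_idx])

lemma cf_Y: "cf (Y_pol hh vv f) = (\<lambda>m. ev m * cf f m)"
proof
  fix l
  have "cf (Y_pol hh vv f) l = (\<Sum>m\<in>idx n. cf f m * cf (Y_pol hh vv (ep m)) l)"
    by (rule fun_cong[OF cf_descends[OF descends_Y]])
  also have "\<dots> = (\<Sum>m\<in>idx n. if m = l then cf f l * ev l else 0)"
    by (rule sum.cong) (auto simp: Y_ep cf_scale cf_ep)
  finally show "cf (Y_pol hh vv f) l = ev l * cf f l"
    using finite_idx cf_outside[of l f] by (simp add: mult.commute)
qed

text \<open>If both indices are \<le> 0, or both are positive, equal eigenvalues of distinct indices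
  give h^d = 1 with 0 < d < n, hence q^d = 1. In the mixed case t h^{i+j} = 1, that is h^{i+j} =
  -h^n with 0 < i + j < 2n.\<close>

lemma ev_distinct:
  assumes "m \<in> idx n" "l \<in> idx n" "ev m = ev l" shows "m = l"
proof -
  have h1: "i = j" if "hh ^ i = hh ^ j" "i \<le> j" "j - i < n" for i j
  proof (rule ccontr)
    assume "i \<noteq> j"
    then have "qq ^ (j - i) \<noteq> 1" using that by (intro q_ne_1) auto
    moreover have "hh ^ (j - i) = 1" by (rule power_eq_imp_diff_eq_1[OF hh that(1,2)])
    ultimately show False unfolding qq_power by simp
  qed
  have h1': "i = j" if "hh ^ i = hh ^ j" "i < j + n" "j < i + n" for i j
  proof (cases "i \<le> j")
    case True
    have "j - i < n" using that(3) True by linarith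
    then show ?thesis by (rule h1[OF that(1) True])
  next
    case False
    then have "j \<le> i" "i - j < n" using that(2) by linarith+
    then show ?thesis using h1[OF that(1)[symmetric]] by metis
  qed
  have h2: "vv * hh ^ i \<noteq> inverse (vv * hh ^ j)" if "i < n" "1 \<le> j" "j \<le> n" for i j
  proof
    assume "vv * hh ^ i = inverse (vv * hh ^ j)"
    moreover have "vv * hh ^ j \<noteq> 0" using vv hh by simp
    ultimately have "vv * hh ^ i * (vv * hh ^ j) = 1" by (simp only: left_inverse not_False_eq_True)
    then have "tt' * hh ^ (i + j) = 1" by (simp add: power2_eq_square power_add mult_ac)
    then have "hh ^ n * (tt' * hh ^ (i + j)) = hh ^ n" by (simp only: mult_1_right)
    then have "tt' * hh ^ n * hh ^ (i + j) = hh ^ n" by (simp only: mult_ac)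
    then have "- (hh ^ (i + j)) = hh ^ n" unfolding tt by (simp only: mult_minus_left mult_1_left)
    then have *: "hh ^ (i + j) = - (hh ^ n)" by (metis add.inverse_inverse)
    show False
    proof (cases "i + j = n")
      case True then show False using * hh by simp
    next
      case False then show False using hh_power_ne[of "i + j"] * that by auto
    qed
  qed
  have I: "m \<le> n" "1 - int n \<le> m" "l \<le> n" "1 - int n \<le> l" using assms(1,2) by (auto simp: idx_def)
  show ?thesis
  proof (cases "m \<le> 0"; cases "l \<le> 0")
    assume "m \<le> 0" "l \<le> 0"
    then have "hh ^ nat (- m) = hh ^ nat (- l)" using assms(3) vv by (simp only: Y_eig_def if_True mult_cancel_left) simp
    then have "nat (- m) = nat (- l)" by (rule h1') (use I in linarith)+
    then show ?thesis using \<open>m \<le> 0\<close> \<open>l \<le> 0\<close> by linarith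
  next
    assume "\<not> m \<le> 0" "\<not> l \<le> 0"
    then have "hh ^ nat m = hh ^ nat l"
      using assms(3) vv by (simp only: Y_eig_def if_False inverse_eq_iff_eq mult_cancel_left) simp
    then have "nat m = nat l" by (rule h1') (use I \<open>\<not> m \<le> 0\<close> \<open>\<not> l \<le> 0\<close> in linarith)+
    then show ?thesis using \<open>\<not> m \<le> 0\<close> \<open>\<not> l \<le> 0\<close> by linarith
  next
    assume "m \<le> 0" "\<not> l \<le> 0"
    then have "nat (- m) < n" "1 \<le> nat l" "nat l \<le> n" using I by linarith+
    from h2[OF this] show ?thesis
      using assms(3) \<open>m \<le> 0\<close> \<open>\<not> l \<le> 0\<close> by (simp only: Y_eig_def if_True if_False)
  next
    assume "\<not> m \<le> 0" "l \<le> 0"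
    then have "nat (- l) < n" "1 \<le> nat m" "nat m \<le> n" using I by linarith+
    from h2[OF this] show ?thesis
      using assms(3)[symmetric] \<open>l \<le> 0\<close> \<open>\<not> m \<le> 0\<close> by (simp only: Y_eig_def if_True if_False)
  qed
qed

lemma Y_semisimple: "semisimple_op MM (opY MM)"
  by (rule is_basis_semisimple[OF refl basis_e])
    (auto simp: Vp_e_eq Y_ep pol_quot_smult)

lemma ep_0: "ep 0 = 1"
  by (simp add: e_poly_def)

lemma idx_0: "0 \<in> idx n" using n by (simp add: idx_def)

text \<open>The eigenvalue t^{1/2} of Y is simple and belongs to e_0 = 1. This is how the Y-spectrum
  enters Schur's lemma.\<close>

lemma scalar_of_Y:
  assumes "qclass EE (Y_pol hh vv u) = qclass EE (lconst vv * u)"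
  shows "qclass EE u = qclass EE (lconst (cf u 0))"
proof -
  have "ev m * cf u m = vv * cf u m" for m
    using assms unfolding qclass_cf cf_Y cf_scale by metis
  moreover have "ev 0 = vv" by (simp add: Y_eig_def)
  ultimately have "cf u m = 0" if "m \<noteq> 0" for m
    using ev_distinct[of m 0] that idx_0 cf_outside[of m u] by (cases "m \<in> idx n") auto
  then have "cf u = cf (lconst (cf u 0) * ep 0)"
    unfolding cf_scale cf_ep[OF idx_0] by auto
  then show ?thesis unfolding qclass_cf by (simp add: ep_0)
qed

section \<open>The matrix of T, the operator X \<pi>, and the norms\<close>

abbreviation "dd \<equiv> vv - inverse vv"
abbreviation "aa \<equiv> \<lambda>k. T_diag hh vv k"
abbreviation "rho \<equiv> \<lambda>k. aa k * (dd - aa k) + 1"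

lemma ep_pos: "ep (int (Suc k)) = e_pos qq tt' k"
  by (simp add: e_poly_def)

lemma ep_neg: "ep (- int k) = e_neg qq tt' k"
  by (simp add: e_poly_def)

lemma EE_eq: "EE = e_neg qq tt' n"
  using e_neg_curve[OF hh tt nondeg_n] by simp

lemma T_ep_0: "T_pol vv (ep 0) = lconst vv * ep 0"
  by (simp add: ep_0 T_pol_1 vv)

lemma T_ep_pos: "k < n \<Longrightarrow> T_pol vv (ep (int (Suc k)))
    = lconst (inverse vv) * ep (- int (Suc k)) + lconst (aa (Suc k)) * ep (int (Suc k))"
  unfolding ep_pos ep_neg by (rule T_pol_e_pos[OF hh vv]) (rule nondeg_mono[OF nondeg_n], simp)

lemma T_ep_neg: "Suc k < n \<Longrightarrow> T_pol vv (ep (- int (Suc k)))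
    = lconst (dd - aa (Suc k)) * ep (- int (Suc k)) + lconst (vv * rho (Suc k)) * ep (int (Suc k))"
  unfolding ep_pos ep_neg by (rule T_pol_e_neg[OF hh vv]) (rule nondeg_mono[OF nondeg_n], simp)

text \<open>X \<pi> exchanges the lines of e_m and e_{1-m}. Since X = (X \<pi>) Y T^{-1}, statements
  about X follow from those for one operator that permutes the lines, one that is diagonal, and one
  with blocks of size at most two.\<close>

definition XP :: "complex laurent \<Rightarrow> complex laurent" where
  "XP f = lX 1 * pi_op hh f"

lemma XP_XP: "XP (XP f) = lconst hh * f"
  using hh by (simp add: XP_def pi_op_lX_mult mult.left_commute[of "lX _"] mult.assoc[symmetric])

lemma XP_lconst: "XP (lconst c * f) = lconst c * XP f"
  by (simp add: XP_def pi_op_lconst_mult mult.left_commute)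

lemma XP_ep_neg: "XP (ep (- int k)) = lconst (inverse (hh ^ k)) * ep (int (Suc k))"
  unfolding ep_pos ep_neg e_pos_eq_pi[OF hh] XP_def
  using hh by (simp add: mult.assoc[symmetric] lconst_mult[symmetric])

lemma XP_ep_pos: "XP (ep (int (Suc k))) = lconst (hh ^ Suc k) * ep (- int k)"
proof -
  have "ep (int (Suc k)) = lconst (hh ^ k) * XP (ep (- int k))"
    unfolding ep_pos ep_neg e_pos_eq_pi[OF hh] XP_def ..
  then show ?thesis by (simp add: XP_lconst XP_XP lconst_mult mult_ac)
qed

lemma descends_XP: "descends EE XP"
  using descends_comp[OF descends_X descends_pi] by (simp add: comp_def XP_def[abs_def] X_pol_def[abs_def])

definition wt :: "int \<Rightarrow> complex" where
  "wt = e_norm qq tt'"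

lemma wt_reflect: "wt (1 - m) = wt m"
proof -
  have "(if 1 - m \<le> 0 then nat \<bar>1 - m\<bar> + 1 else nat \<bar>1 - m\<bar>) = (if m \<le> 0 then nat \<bar>m\<bar> + 1 else nat \<bar>m\<bar>)"
    by auto
  then show ?thesis unfolding wt_def e_norm_def by simp
qed

text \<open>The product of the off-diagonal entries of T in the plane of e_k and e_{-k} is the k-th
  factor of the norm formula, that is the norm of e_{-k} divided by that of e_k. This match is what
  makes T unitary.\<close>

lemma rho_eq:
  assumes "0 < k" "k \<le> n"
  shows "rho k = ((1 - qq ^ k) * (1 - qq ^ k * tt'\<^sup>2)) / ((1 - qq ^ k * tt') * (1 - qq ^ k * tt'))"
proof -
  define Q where "Q = qq ^ k"
  have nz: "1 - Q * tt' \<noteq> 0"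
    using nondeg_n assms by (auto simp: nondeg_def Q_def mult.commute)
  have "aa k = dd / (1 - Q * tt')" by (simp add: T_diag_def Q_def mult.commute)
  moreover have "D / w * (D - D / w) + 1 = (D\<^sup>2 * (w - 1) + w\<^sup>2) / w\<^sup>2" if "w \<noteq> 0" for D w :: complex
    using that by (simp add: field_simps power2_eq_square)
  ultimately have "rho k = (dd\<^sup>2 * ((1 - Q * tt') - 1) + (1 - Q * tt')\<^sup>2) / (1 - Q * tt')\<^sup>2"
    using nz by (simp only: not_False_eq_True)
  also have "(1 - Q * tt') - 1 = - (Q * tt')" by simp
  also have "dd\<^sup>2 * (- (Q * tt')) = - Q * (tt' - 1)\<^sup>2"
  proof -
    have "vv * dd = tt' - 1" using vv by (simp add: algebra_simps power2_eq_square)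
    then have "dd\<^sup>2 * tt' = (tt' - 1)\<^sup>2" by (metis power_mult_distrib mult.commute)
    then show ?thesis by (simp add: mult_ac)
  qed
  also have "- Q * (tt' - 1)\<^sup>2 + (1 - Q * tt')\<^sup>2 = (1 - Q) * (1 - Q * tt'\<^sup>2)"
    by (simp add: power2_eq_square algebra_simps)
  finally show ?thesis by (simp add: Q_def power2_eq_square)
qed

lemma wt_neg: "0 < k \<Longrightarrow> k \<le> n \<Longrightarrow> wt (- int k) = rho k * wt (int k)"
proof -
  assume k: "0 < k" "k \<le> n"
  then have "{0<..<k + 1} = insert k {0<..<k}" by auto
  then show ?thesis using k unfolding rho_eq[OF k] wt_def e_norm_def by simp
qed

lemma tt'_sq: "tt'\<^sup>2 * qq ^ n = 1"
proof -
  have "(tt' * hh ^ n)\<^sup>2 = 1" unfolding tt by simp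
  then show ?thesis by (simp add: power_mult_distrib power_mult[symmetric] mult.commute)
qed

text \<open>On the curve t^2 = q^{-n}, so the numerator is (1 - q^k)(1 - q^{k-n}). It vanishes at k
  = n, in accordance with e_{-n} being zero in the quotient.\<close>

lemma rho_ne_0:
  assumes "0 < k" "k < n" shows "rho k \<noteq> 0"
proof -
  have "1 - qq ^ k \<noteq> 0" using q_ne_1[OF assms] by simp
  moreover have "1 - qq ^ k * tt'\<^sup>2 \<noteq> 0"
  proof
    assume "1 - qq ^ k * tt'\<^sup>2 = 0"
    then have "qq ^ k * tt'\<^sup>2 * qq ^ n = 1 * qq ^ n" by (simp only: right_minus_eq)
    then have "qq ^ k = qq ^ n" by (simp only: mult.assoc tt'_sq mult_1_left mult_1_right)
    then have "qq ^ (n - k) = 1" using power_eq_imp_diff_eq_1[of qq k n] assms hh by simp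
    then show False using q_ne_1[of "n - k"] assms by simp
  qed
  moreover have "1 - qq ^ k * tt' \<noteq> 0"
    using nondeg_n assms by (auto simp: nondeg_def mult.commute)
  ultimately show ?thesis using assms by (subst rho_eq) auto
qed

section \<open>Irreducibility\<close>

text \<open>As the Y-spectrum is simple, a nonzero submodule contains some e_m. From there X \<pi>
  and T lead down to e_0 = 1, which generates everything under powers of X.\<close>

lemma irreducible: "irreducible_hmod MM"
  unfolding irreducible_hmod_def
proof (intro conjI allI impI)
  have "cf 1 0 = 1" using cf_ep[OF idx_0] by (simp add: ep_0)
  then have "qclass EE 1 \<noteq> qclass EE 0" unfolding qclass_cf by (auto simp: cf_0)
  then show "carrier MM \<noteq> {\<zero>\<^bsub>MM\<^esub>}" by (auto simp: carrier_pol_quot pol_quot_zero)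
next
  fix W assume W: "submodule W CC MM \<and> (\<forall>F\<in>{opX MM, opY MM, opT MM}. F ` W \<subseteq> W \<and> inv_op MM F ` W \<subseteq> W)"
  then interpret W: submodule W CC MM by blast
  define U where "U = {f. qclass EE f \<in> W}"
  have ops: "F x \<in> W \<and> inv_op MM F x \<in> W" if "F \<in> {opX MM, opY MM, opT MM}" "x \<in> W" for F x
    using W that by blast
  have cong: "g \<in> U" if "f \<in> U" "qclass EE f = qclass EE g" for f g using that by (simp add: U_def)
  have U_add: "f + g \<in> U" if "f \<in> U" "g \<in> U" for f g
    using W.m_closed[of "qclass EE f" "qclass EE g"] that by (simp add: U_def pol_quot_add)
  have U_scale: "lconst c * f \<in> U" if "f \<in> U" for f c
    using W.smult_closed[of c "qclass EE f"] that by (simp add: U_def pol_quot_smult)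
  have U_diff: "f - g \<in> U" if "f \<in> U" "g \<in> U" for f g
    using U_add[OF that(1) U_scale[OF that(2), of "- 1"]] by (simp add: lconst_uminus)
  have U_X: "X_pol f \<in> U" and U_Xi: "X_inv f \<in> U" and U_Y: "Y_pol hh vv f \<in> U"
    and U_T: "T_pol vv f \<in> U" and U_Ti: "T_inv vv f \<in> U" if "f \<in> U" for f
    using ops[of "opX MM" "qclass EE f"] ops[of "opY MM" "qclass EE f"] ops[of "opT MM" "qclass EE f"] that
    by (simp_all add: U_def)
  have U_XP: "XP f \<in> U" if "f \<in> U" for f
    using U_X[OF U_Y[OF U_Ti[OF that]]] vv by (simp add: XP_def X_pol_def Y_pol_def)
  show "W = {\<zero>\<^bsub>MM\<^esub>} \<or> W = carrier MM"
  proof (cases "\<exists>f\<in>U. cf f \<noteq> (\<lambda>_. 0)")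
    case False
    have "x = \<zero>\<^bsub>MM\<^esub>" if "x \<in> W" for x
    proof -
      obtain f where f: "x = qclass EE f" using \<open>x \<in> W\<close> W.subset by (auto simp: carrier_pol_quot)
      then have "cf f = cf 0" using False that by (auto simp: U_def cf_0)
      then show ?thesis by (simp add: f pol_quot_zero qclass_cf)
    qed
    moreover have "\<zero>\<^bsub>MM\<^esub> \<in> W" using W.one_closed by simp
    ultimately show ?thesis by blast
  next
    case True
    define supp where "supp f = {m \<in> idx n. cf f m \<noteq> 0}" for f
    \<comment> \<open>An element with the fewest nonzero coordinates. Were there two of them,
      applying Y minus one of the two eigenvalues would kill one coordinate and keep the
      other.\<close>
    obtain f where f: "f \<in> U" "cf f \<noteq> (\<lambda>_. 0)"
      and min: "\<And>g. g \<in> U \<Longrightarrow> cf g \<noteq> (\<lambda>_. 0) \<Longrightarrow> card (supp f) \<le> card (supp g)"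
      using ex_has_least_nat[of "\<lambda>f. f \<in> U \<and> cf f \<noteq> (\<lambda>_. 0)" _ "\<lambda>f. card (supp f)"] True by blast
    obtain m where m: "cf f m \<noteq> 0" using f by auto
    then have m_idx: "m \<in> idx n" using cf_outside by blast
    have only: "cf f l = 0" if "l \<noteq> m" for l
    proof (rule ccontr)
      assume l: "cf f l \<noteq> 0"
      then have l_idx: "l \<in> idx n" using cf_outside by blast
      define g where "g = Y_pol hh vv f - lconst (ev m) * f"
      have g: "cf g k = (ev k - ev m) * cf f k" for k
        by (simp add: g_def cf_diff cf_Y cf_scale left_diff_distrib)
      have "cf g l \<noteq> 0" using g l ev_distinct[OF l_idx m_idx] that by auto
      moreover have "g \<in> U" unfolding g_def by (intro U_diff U_Y U_scale f)
      ultimately have "card (supp f) \<le> card (supp g)" using min by metis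
      moreover have "supp g \<subset> supp f"
        using m m_idx by (auto simp: supp_def g)
      then have "card (supp g) < card (supp f)"
        by (intro psubset_card_mono) (auto simp: supp_def finite_idx)
      ultimately show False by simp
    qed
    have "ep m \<in> U"
    proof (rule cong)
      show "lconst (inverse (cf f m)) * f \<in> U" by (intro U_scale f)
      have "cf (lconst (inverse (cf f m)) * f) = cf (ep m)"
        unfolding cf_scale cf_ep[OF m_idx] using m only by auto
      then show "qclass EE (lconst (inverse (cf f m)) * f) = qclass EE (ep m)" by (simp add: qclass_cf)
    qed
    have cancel: "f \<in> U" if "lconst c * f \<in> U" "c \<noteq> 0" for c f
      using U_scale[OF that(1), of "inverse c"] that(2)
      by (simp add: mult.assoc[symmetric] lconst_mult[symmetric])
    \<comment> \<open>Descent along the ranks: X \<pi> leads from e_{k+1} to e_{-k}, and T leads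
      from e_{-k-1} to e_{k+1}, since its off-diagonal entry there is nonzero for k + 1 < n.\<close>
    have down: "ep 0 \<in> U" if "m \<in> idx n" "ep m \<in> U" for m
      using that
    proof (induction "rk m" arbitrary: m rule: less_induct)
      case less
      consider "m = 0" | k where "m = int (Suc k)" | k where "m = - int (Suc k)"
        by (metis int_cases2 neg_equal_0_iff_equal of_nat_0 nat.exhaust)
      then show ?case
      proof cases
        case (2 k)
        have "lconst (hh ^ Suc k) * ep (- int k) \<in> U"
          using U_XP[OF less.prems(2)] unfolding 2 XP_ep_pos .
        then have "ep (- int k) \<in> U" by (rule cancel) (use hh in simp)
        then show ?thesis
          by (rule less.hyps[rotated 2]) (use less.prems in \<open>auto simp: 2 rk_def idx_def\<close>)
      next
        case (3 k)
        have k: "Suc k < n" using less.prems by (simp add: 3 idx_def)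
        have "T_pol vv (ep m) - lconst (dd - aa (Suc k)) * ep m = lconst (vv * rho (Suc k)) * ep (int (Suc k))"
          unfolding 3 T_ep_neg[OF k] by simp
        moreover have "T_pol vv (ep m) - lconst (dd - aa (Suc k)) * ep m \<in> U"
          by (intro U_diff U_T U_scale less.prems)
        ultimately have "ep (int (Suc k)) \<in> U"
          using cancel[of "vv * rho (Suc k)" "ep (int (Suc k))"] vv rho_ne_0[of "Suc k"] k by simp
        then show ?thesis
          by (rule less.hyps[rotated 2]) (use k in \<open>auto simp: 3 rk_def idx_def\<close>)
      qed (use less in simp)
    qed
    have one: "1 \<in> U" using down[OF m_idx \<open>ep m \<in> U\<close>] by (simp add: ep_0)
    have "lX (int i) \<in> U" for i
    proof (induction i)
      case (Suc i) then show ?case using U_X[of "lX (int i)"] by (simp add: X_pol_def lX_add)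
    qed (use one in simp)
    moreover have "lX (- int i) \<in> U" for i
    proof (induction i)
      case (Suc i)
      have "lX (- int (Suc i)) = X_inv (lX (- int i) :: complex laurent)"
        by (simp add: X_inv_def lX_add[symmetric])
      then show ?case using U_Xi[OF Suc] by simp
    qed (use one in simp)
    ultimately have lX: "lX k \<in> U" for k by (cases k rule: int_cases2) auto
    have "g \<in> U" for g
      by (induction g rule: laurent_induct) (use one U_scale[OF one, of 0] in \<open>auto intro: U_add U_scale lX\<close>)
    then have "carrier MM \<subseteq> W" by (auto simp: U_def carrier_pol_quot)
    then show ?thesis using W.subset by auto
  qed
qed

end

section \<open>The Hermitian form\<close>

context good_curve
begin

definition frm :: "complex laurent \<Rightarrow> complex laurent \<Rightarrow> complex" where
  "frm f g = (\<Sum>m\<in>idx n. cf f m * cnj (cf g m) * wt m)"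

lemma Vp_form_eq: "Vp_form n \<sigma> r (qclass EE f) (qclass EE g) = frm f g"
  by (simp add: Vp_form_def orth_form_def frm_def cf_def wt_def Vp_mod_eq)

lemma frm_cong: "cf f = cf f' \<Longrightarrow> cf g = cf g' \<Longrightarrow> frm f g = frm f' g'"
  by (simp add: frm_def)

lemma frm_scale: "frm (lconst a * f) (lconst b * g) = a * cnj b * frm f g"
  unfolding frm_def cf_scale sum_distrib_left by (rule sum.cong) (simp_all add: mult_ac)

lemma frm_lincomb_left: "frm (\<Sum>i\<in>S. lconst (c i) * x i) g = (\<Sum>i\<in>S. c i * frm (x i) g)"
  unfolding frm_def cf_sum cf_scale sum_distrib_right sum_distrib_left
  by (subst sum.swap) (simp add: mult_ac)

lemma frm_lincomb_right: "frm f (\<Sum>i\<in>S. lconst (c i) * x i) = (\<Sum>i\<in>S. cnj (c i) * frm f (x i))"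
  unfolding frm_def cf_sum cf_scale cnj_sum sum_distrib_right sum_distrib_left
  by (subst sum.swap) (simp add: mult_ac)

lemma frm_descends:
  assumes "descends EE F" "descends EE G"
  shows "frm (F f) (G g)
    = (\<Sum>m\<in>idx n. \<Sum>l\<in>idx n. cf f m * cnj (cf g l) * frm (F (ep m)) (G (ep l)))"
proof -
  have "cf (F f) = cf (\<Sum>m\<in>idx n. lconst (cf f m) * F (ep m))"
    unfolding descends_sum[OF assms(1), symmetric]
    by (rule cf_cong, rule descends_cong[OF assms(1)], rule cf_expand)
  moreover have "cf (G g) = cf (\<Sum>m\<in>idx n. lconst (cf g m) * G (ep m))"
    unfolding descends_sum[OF assms(2), symmetric]
    by (rule cf_cong, rule descends_cong[OF assms(2)], rule cf_expand)
  ultimately have "frm (F f) (G g)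
    = frm (\<Sum>m\<in>idx n. lconst (cf f m) * F (ep m)) (\<Sum>m\<in>idx n. lconst (cf g m) * G (ep m))"
    by (rule frm_cong)
  then show ?thesis
    unfolding frm_lincomb_left unfolding frm_lincomb_right by (simp add: sum_distrib_left mult.assoc)
qed

text \<open>By sesquilinearity it is enough to compare values on the e_m.\<close>

lemma frm_descends_eqI:
  assumes "descends EE F" "descends EE G" "descends EE F'" "descends EE G'"
    "\<And>m l. m \<in> idx n \<Longrightarrow> l \<in> idx n \<Longrightarrow> frm (F (ep m)) (G (ep l)) = frm (F' (ep m)) (G' (ep l))"
  shows "frm (F f) (G g) = frm (F' f) (G' g)"
proof -
  have "frm (F f) (G g)
    = (\<Sum>m\<in>idx n. \<Sum>l\<in>idx n. cf f m * cnj (cf g l) * frm (F (ep m)) (G (ep l)))"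
    by (rule frm_descends[OF assms(1,2)])
  also have "\<dots> = (\<Sum>m\<in>idx n. \<Sum>l\<in>idx n. cf f m * cnj (cf g l) * frm (F' (ep m)) (G' (ep l)))"
    by (intro sum.cong refl arg_cong2[where f = "(*)"] assms(5))
  also have "\<dots> = frm (F' f) (G' g)"
    by (rule frm_descends[OF assms(3,4), symmetric])
  finally show ?thesis .
qed

lemma frm_ep_right: "l \<in> idx n \<Longrightarrow> frm f (ep l) = cf f l * wt l"
proof -
  assume l: "l \<in> idx n"
  have "frm f (ep l) = (\<Sum>m\<in>idx n. if m = l then cf f l * wt l else 0)"
    unfolding frm_def cf_ep[OF l] by (rule sum.cong) auto
  then show ?thesis using l finite_idx by simp
qed

lemma frm_ep_left: "l \<in> idx n \<Longrightarrow> frm (ep l) f = cnj (cf f l) * wt l"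
proof -
  assume l: "l \<in> idx n"
  have "frm (ep l) f = (\<Sum>m\<in>idx n. if m = l then cnj (cf f l) * wt l else 0)"
    unfolding frm_def cf_ep[OF l] by (rule sum.cong) auto
  then show ?thesis using l finite_idx by simp
qed

lemma cf_EE: "cf EE = (\<lambda>_. 0)"
proof -
  have "qclass EE EE = qclass EE 0" by (simp add: qclass_eq_iff)
  then show ?thesis by (simp add: qclass_cf cf_0)
qed

lemma cf_T_0: "cf (T_pol vv (ep 0)) l = (if l = 0 then vv else 0)"
  by (simp add: T_ep_0 cf_scale cf_ep[OF idx_0])

text \<open>At the edge k + 1 = n the vector e_{-n} is \<open>EE\<close> itself, hence zero in the
  quotient. The formula persists because -n is not an index.\<close>

lemma cf_T_pos:
  assumes "k < n" "l \<in> idx n"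
  shows "cf (T_pol vv (ep (int (Suc k)))) l
    = (if l = - int (Suc k) then inverse vv else if l = int (Suc k) then aa (Suc k) else 0)"
proof -
  have k: "int (Suc k) \<in> idx n" using assms by (simp add: idx_def)
  have "cf (ep (- int (Suc k))) l = (if l = - int (Suc k) then 1 else 0)"
  proof (cases "Suc k = n")
    case True
    then have "ep (- int (Suc k)) = EE" by (simp only: ep_neg EE_eq)
    then show ?thesis using True assms(2) by (simp add: cf_EE idx_def)
  next
    case False
    then have "- int (Suc k) \<in> idx n" using assms by (simp add: idx_def)
    then show ?thesis by (simp add: cf_ep)
  qed
  then show ?thesis
    unfolding T_ep_pos[OF assms(1)] cf_add cf_scale cf_ep[OF k] by auto
qed

lemma cf_T_neg:
  assumes "Suc k < n"
  shows "cf (T_pol vv (ep (- int (Suc k)))) l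
    = (if l = - int (Suc k) then dd - aa (Suc k) else if l = int (Suc k) then vv * rho (Suc k) else 0)"
proof -
  have k: "int (Suc k) \<in> idx n" "- int (Suc k) \<in> idx n" using assms by (auto simp: idx_def)
  show ?thesis
    unfolding T_ep_neg[OF assms(1)] cf_add cf_scale cf_ep[OF k(1)] cf_ep[OF k(2)] by auto
qed

lemma XP_ep: "m \<in> idx n \<Longrightarrow> \<exists>k. XP (ep m) = lconst (hh powi k) * ep (1 - m)"
proof (cases "m \<le> 0")
  case True
  then obtain k where "m = - int k" by (metis nonpos_int_cases)
  then show ?thesis using XP_ep_neg[of k] by (intro exI[of _ "- int k"]) (simp add: power_int_minus)
next
  case False
  then obtain k where k: "m = int (Suc k)" by (metis not_le pos_int_cases Suc_pred)
  have "hh powi (int (Suc k)) = hh ^ Suc k" by (rule power_int_of_nat)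
  moreover have "1 - m = - int k" by (simp add: k)
  ultimately show ?thesis using XP_ep_pos[of k] by (intro exI[of _ "int (Suc k)"]) (simp only: k)
qed

end

lemma cnj_eq_inverse: "cmod z = 1 \<Longrightarrow> cnj z = inverse z"
  by (metis complex_norm_square inverse_unique of_real_1 power_one)

lemma cmod_curve_v: "\<sigma>\<^sup>2 = - 1 \<Longrightarrow> cmod r = 1 \<Longrightarrow> cmod (curve_v n \<sigma> r) = 1"
proof -
  assume "\<sigma>\<^sup>2 = - 1" and r: "cmod r = 1"
  then have "(cmod \<sigma>)\<^sup>2 = 1" by (metis norm_minus_cancel norm_one norm_power)
  then have "cmod \<sigma> = 1" by (simp add: power2_eq_1_iff) (metis norm_ge_zero not_one_le_zero neg_0_le_iff_le)
  then show ?thesis using r by (simp add: curve_v_def norm_mult norm_power_int)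
qed

locale unit_curve = good_curve +
  assumes unit: "cmod r = 1"
begin

lemma cnj_hh: "cnj hh = inverse hh"
  by (rule cnj_eq_inverse) (simp add: norm_power unit)

lemma cnj_vv: "cnj vv = inverse vv"
  by (rule cnj_eq_inverse) (simp add: cmod_curve_v \<sigma> unit)

text \<open>Conjugation inverts Q and t. By 1 - 1/z = -(1 - z)/z each factor changes by a monomial,
  and the monomials cancel because Q times Q t^2 is (Q t)^2.\<close>

lemma cnj_factor:
  fixes Q t :: complex
  assumes "cnj Q = inverse Q" "cnj t = inverse t" "Q \<noteq> 0" "t \<noteq> 0"
  shows "cnj (((1 - Q) * (1 - Q * t\<^sup>2)) / ((1 - Q * t) * (1 - Q * t)))
    = ((1 - Q) * (1 - Q * t\<^sup>2)) / ((1 - Q * t) * (1 - Q * t))"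
proof -
  have 1: "1 - inverse Q = - (1 - Q) / Q" using assms(3) by (simp add: field_simps)
  have 2: "1 - inverse Q * (inverse t)\<^sup>2 = - (1 - Q * t\<^sup>2) / (Q * t\<^sup>2)"
    using assms(3,4) by (simp add: field_simps)
  have 3: "1 - inverse Q * inverse t = - (1 - Q * t) / (Q * t)"
    using assms(3,4) by (simp add: field_simps)
  have "(- B / Q) * (- A / (Q * t\<^sup>2)) / ((- C / (Q * t)) * (- C / (Q * t))) = B * A / (C * C)" for A B C
    using assms(3,4) by (simp add: power2_eq_square)
  then show ?thesis
    unfolding complex_cnj_divide complex_cnj_mult complex_cnj_diff complex_cnj_power complex_cnj_one
      assms(1,2) 1 2 3 .
qed

lemma cnj_qq_power: "cnj (qq ^ j) = inverse (qq ^ j)"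
  by (rule cnj_eq_inverse) (simp add: norm_power unit)

lemma cnj_tt': "cnj tt' = inverse tt'"
  by (rule cnj_eq_inverse) (simp add: norm_power cmod_curve_v \<sigma> unit)

lemma cnj_wt: "cnj (wt m) = wt m"
  unfolding wt_def e_norm_def cnj_prod
  by (intro prod.cong refl cnj_factor cnj_qq_power cnj_tt') (use hh vv in auto)

lemma cnj_rho: "0 < k \<Longrightarrow> k \<le> n \<Longrightarrow> cnj (rho k) = rho k"
  unfolding rho_eq by (intro cnj_factor cnj_qq_power cnj_tt') (use hh vv in auto)

lemma cnj_dd: "cnj dd = - dd"
  by (simp add: cnj_vv)

text \<open>For u = t q^k on the unit circle, d/(1 - u) has the conjugate d u/(1 - u), where d =
  t^{1/2} - t^{-1/2} is anti-invariant.\<close>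

lemma aa_minus_cnj:
  assumes "0 < k" "k \<le> n" shows "aa k - cnj (aa k) = dd"
proof -
  define u where "u = tt' * qq ^ k"
  have u: "1 - u \<noteq> 0" "u \<noteq> 0"
    using nondeg_n assms hh vv by (auto simp: nondeg_def u_def)
  have cu: "cnj u = inverse u"
    unfolding u_def complex_cnj_mult[of tt'] cnj_qq_power cnj_tt' by simp
  have a: "aa k = dd / (1 - u)" by (simp add: T_diag_def u_def)
  have "cnj (aa k) = - dd / (1 - inverse u)"
    unfolding a complex_cnj_divide cnj_dd by (simp add: cu)
  also have "\<dots> = dd * u / (1 - u)"
  proof -
    have "1 - inverse u = - (1 - u) / u" using u by (simp add: field_simps)
    moreover have "- D / (- w / u) = D * u / w" for D w using u by simp
    ultimately show ?thesis by metis
  qed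
  finally have "aa k - cnj (aa k) = (dd - dd * u) / (1 - u)" by (simp add: a diff_divide_distrib)
  also have "dd - dd * u = dd * (1 - u)" by (simp add: algebra_simps)
  finally show ?thesis using u by simp
qed

text \<open>Matrix form of the claim that the adjoint of T is T^{-1} = T - d. Both sides vanish
  outside the blocks of e_k and e_{-k}; nonzero diagonal indices rest on
  \<open>aa_minus_cnj\<close>, off-diagonal entries on the norm ratio \<open>wt_neg\<close>.\<close>

lemma T_adjoint_basis:
  assumes "m \<in> idx n" "l \<in> idx n"
  shows "cf (T_pol vv (ep m)) l * wt l
    = cnj (cf (T_pol vv (ep l)) m - dd * (if m = l then 1 else 0)) * wt m"
proof -
  have cases3: "x = 0 \<or> (\<exists>k. x = int (Suc k)) \<or> (\<exists>k. x = - int (Suc k))" for x :: int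
    by (metis int_cases2 neg_equal_0_iff_equal of_nat_0 nat.exhaust)
  have bound: "int (Suc k) \<in> idx n \<Longrightarrow> k < n" "- int (Suc k) \<in> idx n \<Longrightarrow> Suc k < n" for k
    by (auto simp: idx_def)
  have neq: "int (Suc k) \<noteq> - int (Suc j)" "- int (Suc k) \<noteq> int (Suc j)" for k j by auto
  have real_v: "vv = cnj (vv - dd)" "inverse vv = cnj vv" "vv = cnj (inverse vv)"
    by (simp_all add: cnj_vv)
  have diag: "aa k = cnj (aa k - dd)" "dd - aa k = cnj (dd - aa k - dd)" if "0 < k" "k \<le> n" for k
    using aa_minus_cnj[OF that] unfolding complex_cnj_diff[of _ dd] cnj_dd
    by (simp_all add: algebra_simps)
  consider "m = 0" "l = 0" | k where "m = int (Suc k)" "l = int (Suc k)"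
    | k where "m = - int (Suc k)" "l = - int (Suc k)"
    | k where "m = int (Suc k)" "l = - int (Suc k)"
    | k where "m = - int (Suc k)" "l = int (Suc k)"
    | "\<bar>m\<bar> \<noteq> \<bar>l\<bar>"
    using cases3[of m] cases3[of l] by fastforce
  then show ?thesis
  proof cases
    case 1
    then show ?thesis using real_v(1) by (simp add: cf_T_0)
  next
    case (2 k)
    then have k: "k < n" using bound(1)[of k] assms by simp
    have "cf (T_pol vv (ep m)) l = aa (Suc k)" "cf (T_pol vv (ep l)) m = aa (Suc k)"
      using assms k unfolding 2 by (simp_all only: cf_T_pos neq if_False if_True simp_thms)
    moreover have "m = l" "aa (Suc k) = cnj (aa (Suc k) - dd)" using 2 diag(1)[of "Suc k"] k by simp_all
    ultimately show ?thesis by (simp only: if_True simp_thms mult_1_right)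
  next
    case (3 k)
    then have k: "Suc k < n" using bound(2)[of k] assms by simp
    have "cf (T_pol vv (ep m)) l = dd - aa (Suc k)" "cf (T_pol vv (ep l)) m = dd - aa (Suc k)"
      using assms k unfolding 3 by (simp_all only: cf_T_neg if_True simp_thms)
    moreover have "m = l" using 3 by simp
    moreover have "dd - aa (Suc k) = cnj (dd - aa (Suc k) - dd)" by (rule diag(2)) (use k in auto)
    ultimately show ?thesis by (simp only: if_True simp_thms mult_1_right)
  next
    case (4 k)
    then have k: "Suc k < n" using bound(2)[of k] assms by simp
    have "cf (T_pol vv (ep m)) l = inverse vv" "cf (T_pol vv (ep l)) m = vv * rho (Suc k)"
      using assms k unfolding 4 by (simp_all only: cf_T_neg cf_T_pos Suc_lessD neq if_False if_True simp_thms)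
    moreover have "m \<noteq> l" using 4 by simp
    moreover have "wt l = rho (Suc k) * wt m" using wt_neg[of "Suc k"] k 4 by simp
    moreover have "cnj (vv * rho (Suc k)) = inverse vv * rho (Suc k)"
      unfolding complex_cnj_mult[of vv] cnj_vv using cnj_rho[of "Suc k"] k by simp
    ultimately show ?thesis by (simp del: complex_cnj_mult complex_cnj_add)
  next
    case (5 k)
    then have k: "Suc k < n" using bound(2)[of k] assms by simp
    have "cf (T_pol vv (ep l)) m = inverse vv" "cf (T_pol vv (ep m)) l = vv * rho (Suc k)"
      using assms k unfolding 5 by (simp_all only: cf_T_neg cf_T_pos Suc_lessD neq if_False if_True simp_thms)
    moreover have "m \<noteq> l" using 5 by simp
    moreover have "wt m = rho (Suc k) * wt l" using wt_neg[of "Suc k"] k 5 by simp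
    ultimately show ?thesis using real_v(3) by simp
  next
    case 6
    have z: "cf (T_pol vv (ep x)) y = 0" if "x \<in> idx n" "y \<in> idx n" "\<bar>x\<bar> \<noteq> \<bar>y\<bar>" for x y
      using cases3[of x] that bound by (auto simp: cf_T_0 cf_T_pos cf_T_neg simp del: of_nat_Suc)
    have "m \<noteq> l" using 6 by auto
    then show ?thesis using z[of m l] z[of l m] 6 assms by simp
  qed
qed

lemma T_adjoint: "frm (T_pol vv f) g = frm f (T_inv vv g)"
proof (rule frm_descends_eqI[where G = "\<lambda>g. g" and F' = "\<lambda>f. f"])
  show "descends EE (T_pol vv)" "descends EE (T_inv vv)" by (rule descends_T descends_T_inv)+
  show "descends EE (\<lambda>g. g)" by (simp add: descends_def)
  then show "descends EE (\<lambda>g. g)" .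
  fix m l assume ml: "m \<in> idx n" "l \<in> idx n"
  have "cf (T_inv vv (ep l)) m = cf (T_pol vv (ep l)) m - dd * (if m = l then 1 else 0)"
    by (simp add: T_inv_def cf_diff cf_scale cf_ep[OF ml(2)])
  then show "frm (T_pol vv (ep m)) (ep l) = frm (ep m) (T_inv vv (ep l))"
    unfolding frm_ep_right[OF ml(2)] frm_ep_left[OF ml(1)] T_adjoint_basis[OF ml] by simp
qed

lemma T_unitary: "frm (T_pol vv f) (T_pol vv g) = frm f g"
  using vv by (simp add: T_adjoint)

lemma T_inv_unitary: "frm (T_inv vv f) (T_inv vv g) = frm f g"
  using T_unitary[of "T_inv vv f" "T_inv vv g"] vv by simp

lemma frm_ep_ep: "m \<in> idx n \<Longrightarrow> l \<in> idx n \<Longrightarrow> frm (ep m) (ep l) = (if m = l then wt m else 0)"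
  by (simp add: frm_ep_right cf_ep)

lemma Y_unitary: "frm (Y_pol hh vv f) (Y_pol hh vv g) = frm f g"
proof (rule frm_descends_eqI[where F' = "\<lambda>f. f" and G' = "\<lambda>f. f"])
  fix m l assume ml: "m \<in> idx n" "l \<in> idx n"
  have "ev m \<noteq> 0" using hh vv by (simp add: Y_eig_def)
  have "cnj (ev m) = inverse (ev m)"
    by (rule cnj_eq_inverse)
      (auto simp: Y_eig_def norm_mult norm_power norm_inverse unit cmod_curve_v \<sigma>)
  then have "ev m * cnj (ev m) = 1" using \<open>ev m \<noteq> 0\<close> by simp
  then show "frm (Y_pol hh vv (ep m)) (Y_pol hh vv (ep l)) = frm (ep m) (ep l)"
    by (auto simp: Y_ep ml frm_scale frm_ep_ep)
qed (rule descends_Y | simp add: descends_def)+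

lemma XP_unitary: "frm (XP f) (XP g) = frm f g"
proof (rule frm_descends_eqI[where F' = "\<lambda>f. f" and G' = "\<lambda>f. f"])
  fix m l assume ml: "m \<in> idx n" "l \<in> idx n"
  obtain i j where ij: "XP (ep m) = lconst (hh powi i) * ep (1 - m)" "XP (ep l) = lconst (hh powi j) * ep (1 - l)"
    using XP_ep ml by metis
  have refl: "1 - m \<in> idx n" "1 - l \<in> idx n" using ml by (auto simp: idx_def)
  show "frm (XP (ep m)) (XP (ep l)) = frm (ep m) (ep l)"
  proof (cases "m = l")
    case True
    have "cnj (hh powi i) = inverse (hh powi i)"
      by (rule cnj_eq_inverse) (simp add: norm_power_int norm_power unit)
    then have "hh powi i * cnj (hh powi i) = 1" using hh by simp
    then show ?thesis
      unfolding ij(1) True[symmetric] frm_scale frm_ep_ep[OF refl(1) refl(1)] frm_ep_ep[OF ml(1) ml(1)]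
      by (simp add: wt_reflect)
  next
    case False
    then show ?thesis unfolding ij frm_scale frm_ep_ep[OF refl] frm_ep_ep[OF ml] by simp
  qed
qed (rule descends_XP | simp add: descends_def)+

lemma X_unitary: "frm (X_pol f) (X_pol g) = frm f g"
proof -
  have "X_pol f = XP (Y_pol hh vv (T_inv vv f))" for f
    using hh vv by (simp add: XP_def X_pol_def Y_pol_def)
  then show ?thesis by (simp add: XP_unitary Y_unitary T_inv_unitary)
qed

lemma frm_hermitian: "frm g f = cnj (frm f g)"
  by (simp add: frm_def cnj_wt mult_ac)

lemma hermitian_unitary: "hermitian_unitary MM (Vp_form n \<sigma> r)"
  unfolding hermitian_unitary_def
proof (intro ballI conjI)
  fix x y assume "x \<in> carrier MM" "y \<in> carrier MM"
  then obtain f g where fg: "x = qclass EE f" "y = qclass EE g" by (metis pol_quot_cases)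
  show "Vp_form n \<sigma> r y x = cnj (Vp_form n \<sigma> r x y)"
    unfolding fg Vp_form_eq by (rule frm_hermitian)
  fix F assume "F \<in> {opX MM, opY MM, opT MM}"
  then show "Vp_form n \<sigma> r (F x) (F y) = Vp_form n \<sigma> r x y"
    by (auto simp: fg Vp_form_eq X_unitary Y_unitary T_unitary)
qed

lemma Vp_form_ok: "Vp_form_ok n \<sigma> r"
  unfolding Vp_form_ok_def Vp_mod_eq
  using ec_idx basis_e hermitian_unitary by blast

lemma positive_definite:
  assumes pos: "\<And>m. m \<in> idx n \<Longrightarrow> Re (wt m) > 0"
  shows "positive_definite MM (Vp_form n \<sigma> r)"
  unfolding positive_definite_def
proof (intro ballI conjI)
  fix x assume x: "x \<in> carrier MM - {\<zero>\<^bsub>MM\<^esub>}"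
  then obtain f where f: "x = qclass EE f" by (metis DiffD1 pol_quot_cases)
  then have "cf f \<noteq> cf 0" using x by (metis DiffD2 insertI1 pol_quot_zero qclass_cf)
  then obtain k where k: "cf f k \<noteq> 0" unfolding cf_0 by auto
  then have k_idx: "k \<in> idx n" using cf_outside by blast
  have wt_real: "wt m = of_real (Re (wt m))" for m
    using cnj_wt[of m] by (simp add: complex_eq_iff)
  have form: "Vp_form n \<sigma> r x x = of_real (\<Sum>m\<in>idx n. (cmod (cf f m))\<^sup>2 * Re (wt m))"
  proof -
    have "cf f m * cnj (cf f m) * wt m = of_real ((cmod (cf f m))\<^sup>2 * Re (wt m))" for m
      by (subst wt_real) (simp only: of_real_mult complex_norm_square)
    then show ?thesis unfolding f Vp_form_eq frm_def by simp
  qed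
  then show "Vp_form n \<sigma> r x x \<in> \<real>" by (simp only: Reals_of_real)
  have "(\<Sum>m\<in>idx n. (cmod (cf f m))\<^sup>2 * Re (wt m)) > 0"
  proof (rule sum_pos2[OF finite_idx k_idx])
    show "0 < (cmod (cf f k))\<^sup>2 * Re (wt k)" using k pos[OF k_idx] by simp
    show "0 \<le> (cmod (cf f i))\<^sup>2 * Re (wt i)" if "i \<in> idx n" for i using pos[OF that] by simp
  qed
  then show "Re (Vp_form n \<sigma> r x x) > 0" unfolding form by simp
qed

end

section \<open>Positivity\<close>

text \<open>The norm factor for q^j = e^{4ia} and t = -e^{-2i(a+b)}. The half-angle forms 1 -
  e^{2ix} = -2i sin(x) e^{ix} and 1 + e^{2ix} = 2 cos(x) e^{ix} are used, and the phases
  cancel.\<close>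

lemma norm_factor_cis:
  fixes a b :: real
  assumes "cos (a - b) \<noteq> 0"
  shows "((1 - cis (4 * a)) * (1 - cis (4 * a) * cis (- 4 * (a + b))))
      / ((1 + cis (4 * a) * cis (- 2 * (a + b))) * (1 + cis (4 * a) * cis (- 2 * (a + b))))
    = of_real (sin (2 * a) * sin (2 * b) / (cos (a - b))\<^sup>2)"
proof -
  have minus: "1 - cis (2 * x) = - 2 * \<i> * of_real (sin x) * cis x" for x
  proof -
    have "sin x * sin x = 1 - cos x * cos x" by (metis cos_squared_eq power2_eq_square diff_diff_eq2 add_diff_cancel_left' sin_squared_eq)
    then show ?thesis
      by (simp add: complex_eq_iff cos_double sin_double power2_eq_square)
  qed
  have plus: "1 + cis (2 * x) = 2 * of_real (cos x) * cis x" for x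
  proof -
    have "sin x * sin x = 1 - cos x * cos x" by (metis cos_squared_eq power2_eq_square diff_diff_eq2 add_diff_cancel_left' sin_squared_eq)
    then show ?thesis
      by (simp add: complex_eq_iff cos_double sin_double power2_eq_square)
  qed
  have 1: "1 - cis (4 * a) = - 2 * \<i> * of_real (sin (2 * a)) * cis (2 * a)"
    using minus[of "2 * a"] by (simp add: mult.assoc[symmetric])
  have 2: "1 - cis (4 * a) * cis (- 4 * (a + b)) = 2 * \<i> * of_real (sin (2 * b)) * cis (- 2 * b)"
    using minus[of "- 2 * b"] by (simp add: cis_mult algebra_simps)
  have 3: "1 + cis (4 * a) * cis (- 2 * (a + b)) = 2 * of_real (cos (a - b)) * cis (a - b)"
    using plus[of "a - b"] by (simp add: cis_mult algebra_simps)
  have "cis (2 * a) * cis (- 2 * b) = cis (a - b) * cis (a - b)"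
    by (simp add: cis_mult)
  then have "(- 2 * \<i> * of_real (sin (2 * a)) * cis (2 * a)) * (2 * \<i> * of_real (sin (2 * b)) * cis (- 2 * b))
      = 4 * of_real (sin (2 * a) * sin (2 * b)) * (cis (a - b) * cis (a - b))"
    by (simp add: mult_ac)
  then show ?thesis unfolding 1 2 3
    using assms by (simp add: power2_eq_square field_simps)
qed

context unit_curve
begin

lemma wt_positive:
  assumes h: "hh = cis (\<theta> / 2)" and \<theta>: "\<bar>\<theta>\<bar> \<le> 2 * pi / real N" "\<theta> \<noteq> 0 \<or> n = 1" and N: "n < N"
    and m: "m \<in> idx n"
  shows "Re (wt m) > 0"
proof -
  have factor: "\<exists>x>0. ((1 - qq ^ j) * (1 - qq ^ j * tt'\<^sup>2)) / ((1 - qq ^ j * tt') * (1 - qq ^ j * tt')) = of_real x"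
    if j: "0 < j" "j < n" for j
  proof -
    \<comment> \<open>With q = e^{i\<theta>} one has q^j = e^{4ia}, q^{n-j} = e^{4ib} and h^n =
      e^{2i(a+b)}, so the equation of the curve gives t = -e^{-2i(a+b)}.\<close>
    define a b where "a = real j * \<theta> / 4" and "b = real (n - j) * \<theta> / 4"
    have ab: "a + b = real n * \<theta> / 4" using j by (simp add: a_def b_def of_nat_diff field_simps)
    have q: "qq ^ j = cis (4 * a)" by (simp add: h DeMoivre a_def)
    have "hh ^ n = cis (2 * (a + b))" unfolding ab by (simp add: h DeMoivre mult.commute)
    then have "tt' * cis (2 * (a + b)) = - 1" using tt by simp
    moreover have "cis (2 * (a + b)) * cis (- 2 * (a + b)) = 1" by (simp add: cis_mult)
    ultimately have t: "tt' = - cis (- 2 * (a + b))"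
      by (metis mult.assoc mult_1_left mult_1_right mult_minus_left)
    have t2: "tt'\<^sup>2 = cis (- 4 * (a + b))" unfolding t by (simp add: DeMoivre)
    have theta: "\<theta> \<noteq> 0" using \<theta>(2) j by auto
    \<comment> \<open>The closed bound 2\<pi>/N on |\<theta>| becomes strict after multiplication by
      an index below N.\<close>
    have bound: "real i * \<bar>\<theta>\<bar> < 2 * pi" if "i < N" for i
    proof -
      have "real i * \<bar>\<theta>\<bar> \<le> real i * (2 * pi / real N)" using \<theta>(1) by (intro mult_left_mono) auto
      also have "\<dots> < 2 * pi" using that by (simp add: field_simps)
      finally show ?thesis .
    qed
    have cos: "cos (a - b) > 0"
    proof -
      have "\<bar>a - b\<bar> \<le> real n * \<bar>\<theta>\<bar> / 4"
      proof -
        have "a - b = (real j - real (n - j)) * \<theta> / 4" by (simp add: a_def b_def algebra_simps)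
        then have "\<bar>a - b\<bar> = \<bar>real j - real (n - j)\<bar> * \<bar>\<theta>\<bar> / 4"
          by (simp only: abs_mult abs_divide abs_numeral)
        also have "\<dots> \<le> real n * \<bar>\<theta>\<bar> / 4" using j by (intro divide_right_mono mult_right_mono) auto
        finally show ?thesis .
      qed
      also have "\<dots> < pi / 2" using bound[OF N] by linarith
      finally have "- (pi / 2) < a - b" "a - b < pi / 2" by linarith+
      then show ?thesis by (rule cos_gt_zero_pi)
    qed
    \<comment> \<open>Both angles have the sign of \<theta> and modulus below \<pi>, so the two
      sines have the same sign.\<close>
    have sin: "sin (2 * a) * sin (2 * b) > 0"
    proof -
      have s: "sgn (sin (real i * \<theta> / 2)) = sgn \<theta>" if "0 < i" "i < N" for i
      proof -
        have "0 < real i * \<bar>\<theta>\<bar> / 2" using theta that by simp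
        moreover have "real i * \<bar>\<theta>\<bar> / 2 < pi" using bound[OF that(2)] by linarith
        ultimately have pos: "sin (real i * \<bar>\<theta>\<bar> / 2) > 0" by (rule sin_gt_zero)
        show ?thesis
        proof (cases "\<theta> > 0")
          case True
          then show ?thesis using pos by simp
        next
          case False
          then have "sin (real i * \<theta> / 2) = - sin (real i * \<bar>\<theta>\<bar> / 2)" by simp
          then show ?thesis using pos False theta by simp
        qed
      qed
      have ab2: "2 * a = real j * \<theta> / 2" "2 * b = real (n - j) * \<theta> / 2"
        by (simp_all add: a_def b_def)
      have "sgn (sin (real j * \<theta> / 2)) = sgn \<theta>" "sgn (sin (real (n - j) * \<theta> / 2)) = sgn \<theta>"
        by (rule s; use j N in linarith)+
      then have "sgn (sin (2 * a) * sin (2 * b)) = sgn \<theta> * sgn \<theta>"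
        by (simp only: sgn_mult ab2)
      then have "sgn (sin (2 * a) * sin (2 * b)) = 1" using theta by (simp add: sgn_if)
      then show ?thesis by (simp add: sgn_1_pos)
    qed
    have "((1 - qq ^ j) * (1 - qq ^ j * tt'\<^sup>2)) / ((1 - qq ^ j * tt') * (1 - qq ^ j * tt'))
        = of_real (sin (2 * a) * sin (2 * b) / (cos (a - b))\<^sup>2)"
      unfolding q t2 unfolding t using norm_factor_cis[of a b] cos by simp
    moreover have "sin (2 * a) * sin (2 * b) / (cos (a - b))\<^sup>2 > 0" using sin cos by simp
    ultimately show ?thesis by blast
  qed
  obtain x where x: "\<And>j. 0 < j \<Longrightarrow> j < n \<Longrightarrow> x j > 0"
    "\<And>j. 0 < j \<Longrightarrow> j < n \<Longrightarrow>
      ((1 - qq ^ j) * (1 - qq ^ j * tt'\<^sup>2)) / ((1 - qq ^ j * tt') * (1 - qq ^ j * tt')) = of_real (x j)"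
    using factor by metis
  define K where "K = (if m \<le> 0 then nat \<bar>m\<bar> + 1 else nat \<bar>m\<bar>)"
  have K: "K \<le> n" using m by (auto simp: K_def idx_def)
  have "wt m = (\<Prod>j\<in>{0<..<K}. of_real (x j))"
    unfolding wt_def e_norm_def K_def[symmetric]
  proof (rule prod.cong)
    fix j assume "j \<in> {0<..<K}"
    then have "0 < j" "j < n" using K by auto
    then show "(1 - qq ^ j) * (1 - qq ^ j * tt'\<^sup>2) / ((1 - qq ^ j * tt') * (1 - qq ^ j * tt'))
      = complex_of_real (x j)" by (rule x)
  qed simp
  also have "\<dots> = of_real (\<Prod>j\<in>{0<..<K}. x j)" by simp
  finally have "Re (wt m) = (\<Prod>j\<in>{0<..<K}. x j)" by (simp only: Re_complex_of_real)
  also have "\<dots> > 0" by (rule prod_pos) (use K in \<open>auto intro!: x\<close>)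
  finally show ?thesis .
qed

end

section \<open>Regularity of the form\<close>

lemma cnj_qbinom: "cnj (qbinom q n k) = qbinom (cnj q) n k"
  by (induction q n k rule: qbinom.induct) auto

lemma cnj_qpoch: "cnj (qpoch t q k) = qpoch (cnj t) (cnj q) k"
  by (simp add: qpoch_def cnj_prod)

lemma cnj_e_coeff: "cnj (e_coeff q t n j) = e_coeff (cnj q) (cnj t) n j"
  by (simp add: e_coeff_def cnj_qbinom cnj_qpoch)

lemma cnj_e_poly: "cnj (lk (e_poly h v m) j) = lk (e_poly (cnj h) (cnj v) m) j"
  by (auto simp: e_poly_def lookup_e_neg lookup_e_pos cnj_sum cnj_e_coeff intro!: sum.cong)

text \<open>The Gram matrix of the monomials involves conjugated coordinates. On |r| = 1 conjugation
  inverts both parameters, so the conjugates are rational as well; the expansion is carried out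
  among functions regular together with their conjugates.\<close>

lemma regular_form_Vp:
  assumes D: "\<And>r. r \<in> D \<Longrightarrow> unit_curve n \<sigma> r" and D0: "0 \<notin> D"
  shows "regular_form D (idx n) (Vp_X n \<sigma>) (Vp_form n \<sigma>)"
proof (cases "D = {}")
  case True then show ?thesis by (simp add: regular_form_def)
next
  case False
  then obtain r1 where "r1 \<in> D" by auto
  then interpret r1: unit_curve n \<sigma> r1 by (rule D)
  let ?R = "\<lambda>f. regular_on D f \<and> regular_on D (\<lambda>r. cnj (f r))"
  let ?b = "\<lambda>r. e_poly (r\<^sup>2) (curve_v n \<sigma> r)"
  have "\<exists>c. (\<forall>m. ?R (c m)) \<and> (\<forall>r\<in>D. lX i = (\<Sum>m\<in>below (2 * n). lconst (c m r) * ?b r m))"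
    if i: "i \<in> idx n" for i
  proof (rule triangular_expand[where R = ?R])
    show "triangular (2 * n) (?b r)" if "r \<in> D" for r
    proof -
      interpret unit_curve n \<sigma> r by (rule D[OF that])
      show ?thesis by (rule triangular_ep)
    qed
    show "?R (\<lambda>r. lk (?b r m) j)" if m: "m \<in> below (2 * n)" for m j
    proof
      show "regular_on D (\<lambda>r. lk (?b r m) j)"
        unfolding regular_on_def
      proof (intro exI ballI)
        fix r assume "r \<in> D"
        interpret unit_curve n \<sigma> r by (rule D[OF \<open>r \<in> D\<close>])
        show "s1.spec r (lk (e_poly (gen_r1\<^sup>2) (gen_curve n \<sigma>) m) j) (lk (?b r m) j)"
          by (intro s1.spec_e_poly s1.spec_power spec_gen_r1 spec_curve r nondeg_idx)
            (use m in \<open>simp add: below_idx\<close>)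
      qed
      show "regular_on D (\<lambda>r. cnj (lk (?b r m) j))"
        unfolding regular_on_def
      proof (intro exI ballI)
        fix r assume "r \<in> D"
        interpret unit_curve n \<sigma> r by (rule D[OF \<open>r \<in> D\<close>])
        have nd: "nondeg ((cnj hh)\<^sup>2) ((cnj vv)\<^sup>2) (rk m div 2)"
          unfolding nondeg_def
        proof
          fix i assume "i \<in> {1..rk m div 2}"
          then have "1 - tt' * qq ^ i \<noteq> 0"
            using nondeg_idx[of m] m unfolding below_idx nondeg_def by blast
          then have "cnj (1 - tt' * qq ^ i) \<noteq> 0" by (simp only: complex_cnj_zero_iff not_False_eq_True)
          then show "1 - (cnj vv)\<^sup>2 * ((cnj hh)\<^sup>2) ^ i \<noteq> 0"
            by (simp only: complex_cnj_diff complex_cnj_mult complex_cnj_power complex_cnj_one not_False_eq_True)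
        qed
        \<comment> \<open>The conjugate of e_m is e_m at the inverted parameters, obtained by
          specializing the inverted generic ones.\<close>
        show "s1.spec r (lk (e_poly (inverse (gen_r1\<^sup>2)) (inverse (gen_curve n \<sigma>)) m) j) (cnj (lk (?b r m) j))"
          unfolding cnj_e_poly cnj_hh cnj_vv
          by (intro s1.spec_e_poly s1.spec_inverse s1.spec_power spec_gen_r1 spec_curve r hh vv
              nd[unfolded cnj_hh cnj_vv])
      qed
    qed
    show "j \<in> below (2 * n)" if "lk (lX i) j \<noteq> 0" for j
      using that i by (auto simp: lookup_lX below_idx split: if_splits)
    show "?R (\<lambda>r. lk (lX i) j)" for j by auto
  qed (auto intro: regular_on_diff regular_on_mult)
  then obtain c where c: "\<And>i m. i \<in> idx n \<Longrightarrow> ?R (c i m)"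
      "\<And>i r. i \<in> idx n \<Longrightarrow> r \<in> D \<Longrightarrow> lX i = (\<Sum>m\<in>idx n. lconst (c i m r) * ?b r m)"
    unfolding below_idx by metis
  let ?w = "\<lambda>m r. e_norm ((r\<^sup>2)\<^sup>2) ((curve_v n \<sigma> r)\<^sup>2) m"
  have w: "regular_on D (?w m)" if m: "m \<in> idx n" for m
    unfolding e_norm_def
  proof (intro regular_on_prod regular_on_divide regular_on_mult regular_on_diff regular_on_power
      regular_on_const regular_on_id regular_on_curve D0)
    fix j r assume j: "j \<in> {0<..<if m \<le> 0 then nat \<bar>m\<bar> + 1 else nat \<bar>m\<bar>}" and "r \<in> D"
    interpret unit_curve n \<sigma> r by (rule D[OF \<open>r \<in> D\<close>])
    have "0 < j" "j \<le> n" using j m by (auto simp: idx_def split: if_splits)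
    then show "(1 - qq ^ j * tt') * (1 - qq ^ j * tt') \<noteq> 0"
      using nondeg_n by (auto simp: nondeg_def mult.commute)
  qed
  have "\<exists>G. \<forall>r\<in>D. s1.spec r G (Vp_form n \<sigma> r (Vp_X n \<sigma> r i) (Vp_X n \<sigma> r j))"
    if ij: "i \<in> idx n" "j \<in> idx n" for i j
  proof -
    have "regular_on D (\<lambda>r. \<Sum>m\<in>idx n. c i m r * cnj (c j m r) * ?w m r)"
      using c(1) ij w by (intro regular_on_sum regular_on_mult) auto
    moreover have "Vp_form n \<sigma> r (Vp_X n \<sigma> r i) (Vp_X n \<sigma> r j)
        = (\<Sum>m\<in>idx n. c i m r * cnj (c j m r) * ?w m r)" if "r \<in> D" for r
    proof -
      interpret unit_curve n \<sigma> r by (rule D[OF that])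
      have cfX: "cf (lX k) m = c k m r" if "k \<in> idx n" "m \<in> idx n" for k m
        using c(2)[OF that(1) \<open>r \<in> D\<close>] cf_lincomb[of "\<lambda>m. c k m r"] that(2) by simp
      have "Vp_form n \<sigma> r (Vp_X n \<sigma> r i) (Vp_X n \<sigma> r j) = frm (lX i) (lX j)"
        by (simp add: Vp_X_def ec_minus_n[OF \<sigma> r] Vp_form_eq)
      also have "\<dots> = (\<Sum>m\<in>idx n. c i m r * cnj (c j m r) * ?w m r)"
        unfolding frm_def wt_def by (rule sum.cong) (simp_all add: cfX ij)
      finally show ?thesis .
    qed
    ultimately show ?thesis unfolding regular_on_def by metis
  qed
  then have "\<forall>i j. \<exists>G. i \<in> idx n \<longrightarrow> j \<in> idx n \<longrightarrow> (\<forall>r\<in>D. s1.spec r G (Vp_form n \<sigma> r (Vp_X n \<sigma> r i) (Vp_X n \<sigma> r j)))"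
    by blast
  then obtain G where "\<And>i j r. i \<in> idx n \<Longrightarrow> j \<in> idx n \<Longrightarrow> r \<in> D \<Longrightarrow>
      s1.spec r (G i j) (Vp_form n \<sigma> r (Vp_X n \<sigma> r i) (Vp_X n \<sigma> r j))"
    by metis
  then show ?thesis unfolding regular_form_def
    by (intro exI[of _ G]) (auto intro: regular1I value1_eqI[symmetric])
qed

section \<open>Evaluation of Laurent polynomials\<close>

definition leval :: "'a::field \<Rightarrow> 'a laurent \<Rightarrow> 'a" where
  "leval x f = (\<Sum>k\<in>Poly_Mapping.keys f. lk f k * x powi k)"

lemma leval_superset:
  assumes "finite S" "\<And>k. lk f k \<noteq> 0 \<Longrightarrow> k \<in> S"
  shows "leval x f = (\<Sum>k\<in>S. lk f k * x powi k)"
  unfolding leval_def by (rule sum.mono_neutral_left) (use assms in \<open>auto simp: in_keys_iff\<close>)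

lemma leval_0 [simp]: "leval x 0 = 0"
  by (simp add: leval_def)

lemma leval_add: "leval x (f + g) = leval x f + leval x g"
proof -
  let ?S = "Poly_Mapping.keys f \<union> Poly_Mapping.keys g"
  have "leval x (f + g) = (\<Sum>k\<in>?S. lk (f + g) k * x powi k)"
    by (rule leval_superset) (auto simp: lookup_add in_keys_iff)
  moreover have "leval x f = (\<Sum>k\<in>?S. lk f k * x powi k)" "leval x g = (\<Sum>k\<in>?S. lk g k * x powi k)"
    by (rule leval_superset; auto simp: in_keys_iff)+
  ultimately show ?thesis by (simp add: lookup_add distrib_right sum.distrib)
qed

lemma leval_monom: "leval x (lconst c * lX k) = c * x powi k"
proof -
  have "leval x (lconst c * lX k) = (\<Sum>j\<in>{k}. lk (lconst c * lX k) j * x powi j)"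
    by (rule leval_superset) (auto simp: lookup_lX split: if_splits)
  then show ?thesis by (simp add: lookup_lX)
qed

lemma leval_lconst [simp]: "leval x (lconst c) = c"
  and leval_lX [simp]: "leval x (lX k) = x powi k"
  and leval_1 [simp]: "leval x 1 = 1"
  using leval_monom[of x c 0] leval_monom[of x 1 k] leval_monom[of x 1 0] by simp_all

lemma leval_mult:
  assumes "x \<noteq> 0" shows "leval x (f * g) = leval x f * leval x g"
proof (induction f rule: laurent_induct)
  case (monom c k)
  show ?case
  proof (induction g rule: laurent_induct)
    case (monom d l)
    have "lconst c * lX k * (lconst d * lX l) = lconst (c * d) * lX (k + l)"
      by (simp add: lconst_mult lX_add mult_ac)
    then show ?case using assms by (simp only: leval_monom) (simp add: power_int_add)
  qed (auto simp: distrib_left leval_add)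
qed (auto simp: distrib_right leval_add)

lemma leval_uminus [simp]: "leval x (- f) = - leval x f"
  by (metis add.right_inverse leval_0 leval_add minus_unique)

lemma leval_diff: "leval x (f - g) = leval x f - leval x g"
  using leval_add[of x f "- g"] by simp

lemma leval_sum: "leval x (sum g S) = (\<Sum>i\<in>S. leval x (g i))"
  by (induction S rule: infinite_finite_induct) (auto simp: leval_add)

lemma leval_prod: "x \<noteq> 0 \<Longrightarrow> leval x (prod g S) = (\<Prod>i\<in>S. leval x (g i))"
  by (induction S rule: infinite_finite_induct) (auto simp: leval_mult)

lemma leval_s_op: "x \<noteq> 0 \<Longrightarrow> leval x (s_op f) = leval (inverse x) f"
proof (induction f rule: laurent_induct)
  case (monom c k)
  then show ?case
    by (simp add: s_op_lconst_mult leval_monom power_int_inverse power_int_minus)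
qed (auto simp: s_op_add leval_add)

lemma leval_pi_op: "h \<noteq> 0 \<Longrightarrow> x \<noteq> 0 \<Longrightarrow> leval x (pi_op h f) = leval (h / x) f"
proof (induction f rule: laurent_induct)
  case (monom c k)
  then show ?case
    by (simp add: pi_op_lconst_mult leval_mult power_int_mult_distrib power_int_inverse
        power_int_minus divide_inverse)
qed (auto simp: pi_op_add leval_add)

lemma leval_T_pol:
  assumes "v \<noteq> 0" "x \<noteq> 0"
  shows "(x\<^sup>2 - 1) * leval x (T_pol v f)
    = (v * x\<^sup>2 - inverse v) * leval (inverse x) f - (v - inverse v) * leval x f"
  using arg_cong[OF T_pol_mult_eq[OF assms(1), of f], of "leval x"] assms
  by (simp add: leval_mult leval_diff leval_s_op)

text \<open>The remainder theorem; negative powers reduce to positive ones because X and x are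
  units.\<close>

lemma linear_factor_dvd:
  assumes x: "x \<noteq> 0" shows "(lX 1 - lconst x) dvd (f - lconst (leval x f))"
proof (induction f rule: laurent_induct)
  case (monom c k)
  have nonneg: "(lX 1 - lconst x) dvd (lX (int i) - lconst (x ^ i))" for i
  proof -
    have "lX (int i) = (lX 1 ^ i :: 'a laurent)" by (simp add: power_lX)
    then show ?thesis unfolding lconst_power by (simp only: power_diff_sumr2 dvd_triv_left)
  qed
  have "(lX 1 - lconst x) dvd (lX k - lconst (x powi k))"
  proof (cases k rule: int_cases2)
    case (nonneg i)
    then show ?thesis using \<open>\<And>i. _ dvd (lX (int i) - _)\<close>[of i] by simp
  next
    case (nonpos i)
    have "x powi k * x ^ i = 1" using x by (simp add: nonpos power_int_minus)
    then have 1: "lconst (x powi k) * lconst (x ^ i) = 1" by (simp flip: lconst_mult)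
    have 2: "lX k * lX (int i) = (1 :: 'a laurent)" by (simp add: nonpos)
    have "lX k - lconst (x powi k) = lX k * (lconst (x powi k) * lconst (x ^ i)) - lconst (x powi k) * (lX k * lX (int i))"
      by (simp add: 1 2)
    also have "\<dots> = - (lX k * lconst (x powi k)) * (lX (int i) - lconst (x ^ i))"
      by (simp add: algebra_simps)
    finally show ?thesis using \<open>\<And>i. _ dvd (lX (int i) - _)\<close>[of i] by simp
  qed
  then have "(lX 1 - lconst x) dvd lconst c * (lX k - lconst (x powi k))" by (rule dvd_mult)
  then show ?case by (simp add: leval_monom lconst_mult right_diff_distrib)
next
  case (add f g)
  then show ?case using dvd_add[OF add] by (simp add: leval_add lconst_add add_diff_add)
qed simp

lemma vanishing_dvd:
  assumes "finite I" "inj_on p I" "\<And>i. i \<in> I \<Longrightarrow> p i \<noteq> 0" "\<And>i. i \<in> I \<Longrightarrow> leval (p i) f = 0"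
  shows "(\<Prod>i\<in>I. lX 1 - lconst (p i)) dvd f"
  using assms
proof (induction I arbitrary: f)
  case (insert i I)
  have "(lX 1 - lconst (p i)) dvd f"
    using linear_factor_dvd[of "p i" f] insert.prems by simp
  then obtain g where g: "f = (lX 1 - lconst (p i)) * g" by (rule dvdE)
  have "leval (p j) g = 0" if "j \<in> I" for j
  proof -
    have "p j \<noteq> p i" using that insert.hyps insert.prems(1) by (auto simp: inj_on_def)
    moreover have "leval (p j) f = (p j - p i) * leval (p j) g"
      unfolding g using insert.prems(2)[of j] that by (simp add: leval_mult leval_diff)
    ultimately show ?thesis using insert.prems(3)[of j] that by simp
  qed
  then have "(\<Prod>i\<in>I. lX 1 - lconst (p i)) dvd g"
    using insert by (intro insert.IH) auto
  then show ?case using insert.hyps by (simp add: g mult_dvd_mono)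
qed simp

section \<open>The X-spectrum\<close>

text \<open>Labels for the 2n zeros of \<open>E_curve\<close>: j < n numbers the factor 1 + h^{2j-n}
  X^2, and the Boolean selects one of the square roots \<plusminus>\<sigma> r^{n-2j} of
  -h^{n-2j}.\<close>

definition pts :: "nat \<Rightarrow> (bool \<times> nat) set" where
  "pts n = UNIV \<times> {..<n}"

definition pt :: "nat \<Rightarrow> complex \<Rightarrow> complex \<Rightarrow> bool \<times> nat \<Rightarrow> complex" where
  "pt n \<sigma> r i = (if fst i then \<sigma> else - \<sigma>) * r powi (int n - 2 * int (snd i))"

text \<open>The values of the Gaussian at the points, normalized to be \<open>1\<close> at the first one.\<close>

definition gauss :: "nat \<Rightarrow> complex \<Rightarrow> complex \<Rightarrow> bool \<times> nat \<Rightarrow> complex" where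
  "gauss n \<sigma> r i = (- \<sigma>) ^ (if fst i then snd i else n - snd i) * r powi (- (int (snd i) * (int n - int (snd i))))"

text \<open>Lagrange polynomials. Their classes are the idempotents of the quotient ring and
  eigenvectors of X.\<close>

definition interp :: "nat \<Rightarrow> complex \<Rightarrow> complex \<Rightarrow> bool \<times> nat \<Rightarrow> complex laurent" where
  "interp n \<sigma> r i = (\<Prod>k\<in>pts n - {i}. lconst (inverse (pt n \<sigma> r i - pt n \<sigma> r k)) * (lX 1 - lconst (pt n \<sigma> r k)))"

definition gaussian :: "nat \<Rightarrow> complex \<Rightarrow> complex \<Rightarrow> complex laurent" where
  "gaussian n \<sigma> r = (\<Sum>i\<in>pts n. lconst (gauss n \<sigma> r i) * interp n \<sigma> r i)"

lemma finite_pts [simp]: "finite (pts n)"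
  by (simp add: pts_def)

context good_curve
begin

abbreviation "p \<equiv> pt n \<sigma> r"

lemma \<sigma>_ne_0: "\<sigma> \<noteq> 0" using \<sigma> by auto

lemma p_ne_0: "p i \<noteq> 0"
  using r \<sigma>_ne_0 by (simp add: pt_def)

lemma p_square: "(p i)\<^sup>2 = - (hh powi (int n - 2 * int (snd i)))"
proof -
  have "(r powi k)\<^sup>2 = hh powi k" for k
    by (metis mult.commute power_int_mult power_int_of_nat of_nat_numeral)
  then show ?thesis by (simp add: pt_def power_mult_distrib \<sigma>)
qed

lemma p_inj: "inj_on p (pts n)"
proof (rule inj_onI)
  fix i k assume ik: "i \<in> pts n" "k \<in> pts n" "p i = p k"
  have h2: "hh powi (2 * int a) = qq ^ a" for a
    by (metis of_nat_mult of_nat_numeral power_int_of_nat power_mult)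
  have *: "a = b" if "hh powi (int n - 2 * int a) = hh powi (int n - 2 * int b)" "a < n" "a \<le> b" "b < n" for a b
  proof (rule ccontr)
    assume "a \<noteq> b"
    have "hh powi (int n - 2 * int a) = hh powi (int n - 2 * int b) * qq ^ (b - a)"
      unfolding h2[symmetric] using hh that by (simp add: power_int_add[symmetric] of_nat_diff)
    then have "qq ^ (b - a) = 1" using that(1) hh by simp
    moreover have "0 < b - a" "b - a < n" using that \<open>a \<noteq> b\<close> by linarith+
    ultimately show False using q_ne_1 by blast
  qed
  have lt: "snd i < n" "snd k < n" using ik(1,2) by (auto simp: pts_def)
  have eq: "hh powi (int n - 2 * int (snd i)) = hh powi (int n - 2 * int (snd k))"
    using p_square[of i] p_square[of k] ik(3) by simp
  have s: "snd i = snd k"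
  proof (cases "snd i \<le> snd k")
    case True
    show ?thesis by (rule *[OF eq lt(1) True lt(2)])
  next
    case False
    then have "snd k \<le> snd i" by simp
    from *[OF eq[symmetric] lt(2) this lt(1)] show ?thesis by simp
  qed
  have "fst i = fst k"
  proof (rule ccontr)
    assume "fst i \<noteq> fst k"
    then have "p k = - p i" using s by (auto simp: pt_def)
    then show False using ik(3) p_ne_0[of i] by simp
  qed
  then show "i = k" using s by (simp add: prod_eq_iff)
qed

text \<open>X^2 - 1 must be invertible on the spectrum, as the formula for T is used with that
  denominator cleared. Points with j = 0 rely on h^n \<noteq> -1; for 2j = n the square is -1; the
  others rely on q^d \<noteq> 1 for 0 < d < n.\<close>

lemma p_square_ne_1:
  assumes "i \<in> pts n" shows "(p i)\<^sup>2 \<noteq> 1"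
proof
  let ?j = "snd i"
  assume "(p i)\<^sup>2 = 1"
  then have *: "hh powi (int n - 2 * int ?j) = - 1" by (simp add: p_square minus_equation_iff[of _ 1])
  have j: "?j < n" using assms by (auto simp: pts_def)
  have sq: "(hh ^ a)\<^sup>2 = qq ^ a" for a by (simp only: qq_power)
  consider "?j = 0" | "2 * ?j = n" | "0 < ?j" "2 * ?j < n" | "n < 2 * ?j" by linarith
  then show False
  proof cases
    case 1
    then show False using * hn by simp
  next
    case 2
    then have "int n - 2 * int ?j = 0" by linarith
    then show False using * by simp
  next
    case 3
    then have e: "int n - 2 * int ?j = int (n - 2 * ?j)" by linarith
    have "hh ^ (n - 2 * ?j) = - 1" using *[unfolded e] by (simp only: power_int_of_nat)
    then have "qq ^ (n - 2 * ?j) = 1" unfolding sq[symmetric] by simp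
    then show False using q_ne_1[of "n - 2 * ?j"] 3 by simp
  next
    case 4
    then have e: "int n - 2 * int ?j = - int (2 * ?j - n)" by linarith
    have "inverse (hh ^ (2 * ?j - n)) = - 1"
      using *[unfolded e] by (simp only: power_int_minus power_int_of_nat)
    then have "hh ^ (2 * ?j - n) = - 1" by (metis inverse_inverse_eq inverse_minus_eq inverse_1)
    then have "qq ^ (2 * ?j - n) = 1" unfolding sq[symmetric] by simp
    moreover have "0 < 2 * ?j - n" "2 * ?j - n < n" using 4 j by linarith+
    ultimately show False using q_ne_1 by blast
  qed
qed

text \<open>Up to a unit, \<open>EE\<close> is the product of distinct linear factors, so the
  quotient is the ring of functions on its zeros.\<close>

lemma prod_pts: "(\<Prod>i\<in>pts n. lX 1 - lconst (p i))
    = (\<Prod>j<n. lconst (hh powi (int n - 2 * int j))) * lX (int n) * EE"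
proof -
  have pair: "(lX 1 - lconst (p (True, j))) * (lX 1 - lconst (p (False, j)))
      = lconst (hh powi (int n - 2 * int j)) * (1 + lconst (hh powi (2 * int j - int n)) * lX 2)" for j
  proof -
    have "p (False, j) = - p (True, j)" by (simp add: pt_def)
    then have "(lX 1 - lconst (p (True, j))) * (lX 1 - lconst (p (False, j)))
        = lX 2 - lconst ((p (True, j))\<^sup>2)"
      by (simp add: lconst_uminus lX2_power(1) lconst_mult algebra_simps power2_eq_square)
    also have "\<dots> = lX 2 + lconst (hh powi (int n - 2 * int j))"
      by (simp add: p_square lconst_uminus)
    finally have 1: "(lX 1 - lconst (p (True, j))) * (lX 1 - lconst (p (False, j))) = \<dots>" .
    have "hh powi (int n - 2 * int j) * hh powi (2 * int j - int n) = 1"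
      using hh by (simp add: power_int_add[symmetric])
    then have "lconst (hh powi (int n - 2 * int j)) * lconst (hh powi (2 * int j - int n)) = 1"
      by (simp flip: lconst_mult)
    then show ?thesis unfolding 1 by (simp add: distrib_left mult.assoc[symmetric])
  qed
  have "(\<Prod>i\<in>pts n. lX 1 - lconst (p i)) = (\<Prod>b\<in>UNIV. \<Prod>j<n. lX 1 - lconst (p (b, j)))"
    by (simp add: pts_def prod.cartesian_product)
  also have "\<dots> = (\<Prod>j<n. (lX 1 - lconst (p (True, j))) * (lX 1 - lconst (p (False, j))))"
    by (simp add: UNIV_bool prod.distrib mult.commute)
  also have "\<dots> = (\<Prod>j<n. lconst (hh powi (int n - 2 * int j)))
      * (\<Prod>j<n. 1 + lconst (hh powi (2 * int j - int n)) * lX 2)"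
    unfolding pair prod.distrib ..
  also have "(\<Prod>j<n. 1 + lconst (hh powi (2 * int j - int n)) * lX 2) = lX (int n) * EE"
    unfolding E_curve_prod[OF hh] by (simp add: mult.assoc[symmetric])
  finally show ?thesis by (simp only: mult.assoc)
qed

lemma leval_EE: "i \<in> pts n \<Longrightarrow> leval (p i) EE = 0"
proof -
  assume i: "i \<in> pts n"
  then have j: "snd i \<in> {..<n}" by (auto simp: pts_def)
  have "hh powi (2 * int (snd i) - int n) * hh powi (int n - 2 * int (snd i)) = 1"
    using hh by (simp add: power_int_add[symmetric])
  then have "leval (p i) (1 + lconst (hh powi (2 * int (snd i) - int n)) * lX 2) = 0"
    using p_square[of i] p_ne_0[of i] by (simp add: leval_add leval_mult)
  then show ?thesis
    unfolding E_curve_prod[OF hh] using j p_ne_0[of i]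
    by (auto simp: leval_mult leval_prod intro!: prod_zero)
qed

lemma qclass_leval: "qclass EE f = qclass EE g \<longleftrightarrow> (\<forall>i\<in>pts n. leval (p i) f = leval (p i) g)"
proof
  assume "qclass EE f = qclass EE g"
  then obtain k where "f - g = EE * k" unfolding qclass_eq_iff by (auto elim: dvdE)
  then have "leval (p i) (f - g) = 0" if "i \<in> pts n" for i
    using that p_ne_0[of i] by (simp add: leval_mult leval_EE)
  then show "\<forall>i\<in>pts n. leval (p i) f = leval (p i) g" by (simp add: leval_diff)
next
  assume "\<forall>i\<in>pts n. leval (p i) f = leval (p i) g"
  then have "(\<Prod>i\<in>pts n. lX 1 - lconst (p i)) dvd f - g"
    by (intro vanishing_dvd p_inj) (auto simp: p_ne_0 leval_diff)
  then show "qclass EE f = qclass EE g"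
    unfolding prod_pts qclass_eq_iff by (rule dvd_mult_right)
qed

lemma leval_interp: "i \<in> pts n \<Longrightarrow> k \<in> pts n \<Longrightarrow> leval (p k) (interp n \<sigma> r i) = (if k = i then 1 else 0)"
proof -
  assume ik: "i \<in> pts n" "k \<in> pts n"
  have e: "leval (p k) (interp n \<sigma> r i) = (\<Prod>l\<in>pts n - {i}. inverse (p i - p l) * (p k - p l))"
    unfolding interp_def using p_ne_0[of k] by (simp add: leval_prod leval_mult leval_diff)
  show ?thesis
  proof (cases "k = i")
    case True
    have "p i \<noteq> p l" if "l \<in> pts n - {i}" for l
      using that ik inj_on_eq_iff[OF p_inj] by blast
    then have "inverse (p i - p l) * (p k - p l) = 1" if "l \<in> pts n - {i}" for l
      using that True by simp
    then have "(\<Prod>l\<in>pts n - {i}. inverse (p i - p l) * (p k - p l)) = 1" by (rule prod.neutral[OF ballI])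
    then show ?thesis using e True by simp
  next
    case False
    then have "k \<in> pts n - {i}" using ik by simp
    then show ?thesis unfolding e using False by (auto intro!: prod_zero)
  qed
qed

lemma leval_interp_sum:
  assumes "k \<in> pts n"
  shows "leval (p k) (\<Sum>i\<in>pts n. lconst (c i) * interp n \<sigma> r i) = c k"
proof -
  have "leval (p k) (\<Sum>i\<in>pts n. lconst (c i) * interp n \<sigma> r i)
      = (\<Sum>i\<in>pts n. if i = k then c k else 0)"
    unfolding leval_sum using assms p_ne_0[of k] by (intro sum.cong) (auto simp: leval_mult leval_interp)
  then show ?thesis using assms by simp
qed

lemma basis_interp: "is_basis MM (pts n) (\<lambda>i. qclass EE (interp n \<sigma> r i))"
  unfolding is_basis_def
proof (intro conjI ballI)
  show "finite (pts n)" by simp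
  show "(\<lambda>i. qclass EE (interp n \<sigma> r i)) ` pts n \<subseteq> carrier MM" by (auto simp: carrier_pol_quot)
  fix x assume "x \<in> carrier MM"
  then obtain f where x: "x = qclass EE f" by (rule pol_quot_cases)
  have lc: "lincomb MM (pts n) c (\<lambda>i. qclass EE (interp n \<sigma> r i))
      = qclass EE (\<Sum>i\<in>pts n. lconst (c i) * interp n \<sigma> r i)" for c
    by (rule pol_quot_lincomb) auto
  have iff: "x = lincomb MM (pts n) c (\<lambda>i. qclass EE (interp n \<sigma> r i)) \<longleftrightarrow> (\<forall>i\<in>pts n. c i = leval (p i) f)" for c
    unfolding lc x qclass_leval by (auto simp: leval_interp_sum)
  show "\<exists>!c. (\<forall>i. i \<notin> pts n \<longrightarrow> c i = 0) \<and> x = lincomb MM (pts n) c (\<lambda>i. qclass EE (interp n \<sigma> r i))"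
    unfolding iff by (rule ex1I[of _ "\<lambda>i. if i \<in> pts n then leval (p i) f else 0"]) auto
qed

lemma X_semisimple: "semisimple_op MM (opX MM)"
proof (rule is_basis_semisimple[OF refl basis_interp])
  fix i assume i: "i \<in> pts n"
  have "qclass EE (X_pol (interp n \<sigma> r i)) = qclass EE (lconst (p i) * interp n \<sigma> r i)"
    unfolding qclass_leval
    by (auto simp: X_pol_def leval_mult p_ne_0 leval_interp i)
  then show "\<exists>c. opX MM (qclass EE (interp n \<sigma> r i)) = c \<odot>\<^bsub>MM\<^esub> qclass EE (interp n \<sigma> r i)"
    by (auto simp: pol_quot_smult)
qed

section \<open>The Gaussian on the spectrum of X\<close>

abbreviation "ga \<equiv> gauss n \<sigma> r"
abbreviation "GG \<equiv> gaussian n \<sigma> r"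

lemma leval_GG: "i \<in> pts n \<Longrightarrow> leval (p i) GG = ga i"
  unfolding gaussian_def by (rule leval_interp_sum)

lemma ga_ne_0: "ga i \<noteq> 0"
  using r \<sigma>_ne_0 by (simp add: gauss_def)

lemma inverse_\<sigma>: "inverse \<sigma> = - \<sigma>"
  using \<sigma> by (intro inverse_unique) (simp add: power2_eq_square)

text \<open>With \<open>pi_pt\<close> this is the origin of \<open>gauss\<close>: the function must
  be invariant under x -> 1/x, to commute with T, and satisfy g(x) = r^{-1} x g(h/x), to turn \<pi>
  into q^{-1/4} X \<pi>. Applied alternately, the two reflections of labels run from (True, 0)
  through all 2n points, so the value there fixes the others. For j = 0 the inverse need not be a
  zero of \<open>EE\<close>; see \<open>T_coeff_0\<close>.\<close>

lemma inverse_pt: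
  assumes "i \<in> pts n" "snd i \<noteq> 0"
  shows "inverse (p i) = p (\<not> fst i, n - snd i)" "(\<not> fst i, n - snd i) \<in> pts n"
    "ga (\<not> fst i, n - snd i) = ga i"
proof -
  have j: "snd i < n" "0 < snd i" using assms by (auto simp: pts_def)
  have e: "int n - 2 * int (n - snd i) = - (int n - 2 * int (snd i))" using j by (simp add: of_nat_diff)
  have "inverse (p i) = inverse (if fst i then \<sigma> else - \<sigma>) * r powi (- (int n - 2 * int (snd i)))"
    unfolding pt_def by (simp only: inverse_mult_distrib power_int_minus)
  also have "inverse (if fst i then \<sigma> else - \<sigma>) = (if \<not> fst i then \<sigma> else - \<sigma>)"
    by (simp add: inverse_\<sigma>)
  finally show "inverse (p i) = p (\<not> fst i, n - snd i)" unfolding pt_def fst_conv snd_conv e .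
  show "(\<not> fst i, n - snd i) \<in> pts n" using j by (simp add: pts_def)
  show "ga (\<not> fst i, n - snd i) = ga i"
    using j by (simp add: gauss_def of_nat_diff mult.commute)
qed

lemma pi_pt:
  assumes "i \<in> pts n"
  shows "hh / p i = p (\<not> fst i, n - Suc (snd i))" "(\<not> fst i, n - Suc (snd i)) \<in> pts n"
    "ga i = inverse r * p i * ga (\<not> fst i, n - Suc (snd i))"
proof -
  have j: "snd i < n" using assms by (auto simp: pts_def)
  have e: "int n - 2 * int (n - Suc (snd i)) = 2 + - (int n - 2 * int (snd i))" using j by (simp add: of_nat_diff)
  have "hh / p i = inverse (if fst i then \<sigma> else - \<sigma>) * (r powi 2 * r powi (- (int n - 2 * int (snd i))))"
  proof -
    have "r powi 2 = hh" by simp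
    then show ?thesis unfolding pt_def
      by (simp only: divide_inverse inverse_mult_distrib power_int_minus mult.left_commute)
  qed
  also have "inverse (if fst i then \<sigma> else - \<sigma>) = (if \<not> fst i then \<sigma> else - \<sigma>)"
    by (simp add: inverse_\<sigma>)
  also have "r powi 2 * r powi (- (int n - 2 * int (snd i))) = r powi (2 + - (int n - 2 * int (snd i)))"
    using r by (subst power_int_add) auto
  finally show "hh / p i = p (\<not> fst i, n - Suc (snd i))" unfolding pt_def fst_conv snd_conv e .
  show "(\<not> fst i, n - Suc (snd i)) \<in> pts n" using j by (simp add: pts_def)
  obtain b a where i: "i = (b, a)" by (cases i)
  have a: "a < n" using j i by simp
  obtain c where c: "n = Suc (a + c)" using a less_imp_Suc_add by blast
  have s: "\<sigma> * (- \<sigma>) = 1" using \<sigma> by (simp add: power2_eq_square)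
  have exps: "r powi (- (int a * (int n - int a)))
      = inverse r * r powi (int n - 2 * int a) * r powi (- (int c * (int n - int c)))"
  proof -
    have "inverse r = r powi (- 1)" by (simp add: power_int_minus)
    then have "inverse r * r powi (int n - 2 * int a) * r powi (- (int c * (int n - int c)))
        = r powi (- 1 + (int n - 2 * int a) + - (int c * (int n - int c)))"
      using r by (simp only: power_int_add simp_thms)
    also have "- 1 + (int n - 2 * int a) + - (int c * (int n - int c)) = - (int a * (int n - int a))"
      by (simp add: c algebra_simps)
    finally show ?thesis ..
  qed
  have nc: "n - Suc a = c" "n - c = Suc a" "n - a = Suc c" using c by auto
  show "ga i = inverse r * p i * ga (\<not> fst i, n - Suc (snd i))"
  proof (cases b)
    case True
    have P: "(- \<sigma>) ^ a = \<sigma> * (- \<sigma>) ^ Suc a" by (simp only: power_Suc mult.assoc[symmetric] s mult_1_left)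
    show ?thesis unfolding gauss_def pt_def i fst_conv snd_conv nc exps
      by (simp only: True if_True if_False simp_thms nc P mult_ac)
  next
    case False
    then show ?thesis unfolding gauss_def pt_def i fst_conv snd_conv nc exps
      by (simp add: nc mult_ac)
  qed
qed

text \<open>For j = 0 one has t x^2 = -t h^n = 1, so the coefficient of f(1/x) in T drops out just
  where 1/x may leave the spectrum.\<close>

lemma T_coeff_0:
  assumes "i \<in> pts n" "snd i = 0" shows "vv * (p i)\<^sup>2 - inverse vv = 0"
proof -
  have "vv * (vv * (p i)\<^sup>2) = 1"
    using tt assms(2) by (simp add: p_square mult.assoc[symmetric] flip: power2_eq_square)
  then have "vv * (p i)\<^sup>2 = inverse vv" using inverse_unique by metis
  then show ?thesis by simp
qed

text \<open>The value of T f at x depends only on f(x) and f(1/x); either the Gaussian agrees at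
  both points or the second term is absent.\<close>

lemma leval_T_GG:
  assumes i: "i \<in> pts n"
  shows "leval (p i) (T_pol vv (GG * f)) = ga i * leval (p i) (T_pol vv f)"
proof -
  let ?x = "p i"
  have key: "(vv * ?x\<^sup>2 - inverse vv) * leval (inverse ?x) (GG * f)
      = ga i * ((vv * ?x\<^sup>2 - inverse vv) * leval (inverse ?x) f)"
  proof (cases "snd i = 0")
    case True
    then show ?thesis using T_coeff_0[OF i] by simp
  next
    case False
    note ip = inverse_pt[OF i False]
    show ?thesis unfolding ip(1) by (simp add: leval_mult p_ne_0 leval_GG[OF ip(2)] ip(3))
  qed
  have "(?x\<^sup>2 - 1) * leval ?x (T_pol vv (GG * f)) = ga i * ((?x\<^sup>2 - 1) * leval ?x (T_pol vv f))"
    unfolding leval_T_pol[OF vv p_ne_0] key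
    by (simp add: leval_mult p_ne_0 leval_GG[OF i] algebra_simps)
  then show ?thesis using p_square_ne_1[OF i] by simp
qed

lemma T_GG: "qclass EE (T_pol vv (GG * f)) = qclass EE (GG * T_pol vv f)"
  unfolding qclass_leval by (simp add: leval_T_GG leval_mult p_ne_0 leval_GG)

text \<open>Y = \<pi> T, and evaluation at x after \<pi> is evaluation at h/x. The behaviour of the
  Gaussian under x -> h/x produces the factor r^{-1} x.\<close>

lemma Y_GG: "qclass EE (GG * Y_pol hh vv f) = qclass EE (lconst (inverse r) * X_pol (Y_pol hh vv (GG * f)))"
  unfolding qclass_leval
proof
  fix i assume i: "i \<in> pts n"
  note ip = pi_pt[OF i]
  have "leval (p i) (GG * Y_pol hh vv f) = ga i * leval (hh / p i) (T_pol vv f)"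
    by (simp add: leval_mult p_ne_0 leval_GG i Y_pol_def leval_pi_op[OF hh p_ne_0])
  also have "\<dots> = inverse r * p i * (ga (\<not> fst i, n - Suc (snd i)) * leval (hh / p i) (T_pol vv f))"
    by (subst ip(3)) (simp only: mult.assoc)
  also have "ga (\<not> fst i, n - Suc (snd i)) * leval (hh / p i) (T_pol vv f)
      = leval (hh / p i) (T_pol vv (GG * f))"
    unfolding ip(1) leval_T_GG[OF ip(2)] ..
  also have "inverse r * p i * leval (hh / p i) (T_pol vv (GG * f))
      = leval (p i) (lconst (inverse r) * X_pol (Y_pol hh vv (GG * f)))"
    by (simp add: leval_mult p_ne_0 Y_pol_def leval_pi_op[OF hh p_ne_0] X_pol_def)
  finally show "leval (p i) (GG * Y_pol hh vv f)
      = leval (p i) (lconst (inverse r) * X_pol (Y_pol hh vv (GG * f)))" .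
qed

end

section \<open>Operators inducing the projective action\<close>

lemma linear_mapD:
  assumes "linear_map M N F"
  shows "x \<in> carrier M \<Longrightarrow> F x \<in> carrier N"
    "x \<in> carrier M \<Longrightarrow> y \<in> carrier M \<Longrightarrow> F (x \<oplus>\<^bsub>M\<^esub> y) = F x \<oplus>\<^bsub>N\<^esub> F y"
    "x \<in> carrier M \<Longrightarrow> F (c \<odot>\<^bsub>M\<^esub> x) = c \<odot>\<^bsub>N\<^esub> F x"
  using assms by (auto simp: linear_map_def)

lemma linear_isoD:
  assumes "linear_iso M M F"
  shows "x \<in> carrier M \<Longrightarrow> F x \<in> carrier M"
    "x \<in> carrier M \<Longrightarrow> inv_op M F x \<in> carrier M"
    "x \<in> carrier M \<Longrightarrow> inv_op M F (F x) = x"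
    "x \<in> carrier M \<Longrightarrow> F (inv_op M F x) = x"
    "x \<in> carrier M \<Longrightarrow> F (c \<odot>\<^bsub>M\<^esub> x) = c \<odot>\<^bsub>M\<^esub> F x"
proof -
  have bij: "bij_betw F (carrier M) (carrier M)" and lin: "linear_map M M F"
    using assms by (auto simp: linear_iso_def)
  show "x \<in> carrier M \<Longrightarrow> F x \<in> carrier M" by (rule linear_mapD(1)[OF lin])
  show "x \<in> carrier M \<Longrightarrow> inv_op M F x \<in> carrier M"
    using bij by (metis bij_betw_def inv_into_into)
  show "x \<in> carrier M \<Longrightarrow> inv_op M F (F x) = x" by (rule bij_betw_inv_into_left[OF bij])
  show "x \<in> carrier M \<Longrightarrow> F (inv_op M F x) = x" by (rule bij_betw_inv_into_right[OF bij])
  show "x \<in> carrier M \<Longrightarrow> F (c \<odot>\<^bsub>M\<^esub> x) = c \<odot>\<^bsub>M\<^esub> F x" by (rule linear_mapD(3)[OF lin])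
qed

lemma linear_map_comp: "linear_map M M F \<Longrightarrow> linear_map M M G \<Longrightarrow> linear_map M M (\<lambda>x. F (G x))"
  unfolding linear_map_def by (auto simp: image_subset_iff)

lemma linear_iso_inv:
  assumes "module CC M" "linear_iso M M F"
  shows "linear_map M M (inv_op M F)"
proof -
  interpret module CC M by fact
  note F = linear_isoD[OF assms(2)]
  have add: "F (x \<oplus>\<^bsub>M\<^esub> y) = F x \<oplus>\<^bsub>M\<^esub> F y" if "x \<in> carrier M" "y \<in> carrier M" for x y
    using assms(2) that by (auto simp: linear_iso_def linear_map_def)
  have "inv_op M F (x \<oplus>\<^bsub>M\<^esub> y) = inv_op M F x \<oplus>\<^bsub>M\<^esub> inv_op M F y" if "x \<in> carrier M" "y \<in> carrier M" for x y
    using F(3)[of "inv_op M F x \<oplus>\<^bsub>M\<^esub> inv_op M F y"] that by (simp add: add F)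
  moreover have "inv_op M F (c \<odot>\<^bsub>M\<^esub> x) = c \<odot>\<^bsub>M\<^esub> inv_op M F x" if "x \<in> carrier M" for x c
    using F(3)[of "c \<odot>\<^bsub>M\<^esub> inv_op M F x"] that by (simp add: F smult_closed)
  ultimately show ?thesis unfolding linear_map_def using F(2) by auto
qed

text \<open>The conjugation conditions of \<open>psl2_action\<close> on one operator, without the
  braid relation, which \<open>tau_psl2\<close> recovers for good parameters.\<close>

definition tau_plus :: "complex \<Rightarrow> 'b hmod \<Rightarrow> ('b \<Rightarrow> 'b) \<Rightarrow> bool" where
  "tau_plus r M A \<longleftrightarrow> linear_iso M M A \<and> (\<forall>x\<in>carrier M. A (opX M x) = opX M (A x) \<and>
     A (opT M x) = opT M (A x) \<and> A (opY M x) = inverse r \<odot>\<^bsub>M\<^esub> opX M (opY M (A x)))"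

definition tau_minus :: "complex \<Rightarrow> 'b hmod \<Rightarrow> ('b \<Rightarrow> 'b) \<Rightarrow> bool" where
  "tau_minus r M B \<longleftrightarrow> linear_iso M M B \<and> (\<forall>x\<in>carrier M. B (opY M x) = opY M (B x) \<and>
     B (opT M x) = opT M (B x) \<and> B (opX M x) = r \<odot>\<^bsub>M\<^esub> opY M (opX M (B x)))"

lemma psl2_action_tau: "psl2_action r M A B \<Longrightarrow> tau_plus r M A \<and> tau_minus r M B"
  by (auto simp: psl2_action_def tau_plus_def tau_minus_def)

lemma tau_scale:
  assumes M: "module CC M" and iso: "linear_iso M M (opX M)" "linear_iso M M (opY M)" "linear_iso M M (opT M)"
    and c: "c \<noteq> 0"
  shows "tau_plus r M A \<Longrightarrow> tau_plus r M (\<lambda>x. c \<odot>\<^bsub>M\<^esub> A x)"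
    "tau_minus r M A \<Longrightarrow> tau_minus r M (\<lambda>x. c \<odot>\<^bsub>M\<^esub> A x)"
proof -
  interpret module CC M by (rule M)
  note ops = linear_isoD[OF iso(1)] linear_isoD[OF iso(2)] linear_isoD[OF iso(3)]
  have comm: "a \<odot>\<^bsub>M\<^esub> (b \<odot>\<^bsub>M\<^esub> x) = b \<odot>\<^bsub>M\<^esub> (a \<odot>\<^bsub>M\<^esub> x)" if "x \<in> carrier M" for a b x
    using smult_assoc1[of a b x] smult_assoc1[of b a x] that by (simp add: mult.commute)
  have iso_scale: "linear_iso M M (\<lambda>x. c \<odot>\<^bsub>M\<^esub> A x)" if "linear_iso M M A"
  proof -
    note A = linear_isoD[OF that]
    have cc: "c \<odot>\<^bsub>M\<^esub> (inverse c \<odot>\<^bsub>M\<^esub> x) = x" "inverse c \<odot>\<^bsub>M\<^esub> (c \<odot>\<^bsub>M\<^esub> x) = x" if "x \<in> carrier M" for x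
      using smult_assoc1[of c "inverse c" x] smult_assoc1[of "inverse c" c x] smult_one[of x] that c by simp_all
    have add: "A (x \<oplus>\<^bsub>M\<^esub> y) = A x \<oplus>\<^bsub>M\<^esub> A y" if "x \<in> carrier M" "y \<in> carrier M" for x y
      using \<open>linear_iso M M A\<close> that by (auto simp: linear_iso_def linear_map_def)
    have "bij_betw (\<lambda>x. c \<odot>\<^bsub>M\<^esub> A x) (carrier M) (carrier M)"
      by (rule bij_betw_byWitness[where f' = "\<lambda>y. inv_op M A (inverse c \<odot>\<^bsub>M\<^esub> y)"])
        (auto simp: A cc smult_closed)
    then show ?thesis
      by (auto simp: linear_iso_def linear_map_def A smult_closed add smult_r_distr comm)
  qed
  show "tau_plus r M (\<lambda>x. c \<odot>\<^bsub>M\<^esub> A x)" if "tau_plus r M A"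
    using that iso_scale linear_isoD[of M A] by (auto simp: tau_plus_def ops smult_closed comm)
  show "tau_minus r M (\<lambda>x. c \<odot>\<^bsub>M\<^esub> A x)" if "tau_minus r M A"
    using that iso_scale linear_isoD[of M A] by (auto simp: tau_minus_def ops smult_closed comm)
qed

text \<open>On an irreducible module Schur's lemma then makes \<open>A B\<^sup>-\<^sup>1 A\<close> and \<open>B\<^sup>-\<^sup>1 A B\<^sup>-\<^sup>1\<close> proportional.\<close>

lemma braid_conjugation:
  assumes M: "module CC M" and X: "linear_iso M M (opX M)" and Y: "linear_iso M M (opY M)"
    and A: "tau_plus r M A" and B: "tau_minus r M B" and r: "r \<noteq> 0" and x: "x \<in> carrier M"
  defines "P \<equiv> \<lambda>x. A (inv_op M B (A x))" and "R \<equiv> \<lambda>x. inv_op M B (A (inv_op M B x))"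
    and "iY \<equiv> inv_op M (opY M)"
  shows "P (opX M x) = iY (P x)" "R (opX M x) = iY (R x)"
    "P (opY M x) = inverse r \<odot>\<^bsub>M\<^esub> (inverse r \<odot>\<^bsub>M\<^esub> iY (opX M (opY M (P x))))"
    "R (opY M x) = inverse r \<odot>\<^bsub>M\<^esub> (inverse r \<odot>\<^bsub>M\<^esub> iY (opX M (opY M (R x))))"
proof -
  interpret module CC M by (rule M)
  have isoA: "linear_iso M M A" and isoB: "linear_iso M M B"
    using A B by (auto simp: tau_plus_def tau_minus_def)
  let ?iX = "inv_op M (opX M)" and ?Bi = "inv_op M B"
  note lX = linear_isoD[OF X] and lY = linear_isoD[OF Y, folded iY_def]
  note lA = linear_isoD[OF isoA] and lB = linear_isoD[OF isoB]
  note iXs = linear_mapD(3)[OF linear_iso_inv[OF M X]]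
  note iYs = linear_mapD(3)[OF linear_iso_inv[OF M Y], folded iY_def]
  note iBs = linear_mapD(3)[OF linear_iso_inv[OF M isoB]]
  have rr: "r \<odot>\<^bsub>M\<^esub> (inverse r \<odot>\<^bsub>M\<^esub> y) = y" "inverse r \<odot>\<^bsub>M\<^esub> (r \<odot>\<^bsub>M\<^esub> y) = y" if "y \<in> carrier M" for y
    using smult_assoc1[of r "inverse r" y] smult_assoc1[of "inverse r" r y] smult_one[of y] that r by simp_all
  note cl = lX(1,2) lY(1,2) lA(1) lB(1,2) smult_closed UNIV_I CC_simps(1)
  have AX: "A (opX M y) = opX M (A y)" if "y \<in> carrier M" for y using A that by (simp add: tau_plus_def)
  have AY: "A (opY M y) = inverse r \<odot>\<^bsub>M\<^esub> opX M (opY M (A y))" if "y \<in> carrier M" for y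
    using A that by (simp add: tau_plus_def)
  \<comment> \<open>A sends Y to r^{-1} X Y, hence Y^{-1} to r Y^{-1} X^{-1}.\<close>
  have AiY: "A (iY y) = r \<odot>\<^bsub>M\<^esub> iY (?iX (A y))" if y: "y \<in> carrier M" for y
  proof -
    have "r \<odot>\<^bsub>M\<^esub> A y = opX M (opY M (A (iY y)))"
      using AY[of "iY y"] y by (simp add: cl lY rr)
    then have "r \<odot>\<^bsub>M\<^esub> iY (?iX (A y)) = iY (?iX (opX M (opY M (A (iY y)))))"
      using y by (simp add: cl iXs iYs flip: \<open>r \<odot>\<^bsub>M\<^esub> A y = _\<close>)
    then show ?thesis using y by (simp add: cl lX lY)
  qed
  have BY: "B (opY M y) = opY M (B y)" if "y \<in> carrier M" for y using B that by (simp add: tau_minus_def)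
  have BX: "B (opX M y) = r \<odot>\<^bsub>M\<^esub> opY M (opX M (B y))" if "y \<in> carrier M" for y
    using B that by (simp add: tau_minus_def)
  have iBY: "?Bi (opY M y) = opY M (?Bi y)" if y: "y \<in> carrier M" for y
    using lB(3)[of "opY M (?Bi y)"] y by (simp add: cl BY lB)
  have iBiY: "?Bi (iY y) = iY (?Bi y)" if y: "y \<in> carrier M" for y
    using iBY[of "iY y"] lY(3)[of "?Bi (iY y)"] y by (simp add: cl lY)
  \<comment> \<open>B sends X to r Y X and fixes Y, so its inverse sends X to r^{-1} Y^{-1}
    X.\<close>
  have iBX: "?Bi (opX M y) = inverse r \<odot>\<^bsub>M\<^esub> iY (opX M (?Bi y))" if y: "y \<in> carrier M" for y
  proof -
    have "opX M (?Bi y) = ?Bi (B (opX M (?Bi y)))" using y by (simp add: cl lB)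
    also have "\<dots> = r \<odot>\<^bsub>M\<^esub> opY M (?Bi (opX M y))"
      using y by (simp add: BX cl lB iBs iBY)
    finally have "iY (opX M (?Bi y)) = r \<odot>\<^bsub>M\<^esub> ?Bi (opX M y)"
      using y by (simp add: cl iYs lY)
    then show ?thesis using y by (simp add: cl rr)
  qed
  \<comment> \<open>Conjugation by P and by R has the same effect: X goes to Y^{-1} and Y goes to
    q^{-1/2} Y^{-1} X Y.\<close>
  show "P (opX M x) = iY (P x)" using x
    by (simp add: P_def AX AiY iBX cl lA lX lY lB iYs iXs rr)
  show "R (opX M x) = iY (R x)" using x
    by (simp add: R_def AX AiY iBX iBiY iBs cl lA lX lY lB iYs iXs rr)
  show "P (opY M x) = inverse r \<odot>\<^bsub>M\<^esub> (inverse r \<odot>\<^bsub>M\<^esub> iY (opX M (opY M (P x))))" using x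
    by (simp add: P_def AY AX AiY iBX iBY iBs cl lA lX lY lB iYs iXs rr)
  show "R (opY M x) = inverse r \<odot>\<^bsub>M\<^esub> (inverse r \<odot>\<^bsub>M\<^esub> iY (opX M (opY M (R x))))" using x
    by (simp add: R_def AY AX iBX iBY iBs cl lA lX lY lB iYs iXs rr)
qed

text \<open>For operators inverse to each other only modulo the ideal, such as multiplication by the
  Gaussian and by its pointwise inverse on the spectrum.\<close>

lemma pol_quot_linear_iso_mod:
  assumes M: "M = pol_quot h v e" and "descends e F" "descends e G"
    "\<And>f. qclass e (F (G f)) = qclass e f" "\<And>f. qclass e (G (F f)) = qclass e f"
    "\<And>f. A (qclass e f) = qclass e (F f)"
  shows "linear_iso M M A"
proof -
  have inj: "inj_on A (carrier M)"
  proof (rule inj_onI)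
    fix x y assume "x \<in> carrier M" "y \<in> carrier M" "A x = A y"
    then obtain f g where fg: "x = qclass e f" "y = qclass e g" "qclass e (F f) = qclass e (F g)"
      by (auto simp: M carrier_pol_quot assms(6))
    then have "qclass e (G (F f)) = qclass e (G (F g))" by (intro descends_cong[OF assms(3)])
    then show "x = y" using fg assms(5) by simp
  qed
  have "A (qclass e (G f)) = qclass e f" for f by (simp add: assms)
  then have "carrier M \<subseteq> A ` carrier M" unfolding M carrier_pol_quot by (metis image_subsetI rangeI image_eqI)
  moreover have "linear_map M M A"
    unfolding M by (rule pol_quot_linear_map[OF assms(2,6)])
  ultimately show ?thesis
    using inj unfolding linear_iso_def bij_betw_def by (auto simp: linear_map_def)
qed

section \<open>Schur's lemma and its consequences\<close>

context good_curve
begin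

text \<open>Commuting with X makes U the multiplication by u = U(1). Commuting with Y makes u an
  eigenvector for the eigenvalue t^{1/2} of 1, hence a scalar by \<open>scalar_of_Y\<close>.\<close>

lemma schur:
  assumes lin: "linear_map MM MM U"
    and UX: "\<And>x. x \<in> carrier MM \<Longrightarrow> U (opX MM x) = opX MM (U x)"
    and UY: "\<And>x. x \<in> carrier MM \<Longrightarrow> U (opY MM x) = opY MM (U x)"
  shows "\<exists>c. \<forall>x\<in>carrier MM. U x = c \<odot>\<^bsub>MM\<^esub> x"
proof -
  note lin = linear_mapD[OF lin]
  have cl: "qclass EE f \<in> carrier MM" for f by (simp add: carrier_pol_quot)
  obtain u where u: "U (qclass EE 1) = qclass EE u"
    using lin(1)[OF cl[of 1]] by (rule pol_quot_cases)
  have scale: "U (qclass EE (lconst c * f)) = qclass EE (lconst c * (f * u))" if "U (qclass EE f) = qclass EE (f * u)" for c f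
    using lin(3)[OF cl, of c f] that by (simp add: pol_quot_smult)
  have up: "U (qclass EE (X_pol f)) = qclass EE (X_pol f * u)" if "U (qclass EE f) = qclass EE (f * u)" for f
    using UX[OF cl, of f] that by (simp add: X_pol_def mult.assoc)
  have down: "U (qclass EE (X_inv f)) = qclass EE (X_inv f * u)" if "U (qclass EE f) = qclass EE (f * u)" for f
  proof -
    obtain g where g: "U (qclass EE (X_inv f)) = qclass EE g"
      using lin(1)[OF cl] by (rule pol_quot_cases)
    have "qclass EE (X_pol g) = qclass EE (f * u)"
      using UX[OF cl, of "X_inv f"] that g by simp
    from descends_cong[OF descends_X_inv this] have "qclass EE g = qclass EE (X_inv (f * u))" by simp
    then show ?thesis unfolding g by (simp add: X_inv_def mult.assoc)
  qed
  have "U (qclass EE (lX (int i))) = qclass EE (lX (int i) * u)" for i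
  proof (induction i)
    case (Suc i)
    from up[OF Suc] show ?case by (simp add: X_pol_def lX_add)
  qed (simp add: u)
  moreover have "U (qclass EE (lX (- int i))) = qclass EE (lX (- int i) * u)" for i
  proof (induction i)
    case (Suc i)
    have "X_inv (lX (- int i)) = (lX (- int (Suc i)) :: complex laurent)"
      by (simp add: X_inv_def lX_add[symmetric])
    with down[OF Suc] show ?case by simp
  qed (simp add: u)
  ultimately have lX: "U (qclass EE (lX k)) = qclass EE (lX k * u)" for k
    by (cases k rule: int_cases2) auto
  have all: "U (qclass EE f) = qclass EE (f * u)" for f
  proof (induction f rule: laurent_induct)
    case zero
    show ?case using scale[OF lX[of 0], of 0] by simp
  next
    case (monom c k)
    show ?case using scale[OF lX] by (simp add: mult.assoc)
  next
    case (add f g)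
    then show ?case using lin(2)[OF cl cl, of f g] by (simp add: pol_quot_add distrib_right)
  qed
  have "qclass EE (Y_pol hh vv u) = opY MM (U (qclass EE 1))" by (simp add: u)
  also have "\<dots> = U (qclass EE (lconst vv))"
    using UY[OF cl, of 1] vv by (simp add: Y_pol_def T_pol_1)
  also have "\<dots> = qclass EE (lconst vv * u)" by (rule all)
  finally have "qclass EE u = qclass EE (lconst (cf u 0))" by (rule scalar_of_Y)
  then have "qclass EE (f * u) = qclass EE (lconst (cf u 0) * f)" for f
    using descends_cong[OF descends_mult, of EE u "lconst (cf u 0)" f] by (simp add: mult.commute)
  then have "U (qclass EE f) = cf u 0 \<odot>\<^bsub>MM\<^esub> qclass EE f" for f
    by (simp add: all pol_quot_smult)
  then show ?thesis by (metis pol_quot_cases)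
qed

lemma carrier_nontrivial: "qclass EE 1 \<noteq> \<zero>\<^bsub>MM\<^esub>"
proof -
  have "cf 1 0 = 1" using cf_ep[OF idx_0] by (simp add: ep_0)
  then have "qclass EE 1 \<noteq> qclass EE 0" unfolding qclass_cf by (auto simp: cf_0)
  then show ?thesis by (simp add: pol_quot_zero)
qed

lemma smult_0_MM: "x \<in> carrier MM \<Longrightarrow> 0 \<odot>\<^bsub>MM\<^esub> x = \<zero>\<^bsub>MM\<^esub>"
  by (auto simp: carrier_pol_quot pol_quot_simps)

text \<open>The operator R^{-1} P commutes with X and Y, so it is a scalar; the scalar is nonzero
  because P is onto and 1 is not zero in the quotient.\<close>

lemma intertwiner_scalar:
  assumes P: "linear_iso MM MM P" and R: "linear_iso MM MM R"
    and X: "\<And>x. x \<in> carrier MM \<Longrightarrow> inv_op MM R (P (opX MM x)) = opX MM (inv_op MM R (P x))"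
    and Y: "\<And>x. x \<in> carrier MM \<Longrightarrow> inv_op MM R (P (opY MM x)) = opY MM (inv_op MM R (P x))"
  shows "\<exists>c. c \<noteq> 0 \<and> (\<forall>x\<in>carrier MM. P x = c \<odot>\<^bsub>MM\<^esub> R x)"
proof -
  note lP = linear_isoD[OF P] and lR = linear_isoD[OF R]
  have "linear_map MM MM (\<lambda>x. inv_op MM R (P x))"
    by (rule linear_map_comp[OF linear_iso_inv[OF module_pol_quot R]])
      (use P in \<open>simp add: linear_iso_def\<close>)
  from schur[OF this X Y] obtain c where c: "\<And>x. x \<in> carrier MM \<Longrightarrow> inv_op MM R (P x) = c \<odot>\<^bsub>MM\<^esub> x" by blast
  have Pc: "P x = c \<odot>\<^bsub>MM\<^esub> R x" if "x \<in> carrier MM" for x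
    using c[OF that] lR(4)[OF lP(1)[OF that]] lR(5)[OF that, of c] by simp
  have "c \<noteq> 0"
  proof
    assume c0: "c = 0"
    have one: "qclass EE 1 \<in> carrier MM" by (simp add: carrier_pol_quot)
    have "qclass EE 1 = P (inv_op MM P (qclass EE 1))" using lP(4)[OF one] by simp
    also have "\<dots> = \<zero>\<^bsub>MM\<^esub>" using Pc[OF lP(2)[OF one]] c0 smult_0_MM[OF lR(1)[OF lP(2)[OF one]]] by simp
    finally show False using carrier_nontrivial by simp
  qed
  then show ?thesis using Pc by blast
qed

lemma tau_plus_unique:
  assumes A: "tau_plus r MM A" and A': "tau_plus r MM A'"
  shows "\<exists>c. c \<noteq> 0 \<and> (\<forall>x\<in>carrier MM. A' x = c \<odot>\<^bsub>MM\<^esub> A x)"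
proof (rule intertwiner_scalar)
  have iA: "linear_iso MM MM A" and iA': "linear_iso MM MM A'"
    using A A' by (auto simp: tau_plus_def)
  then show "linear_iso MM MM A'" "linear_iso MM MM A" by auto
  note lA = linear_isoD[OF iA] and lA' = linear_isoD[OF iA'] and lX = linear_isoD[OF iso_X] and lY = linear_isoD[OF iso_Y]
  fix x assume x: "x \<in> carrier MM"
  define y where "y = inv_op MM A (A' x)"
  have y: "y \<in> carrier MM" "A' x = A y" using x by (simp_all add: y_def lA lA')
  have "A' (opX MM x) = A (opX MM y)" using A A' x y by (simp add: tau_plus_def)
  then show "inv_op MM A (A' (opX MM x)) = opX MM (inv_op MM A (A' x))"
    using y by (simp add: lA lX)
  have "A' (opY MM x) = A (opY MM y)" using A A' x y by (simp add: tau_plus_def)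
  then show "inv_op MM A (A' (opY MM x)) = opY MM (inv_op MM A (A' x))"
    using y by (simp add: lA lY)
qed

lemma tau_minus_unique:
  assumes A: "tau_minus r MM A" and A': "tau_minus r MM A'"
  shows "\<exists>c. c \<noteq> 0 \<and> (\<forall>x\<in>carrier MM. A' x = c \<odot>\<^bsub>MM\<^esub> A x)"
proof (rule intertwiner_scalar)
  have iA: "linear_iso MM MM A" and iA': "linear_iso MM MM A'"
    using A A' by (auto simp: tau_minus_def)
  then show "linear_iso MM MM A'" "linear_iso MM MM A" by auto
  note lA = linear_isoD[OF iA] and lA' = linear_isoD[OF iA'] and lX = linear_isoD[OF iso_X] and lY = linear_isoD[OF iso_Y]
  fix x assume x: "x \<in> carrier MM"
  define y where "y = inv_op MM A (A' x)"
  have y: "y \<in> carrier MM" "A' x = A y" using x by (simp_all add: y_def lA lA')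
  have "A' (opX MM x) = A (opX MM y)" using A A' x y by (simp add: tau_minus_def)
  then show "inv_op MM A (A' (opX MM x)) = opX MM (inv_op MM A (A' x))"
    using y by (simp add: lA lX)
  have "A' (opY MM x) = A (opY MM y)" using A A' x y by (simp add: tau_minus_def)
  then show "inv_op MM A (A' (opY MM x)) = opY MM (inv_op MM A (A' x))"
    using y by (simp add: lA lY)
qed

lemma linear_iso_comp: "linear_iso M M F \<Longrightarrow> linear_iso M M G \<Longrightarrow> linear_iso M M (\<lambda>x. F (G x))"
  unfolding linear_iso_def using linear_map_comp bij_betw_trans[of G _ _ F] by (auto simp: comp_def)

lemma linear_iso_inv_op: "linear_iso MM MM F \<Longrightarrow> linear_iso MM MM (inv_op MM F)"
  using linear_iso_inv[OF module_pol_quot] bij_betw_inv_into by (auto simp: linear_iso_def)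

text \<open>By \<open>braid_conjugation\<close> the two sides of the braid relation conjugate X and
  Y alike, so they are proportional.\<close>

lemma tau_psl2:
  assumes A: "tau_plus r MM A" and B: "tau_minus r MM B"
  shows "psl2_action r MM A B"
proof -
  have iA: "linear_iso MM MM A" and iB: "linear_iso MM MM B"
    using A B by (auto simp: tau_plus_def tau_minus_def)
  let ?P = "\<lambda>x. A (inv_op MM B (A x))" and ?R = "\<lambda>x. inv_op MM B (A (inv_op MM B x))"
  have iP: "linear_iso MM MM ?P"
    by (rule linear_iso_comp[OF iA linear_iso_comp[OF linear_iso_inv_op[OF iB] iA]])
  have iR: "linear_iso MM MM ?R"
    by (rule linear_iso_comp[OF linear_iso_inv_op[OF iB] linear_iso_comp[OF iA linear_iso_inv_op[OF iB]]])
  note lP = linear_isoD[OF iP] and lR = linear_isoD[OF iR] and lX = linear_isoD[OF iso_X] and lY = linear_isoD[OF iso_Y]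
  note br = braid_conjugation[OF module_pol_quot iso_X iso_Y A B r]
  have "\<exists>c. c \<noteq> 0 \<and> (\<forall>x\<in>carrier MM. ?P x = c \<odot>\<^bsub>MM\<^esub> ?R x)"
  proof (rule intertwiner_scalar[OF iP iR])
    fix x assume x: "x \<in> carrier MM"
    define y where "y = inv_op MM ?R (?P x)"
    have y: "y \<in> carrier MM" "?P x = ?R y" using x by (simp_all only: y_def lP lR)
    have "?P (opX MM x) = ?R (opX MM y)"
      by (simp only: br(1)[OF x] br(2)[OF y(1)] y(2))
    then show "inv_op MM ?R (?P (opX MM x)) = opX MM (inv_op MM ?R (?P x))"
      using lR(3)[OF lX(1)[OF y(1)]] by (simp only: y_def)
    have "?P (opY MM x) = ?R (opY MM y)"
      by (simp only: br(3)[OF x] br(4)[OF y(1)] y(2))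
    then show "inv_op MM ?R (?P (opY MM x)) = opY MM (inv_op MM ?R (?P x))"
      using lR(3)[OF lY(1)[OF y(1)]] by (simp only: y_def)
  qed
  then show ?thesis
    using A B unfolding psl2_action_def tau_plus_def tau_minus_def by blast
qed

section \<open>Construction of operators inducing \<tau>\<open>\<^sub>+\<close> and
  \<tau>\<open>\<^sub>-\<close>\<close>

definition tauA :: "complex laurent set \<Rightarrow> complex laurent set" where
  "tauA = induced EE (\<lambda>f. GG * f)"

lemma tauA_q: "tauA (qclass EE f) = qclass EE (GG * f)"
  unfolding tauA_def by (rule induced_qclass[OF descends_mult])

lemma tau_plus_tauA: "tau_plus r MM tauA"
proof -
  define GI where "GI = (\<Sum>i\<in>pts n. lconst (inverse (ga i)) * interp n \<sigma> r i)"
  have "qclass EE (GG * (GI * f)) = qclass EE f" "qclass EE (GI * (GG * f)) = qclass EE f" for f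
    unfolding qclass_leval GI_def
    by (simp_all add: leval_mult p_ne_0 leval_GG leval_interp_sum ga_ne_0)
  then have "linear_iso MM MM tauA"
    by (intro pol_quot_linear_iso_mod[OF refl descends_mult[of EE GG] descends_mult[of EE GI]] tauA_q)
  moreover have "GG * X_pol f = X_pol (GG * f)" for f by (simp add: X_pol_def mult_ac)
  ultimately show ?thesis
    unfolding tau_plus_def
    by (auto simp: carrier_pol_quot tauA_q T_GG Y_GG pol_quot_smult)
qed

text \<open>This is t^{-|m|/2} q^{-m^2/4}. Dependence on |m| alone yields commutation with T, whose
  blocks are spanned by e_m and e_{-m}; the quadratic exponent yields the recursion
  \<open>bt_reflect\<close> for X \<pi>.\<close>

definition bt :: "int \<Rightarrow> complex" where
  "bt m = inverse (vv ^ nat \<bar>m\<bar> * r ^ (nat \<bar>m\<bar>)\<^sup>2)"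

definition diag :: "(int \<Rightarrow> complex) \<Rightarrow> complex laurent \<Rightarrow> complex laurent" where
  "diag b f = (\<Sum>m\<in>idx n. lconst (b m * cf f m) * ep m)"

lemma cf_diag: "cf (diag b f) = (\<lambda>m. b m * cf f m)"
  unfolding diag_def cf_lincomb using cf_outside by auto

lemma descends_diag: "descends EE (diag b)"
proof -
  have "cf (EE * f) = (\<lambda>_. 0)" for f
  proof -
    have "qclass EE (EE * f) = qclass EE 0" by (simp add: qclass_eq_iff)
    then show ?thesis by (simp add: qclass_cf cf_0)
  qed
  then have "diag b (EE * f) = 0" for f by (simp add: diag_def)
  moreover have "diag b (lconst c * f) = lconst c * diag b f" for c f
    unfolding diag_def cf_scale sum_distrib_left lconst_mult
    by (rule sum.cong) (simp_all only: mult_ac)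
  moreover have "diag b (f + g) = diag b f + diag b g" for f g
    unfolding diag_def cf_add distrib_left lconst_add distrib_right sum.distrib ..
  ultimately show ?thesis unfolding descends_def by simp
qed

definition tauB :: "complex laurent set \<Rightarrow> complex laurent set" where
  "tauB = induced EE (diag bt)"

lemma tauB_q: "tauB (qclass EE f) = qclass EE (diag bt f)"
  unfolding tauB_def by (rule induced_qclass[OF descends_diag])

lemma bt_ne_0: "bt m \<noteq> 0" using r vv by (simp add: bt_def)

lemma cf_ext:
  assumes "descends EE F" "descends EE G" "\<And>m. m \<in> idx n \<Longrightarrow> cf (F (ep m)) = cf (G (ep m))"
  shows "cf (F f) = cf (G f)"
proof -
  have "cf (F f) = (\<lambda>l. \<Sum>m\<in>idx n. cf f m * cf (F (ep m)) l)" by (rule cf_descends[OF assms(1)])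
  also have "\<dots> = (\<lambda>l. \<Sum>m\<in>idx n. cf f m * cf (G (ep m)) l)"
    by (rule ext, rule sum.cong) (auto simp: assms(3))
  also have "\<dots> = cf (G f)" by (rule cf_descends[OF assms(2), symmetric])
  finally show ?thesis .
qed

lemma cf_T_support:
  assumes "m \<in> idx n" "l \<in> idx n" "\<bar>m\<bar> \<noteq> \<bar>l\<bar>"
  shows "cf (T_pol vv (ep m)) l = 0"
proof -
  have bound: "int (Suc k) \<in> idx n \<Longrightarrow> k < n" "- int (Suc k) \<in> idx n \<Longrightarrow> Suc k < n" for k
    by (auto simp: idx_def)
  have "m = 0 \<or> (\<exists>k. m = int (Suc k)) \<or> (\<exists>k. m = - int (Suc k))"
    by (metis int_cases2 neg_equal_0_iff_equal of_nat_0 nat.exhaust)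
  then show ?thesis
    using assms bound by (auto simp: cf_T_0 cf_T_pos cf_T_neg simp del: of_nat_Suc)
qed

lemma cf_diag_ep: "m \<in> idx n \<Longrightarrow> cf (diag bt (ep m)) = cf (lconst (bt m) * ep m)"
  unfolding cf_diag cf_scale by (auto simp: cf_ep)

lemma cf_image: "descends EE F \<Longrightarrow> cf f = cf g \<Longrightarrow> cf (F f) = cf (F g)"
  using descends_cong[of EE F f g] by (simp add: qclass_cf)

lemma descends_comp': "descends EE F \<Longrightarrow> descends EE G \<Longrightarrow> descends EE (\<lambda>f. F (G f))"
  using descends_comp[of EE F G] by (simp add: comp_def)

lemma diag_T: "cf (diag bt (T_pol vv f)) = cf (T_pol vv (diag bt f))"
proof (rule cf_ext[where F = "\<lambda>f. diag bt (T_pol vv f)" and G = "\<lambda>f. T_pol vv (diag bt f)"])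
  show "descends EE (\<lambda>f. diag bt (T_pol vv f))" "descends EE (\<lambda>f. T_pol vv (diag bt f))"
    by (rule descends_comp'[OF descends_diag descends_T] descends_comp'[OF descends_T descends_diag])+
  fix m assume m: "m \<in> idx n"
  have 1: "cf (T_pol vv (diag bt (ep m))) = cf (lconst (bt m) * T_pol vv (ep m))"
    using cf_image[OF descends_T cf_diag_ep[OF m]] vv by (simp add: T_pol_lconst_mult)
  have 2: "bt l * cf (T_pol vv (ep m)) l = bt m * cf (T_pol vv (ep m)) l" for l
  proof (cases "l \<in> idx n \<and> \<bar>m\<bar> \<noteq> \<bar>l\<bar>")
    case True
    then show ?thesis using cf_T_support[OF m] by simp
  next
    case False
    then show ?thesis using cf_outside[of l] by (auto simp: bt_def)
  qed
  show "cf (diag bt (T_pol vv (ep m))) = cf (T_pol vv (diag bt (ep m)))"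
    unfolding 1 cf_diag cf_scale by (rule ext) (rule 2)
qed

lemma diag_T_inv: "cf (diag bt (T_inv vv f)) = cf (T_inv vv (diag bt f))"
  using diag_T[of f]
  by (simp add: T_inv_def cf_diag cf_diff cf_scale fun_eq_iff right_diff_distrib mult.left_commute)

lemma diag_Y: "cf (diag bt (Y_pol hh vv f)) = cf (Y_pol hh vv (diag bt f))"
  by (simp add: cf_diag cf_Y fun_eq_iff)

text \<open>As (k+1)^2 - k^2 = 2k + 1 and h = r^2, the ratio of consecutive values is a Y-eigenvalue
  up to one factor r.\<close>

lemma bt_reflect:
  assumes "m \<in> idx n" shows "bt (1 - m) = r * ev (1 - m) * bt m"
proof (cases "m \<le> 0")
  case True
  then obtain k where k: "m = - int k" by (metis nonpos_int_cases)
  have b1: "bt (1 - m) = inverse (vv ^ Suc k * r ^ (Suc k)\<^sup>2)"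
    by (simp add: bt_def k nat_add_distrib)
  have e1: "ev (1 - m) = inverse (vv * hh ^ Suc k)"
    by (simp add: Y_eig_def k nat_add_distrib)
  have b2: "bt m = inverse (vv ^ k * r ^ k\<^sup>2)" by (simp add: bt_def k)
  have rel: "r ^ (Suc k)\<^sup>2 * r = r ^ k\<^sup>2 * hh ^ Suc k"
  proof -
    have "(Suc k)\<^sup>2 + 1 = k\<^sup>2 + 2 * Suc k" by (simp add: power2_eq_square)
    then have "r ^ ((Suc k)\<^sup>2 + 1) = r ^ (k\<^sup>2 + 2 * Suc k)" by (simp only:)
    then show ?thesis by (simp only: power_add power_mult power_one_right)
  qed
  have "inverse (V * R1) = r * inverse (vv * H) * inverse (W * R2)"
    if "R1 * r = R2 * H" "V = vv * W" "H \<noteq> 0" "W \<noteq> 0" "R2 \<noteq> 0" for V R1 H W R2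
  proof -
    have R1: "R1 = R2 * H / r" using that(1) r by (simp add: field_simps)
    show ?thesis unfolding R1 that(2) using that(3-5) r vv by (simp add: field_simps)
  qed
  from this[OF rel power_Suc[of vv k]] show ?thesis
    unfolding b1 e1 b2 using hh vv r by simp
next
  case False
  then obtain k where k: "m = int (Suc k)" by (metis not_le pos_int_cases Suc_pred)
  have b1: "bt m = inverse (vv ^ Suc k * r ^ (Suc k)\<^sup>2)"
    by (simp add: bt_def k nat_add_distrib)
  have e1: "ev (1 - m) = vv * hh ^ k"
    by (simp add: Y_eig_def k)
  have b2: "bt (1 - m) = inverse (vv ^ k * r ^ k\<^sup>2)" by (simp add: bt_def k)
  have rel: "r ^ (Suc k)\<^sup>2 = r ^ k\<^sup>2 * (r * hh ^ k)"
  proof -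
    have "(Suc k)\<^sup>2 = k\<^sup>2 + (1 + 2 * k)" by (simp add: power2_eq_square)
    then have "r ^ (Suc k)\<^sup>2 = r ^ (k\<^sup>2 + (1 + 2 * k))" by (simp only:)
    then show ?thesis by (simp only: power_add power_mult power_one_right)
  qed
  have "inverse (W * R2) = r * (vv * H) * inverse (V * R1)"
    if "R1 = R2 * (r * H)" "V = vv * W" "H \<noteq> 0" "W \<noteq> 0" "R2 \<noteq> 0" for V R1 H W R2
    using that r vv by (simp add: field_simps)
  from this[OF rel power_Suc[of vv k]] show ?thesis
    unfolding b1 e1 b2 using hh vv r by simp
qed

lemma diag_XP: "cf (diag bt (XP f)) = cf (lconst r * Y_pol hh vv (XP (diag bt f)))"
proof (rule cf_ext[where F = "\<lambda>f. diag bt (XP f)" and G = "\<lambda>f. lconst r * Y_pol hh vv (XP (diag bt f))"])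
  show "descends EE (\<lambda>f. diag bt (XP f))" by (rule descends_comp'[OF descends_diag descends_XP])
  show G: "descends EE (\<lambda>f. lconst r * Y_pol hh vv (XP (diag bt f)))"
    by (rule descends_comp'[OF descends_mult descends_comp'[OF descends_Y
          descends_comp'[OF descends_XP descends_diag]]])
  fix m assume m: "m \<in> idx n"
  obtain k where k: "XP (ep m) = lconst (hh powi k) * ep (1 - m)" using XP_ep[OF m] by blast
  have m': "1 - m \<in> idx n" using m by (auto simp: idx_def)
  have "cf (XP (diag bt (ep m))) = cf (lconst (bt m) * (lconst (hh powi k) * ep (1 - m)))"
    using cf_image[OF descends_XP cf_diag_ep[OF m]] by (simp add: XP_lconst k)
  then have "cf (lconst r * Y_pol hh vv (XP (diag bt (ep m))))
      = (\<lambda>l. r * (ev l * (bt m * (hh powi k * (if l = 1 - m then 1 else 0)))))"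
    unfolding cf_scale cf_Y cf_ep[OF m'] by simp
  moreover have "cf (diag bt (XP (ep m))) = (\<lambda>l. bt l * (hh powi k * (if l = 1 - m then 1 else 0)))"
    unfolding cf_diag k cf_scale cf_ep[OF m'] ..
  ultimately show "cf (diag bt (XP (ep m))) = cf (lconst r * Y_pol hh vv (XP (diag bt (ep m))))"
    using bt_reflect[OF m] by (auto simp: fun_eq_iff)
qed

text \<open>X is (X \<pi>) Y T^{-1}, and the diagonal operator commutes with Y and T^{-1}, so only X
  \<pi> contributes the factor r Y.\<close>

lemma diag_X: "cf (diag bt (X_pol f)) = cf (lconst r * Y_pol hh vv (X_pol (diag bt f)))"
proof -
  have X: "X_pol f = XP (Y_pol hh vv (T_inv vv f))" for f
    using hh vv by (simp add: XP_def X_pol_def Y_pol_def)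
  have "cf (diag bt (Y_pol hh vv (T_inv vv f))) = cf (Y_pol hh vv (T_inv vv (diag bt f)))"
    unfolding diag_Y by (rule cf_image[OF descends_Y diag_T_inv])
  from cf_image[OF descends_XP this]
  have "cf (XP (diag bt (Y_pol hh vv (T_inv vv f)))) = cf (X_pol (diag bt f))" unfolding X .
  then show ?thesis unfolding X[of f] diag_XP by (simp add: cf_scale cf_Y)
qed

lemma tau_minus_tauB: "tau_minus r MM tauB"
proof -
  have *: "qclass EE (diag bt (diag (\<lambda>m. inverse (bt m)) f)) = qclass EE f"
    "qclass EE (diag (\<lambda>m. inverse (bt m)) (diag bt f)) = qclass EE f" for f
    unfolding qclass_cf cf_diag by (simp_all add: mult.assoc[symmetric] bt_ne_0)
  have "linear_iso MM MM tauB"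
    by (rule pol_quot_linear_iso_mod[OF refl descends_diag descends_diag * tauB_q])
  then show ?thesis
    unfolding tau_minus_def
    by (auto simp: carrier_pol_quot tauB_q qclass_cf diag_T diag_Y diag_X pol_quot_smult)
qed

end

section \<open>Regularity of the projective action\<close>

text \<open>A common finite support is demanded, so that reduction to the window is one finite sum
  valid for all parameters.\<close>

definition regular_family :: "complex set \<Rightarrow> (complex \<Rightarrow> complex laurent) \<Rightarrow> bool" where
  "regular_family D F \<longleftrightarrow> (\<exists>S. finite S \<and> (\<forall>r\<in>D. \<forall>k. lk (F r) k \<noteq> 0 \<longrightarrow> k \<in> S)) \<and>
     (\<forall>k. regular_on D (\<lambda>r. lk (F r) k))"

lemma regular_family_support:
  assumes "regular_family D F"
  obtains S where "finite S" "\<And>r k. r \<in> D \<Longrightarrow> lk (F r) k \<noteq> 0 \<Longrightarrow> k \<in> S"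
proof -
  have "\<exists>S. finite S \<and> (\<forall>r\<in>D. \<forall>k. lk (F r) k \<noteq> 0 \<longrightarrow> k \<in> S)"
    using assms unfolding regular_family_def by (rule conjunct1)
  then obtain S where "finite S \<and> (\<forall>r\<in>D. \<forall>k. lk (F r) k \<noteq> 0 \<longrightarrow> k \<in> S)" ..
  then show ?thesis using that[of S] by simp
qed

lemma regular_family_coeff: "regular_family D F \<Longrightarrow> regular_on D (\<lambda>r. lk (F r) k)"
  unfolding regular_family_def by simp

lemma regular_family_const: "regular_family D (\<lambda>_. f)"
  unfolding regular_family_def
  by (intro conjI exI[of _ "Poly_Mapping.keys f"] allI regular_on_const) (simp_all add: in_keys_iff)

lemma regular_family_lconst:
  assumes "regular_on D a" shows "regular_family D (\<lambda>r. lconst (a r))"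
proof -
  have "regular_on D (\<lambda>r. lk (lconst (a r)) k)" for k
    by (cases "k = 0") (simp_all add: lookup_lconst assms regular_on_const)
  then show ?thesis
    unfolding regular_family_def
    by (intro conjI exI[of _ "{0}"] allI) (simp_all add: lookup_lconst)
qed

lemma regular_family_add:
  assumes "regular_family D F" "regular_family D G"
  shows "regular_family D (\<lambda>r. F r + G r)"
proof -
  obtain S where S: "finite S" "\<And>r k. r \<in> D \<Longrightarrow> lk (F r) k \<noteq> 0 \<Longrightarrow> k \<in> S"
    using regular_family_support[OF assms(1)] by metis
  obtain T where T: "finite T" "\<And>r k. r \<in> D \<Longrightarrow> lk (G r) k \<noteq> 0 \<Longrightarrow> k \<in> T"
    using regular_family_support[OF assms(2)] by metis
  have 1: "\<forall>r\<in>D. \<forall>k. lk (F r + G r) k \<noteq> 0 \<longrightarrow> k \<in> S \<union> T"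
  proof (intro ballI allI impI)
    fix r k assume "r \<in> D" "lk (F r + G r) k \<noteq> 0"
    then have "lk (F r) k \<noteq> 0 \<or> lk (G r) k \<noteq> 0" by (auto simp: lookup_add)
    then show "k \<in> S \<union> T" using S(2) T(2) \<open>r \<in> D\<close> by blast
  qed
  have 2: "regular_on D (\<lambda>r. lk (F r + G r) k)" for k
    unfolding lookup_add using assms by (intro regular_on_add regular_family_coeff)
  show ?thesis unfolding regular_family_def
    using 1 2 S(1) T(1) by (intro conjI exI[of _ "S \<union> T"]) simp_all
qed

lemma regular_family_mult:
  assumes "regular_family D F" "regular_family D G"
  shows "regular_family D (\<lambda>r. F r * G r)"
proof -
  obtain S where S: "finite S" "\<And>r k. r \<in> D \<Longrightarrow> lk (F r) k \<noteq> 0 \<Longrightarrow> k \<in> S"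
    using regular_family_support[OF assms(1)] by metis
  obtain T where T: "finite T" "\<And>r k. r \<in> D \<Longrightarrow> lk (G r) k \<noteq> 0 \<Longrightarrow> k \<in> T"
    using regular_family_support[OF assms(2)] by metis
  have eq: "lk (F r * G r) k = (\<Sum>l\<in>S. lk (F r) l * lk (G r) (k - l))" if "r \<in> D" for r k
  proof -
    have F: "F r = (\<Sum>l\<in>S. lconst (lk (F r) l) * lX l)"
      by (rule laurent_eq_sum[OF S(1) S(2)[OF that]])
    have "F r * G r = (\<Sum>l\<in>S. lconst (lk (F r) l) * lX l) * G r"
      by (rule arg_cong[OF F, of "\<lambda>x. x * G r"])
    also have "\<dots> = (\<Sum>l\<in>S. lconst (lk (F r) l) * (lX l * G r))"
      unfolding sum_distrib_right mult.assoc ..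
    finally have "lk (F r * G r) k = lk (\<Sum>l\<in>S. lconst (lk (F r) l) * (lX l * G r)) k"
      by (rule arg_cong)
    also have "\<dots> = (\<Sum>l\<in>S. lk (F r) l * lk (G r) (k - l))"
      unfolding lookup_sum by (rule sum.cong) simp_all
    finally show ?thesis .
  qed
  let ?U = "(\<lambda>(a, b). a + b) ` (S \<times> T)"
  have 1: "k \<in> ?U" if rD: "r \<in> D" and nz: "lk (F r * G r) k \<noteq> 0" for r k
  proof -
    obtain l where "l \<in> S" "lk (F r) l * lk (G r) (k - l) \<noteq> 0"
      using sum.not_neutral_contains_not_neutral[OF nz[unfolded eq[OF rD]]] by metis
    then have "l \<in> S" "k - l \<in> T" using T(2)[OF rD, of "k - l"] by auto
    then show ?thesis by (intro image_eqI[of _ _ "(l, k - l)"]) auto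
  qed
  have 2: "regular_on D (\<lambda>r. lk (F r * G r) k)" for k
  proof -
    have "regular_on D (\<lambda>r. \<Sum>l\<in>S. lk (F r) l * lk (G r) (k - l))"
      using assms by (intro regular_on_sum regular_on_mult regular_family_coeff)
    then show ?thesis
      using regular_on_cong[of D "\<lambda>r. lk (F r * G r) k" "\<lambda>r. \<Sum>l\<in>S. lk (F r) l * lk (G r) (k - l)"] eq[of _ k]
      by simp
  qed
  show ?thesis unfolding regular_family_def
    using 1 2 S(1) T(1) by (intro conjI exI[of _ ?U] allI) auto
qed

lemma regular_family_uminus: "regular_family D F \<Longrightarrow> regular_family D (\<lambda>r. - F r)"
  using regular_family_mult[OF regular_family_const[of D "- 1"], of F] by simp

lemma regular_family_diff:
  "regular_family D F \<Longrightarrow> regular_family D G \<Longrightarrow> regular_family D (\<lambda>r. F r - G r)"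
  using regular_family_add[OF _ regular_family_uminus, of D F G] by simp

lemma regular_family_sum:
  "(\<And>i. i \<in> S \<Longrightarrow> regular_family D (F i)) \<Longrightarrow> regular_family D (\<lambda>r. \<Sum>i\<in>S. F i r)"
  by (induction S rule: infinite_finite_induct) (auto intro: regular_family_add regular_family_const)

lemma regular_family_prod:
  "(\<And>i. i \<in> S \<Longrightarrow> regular_family D (F i)) \<Longrightarrow> regular_family D (\<lambda>r. \<Prod>i\<in>S. F i r)"
  by (induction S rule: infinite_finite_induct) (auto intro: regular_family_mult regular_family_const)

lemma regular_family_reduces:
  assumes "regular_family D F" "n > 0" "0 \<notin> D" shows "reduces n D F"
proof -
  obtain S where S: "finite S" "\<And>r k. r \<in> D \<Longrightarrow> lk (F r) k \<noteq> 0 \<Longrightarrow> k \<in> S"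
    using regular_family_support[OF assms(1)] by metis
  show ?thesis
    by (rule reduces_family[OF assms(2,3) S(1)])
      (simp_all add: S(2) regular_family_coeff[OF assms(1)])
qed

context
  fixes n :: nat and \<sigma> :: complex and D :: "complex set"
  assumes D: "\<And>r. r \<in> D \<Longrightarrow> good_curve n \<sigma> r" and n0: "n > 0" and \<sigma>0: "\<sigma>\<^sup>2 = - 1" and D0: "0 \<notin> D"
begin

lemma regular_pt: "regular_on D (\<lambda>r. pt n \<sigma> r i)"
  unfolding pt_def by (intro regular_on_mult regular_on_const regular_on_power_int regular_on_id) (use D0 in auto)

lemma regular_gaussian: "regular_family D (gaussian n \<sigma>)"
  unfolding gaussian_def interp_def
proof (intro regular_family_sum regular_family_mult regular_family_prod regular_family_lconst
    regular_family_diff regular_family_const regular_pt regular_on_inverse regular_on_diff)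
  show "regular_on D (\<lambda>r. gauss n \<sigma> r i)" for i
    unfolding gauss_def
    by (intro regular_on_mult regular_on_const regular_on_power_int regular_on_id) (use D0 in auto)
  fix i k r assume "i \<in> pts n" "k \<in> pts n - {i}" "r \<in> D"
  interpret good_curve n \<sigma> r by (rule D[OF \<open>r \<in> D\<close>])
  show "pt n \<sigma> r i - pt n \<sigma> r k \<noteq> 0"
    using inj_on_eq_iff[OF p_inj] \<open>i \<in> pts n\<close> \<open>k \<in> pts n - {i}\<close> by auto
qed

lemma regular_e_poly:
  assumes m: "m \<in> idx n"
  shows "regular_on D (\<lambda>r. lk (e_poly (r\<^sup>2) (curve_v n \<sigma> r) m) j)"
  unfolding regular_on_def
proof (intro exI ballI)
  fix r assume "r \<in> D"
  interpret good_curve n \<sigma> r by (rule D[OF \<open>r \<in> D\<close>])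
  show "s1.spec r (lk (e_poly (gen_r1\<^sup>2) (gen_curve n \<sigma>) m) j) (lk (e_poly (r\<^sup>2) (curve_v n \<sigma> r) m) j)"
    by (intro s1.spec_e_poly s1.spec_power spec_gen_r1 spec_curve r nondeg_idx m)
qed

text \<open>The basis e_m is unitriangular, so expanding a monomial in it needs no division and the
  coordinates stay regular.\<close>

lemma regular_cf:
  assumes i: "i \<in> idx n"
  obtains c where "\<And>m. regular_on D (c m)"
    "\<And>r m. r \<in> D \<Longrightarrow> m \<in> idx n \<Longrightarrow> good_curve.cf n \<sigma> r (lX i) m = c m r"
proof -
  let ?b = "\<lambda>r. e_poly (r\<^sup>2) (curve_v n \<sigma> r)"
  have "\<exists>c. (\<forall>m. regular_on D (c m)) \<and> (\<forall>r\<in>D. lX i = (\<Sum>m\<in>below (2 * n). lconst (c m r) * ?b r m))"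
  proof (rule triangular_expand[where R = "regular_on D"])
    show "triangular (2 * n) (?b r)" if "r \<in> D" for r
      using good_curve.triangular_ep[OF D[OF that]] .
    show "regular_on D (\<lambda>r. lk (?b r m) j)" if "m \<in> below (2 * n)" for m j
      using that by (intro regular_e_poly) (simp add: below_idx)
    show "j \<in> below (2 * n)" if "lk (lX i) j \<noteq> 0" for j
      using that i by (auto simp: lookup_lX below_idx split: if_splits)
  qed auto
  then obtain c where c: "\<And>m. regular_on D (c m)"
      "\<And>r. r \<in> D \<Longrightarrow> lX i = (\<Sum>m\<in>idx n. lconst (c m r) * ?b r m)"
    unfolding below_idx by blast
  have "good_curve.cf n \<sigma> r (lX i) m = c m r" if "r \<in> D" "m \<in> idx n" for r m
  proof -
    interpret good_curve n \<sigma> r by (rule D[OF that(1)])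
    show ?thesis using c(2)[OF that(1)] cf_lincomb[of "\<lambda>m. c m r"] that(2) by simp
  qed
  then show ?thesis using c(1) that by blast
qed

text \<open>The constant c absorbs the scalar by which a prescribed operator at the root of unity
  differs from the constructed one.\<close>

lemma regular_ops_scaled:
  assumes "\<And>j. j \<in> idx n \<Longrightarrow> reduces n D (F j)"
    and "\<And>r j. r \<in> D \<Longrightarrow> j \<in> idx n \<Longrightarrow> A r (qclass (E_curve n (r\<^sup>2)) (lX j)) = qclass (E_curve n (r\<^sup>2)) (F j r)"
  shows "regular_ops D (Vp_mod n \<sigma>) (idx n) (Vp_X n \<sigma>) (\<lambda>r x. c \<odot>\<^bsub>Vp_mod n \<sigma> r\<^esub> A r x)"
  unfolding regular_ops_def
proof
  fix j assume j: "j \<in> idx n"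
  show "regular_vectors D (Vp_mod n \<sigma>) (idx n) (Vp_X n \<sigma>) (\<lambda>r. c \<odot>\<^bsub>Vp_mod n \<sigma> r\<^esub> A r (Vp_X n \<sigma> r j))"
  proof (rule reduces_regular_vectors[OF _ n0 D0 \<sigma>0])
    show "reduces n D (\<lambda>r. lconst c * F j r)"
      by (intro reduces_scale assms(1) j regular_on_const)
    fix r assume "r \<in> D"
    interpret good_curve n \<sigma> r by (rule D[OF \<open>r \<in> D\<close>])
    show "c \<odot>\<^bsub>Vp_mod n \<sigma> r\<^esub> A r (Vp_X n \<sigma> r j) = qclass EE (lconst c * F j r)"
      by (simp add: Vp_mod_eq Vp_X_def ec_minus_n[OF \<sigma> r] assms(2)[OF \<open>r \<in> D\<close> j] pol_quot_smult)
  qed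
qed

lemma regular_ops_tauA:
  "regular_ops D (Vp_mod n \<sigma>) (idx n) (Vp_X n \<sigma>) (\<lambda>r x. c \<odot>\<^bsub>Vp_mod n \<sigma> r\<^esub> good_curve.tauA n \<sigma> r x)"
proof (rule regular_ops_scaled)
  show "reduces n D (\<lambda>r. gaussian n \<sigma> r * lX j)" for j
    by (intro regular_family_reduces regular_family_mult regular_gaussian regular_family_const n0 D0)
  show "good_curve.tauA n \<sigma> r (qclass (E_curve n (r\<^sup>2)) (lX j)) = qclass (E_curve n (r\<^sup>2)) (gaussian n \<sigma> r * lX j)"
    if "r \<in> D" for r j
    by (rule good_curve.tauA_q[OF D[OF that]])
qed

lemma regular_ops_tauB:
  "regular_ops D (Vp_mod n \<sigma>) (idx n) (Vp_X n \<sigma>) (\<lambda>r x. c \<odot>\<^bsub>Vp_mod n \<sigma> r\<^esub> good_curve.tauB n \<sigma> r x)"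
proof (rule regular_ops_scaled)
  fix j assume j: "j \<in> idx n"
  obtain a where a: "\<And>m. regular_on D (a m)"
    "\<And>r m. r \<in> D \<Longrightarrow> m \<in> idx n \<Longrightarrow> good_curve.cf n \<sigma> r (lX j) m = a m r"
    using regular_cf[OF j] by blast
  let ?bt = "\<lambda>m r. inverse (curve_v n \<sigma> r ^ nat \<bar>m\<bar> * r ^ (nat \<bar>m\<bar>)\<^sup>2)"
  have bt: "regular_on D (?bt m)" for m
  proof -
    have nz: "curve_v n \<sigma> r \<noteq> 0" "r \<noteq> 0" if "r \<in> D" for r
      using that D0 curve_v_ne_0[OF _ \<sigma>0] by metis+
    show ?thesis
      by (intro regular_on_inverse regular_on_mult regular_on_power regular_on_curve regular_on_id D0)
        (simp add: nz)
  qed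
  have fam: "reduces n D (\<lambda>r. e_poly (r\<^sup>2) (curve_v n \<sigma> r) m)" if m: "m \<in> idx n" for m
  proof (rule reduces_family[OF n0 D0, of "idx n"])
    show "finite (idx n)" by (simp add: idx_def)
    show "regular_on D (\<lambda>r. lk (e_poly (r\<^sup>2) (curve_v n \<sigma> r) m) k)" for k by (rule regular_e_poly[OF m])
    show "k \<in> idx n" if "lk (e_poly (r\<^sup>2) (curve_v n \<sigma> r) m) k \<noteq> 0" for r k
      using e_poly_support[OF that] m unfolding below_idx[symmetric] below_def by auto
  qed
  have "reduces n D (\<lambda>r. \<Sum>m\<in>idx n. lconst (?bt m r * a m r) * e_poly (r\<^sup>2) (curve_v n \<sigma> r) m)"
    by (intro reduces_sum reduces_scale fam regular_on_mult bt a)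
  then show "reduces n D (\<lambda>r. good_curve.diag n \<sigma> r (good_curve.bt n \<sigma> r) (lX j))"
  proof (rule reduces_cong_dvd)
    fix r assume "r \<in> D"
    interpret good_curve n \<sigma> r by (rule D[OF \<open>r \<in> D\<close>])
    have "diag bt (lX j) = (\<Sum>m\<in>idx n. lconst (?bt m r * a m r) * e_poly (r\<^sup>2) (curve_v n \<sigma> r) m)"
      unfolding diag_def bt_def by (rule sum.cong) (simp_all add: a(2)[OF \<open>r \<in> D\<close>])
    then show "EE dvd diag bt (lX j) - (\<Sum>m\<in>idx n. lconst (?bt m r * a m r) * e_poly (r\<^sup>2) (curve_v n \<sigma> r) m)"
      by simp
  qed
next
  show "good_curve.tauB n \<sigma> r (qclass (E_curve n (r\<^sup>2)) (lX j))
      = qclass (E_curve n (r\<^sup>2)) (good_curve.diag n \<sigma> r (good_curve.bt n \<sigma> r) (lX j))"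
    if "r \<in> D" for r j
    by (rule good_curve.tauB_q[OF D[OF that]])
qed

end

section \<open>The two modules at one good parameter\<close>

context good_curve
begin

lemma V_mod_eq: "V_mod n r vv = MM"
proof -
  have "rk (- int n) div 2 = n" by (simp add: rk_def)
  then have "e_at r vv (- int n) = e_poly hh vv (- int n)"
    using e_at_nondeg[of r vv "- int n"] nondeg_n by simp
  then show ?thesis by (simp only: V_mod_def ep_neg EE_eq[symmetric])
qed

lemma e_at_minus_n: "e_at r vv (- int n) = EE" "e_regular r vv (- int n)"
proof -
  have "rk (- int n) div 2 = n" by (simp add: rk_def)
  then have nd: "nondeg qq tt' (rk (- int n) div 2)" using nondeg_n by simp
  show "e_at r vv (- int n) = EE" using e_at_nondeg[OF nd] by (simp only: ep_neg EE_eq)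
  show "e_regular r vv (- int n)" by (rule e_regular_nondeg[OF nd])
qed

lemma V_well_defined: "V_well_defined n r vv"
  unfolding V_well_defined_def V_mod_eq e_at_minus_n(1)
  by (simp add: e_at_minus_n(2) stable_ideal_e daha_module_Q algebra_pol_quot)

lemma V_e_eq: "m \<in> idx n \<Longrightarrow> V_e n r vv m = qclass EE (ep m)"
  unfolding V_e_def e_at_minus_n(1) using e_at_nondeg[OF nondeg_idx] by simp

text \<open>The specializations in two variables and along the curve give the same classes of e_m,
  hence the same coordinates and norms.\<close>

lemma V_form_eq: "V_form n r vv = Vp_form n \<sigma> r"
proof -
  have "lincomb MM (idx n) c (V_e n r vv) = lincomb MM (idx n) c (Vp_e n \<sigma> r)" for c
    unfolding lincomb_e by (rule pol_quot_lincomb[OF finite_idx V_e_eq])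
  then have "coords MM (idx n) (V_e n r vv) = coords MM (idx n) (Vp_e n \<sigma> r)"
    by (simp add: coords_def fun_eq_iff)
  then show ?thesis
    by (simp add: V_form_def Vp_form_def orth_form_def fun_eq_iff V_mod_eq Vp_mod_eq)
qed

end

lemma (in unit_curve) V_form_ok: "V_form_ok n r vv"
proof -
  have "e_regular r vv m" if "m \<in> idx n" for m by (rule e_regular_nondeg[OF nondeg_idx[OF that]])
  moreover have "is_basis MM (idx n) (V_e n r vv)"
    by (rule triangular_is_basis[OF n r triangular_ep V_e_eq])
  ultimately show ?thesis
    unfolding V_form_ok_def V_mod_eq V_form_eq using hermitian_unitary by blast
qed

section \<open>Values of the parameter\<close>

text \<open>Excluding q^n = 1 also excludes h^n = -1, since q^n is the square of h^n.\<close>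

lemma good_curve_general:
  assumes "n > 0" "\<sigma>\<^sup>2 = - 1" "r \<in> general_r n"
  shows "good_curve n \<sigma> r"
proof unfold_locales
  show "n > 0" "\<sigma>\<^sup>2 = - 1" "r \<noteq> 0" using assms by (auto simp: general_r_def)
  have q: "((r\<^sup>2)\<^sup>2) ^ j \<noteq> 1" if "1 \<le> j" "j \<le> n" for j
    using assms(3) that by (auto simp: general_r_def)
  show "((r\<^sup>2)\<^sup>2) ^ j \<noteq> 1" if "0 < j" "j < n" for j using q[of j] that by simp
  show "(r\<^sup>2) ^ n \<noteq> - 1"
  proof
    assume "(r\<^sup>2) ^ n = - 1"
    then have "((r\<^sup>2)\<^sup>2) ^ n = 1" by (metis mult.commute power_mult power2_eq_1_iff)
    then show False using q[of n] assms(1) by simp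
  qed
qed

lemma cis_eq_1_imp: "cis x = 1 \<Longrightarrow> \<bar>x\<bar> < 2 * pi \<Longrightarrow> x = 0"
proof -
  assume "cis x = 1" and x: "\<bar>x\<bar> < 2 * pi"
  then have "cos x = 1" by (simp add: complex_eq_iff)
  then obtain i :: int where i: "x = of_int i * 2 * pi" using cos_one_2pi_int by blast
  have "\<bar>real_of_int i\<bar> < 1" using x by (simp add: i abs_mult)
  then have "i = 0" by linarith
  then show ?thesis by (simp add: i)
qed

text \<open>Here n |\<theta>| < 2\<pi>, so q^j = 1 with 0 < j \<le> n forces \<theta> = 0. For n > 1
  this contradicts r^4 \<noteq> 1, and in any case it gives h = 1, so that h^n is not -1.\<close>

lemma unit_curve_arg:
  assumes n: "n > 0" "n < N" and \<sigma>: "\<sigma>\<^sup>2 = - 1" and \<theta>: "\<bar>\<theta>\<bar> \<le> 2 * pi / real N"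
    and r2: "r\<^sup>2 = cis (\<theta> / 2)" and r4: "r ^ 4 \<noteq> 1 \<or> n = 1"
  shows "unit_curve n \<sigma> r"
proof -
  have "cmod (r\<^sup>2) = 1" by (simp add: r2)
  then have unit: "cmod r = 1" by (simp add: norm_power power2_eq_1_iff) (metis norm_ge_zero not_one_le_zero neg_0_le_iff_le)
  have small: "\<bar>real j * \<theta>\<bar> < 2 * pi" if "j < N" for j
  proof -
    have "\<bar>real j * \<theta>\<bar> \<le> real j * (2 * pi / real N)" using mult_left_mono[OF \<theta>, of "real j"] by (simp add: abs_mult)
    also have "\<dots> < 2 * pi" using that by (simp add: field_simps)
    finally show ?thesis .
  qed
  have q: "((r\<^sup>2)\<^sup>2) ^ j = cis (real j * \<theta>)" for j
    by (simp add: r2 DeMoivre)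
  show ?thesis
  proof unfold_locales
    show "n > 0" "\<sigma>\<^sup>2 = - 1" "cmod r = 1" by fact+
    show "r \<noteq> 0" using unit by auto
    show "((r\<^sup>2)\<^sup>2) ^ j \<noteq> 1" if j: "0 < j" "j < n" for j
    proof
      assume "((r\<^sup>2)\<^sup>2) ^ j = 1"
      then have "real j * \<theta> = 0" unfolding q using small[of j] j n by (intro cis_eq_1_imp) auto
      then have "\<theta> = 0" using j by simp
      moreover have "r ^ 4 = (r\<^sup>2)\<^sup>2" by simp
      ultimately show False using r4 j r2 by simp
    qed
    show "(r\<^sup>2) ^ n \<noteq> - 1"
    proof
      assume m: "(r\<^sup>2) ^ n = - 1"
      then have "((r\<^sup>2)\<^sup>2) ^ n = 1" by (metis mult.commute power_mult power2_eq_1_iff)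
      then have "real n * \<theta> = 0" unfolding q using small[of n] n by (intro cis_eq_1_imp) auto
      then have "\<theta> = 0" using n by simp
      then show False using m r2 by simp
    qed
  qed
qed

theorem proposition1p6:
  fixes N n :: nat and k k' :: real and r0 v0 \<sigma> :: complex
  assumes root: "primitive_root_of_unity (2 * N) (r0\<^sup>2)"
    and k: "2 * k \<in> \<int>" "0 < k" "k < real N / 2"
    and k': "k' = k - real N / 2"
    and n: "real n = real N - 2 * k"
    and t: "v0\<^sup>2 = (r0\<^sup>2) powi \<lfloor>2 * k\<rfloor>"
    and \<sigma>: "\<sigma> = v0 * r0 ^ n"
  shows
    "(r0\<^sup>2) powi \<lfloor>2 * k\<rfloor> = (r0\<^sup>2) powi (int N + \<lfloor>2 * k'\<rfloor>) \<and>
     (r0\<^sup>2) powi (int N + \<lfloor>2 * k'\<rfloor>) = - ((r0\<^sup>2) powi \<lfloor>2 * k'\<rfloor>) \<and>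
     curve_v n \<sigma> r0 = v0 \<and>
     (\<forall>r. r \<noteq> 0 \<longrightarrow> (curve_v n \<sigma> r)\<^sup>2 = - ((r\<^sup>2) powi \<lfloor>2 * k'\<rfloor>)) \<and>
     V_well_defined n r0 v0 \<and>
     (\<forall>r. r \<noteq> 0 \<longrightarrow> Vp_well_defined n \<sigma> r) \<and>
     (\<exists>dim. real dim = 2 * real N - 4 * k \<and> real dim = 4 * \<bar>k'\<bar> \<and>
        has_dim (V_mod n r0 v0) dim \<and> (\<forall>r. r \<noteq> 0 \<longrightarrow> has_dim (Vp_mod n \<sigma> r) dim)) \<and>
     flat_family (- {0}) (Vp_mod n \<sigma>) (idx n) (Vp_X n \<sigma>) \<and>
     V_form_ok n r0 v0 \<and>
     (\<exists>\<phi> d.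
        hmod_iso (Vp_mod n \<sigma> r0) (V_mod n r0 v0) \<phi> \<and>
        \<phi> \<in> ring_iso (Vp_mod n \<sigma> r0) (V_mod n r0 v0) \<and>
        (\<forall>x\<in>carrier (Vp_mod n \<sigma> r0). \<forall>y\<in>carrier (Vp_mod n \<sigma> r0).
           V_form n r0 v0 (\<phi> x) (\<phi> y) = Vp_form n \<sigma> r0 x y) \<and>
        (\<forall>r\<in>general_r d.
           irreducible_hmod (Vp_mod n \<sigma> r) \<and>
           semisimple_op (Vp_mod n \<sigma> r) (opX (Vp_mod n \<sigma> r)) \<and>
           semisimple_op (Vp_mod n \<sigma> r) (opY (Vp_mod n \<sigma> r))) \<and>
        (\<exists>A B. psl2_action r0 (V_mod n r0 v0) A B) \<and>
        (\<forall>A B. psl2_action r0 (V_mod n r0 v0) A B \<longrightarrow>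
           (\<exists>A' B'.
              (\<forall>r\<in>insert r0 (general_r d). psl2_action r (Vp_mod n \<sigma> r) (A' r) (B' r)) \<and>
              regular_ops (insert r0 (general_r d)) (Vp_mod n \<sigma>) (idx n) (Vp_X n \<sigma>) A' \<and>
              regular_ops (insert r0 (general_r d)) (Vp_mod n \<sigma>) (idx n) (Vp_X n \<sigma>) B' \<and>
              (\<forall>x\<in>carrier (Vp_mod n \<sigma> r0).
                 \<phi> (A' r0 x) = A (\<phi> x) \<and> \<phi> (B' r0 x) = B (\<phi> x)))) \<and>
        (\<forall>r\<in>insert r0 (general_r d). cmod r = 1 \<longrightarrow> Vp_form_ok n \<sigma> r) \<and>
        regular_form (insert r0 (general_r d) \<inter> {r. cmod r = 1}) (idx n) (Vp_X n \<sigma>)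
          (Vp_form n \<sigma>)) \<and>
     (\<forall>r \<theta>. \<bar>\<theta>\<bar> \<le> 2 * pi / real N \<and> r\<^sup>2 = cis (\<theta> / 2) \<and> (r ^ 4 \<noteq> 1 \<or> n = 1) \<longrightarrow>
        Vp_form_ok n \<sigma> r \<and> positive_definite (Vp_mod n \<sigma> r) (Vp_form n \<sigma> r))"
proof -
  define K where "K = \<lfloor>2 * k\<rfloor>"
  have K: "real_of_int K = 2 * k" using k(1) by (simp add: K_def)
  have nK: "int n = int N - K" using n K by linarith
  have n0: "n > 0" and nN: "n < N" using n k by linarith+
  \<comment> \<open>The doubles of k and k' are the integers N - n and -n, so the floors in the
    statement lose nothing.\<close>
  have "2 * k' = real_of_int (- int n)" using n k' by simp
  then have k'n: "\<lfloor>2 * k'\<rfloor> = - int n" by (metis floor_of_int)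
  have K': "K = int N - int n" "int N + \<lfloor>2 * k'\<rfloor> = K" using nK k'n by linarith+
  have rN: "(r0\<^sup>2) ^ (2 * N) = 1" and prim: "\<And>j. 0 < j \<Longrightarrow> j < 2 * N \<Longrightarrow> (r0\<^sup>2) ^ j \<noteq> 1"
    using root unfolding primitive_root_of_unity_def by blast+
  have N0: "N > 0" using nN by simp
  \<comment> \<open>h^N is a square root of 1 different from 1, hence -1. This sign turns t = h^{2k}
    into -h^{-n}, the equation of the curve.\<close>
  have "((r0\<^sup>2) ^ N)\<^sup>2 = 1" using rN by (simp add: power_mult[symmetric] mult.commute)
  then have hN: "(r0\<^sup>2) ^ N = - 1" using prim[of N] N0 by (simp add: power2_eq_1_iff)
  have r0: "r0 \<noteq> 0" using hN N0 by (auto simp: power_0_left)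
  have "cmod r0 ^ (2 * N) = 1" using arg_cong[OF hN, of cmod] by (simp add: norm_power power_mult)
  then have unit: "cmod r0 = 1" using N0 power_eq_1_iff[of "cmod r0" "2 * N"] by simp
  have "(r0\<^sup>2) powi K = (r0\<^sup>2) ^ N * (r0\<^sup>2) powi (- int n)"
    using r0 power_int_add[of "r0\<^sup>2" "int N" "- int n"] K'(1) by simp
  then have hK: "(r0\<^sup>2) powi K = - ((r0\<^sup>2) powi (- int n))" by (simp add: hN)
  have v0: "v0\<^sup>2 = - inverse ((r0\<^sup>2) ^ n)"
    using t hK by (simp add: K_def[symmetric] power_int_minus)
  have \<sigma>2: "\<sigma>\<^sup>2 = - 1"
    using r0 by (simp add: \<sigma> power_mult_distrib v0 power_mult[symmetric] mult.commute)
  \<comment> \<open>The constant \<sigma> = t^{1/2} r0^n selects the component v = \<sigma> r^{-n}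
    through the given value of t^{1/2} at r0.\<close>
  have cv: "curve_v n \<sigma> r0 = v0"
    using r0 by (simp add: curve_v_def \<sigma> power_int_minus)
  have uc0: "unit_curve n \<sigma> r0"
  proof unfold_locales
    show "n > 0" "\<sigma>\<^sup>2 = - 1" "r0 \<noteq> 0" "cmod r0 = 1" by fact+
    show "((r0\<^sup>2)\<^sup>2) ^ j \<noteq> 1" if "0 < j" "j < n" for j
      using prim[of "2 * j"] that nN by (simp only: power_mult) simp
    show "(r0\<^sup>2) ^ n \<noteq> - 1"
    proof
      assume "(r0\<^sup>2) ^ n = - 1"
      then have "(r0\<^sup>2) ^ (2 * n) = 1" by (metis mult.commute power_mult power2_eq_1_iff)
      then show False using prim[of "2 * n"] n0 nN by simp
    qed
  qed
  interpret S: unit_curve n \<sigma> r0 by (rule uc0)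
  \<comment> \<open>Special and general parameters form one set, so that the same rational functions
    serve both.\<close>
  define D where "D = insert r0 (general_r n)"
  have D0: "0 \<notin> D" using r0 by (simp add: D_def general_r_def)
  have good: "good_curve n \<sigma> r" if "r \<in> D" for r
    using that S.good_curve_axioms good_curve_general[OF n0 \<sigma>2] by (auto simp: D_def)
  have curve: "curve n \<sigma> r" if "r \<noteq> 0" for r
    using that n0 \<sigma>2 by (simp add: curve_def)
  have V: "V_mod n r0 v0 = Vp_mod n \<sigma> r0" using S.V_mod_eq S.Vp_mod_eq cv by simp
  have V_form: "V_form n r0 v0 = Vp_form n \<sigma> r0" using S.V_form_eq cv by simp
  have dim: "has_dim (Vp_mod n \<sigma> r) (2 * n)" if "r \<noteq> 0" for r
  proof -
    interpret curve n \<sigma> r by (rule curve[OF that])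
    show ?thesis using has_dim_MM by (simp only: Vp_mod_eq)
  qed
  have semisimple: "irreducible_hmod (Vp_mod n \<sigma> r) \<and>
      semisimple_op (Vp_mod n \<sigma> r) (opX (Vp_mod n \<sigma> r)) \<and>
      semisimple_op (Vp_mod n \<sigma> r) (opY (Vp_mod n \<sigma> r))" if "r \<in> general_r n" for r
  proof -
    interpret good_curve n \<sigma> r by (rule good) (use that in \<open>simp add: D_def\<close>)
    show ?thesis unfolding Vp_mod_eq using irreducible X_semisimple Y_semisimple by blast
  qed
  have unit_D: "unit_curve n \<sigma> r" if "r \<in> D" "cmod r = 1" for r
    using good[OF that(1)] that(2) by (simp add: unit_curve_def unit_curve_axioms_def)
  \<comment> \<open>At r0 a given pair differs from the constructed operators by constants a and b;
    the constructed families multiplied by these constants deform it.\<close>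
  have act: "\<exists>A' B'. (\<forall>r\<in>D. psl2_action r (Vp_mod n \<sigma> r) (A' r) (B' r)) \<and>
      regular_ops D (Vp_mod n \<sigma>) (idx n) (Vp_X n \<sigma>) A' \<and>
      regular_ops D (Vp_mod n \<sigma>) (idx n) (Vp_X n \<sigma>) B' \<and>
      (\<forall>x\<in>carrier (Vp_mod n \<sigma> r0). id (A' r0 x) = A (id x) \<and> id (B' r0 x) = B (id x))"
    if AB: "psl2_action r0 (V_mod n r0 v0) A B" for A B
  proof -
    have "tau_plus r0 (Vp_mod n \<sigma> r0) A" "tau_minus r0 (Vp_mod n \<sigma> r0) B"
      using psl2_action_tau[OF AB] by (simp_all add: V)
    then obtain a b where a: "a \<noteq> 0" "\<And>x. x \<in> carrier (Vp_mod n \<sigma> r0) \<Longrightarrow> A x = a \<odot>\<^bsub>Vp_mod n \<sigma> r0\<^esub> S.tauA x"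
      and b: "b \<noteq> 0" "\<And>x. x \<in> carrier (Vp_mod n \<sigma> r0) \<Longrightarrow> B x = b \<odot>\<^bsub>Vp_mod n \<sigma> r0\<^esub> S.tauB x"
      using S.tau_plus_unique[OF S.tau_plus_tauA] S.tau_minus_unique[OF S.tau_minus_tauB]
      unfolding S.Vp_mod_eq by metis
    let ?A = "\<lambda>r x. a \<odot>\<^bsub>Vp_mod n \<sigma> r\<^esub> good_curve.tauA n \<sigma> r x"
    let ?B = "\<lambda>r x. b \<odot>\<^bsub>Vp_mod n \<sigma> r\<^esub> good_curve.tauB n \<sigma> r x"
    have "psl2_action r (Vp_mod n \<sigma> r) (?A r) (?B r)" if "r \<in> D" for r
    proof -
      interpret good_curve n \<sigma> r by (rule good[OF that])
      show ?thesis
        unfolding Vp_mod_eq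
        by (intro tau_psl2 tau_scale module_pol_quot iso_X iso_Y iso_T a b tau_plus_tauA tau_minus_tauB)
    qed
    moreover have "regular_ops D (Vp_mod n \<sigma>) (idx n) (Vp_X n \<sigma>) ?A"
      by (rule regular_ops_tauA[OF good n0 \<sigma>2 D0])
    moreover have "regular_ops D (Vp_mod n \<sigma>) (idx n) (Vp_X n \<sigma>) ?B"
      by (rule regular_ops_tauB[OF good n0 \<sigma>2 D0])
    ultimately show ?thesis
      using a(2) b(2) by (intro exI[of _ ?A] exI[of _ ?B]) simp
  qed
  have action: "\<exists>A B. psl2_action r0 (V_mod n r0 v0) A B"
    using S.tau_psl2[OF S.tau_plus_tauA S.tau_minus_tauB] unfolding V S.Vp_mod_eq by blast
  have iso: "hmod_iso (Vp_mod n \<sigma> r0) (V_mod n r0 v0) id"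
    by (simp add: V hmod_iso_def linear_iso_def linear_map_def)
  have ring_iso: "id \<in> ring_iso (Vp_mod n \<sigma> r0) (V_mod n r0 v0)"
    unfolding V by (rule ring_iso_set_refl)
  have form: "Vp_form_ok n \<sigma> r" if "r \<in> D" "cmod r = 1" for r
    by (rule unit_curve.Vp_form_ok[OF unit_D[OF that]])
  have reg_form: "regular_form (D \<inter> {r. cmod r = 1}) (idx n) (Vp_X n \<sigma>) (Vp_form n \<sigma>)"
    by (rule regular_form_Vp) (use unit_D D0 in auto)
  have positive: "Vp_form_ok n \<sigma> r \<and> positive_definite (Vp_mod n \<sigma> r) (Vp_form n \<sigma> r)"
    if \<theta>: "\<bar>\<theta>\<bar> \<le> 2 * pi / real N" and rc: "r\<^sup>2 = cis (\<theta> / 2)" and r4: "r ^ 4 \<noteq> 1 \<or> n = 1" for r \<theta>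
  proof -
    interpret unit_curve n \<sigma> r by (rule unit_curve_arg[OF n0 nN \<sigma>2 \<theta> rc r4])
    have "r ^ 4 = (r\<^sup>2)\<^sup>2" by simp
    also have "\<dots> = cis \<theta>" unfolding rc by (simp add: DeMoivre)
    finally have "\<theta> \<noteq> 0 \<or> n = 1" using r4 by auto
    then show ?thesis
      using Vp_form_ok positive_definite[OF wt_positive[OF rc \<theta> _ nN]] by (simp add: Vp_mod_eq)
  qed
  have dims: "\<exists>dim. real dim = 2 * real N - 4 * k \<and> real dim = 4 * \<bar>k'\<bar> \<and>
        has_dim (V_mod n r0 v0) dim \<and> (\<forall>r. r \<noteq> 0 \<longrightarrow> has_dim (Vp_mod n \<sigma> r) dim)"
    using n k k' dim r0 by (intro exI[of _ "2 * n"]) (simp add: V)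
  have Vp: "Vp_well_defined n \<sigma> r" if "r \<noteq> 0" for r
    by (rule curve.Vp_well_defined[OF curve[OF that]])
  have tr: "(curve_v n \<sigma> r)\<^sup>2 = - ((r\<^sup>2) powi \<lfloor>2 * k'\<rfloor>)" if "r \<noteq> 0" for r
    using curve_v_sq[OF that \<sigma>2, of n] by (simp add: k'n power_int_minus)
  have deform: "\<exists>\<phi> d.
        hmod_iso (Vp_mod n \<sigma> r0) (V_mod n r0 v0) \<phi> \<and>
        \<phi> \<in> ring_iso (Vp_mod n \<sigma> r0) (V_mod n r0 v0) \<and>
        (\<forall>x\<in>carrier (Vp_mod n \<sigma> r0). \<forall>y\<in>carrier (Vp_mod n \<sigma> r0).
           V_form n r0 v0 (\<phi> x) (\<phi> y) = Vp_form n \<sigma> r0 x y) \<and>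
        (\<forall>r\<in>general_r d.
           irreducible_hmod (Vp_mod n \<sigma> r) \<and>
           semisimple_op (Vp_mod n \<sigma> r) (opX (Vp_mod n \<sigma> r)) \<and>
           semisimple_op (Vp_mod n \<sigma> r) (opY (Vp_mod n \<sigma> r))) \<and>
        (\<exists>A B. psl2_action r0 (V_mod n r0 v0) A B) \<and>
        (\<forall>A B. psl2_action r0 (V_mod n r0 v0) A B \<longrightarrow>
           (\<exists>A' B'.
              (\<forall>r\<in>insert r0 (general_r d). psl2_action r (Vp_mod n \<sigma> r) (A' r) (B' r)) \<and>
              regular_ops (insert r0 (general_r d)) (Vp_mod n \<sigma>) (idx n) (Vp_X n \<sigma>) A' \<and>
              regular_ops (insert r0 (general_r d)) (Vp_mod n \<sigma>) (idx n) (Vp_X n \<sigma>) B' \<and>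
              (\<forall>x\<in>carrier (Vp_mod n \<sigma> r0).
                 \<phi> (A' r0 x) = A (\<phi> x) \<and> \<phi> (B' r0 x) = B (\<phi> x)))) \<and>
        (\<forall>r\<in>insert r0 (general_r d). cmod r = 1 \<longrightarrow> Vp_form_ok n \<sigma> r) \<and>
        regular_form (insert r0 (general_r d) \<inter> {r. cmod r = 1}) (idx n) (Vp_X n \<sigma>)
          (Vp_form n \<sigma>)"
    \<comment> \<open>The modules coincide at r0, hence the identity; n bounds the orders of the
      roots of unity to be avoided.\<close>
    by (intro exI[of _ id] exI[of _ n] conjI iso ring_iso action)
      (use act form reg_form semisimple in \<open>simp_all only: D_def V_form id_apply, auto\<close>)
  show ?thesis
    unfolding K_def[symmetric] K'(2)
    by (intro conjI cv allI impI tr S.V_well_defined[unfolded cv] Vp dims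
        flat_family_Vp n0 \<sigma>2 S.V_form_ok[unfolded cv] deform refl positive)
      (simp_all add: hK k'n)
qed

end
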